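(* Let $g$ be a degenerate (rank three) conformal Lorentzian metric on a four-manifold $N$, with degenerate direction $V$, and let $$\Gamma = g \wedge \mathscr{L}_V g \wedge\mathscr{L}_V^2 g \wedge \mathscr{L}_V^3 g \wedge \mathscr{L}_V^4 g \in \wedge^5 S^2\ker (V\lrcorner) \cong S^2(TN/V).$$ Then $g$ arises (locally) from a third-order ordinary differential equation if and only if either 1. $\Gamma$ is nonzero and the classical adjoint of $\Gamma$ vanishes identically (equivalently, $\Gamma$ has rank $1$). In this case, there exists a natural conformal isometry of $N$ with $J^2$ equipped with its invariant degenerate metric coming from a third-order differential equation with non-zero Wünschmann invariant; or 2. $\mathscr{L}_V g$ is proportional to $g$. In this case, the Wünschmann invariant vanishes and there exists a conformal isometry of $N$ with $J^2$ equipped with its invariant degenerate metric coming from a third-order differential equation, that is natural up to a gauge transformation of $J^2$.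
   Context: All assertions are local. A degenerate conformal Lorentzian metric of rank three on a four-manifold $N$ is a smooth symmetric 2-tensor $g$ on $TN$, given up to multiplication by a nonvanishing function, whose kernel at each point is a line, spanned by a (locally defined) nonvanishing vector field $V$ (determined up to scale), and which induces a nondegenerate form of Lorentzian signature on the rank-three bundle $TN/V$. Here $\ker(V\lrcorner)\subset T^*N$ is the rank-three bundle of one-forms annihilated by $V$; each iterated Lie derivative $\mathscr L_V^k g$ is a section of its symmetric square $S^2\ker(V\lrcorner)$, which has rank six. The fifth exterior power $\wedge^5S^2\ker(V\lrcorner)$ is naturally identified (up to scale, i.e. up to a line-bundle factor) with the dual of $S^2\ker(V\lrcorner)$, that is with $S^2(TN/V)$; thus $\Gamma$ is, up to scale, a $3\times3$ symmetric matrix at each point. Vanishing of $\Gamma$, its rank, and vanishing of its classical adjoint (adjugate, the matrix of $2\times2$ cofactors) do not depend on the scales of $g$ and $V$. For a third-order equation $y'''=F(x,y,y',y'')$, the second jet space $J^2$ has coordinates $(x,y,p,q)$, with $p=y'$, $q=y''$. Let $$V=\frac{\partial}{\partial x}+p\frac{\partial}{\partial y}+q\frac{\partial}{\partial p}+F(x,y,p,q)\frac{\partial}{\partial q}$$ be the total derivative vector field and let $K=\tfrac16V(F_q)-\tfrac19F_q^2-\tfrac12F_p$. The invariant degenerate conformal metric on $J^2$ coming from the equation is the conformal class of $$2[dy-p\,dx]\,[dq-\tfrac13F_q\,dp+K\,dy+(\tfrac13qF_q-F-pK)\,dx]-[dp-q\,dx]^2,$$ a rank-three Lorentzian metric with degenerate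 direction $V$; it is invariant under contact transformations. The Wünschmann invariant of the equation is $$W=F_y+(V-\tfrac23F_q)K = F_y+V(K)-\tfrac23F_qK .$$ A metric $g$ on $N$ arises (locally) from a third-order differential equation if, near each point, $(N,g)$ is conformally isometric to an open subset of $J^2$ with the metric $2[dy-p\,dx]\,[dq-\tfrac13F_q\,dp+K\,dy+(\tfrac13qF_q-F-pK)\,dx]-[dp-q\,dx]^2$, where $K=\tfrac16V(F_q)-\tfrac19F_q^2-\tfrac12F_p$ and $V=\frac{\partial}{\partial x}+p\frac{\partial}{\partial y}+q\frac{\partial}{\partial p}+F\frac{\partial}{\partial q}$, for some $F=F(x,y,p,q)$; a conformal isometry is a (local) diffeomorphism pulling one metric back to a multiple of the other by a nonvanishing function. "Natural" means determined by $(N,g)$ without auxiliary choices (the equation being considered up to contact transformations). A gauge transformation of $J^2$ is a local diffeomorphism of $J^2$ covering the identity of the local quotient $J^2/V$.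
   Formalization: The "if" in case 1 also requires g∧L_V g∧…∧L_V^5 g nonzero (automatic when g arises with Γ nonzero), without which it fails; the equivalence assumes Γ vanishes nowhere or identically, and otherwise "g arises" gives one of the alternatives at each point. *)

theory Defs
  imports "HOL-Analysis.Analysis"
begin

section \<open>Smooth maps and local diffeomorphisms\<close>

text \<open>Meant for open \<open>U\<close>: all iterated directional derivatives up to order \<open>k\<close> exist and are
  continuous.\<close>

primrec Ck_on :: "nat \<Rightarrow> 'a::real_normed_vector set \<Rightarrow> ('a \<Rightarrow> 'b::real_normed_vector) \<Rightarrow> bool" where
  "Ck_on 0 U f \<longleftrightarrow> continuous_on U f"
| "Ck_on (Suc k) U f \<longleftrightarrow> (\<forall>x\<in>U. f differentiable (at x)) \<and>
     (\<forall>v. Ck_on k U (\<lambda>x. frechet_derivative f (at x) v))"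

definition smooth_on :: "'a::real_normed_vector set \<Rightarrow> ('a \<Rightarrow> 'b::real_normed_vector) \<Rightarrow> bool" where
  "smooth_on U f \<longleftrightarrow> (\<forall>k. Ck_on k U f)"

definition diffeo_onto_image :: "'a::real_normed_vector set \<Rightarrow> ('a \<Rightarrow> 'a) \<Rightarrow> bool" where
  "diffeo_onto_image U f \<longleftrightarrow> open U \<and> open (f ` U) \<and> inj_on f U \<and>
     smooth_on U f \<and> smooth_on (f ` U) (inv_into U f)"


section \<open>Symmetric two-tensors on open subsets of four-space\<close>

text \<open>All assertions being local, the four-manifold is an open subset of \<open>real ^ 4\<close>; a section of
  the second tensor power of its cotangent bundle is a function with values in \<open>4 \<times> 4\<close> matrices.\<close>

type_synonym point = "real ^ 4"
type_synonym tensor = "real ^ 4 ^ 4"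

definition tensor_app :: "tensor \<Rightarrow> point \<Rightarrow> point \<Rightarrow> real" where
  "tensor_app T v w = v \<bullet> (T *v w)"

definition pullback :: "(point \<Rightarrow> point) \<Rightarrow> (point \<Rightarrow> tensor) \<Rightarrow> point \<Rightarrow> tensor" where
  "pullback f h x = transpose (jacobian f (at x)) ** h (f x) ** jacobian f (at x)"

text \<open>In coordinates, \<open>(L_V T)_ij = V(T_ij) + T_kj \<partial>_i V^k + T_ik \<partial>_j V^k\<close>.\<close>

definition lie_derivative :: "(point \<Rightarrow> point) \<Rightarrow> (point \<Rightarrow> tensor) \<Rightarrow> point \<Rightarrow> tensor" where
  "lie_derivative V T x = (\<chi> i j.
      frechet_derivative (\<lambda>z. T z $ i $ j) (at x) (V x)
      + (\<Sum>k\<in>UNIV. T x $ k $ j * frechet_derivative V (at x) (axis i 1) $ k)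
      + (\<Sum>k\<in>UNIV. T x $ i $ k * frechet_derivative V (at x) (axis j 1) $ k))"

text \<open>\<open>g\<close> is a representative of the conformal class and \<open>V\<close> a spanning section of its kernel.
  As \<open>g\<close> is only given up to a nonvanishing, possibly negative, factor, Lorentzian signature
  means signature \<open>(1,2)\<close> or \<open>(2,1)\<close> of the form induced on the quotient by \<open>V\<close>.\<close>

definition degenerate_lorentzian ::
    "point set \<Rightarrow> (point \<Rightarrow> tensor) \<Rightarrow> (point \<Rightarrow> point) \<Rightarrow> bool" where
  "degenerate_lorentzian N g V \<longleftrightarrow> smooth_on N g \<and> smooth_on N V \<and>
     (\<forall>x\<in>N. transpose (g x) = g x \<and> V x \<noteq> 0 \<and> {v. g x *v v = 0} = span {V x} \<and>
        (\<exists>\<epsilon>\<in>{1, -1}. \<exists>a b c.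
           tensor_app (g x) a a = \<epsilon> \<and> tensor_app (g x) b b = -\<epsilon> \<and> tensor_app (g x) c c = -\<epsilon> \<and>
           tensor_app (g x) a b = 0 \<and> tensor_app (g x) a c = 0 \<and> tensor_app (g x) b c = 0))"


section \<open>The section \<open>\<Gamma>\<close>\<close>

text \<open>A frame of the rank-three bundle \<open>TN/V\<close>, given by representatives in \<open>TN\<close>. It trivializes
  the bundles in which the exterior product takes its values. The rank of \<open>\<Gamma>\<close> and
  the vanishing of \<open>\<Gamma>\<close>, of its adjugate and of the sixfold product below do not depend on it, so no
  regularity in the base point is required.\<close>

definition transverse_frame ::
    "point set \<Rightarrow> (point \<Rightarrow> point) \<Rightarrow> (point \<Rightarrow> point ^ 3) \<Rightarrow> bool" where
  "transverse_frame N V E \<longleftrightarrow>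
     (\<forall>x\<in>N. det (vector [V x, E x $ 1, E x $ 2, E x $ 3] :: real ^ 4 ^ 4) \<noteq> 0)"

definition frame_matrix :: "point ^ 3 \<Rightarrow> tensor \<Rightarrow> real ^ 3 ^ 3" where
  "frame_matrix e T = (\<chi> i j. tensor_app T (e $ i) (e $ j))"

definition sym_coords :: "real ^ 3 ^ 3 \<Rightarrow> real ^ 6" where
  "sym_coords A = vector [A $ 1 $ 1, A $ 1 $ 2, A $ 1 $ 3, A $ 2 $ 2, A $ 2 $ 3, A $ 3 $ 3]"

definition wedge6 :: "real^3^3 \<Rightarrow> real^3^3 \<Rightarrow> real^3^3 \<Rightarrow> real^3^3 \<Rightarrow> real^3^3 \<Rightarrow> real^3^3 \<Rightarrow> real" where
  "wedge6 A B C D E F = det (vector [sym_coords A, sym_coords B, sym_coords C,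
      sym_coords D, sym_coords E, sym_coords F] :: real ^ 6 ^ 6)"

definition sym_unit :: "3 \<Rightarrow> 3 \<Rightarrow> real ^ 3 ^ 3" where
  "sym_unit i j = (\<chi> k l. ((if k = i \<and> l = j then 1 else 0) + (if k = j \<and> l = i then 1 else 0)) / 2)"

text \<open>The exterior product of five symmetric matrices is identified with the functional
  \<open>\<omega> \<mapsto> A \<and> B \<and> C \<and> D \<and> E \<and> \<omega>\<close> on symmetric matrices, hence with the symmetric matrix \<open>G\<close>
  for which this functional is \<open>\<omega> \<mapsto> \<Sum>i j. G_ij \<omega>_ij\<close>.\<close>

definition wedge5 :: "real^3^3 \<Rightarrow> real^3^3 \<Rightarrow> real^3^3 \<Rightarrow> real^3^3 \<Rightarrow> real^3^3 \<Rightarrow> real^3^3" where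
  "wedge5 A B C D E = (\<chi> i j. wedge6 A B C D E (sym_unit i j))"

definition lie_jet ::
    "(point \<Rightarrow> tensor) \<Rightarrow> (point \<Rightarrow> point) \<Rightarrow> (point \<Rightarrow> point ^ 3) \<Rightarrow> point \<Rightarrow> nat \<Rightarrow> real ^ 3 ^ 3" where
  "lie_jet g V E x k = frame_matrix (E x) ((lie_derivative V ^^ k) g x)"

definition Gamma ::
    "(point \<Rightarrow> tensor) \<Rightarrow> (point \<Rightarrow> point) \<Rightarrow> (point \<Rightarrow> point ^ 3) \<Rightarrow> point \<Rightarrow> real ^ 3 ^ 3" where
  "Gamma g V E x = wedge5 (lie_jet g V E x 0) (lie_jet g V E x 1) (lie_jet g V E x 2)
     (lie_jet g V E x 3) (lie_jet g V E x 4)"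

text \<open>The product of \<open>\<Gamma>\<close> with the fifth Lie derivative of \<open>g\<close>. If \<open>\<Gamma> = \<plusminus> e \<otimes> e\<close> with \<open>e\<close>
  nowhere zero, it is nonzero exactly where \<open>L_V e\<close> is not a multiple of \<open>e\<close> modulo \<open>V\<close>; the metric of an equation
  has this property wherever \<open>\<Gamma>\<close> is nonzero. The property does not follow from \<open>\<Gamma>\<close> having
  rank one: near \<open>t = 0\<close> the metric
  \<open>2 du dv + 2t du dw + t^2 dv^2 + 2t^3 dv dw - (1 - t^4) dw^2\<close> with \<open>V = \<partial>/\<partial>t\<close>
  has \<open>\<Gamma>\<close> a nonzero multiple of the square of \<open>\<partial>/\<partial>u\<close>, which is invariant under \<open>V\<close>, and hence
  it does not arise from any third-order equation.\<close>

definition Gamma_osc ::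
    "(point \<Rightarrow> tensor) \<Rightarrow> (point \<Rightarrow> point) \<Rightarrow> (point \<Rightarrow> point ^ 3) \<Rightarrow> point \<Rightarrow> real" where
  "Gamma_osc g V E x = wedge6 (lie_jet g V E x 0) (lie_jet g V E x 1) (lie_jet g V E x 2)
     (lie_jet g V E x 3) (lie_jet g V E x 4) (lie_jet g V E x 5)"

definition adjugate :: "real ^ 3 ^ 3 \<Rightarrow> real ^ 3 ^ 3" where
  "adjugate A = (\<chi> i j. det (\<chi> k l. if k = j then (if l = i then 1 else 0) else A $ k $ l))"

definition Gamma_nonzero_adj_zero ::
    "point set \<Rightarrow> (point \<Rightarrow> tensor) \<Rightarrow> (point \<Rightarrow> point) \<Rightarrow> (point \<Rightarrow> point ^ 3) \<Rightarrow> bool" where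
  "Gamma_nonzero_adj_zero N g V E \<longleftrightarrow> (\<forall>x\<in>N. Gamma g V E x \<noteq> 0 \<and> adjugate (Gamma g V E x) = 0)"

definition lie_proportional :: "point set \<Rightarrow> (point \<Rightarrow> tensor) \<Rightarrow> (point \<Rightarrow> point) \<Rightarrow> bool" where
  "lie_proportional N g V \<longleftrightarrow> (\<forall>x\<in>N. \<exists>c. lie_derivative V g x = c *\<^sub>R g x)"


section \<open>Third-order equations\<close>

text \<open>The coordinates \<open>(x, y, p, q)\<close> of the second jet space are the components \<open>1, 2, 3, 4\<close>.
  The equation \<open>y''' = F(x, y, y', y'')\<close> is given by a smooth function \<open>F\<close> on an open set \<open>D\<close> of
  jets.\<close>

definition third_order_ode :: "point set \<Rightarrow> (point \<Rightarrow> real) \<Rightarrow> bool" where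
  "third_order_ode D F \<longleftrightarrow> open D \<and> smooth_on D F"

definition partial :: "4 \<Rightarrow> (point \<Rightarrow> real) \<Rightarrow> point \<Rightarrow> real" where
  "partial i f z = frechet_derivative f (at z) (axis i 1)"

definition total_field :: "(point \<Rightarrow> real) \<Rightarrow> point \<Rightarrow> point" where
  "total_field F z = vector [1, z $ 3, z $ 4, F z]"

definition total_deriv :: "(point \<Rightarrow> real) \<Rightarrow> (point \<Rightarrow> real) \<Rightarrow> point \<Rightarrow> real" where
  "total_deriv F f z = frechet_derivative f (at z) (total_field F z)"

definition ode_K :: "(point \<Rightarrow> real) \<Rightarrow> point \<Rightarrow> real" where
  "ode_K F z = total_deriv F (partial 4 F) z / 6 - (partial 4 F z)\<^sup>2 / 9 - partial 3 F z / 2"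

definition wuenschmann :: "(point \<Rightarrow> real) \<Rightarrow> point \<Rightarrow> real" where
  "wuenschmann F z = partial 2 F z + total_deriv F (ode_K F) z - 2 / 3 * partial 4 F z * ode_K F z"

text \<open>Covectors by their components with respect to \<open>dx, dy, dp, dq\<close>.\<close>

definition theta1 :: "point \<Rightarrow> real ^ 4" where
  "theta1 z = vector [- (z $ 3), 1, 0, 0]"

definition theta2 :: "point \<Rightarrow> real ^ 4" where
  "theta2 z = vector [- (z $ 4), 0, 1, 0]"

definition theta3 :: "(point \<Rightarrow> real) \<Rightarrow> point \<Rightarrow> real ^ 4" where
  "theta3 F z = vector [z $ 4 * partial 4 F z / 3 - F z - z $ 3 * ode_K F z,
     ode_K F z, - partial 4 F z / 3, 1]"

definition ode_metric :: "(point \<Rightarrow> real) \<Rightarrow> point \<Rightarrow> tensor" where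
  "ode_metric F z = (\<chi> i j. theta1 z $ i * theta3 F z $ j + theta3 F z $ i * theta1 z $ j
     - theta2 z $ i * theta2 z $ j)"


section \<open>Conformal isometries, contact and gauge transformations\<close>

definition ode_isometry ::
    "(point \<Rightarrow> tensor) \<Rightarrow> point set \<Rightarrow> (point \<Rightarrow> point) \<Rightarrow> point set \<Rightarrow> (point \<Rightarrow> real) \<Rightarrow> bool" where
  "ode_isometry g U \<phi> D F \<longleftrightarrow> third_order_ode D F \<and> diffeo_onto_image U \<phi> \<and> \<phi> ` U \<subseteq> D \<and>
     (\<exists>\<rho>. smooth_on U \<rho> \<and> (\<forall>x\<in>U. \<rho> x \<noteq> 0 \<and> pullback \<phi> (ode_metric F) x = \<rho> x *\<^sub>R g x))"

definition arises_from_ode :: "point set \<Rightarrow> (point \<Rightarrow> tensor) \<Rightarrow> bool" where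
  "arises_from_ode N g \<longleftrightarrow>
     (\<forall>x\<in>N. \<exists>U \<phi> D F. x \<in> U \<and> U \<subseteq> N \<and> ode_isometry g U \<phi> D F)"

definition contact_plane :: "point \<Rightarrow> point set" where
  "contact_plane z = {v. theta1 z \<bullet> v = 0 \<and> theta2 z \<bullet> v = 0}"

text \<open>A contact transformation of the second jet space (a diffeomorphism preserving the contact
  distribution) that takes the equation of \<open>F\<close> to that of \<open>F'\<close>, solution curves to solution
  curves.\<close>

definition contact_equivalence ::
    "point set \<Rightarrow> (point \<Rightarrow> point) \<Rightarrow> (point \<Rightarrow> real) \<Rightarrow> (point \<Rightarrow> real) \<Rightarrow> bool" where
  "contact_equivalence A c F F' \<longleftrightarrow> diffeo_onto_image A c \<and>
     (\<forall>z\<in>A. frechet_derivative c (at z) ` contact_plane z = contact_plane (c z) \<and>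
        (\<exists>\<mu>. \<mu> \<noteq> 0 \<and> frechet_derivative c (at z) (total_field F z) = \<mu> *\<^sub>R total_field F' (c z)))"

definition same_leaf :: "point set \<Rightarrow> (point \<Rightarrow> real) \<Rightarrow> point \<Rightarrow> point \<Rightarrow> bool" where
  "same_leaf D F z z' \<longleftrightarrow> (\<exists>I (\<sigma> :: real \<Rightarrow> point). is_interval I \<and>
     (\<forall>t\<in>I. \<sigma> t \<in> D \<and> (\<sigma> has_vector_derivative total_field F (\<sigma> t)) (at t within I)) \<and>
     (\<exists>s\<in>I. \<exists>t\<in>I. \<sigma> s = z \<and> \<sigma> t = z'))"

text \<open>Covering the identity of the space of leaves of the total derivative field in \<open>D\<close>.\<close>

definition gauge_transformation ::
    "point set \<Rightarrow> (point \<Rightarrow> real) \<Rightarrow> point set \<Rightarrow> (point \<Rightarrow> point) \<Rightarrow> bool" where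
  "gauge_transformation D F A \<gamma> \<longleftrightarrow> diffeo_onto_image A \<gamma> \<and> A \<subseteq> D \<and> \<gamma> ` A \<subseteq> D \<and>
     (\<forall>z\<in>A. same_leaf D F z (\<gamma> z))"

text \<open>Two isometries onto jets of equations are equal up to contact transformations of the
  equations.\<close>

definition contact_related ::
    "point set \<Rightarrow> (point \<Rightarrow> point) \<Rightarrow> (point \<Rightarrow> real) \<Rightarrow> (point \<Rightarrow> point) \<Rightarrow> (point \<Rightarrow> real) \<Rightarrow> bool" where
  "contact_related U \<phi>\<^sub>1 F\<^sub>1 \<phi>\<^sub>2 F\<^sub>2 \<longleftrightarrow>
     (\<exists>c. contact_equivalence (\<phi>\<^sub>1 ` U) c F\<^sub>1 F\<^sub>2 \<and> (\<forall>x\<in>U. \<phi>\<^sub>2 x = c (\<phi>\<^sub>1 x)))"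

text \<open>Equality up to a gauge transformation, the equations again being considered up to contact
  transformations. The common equation \<open>(D, F)\<close> is needed because \<open>\<phi>\<^sub>1\<close> and \<open>\<phi>\<^sub>2\<close> may map to disjoint
  parts of the leaves.\<close>

definition gauge_related ::
    "point set \<Rightarrow> (point \<Rightarrow> point) \<Rightarrow> (point \<Rightarrow> real) \<Rightarrow> (point \<Rightarrow> point) \<Rightarrow> (point \<Rightarrow> real) \<Rightarrow> bool" where
  "gauge_related U \<phi>\<^sub>1 F\<^sub>1 \<phi>\<^sub>2 F\<^sub>2 \<longleftrightarrow>
     (\<exists>D F \<psi>\<^sub>1 \<psi>\<^sub>2 \<gamma>. third_order_ode D F \<and> (\<forall>z\<in>D. wuenschmann F z = 0) \<and>
        contact_related U \<phi>\<^sub>1 F\<^sub>1 \<psi>\<^sub>1 F \<and> contact_related U \<phi>\<^sub>2 F\<^sub>2 \<psi>\<^sub>2 F \<and>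
        gauge_transformation D F (\<psi>\<^sub>1 ` U) \<gamma> \<and> (\<forall>x\<in>U. \<psi>\<^sub>2 x = \<gamma> (\<psi>\<^sub>1 x)))"

end

theory Submission
 imports Defs
begin

text \<open>The span of the tensors \<open>L\<^sub>V\<^sup>j g\<close>, \<open>j < k\<close>, does not change when \<open>g\<close> and \<open>V\<close> are rescaled and is natural
 under diffeomorphisms, and \<open>\<Gamma>\<close> only depends on this flag. For an equation, \<open>L\<^sub>V g = (2/3) F\<^sub>q g + W \<sigma>\<close> with
 \<open>\<sigma> = 2 (dy - p dx)\<^sup>2\<close>, and the components of \<open>L\<^sub>V\<^sup>j \<sigma>\<close> form a triangular system. So the flag has dimension one
 where \<open>W = 0\<close> and dimension six where \<open>W \<noteq> 0\<close>; in the second case \<open>\<partial>/\<partial>q\<close> is, modulo \<open>V\<close>, the direction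
 annihilated quadratically by the first five tensors, hence spans the image of \<open>\<Gamma>\<close>. The metric therefore determines
 the contact plane spanned by \<open>V\<close> and \<open>\<partial>/\<partial>q\<close>, which gives naturality.

 Conversely, let \<open>\<Gamma> = \<plusminus> e \<otimes> e\<close>. By the condition on \<open>Gamma_osc\<close>, \<open>e\<close> rotates along \<open>V\<close>; so, in suitable
 coordinates and up to scale and multiples of \<open>V\<close>, \<open>V = \<partial>/\<partial>z4\<close> and \<open>e = (1, b, z4, 0)\<close>. The distribution
 spanned by \<open>V\<close>, \<open>e\<close>, \<open>L\<^sub>V e\<close> has a Cauchy characteristic, whose first integrals are taken as the jet coordinates
 \<open>x, y, p\<close>; this carries \<open>V\<close> and \<open>e\<close> to the contact planes and \<open>V\<close> to a total derivative. The relations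
 \<open>(L\<^sub>V\<^sup>j g)(e, e) = 0\<close>, \<open>j < 5\<close>, differentiated along \<open>V\<close>, leave only one tensor up to scale, so \<open>g\<close> is the metric of
 the equation. If \<open>L\<^sub>V g\<close> is proportional to \<open>g\<close>, a multiple of \<open>g\<close> is constant along \<open>V\<close>, the same construction
 applies to a field \<open>e\<close> of null directions rotating along \<open>V\<close>, and the choice of \<open>e\<close> is the gauge freedom.\<close>

section \<open>Smooth functions\<close>

text \<open>The proof rests on a count. Symmetric tensors that annihilate \<open>V\<close> form a
  six-dimensional space at each point, and the five equations (L_V^j g)(e, e) = 0, differentiated
  along \<open>V\<close> and unwound to order zero, become five independent linear equations on
  \<open>g\<close> alone. So a field of directions \<open>e\<close> determines the conformal metric,
  and it is enough to find an equation whose contact planes are spanned by \<open>V\<close> and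
  \<open>e\<close>. Independence needs e, L_V e, L_V^2 e and \<open>V\<close> to be a frame. Here
  the fifth Lie derivative enters: (L_V^5 g)(e, e) = -2 (L_V^4 g)(e, L_V e), so a nonzero left side
  forces L_V e off the span of e and \<open>V\<close>; a Lorentzian form has no null plane, so g(L_V
  e, L_V e) is nonzero, and with it g(e, L_V^2 e). The obstacle is analytic. The Cauchy
  characteristic and the straightening of \<open>V\<close> both need flows that are smooth jointly
  in time and initial point, in the sense of \<open>smooth_on\<close>; this is derived from the
  contraction principle by induction on the order of differentiability.\<close>

notation scaleR (infixr "*R" 75)
notation lie_derivative ("\<L>")

abbreviation dd :: "('a::real_normed_vector \<Rightarrow> 'b::real_normed_vector) \<Rightarrow> 'a \<Rightarrow> 'a \<Rightarrow> 'b" where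
  "dd f x \<equiv> frechet_derivative f (at x)"

lemma frechet_cong:
 assumes "open U" "x \<in> U" "\<And>y. y \<in> U ==> f y = g y"
 shows "dd f x = dd g x"
proof -
 have "(f has_derivative D) (at x) \<longleftrightarrow> (g has_derivative D) (at x)" for D
  using assms has_derivative_transform_within_open[of f D x UNIV U g]
   has_derivative_transform_within_open[of g D x UNIV U f] by auto
 thus ?thesis unfolding frechet_derivative_def by simp
qed

lemma differentiable_cong:
 assumes "open U" "x \<in> U" "\<And>y. y \<in> U ==> f y = g y" "f differentiable (at x)"
 shows "g differentiable (at x)"
 using assms has_derivative_transform_within_open[of f _ x UNIV U g] unfolding differentiable_def by blast

lemma Ck_on_cong:
 assumes "open U" "\<And>y. y \<in> U ==> f y = g y" "Ck_on k U f"
 shows "Ck_on k U g"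
 using assms(2,3)
proof (induction k arbitrary: f g)
 case 0 thus ?case by (auto cong: continuous_on_cong)
next
 case (Suc k)
 have "Ck_on k U (\<lambda>x. dd g x v)" for v
 proof (rule Suc.IH)
  show "Ck_on k U (\<lambda>x. dd f x v)" using Suc.prems(2) by simp
 qed (use frechet_cong[OF assms(1), of _ f g] Suc.prems(1) in auto)
 thus ?case using Suc.prems differentiable_cong[OF assms(1), of _ f g] by auto
qed

lemma Ck_on_subset: "Ck_on k U f ==> V \<subseteq> U ==> Ck_on k V f"
 by (induction k arbitrary: f) (auto intro: continuous_on_subset)

lemma Ck_on_SucD: "Ck_on (Suc k) U f ==> Ck_on k U f"
proof (induction k arbitrary: f)
 case 0 thus ?case
  by (auto intro!: differentiable_imp_continuous_on differentiable_at_imp_differentiable_on)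
qed auto

text \<open>Lets a statement proved on all shorter time intervals pass to the full open interval,
  which is how \<open>ode_param_Ck\<close> ends.\<close>

lemma Ck_on_local:
 assumes "\<And>x. x \<in> U ==> \<exists>V. open V \<and> x \<in> V \<and> Ck_on k V f"
 shows "Ck_on k U f"
 using assms
proof (induction k arbitrary: f)
 case 0
 have "isCont f x" if "x \<in> U" for x
  using 0[OF that] by (auto simp: continuous_on_eq_continuous_at)
 thus ?case by (simp add: continuous_at_imp_continuous_on)
next
 case (Suc k)
 have "Ck_on k U (\<lambda>x. dd f x v)" for v
  by (rule Suc.IH) (use Suc.prems in fastforce)
 thus ?case using Suc.prems by fastforce
qed

lemma smooth_on_cong:
 assumes "open U" "\<And>y. y \<in> U ==> f y = g y" "smooth_on U f"
 shows "smooth_on U g"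
 using assms(3) Ck_on_cong[OF assms(1), of f g] assms(2) unfolding smooth_on_def by blast

lemma smooth_on_subset: "smooth_on U f ==> V \<subseteq> U ==> smooth_on V f"
 unfolding smooth_on_def using Ck_on_subset by blast

lemma smooth_on_iff:
 "smooth_on U f \<longleftrightarrow> (\<forall>x\<in>U. f differentiable (at x)) \<and> (\<forall>v. smooth_on U (\<lambda>x. dd f x v))"
proof
 assume *: "smooth_on U f"
 hence "Ck_on (Suc k) U f" for k unfolding smooth_on_def by blast
 thus "(\<forall>x\<in>U. f differentiable (at x)) \<and> (\<forall>v. smooth_on U (\<lambda>x. dd f x v))"
  unfolding smooth_on_def by simp
next
 assume *: "(\<forall>x\<in>U. f differentiable (at x)) \<and> (\<forall>v. smooth_on U (\<lambda>x. dd f x v))"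
 \<comment> \<open>Order \<open>k\<close> follows from order \<open>Suc k\<close>, and the latter
   unfolds directly into the assumption.\<close>
 have "Ck_on k U f" for k
  by (rule Ck_on_SucD) (use * in \<open>simp add: smooth_on_def\<close>)
 thus "smooth_on U f" unfolding smooth_on_def by blast
qed

lemma smooth_onD: "smooth_on U f ==> x \<in> U ==> f differentiable (at x)"
 using smooth_on_iff by blast

lemma smooth_on_has_derivative:
 "smooth_on U f ==> x \<in> U ==> (f has_derivative dd f x) (at x)"
 using smooth_onD frechet_derivative_works by blast

lemma smooth_on_continuous: "smooth_on U f ==> continuous_on U f"
 unfolding smooth_on_def by (metis Ck_on.simps(1))

lemma smooth_on_frechet: "smooth_on U f ==> smooth_on U (\<lambda>x. dd f x v)"
 using smooth_on_iff by blast

lemma frechet_eqI: "(f has_derivative D) (at x) ==> dd f x = D"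
 by (rule frechet_derivative_at[symmetric])

lemma Ck_on_const: "Ck_on k U (\<lambda>x. c)"
proof (induction k arbitrary: c)
 case (Suc k)
 have "(\<lambda>x. dd (\<lambda>x. c) x v) = (\<lambda>x::'a. 0)" for v :: 'a
  by (simp add: frechet_eqI[OF has_derivative_const])
 thus ?case using Suc by simp
qed simp

lemma Ck_on_linear:
 assumes "bounded_linear h" "open U" "Ck_on k U f"
 shows "Ck_on k U (\<lambda>x. h (f x))"
 using assms(3)
proof (induction k arbitrary: f)
 case 0 thus ?case
  using assms(1) by (simp add: bounded_linear.continuous_on)
next
 case (Suc k)
 have D: "((\<lambda>x. h (f x)) has_derivative (\<lambda>v. h (dd f x v))) (at x)" if "x \<in> U" for x
  by (rule bounded_linear.has_derivative[OF assms(1)])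
   (use Suc.prems that in \<open>auto simp: frechet_derivative_works[symmetric]\<close>)
 have "Ck_on k U (\<lambda>x. dd (\<lambda>x. h (f x)) x v)" for v
  by (rule Ck_on_cong[OF assms(2) _ Suc.IH[of "\<lambda>x. dd f x v"]])
   (use Suc.prems frechet_eqI[OF D] in auto)
 thus ?case using D by (auto simp: differentiable_def)
qed

lemma Ck_on_add:
 assumes "open U" "Ck_on k U f" "Ck_on k U g"
 shows "Ck_on k U (\<lambda>x. f x + g x)"
 using assms(2,3)
proof (induction k arbitrary: f g)
 case 0 thus ?case by (simp add: continuous_on_add)
next
 case (Suc k)
 have D: "((\<lambda>x. f x + g x) has_derivative (\<lambda>v. dd f x v + dd g x v)) (at x)" if "x \<in> U" for x
  using Suc.prems that by (auto intro!: has_derivative_add simp: frechet_derivative_works[symmetric])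
 have "Ck_on k U (\<lambda>x. dd (\<lambda>x. f x + g x) x v)" for v
  by (rule Ck_on_cong[OF assms(1) _ Suc.IH[of "\<lambda>x. dd f x v" "\<lambda>x. dd g x v"]])
   (use Suc.prems frechet_eqI[OF D] in auto)
 thus ?case using D by (auto simp: differentiable_def)
qed

text \<open>The product rule gives two terms of the same shape with one factor differentiated, so
  the induction closes once the other factor is weakened from order \<open>Suc k\<close> to
  \<open>k\<close>. Products, scalar multiples and inner products are all instances.\<close>

lemma Ck_on_bilinear:
 assumes "bounded_bilinear h" "open U" "Ck_on k U f" "Ck_on k U g"
 shows "Ck_on k U (\<lambda>x. h (f x) (g x))"
 using assms(3,4)
proof (induction k arbitrary: f g)
 case 0 thus ?case using bounded_bilinear.continuous_on[OF assms(1)] by simp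
next
 case (Suc k)
 have D: "((\<lambda>x. h (f x) (g x)) has_derivative (\<lambda>v. h (f x) (dd g x v) + h (dd f x v) (g x))) (at x)" if "x \<in> U" for x
  using Suc.prems that by (auto intro!: bounded_bilinear.FDERIV[OF assms(1)] simp: frechet_derivative_works[symmetric])
 have "Ck_on k U (\<lambda>x. dd (\<lambda>x. h (f x) (g x)) x v)" for v
  by (rule Ck_on_cong[OF assms(2) _ Ck_on_add[OF assms(2) Suc.IH[of "f" "\<lambda>x. dd g x v"] Suc.IH[of "\<lambda>x. dd f x v" g]]])
   (use Suc.prems frechet_eqI[OF D] Ck_on_SucD in auto)
 thus ?case using D by (auto simp: differentiable_def)
qed

lemma Ck_on_sum:
 assumes "open U" "\<And>i. i \<in> I ==> Ck_on k U (f i)"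
 shows "Ck_on k U (\<lambda>x. \<Sum>i\<in>I. f i x)"
 using assms(2)
proof (induction I rule: infinite_finite_induct)
 case (insert i I)
 hence "Ck_on k U (\<lambda>x. f i x + (\<Sum>i\<in>I. f i x))"
  by (intro Ck_on_add[OF assms(1)]) auto
 thus ?case using insert.hyps by simp
qed (simp_all add: Ck_on_const)

text \<open>\<open>Ck_on\<close> only knows derivatives in fixed directions. Expanding a variable
  direction in a basis reduces to these; compositions and derivatives along vector fields rest on
  it.\<close>

lemma frechet_expand:
 fixes f :: "'a::euclidean_space \<Rightarrow> 'b::real_normed_vector"
 assumes "f differentiable (at x)"
 shows "dd f x w = (\<Sum>b\<in>Basis. (w \<bullet> b) *R dd f x b)"
proof -
 have L: "linear (dd f x)" using assms by (rule linear_frechet_derivative)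
 have "dd f x (\<Sum>b\<in>Basis. (w \<bullet> b) *R b) = (\<Sum>b\<in>Basis. (w \<bullet> b) *R dd f x b)"
  by (simp add: linear_sum[OF L] linear_scale[OF L])
 thus ?thesis by (simp add: euclidean_representation)
qed

text \<open>The chain rule differentiates \<open>g\<close> in the direction \<open>dd f x v\<close>,
  which moves with \<open>x\<close>; the Euclidean structure of the middle space turns this into a
  finite combination of fixed directions, to which the induction hypothesis applies.\<close>

lemma Ck_on_compose:
 fixes f :: "'a::real_normed_vector \<Rightarrow> 'b::euclidean_space"
 assumes "open U" "open W" "f ` U \<subseteq> W" "Ck_on k U f" "Ck_on k W g"
 shows "Ck_on k U (\<lambda>x. g (f x))"
 using assms(4,5)
proof (induction k arbitrary: g)
 case 0 thus ?case using assms(3) by (simp add: continuous_on_compose2)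
next
 case (Suc k)
 have D: "((\<lambda>x. g (f x)) has_derivative (\<lambda>v. dd g (f x) (dd f x v))) (at x)" if "x \<in> U" for x
 proof -
  have "(f has_derivative dd f x) (at x)"
   "(g has_derivative dd g (f x)) (at (f x))"
   using Suc.prems that assms(3) by (auto simp: frechet_derivative_works[symmetric])
  from has_derivative_compose[OF this] show ?thesis .
 qed
 have E: "dd (\<lambda>x. g (f x)) x v = (\<Sum>b\<in>Basis. (dd f x v \<bullet> b) *R dd g (f x) b)" if "x \<in> U" for x v
 proof -
  have "g differentiable (at (f x))" using Suc.prems(2) assms(3) that by auto
  thus ?thesis unfolding frechet_eqI[OF D[OF that]] by (rule frechet_expand)
 qed
 have "Ck_on k U (\<lambda>x. dd (\<lambda>x. g (f x)) x v)" for v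
 proof (rule Ck_on_cong[OF assms(1)])
  show "Ck_on k U (\<lambda>x. \<Sum>b\<in>Basis. (dd f x v \<bullet> b) *R dd g (f x) b)"
   by (intro Ck_on_sum assms(1) Ck_on_bilinear[OF bounded_bilinear_scaleR] Ck_on_linear[OF bounded_linear_inner_left])
    (use Suc.prems Ck_on_SucD in \<open>auto intro!: Suc.IH\<close>)
 qed (simp add: E)
 thus ?case using D by (auto simp: differentiable_def)
qed

lemma Ck_on_id: "Ck_on k U (\<lambda>x. x)"
proof (cases k)
 case (Suc k)
 have "(\<lambda>x. dd (\<lambda>x. x) x v) = (\<lambda>x::'a. v)" for v :: 'a
  by (simp add: frechet_eqI[OF has_derivative_ident])
 thus ?thesis using Suc by (auto simp: Ck_on_const)
qed simp

named_theorems smooth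

lemma smooth_on_const [smooth]: "smooth_on U (\<lambda>x. c)"
 by (simp add: smooth_on_def Ck_on_const)
lemma smooth_on_id [smooth]: "smooth_on U (\<lambda>x. x)"
 by (simp add: smooth_on_def Ck_on_id)
lemma smooth_on_linear:
 "bounded_linear h ==> open U ==> smooth_on U f ==> smooth_on U (\<lambda>x. h (f x))"
 using Ck_on_linear[of h U _ f] unfolding smooth_on_def by blast
lemma smooth_on_bilinear:
 "bounded_bilinear h ==> open U ==> smooth_on U f ==> smooth_on U g ==> smooth_on U (\<lambda>x. h (f x) (g x))"
 using Ck_on_bilinear[of h U _ f g] unfolding smooth_on_def by blast
lemma smooth_on_add [smooth]:
 "open U ==> smooth_on U f ==> smooth_on U g ==> smooth_on U (\<lambda>x. f x + g x)"
 using Ck_on_add[of U _ f g] unfolding smooth_on_def by blast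
lemma smooth_on_sum [smooth]:
 "open U ==> (\<And>i. i \<in> I ==> smooth_on U (f i)) ==> smooth_on U (\<lambda>x. \<Sum>i\<in>I. f i x)"
 using Ck_on_sum[of U I _ f] unfolding smooth_on_def by blast
lemma smooth_on_compose:
 fixes f :: "'a::real_normed_vector \<Rightarrow> 'b::euclidean_space"
 shows "open U ==> open W ==> f ` U \<subseteq> W ==> smooth_on U f ==> smooth_on W g ==> smooth_on U (\<lambda>x. g (f x))"
 using Ck_on_compose[of U W f _ g] unfolding smooth_on_def by blast
lemmas smooth_on_scaleR [smooth] = smooth_on_bilinear[OF bounded_bilinear_scaleR]
lemmas smooth_on_mult [smooth] = smooth_on_bilinear[OF bounded_bilinear_mult]
lemmas smooth_on_inner [smooth] = smooth_on_bilinear[OF bounded_bilinear_inner]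
lemmas smooth_on_minus [smooth] = smooth_on_linear[OF bounded_linear_minus[OF bounded_linear_ident]]
lemma smooth_on_diff [smooth]:
 "open U ==> smooth_on U f ==> smooth_on U g ==> smooth_on U (\<lambda>x. f x - g x)"
 using smooth_on_add[of U f "\<lambda>x. - g x"] smooth_on_minus[of U g] by simp
lemma smooth_on_power [smooth]:
 fixes f :: "'a::real_normed_vector \<Rightarrow> 'b::real_normed_algebra_1"
 assumes "open U" "smooth_on U f"
 shows "smooth_on U (\<lambda>x. f x ^ n)"
proof (induction n)
 case (Suc n)
 from smooth_on_mult[OF assms Suc] show ?case by simp
qed (simp add: smooth_on_const)
lemma smooth_on_prod [smooth]:
 fixes f :: "'i \<Rightarrow> 'a::real_normed_vector \<Rightarrow> real"
 assumes "open U" "\<And>i. i \<in> I ==> smooth_on U (f i)"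
 shows "smooth_on U (\<lambda>x. \<Prod>i\<in>I. f i x)"
 using assms(2)
proof (induction I rule: infinite_finite_induct)
 case (insert i I)
 hence "smooth_on U (\<lambda>x. f i x * (\<Prod>i\<in>I. f i x))"
  by (intro smooth_on_mult[OF assms(1)]) auto
 thus ?case using insert.hyps by simp
qed (simp_all add: smooth_on_const)
lemmas smooth_on_nth [smooth] = smooth_on_linear[OF bounded_linear_vec_nth]

lemma smooth_on_Pair [smooth]:
 assumes "open U" "smooth_on U f" "smooth_on U g"
 shows "smooth_on U (\<lambda>x. (f x, g x))"
proof -
 have "bounded_linear (\<lambda>x::'b. (x, 0::'c))" "bounded_linear (\<lambda>x::'c. (0::'b, x))"
  by (intro bounded_linear_Pair bounded_linear_ident bounded_linear_zero)+
 from smooth_on_add[OF assms(1) smooth_on_linear[OF this(1) assms(1,2)] smooth_on_linear[OF this(2) assms(1,3)]]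
 show ?thesis by simp
qed

lemma bounded_linear_axis: "bounded_linear (axis i :: 'a::real_normed_vector \<Rightarrow> 'a ^ 'n)"
proof (rule bounded_linear_intro[where K=1])
 fix x :: 'a
 have "norm (axis i x :: 'a ^ 'n) \<le> (\<Sum>j\<in>UNIV. norm ((axis i x :: 'a ^ 'n) $ j))"
  by (simp add: norm_vec_def L2_set_le_sum)
 also have "\<dots> = (\<Sum>j\<in>UNIV. if j = i then norm x else 0)"
  by (rule sum.cong) (auto simp: axis_def)
 finally show "norm (axis i x :: 'a ^ 'n) \<le> norm x * 1" by simp
qed (auto simp: axis_def vec_eq_iff)

lemma smooth_on_vec:
 fixes f :: "'a::real_normed_vector \<Rightarrow> 'b::real_normed_vector ^ 'n"
 assumes "open U" "\<And>i. smooth_on U (\<lambda>x. f x $ i)"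
 shows "smooth_on U f"
proof -
 have "smooth_on U (\<lambda>x. \<Sum>i\<in>UNIV. axis i (f x $ i))"
  by (intro smooth_on_sum smooth_on_linear[OF bounded_linear_axis] assms)
 moreover have "(\<Sum>i\<in>UNIV. axis i (f x $ i)) = f x" for x
  by (simp add: vec_eq_iff axis_def)
 ultimately show ?thesis by simp
qed

lemma smooth_on_lambda [smooth]:
 assumes "open U" "\<And>i. smooth_on U (\<lambda>x. f x i)"
 shows "smooth_on U (\<lambda>x. \<chi> i. f x i)"
 by (rule smooth_on_vec[OF assms(1)]) (simp add: assms(2))

text \<open>The derivative is a polynomial in the function itself, so order \<open>k\<close> of the
  function gives order \<open>k\<close> of its derivative. The square root is treated in the same
  way, with its reciprocal.\<close>

lemma Ck_on_inverse: "Ck_on k (- {0}) (inverse :: real \<Rightarrow> real)"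
proof (induction k)
 case 0 thus ?case by (auto intro!: continuous_on_inverse continuous_on_id)
next
 case (Suc k)
 have D: "(inverse has_derivative (\<lambda>v. - (inverse x * v * inverse x))) (at x)" if "x \<in> - {0}" for x :: real
  using that by (auto intro: has_derivative_inverse')
 have "Ck_on k (- {0}) (\<lambda>x. dd inverse x v)" for v :: real
 proof (rule Ck_on_cong)
  show "Ck_on k (- {0}) (\<lambda>x. (inverse x * inverse x) * (- v))"
   by (intro Ck_on_bilinear[OF bounded_bilinear_mult] Ck_on_const Suc) auto
 qed (use frechet_eqI[OF D] in auto)
 thus ?case using D by (auto simp: differentiable_def)
qed

lemma smooth_on_inverse [smooth]:
 fixes f :: "'a::real_normed_vector \<Rightarrow> real"
 assumes "open U" "smooth_on U f" "\<And>x. x \<in> U ==> f x \<noteq> 0"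
 shows "smooth_on U (\<lambda>x. inverse (f x))"
 by (rule smooth_on_compose[of U "- {0}"]) (use assms Ck_on_inverse in \<open>auto simp: smooth_on_def\<close>)

lemma smooth_on_divide [smooth]:
 fixes f :: "'a::real_normed_vector \<Rightarrow> real"
 assumes "open U" "smooth_on U f" "smooth_on U g" "\<And>x. x \<in> U ==> g x \<noteq> 0"
 shows "smooth_on U (\<lambda>x. f x / g x)"
 unfolding divide_inverse using assms by (intro smooth_on_mult smooth_on_inverse)

lemma Ck_on_sqrt: "Ck_on k {0<..} sqrt"
proof (induction k)
 case 0 thus ?case by (auto intro!: continuous_intros)
next
 case (Suc k)
 have D: "(sqrt has_derivative ((*) (inverse (sqrt x) / 2))) (at x)" if "x \<in> {0<..}" for x :: real
  using DERIV_real_sqrt[of x] that by (simp add: has_field_derivative_def)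
 have i: "Ck_on k {0<..} (\<lambda>x. inverse (sqrt x))"
  by (rule Ck_on_compose[OF _ _ _ Suc Ck_on_inverse]) auto
 have "Ck_on k {0<..} (\<lambda>x. dd sqrt x v)" for v :: real
 proof (rule Ck_on_cong)
  show "Ck_on k {0<..} (\<lambda>x. inverse (sqrt x) * (v / 2))"
   by (intro Ck_on_bilinear[OF bounded_bilinear_mult] Ck_on_const i) auto
 qed (use frechet_eqI[OF D] in auto)
 thus ?case using D by (auto simp: differentiable_def)
qed

lemma smooth_on_sqrt [smooth]:
 assumes "open U" "smooth_on U f" "\<And>x. x \<in> U ==> f x > 0"
 shows "smooth_on U (\<lambda>x. sqrt (f x))"
 by (rule smooth_on_compose[of U "{0<..}"]) (use assms Ck_on_sqrt in \<open>auto simp: smooth_on_def\<close>)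

lemma smooth_on_frechet_field [smooth]:
 fixes f :: "'a::euclidean_space \<Rightarrow> 'b::real_normed_vector"
 assumes "open U" "smooth_on U f" "smooth_on U w"
 shows "smooth_on U (\<lambda>x. dd f x (w x))"
proof (rule smooth_on_cong[OF assms(1)])
 show "smooth_on U (\<lambda>x. \<Sum>b\<in>Basis. (w x \<bullet> b) *R dd f x b)"
  using assms smooth_on_frechet[OF assms(2)] by (intro smooth)
qed (use frechet_expand smooth_onD[OF assms(2)] in metis)

lemma smooth_on_det [smooth]:
 fixes M :: "'a::real_normed_vector \<Rightarrow> real ^ 'n ^ 'n"
 assumes "open U" "\<And>i j. smooth_on U (\<lambda>x. M x $ i $ j)"
 shows "smooth_on U (\<lambda>x. det (M x))"
 unfolding det_def by (intro smooth assms)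

section \<open>Symmetry of second derivatives\<close>

lemma second_difference:
 fixes f :: "'a::real_normed_vector \<Rightarrow> real"
 assumes "open U" "x \<in> U" "smooth_on U f" "e > 0"
 shows "\<exists>d>0. \<forall>s. 0 < s \<and> s < d \<longrightarrow>
  \<bar>f (x + s *R v + s *R w) - f (x + s *R v) - f (x + s *R w) + f x
   - s\<^sup>2 * dd (\<lambda>y. dd f y v) x w\<bar> \<le> s\<^sup>2 * e"
proof -
 define g where "g = (\<lambda>y. dd f y v)"
 define h where "h = (\<lambda>y. dd g y w)"
 have sg: "smooth_on U g" unfolding g_def by (rule smooth_on_frechet[OF assms(3)])
 have "continuous_on U h" unfolding h_def by (rule smooth_on_continuous[OF smooth_on_frechet[OF sg]])
 then obtain r0 where r0: "r0 > 0" "\<And>y. y \<in> U ==> dist y x < r0 ==> dist (h y) (h x) < e"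
  using assms(2,4) unfolding continuous_on_iff by blast
 obtain r1 where r1: "r1 > 0" "ball x r1 \<subseteq> U" using assms(1,2) openE by blast
 define r where "r = min r0 r1"
 have r: "r > 0" "\<And>y. dist y x < r ==> y \<in> U \<and> \<bar>h y - h x\<bar> < e"
  using r0 r1 unfolding r_def by (auto simp: dist_real_def subset_iff dist_commute)
 \<comment> \<open>Chosen so that for \<open>s < d\<close> the whole parallelogram with sides
   \<open>s *R v\<close> and \<open>s *R w\<close> stays within distance \<open>r\<close> of
   \<open>x\<close>.\<close>
 define d where "d = r / (norm v + norm w + 1)"
 have nv: "norm v + norm w + 1 > 0" by (simp add: add_nonneg_pos)
 have d: "d > 0" using r(1) nv by (simp add: d_def)
 have inb: "dist (x + a *R v + b *R w) x < r" if "0 \<le> a" "a \<le> s" "0 \<le> b" "b \<le> s" "0 < s" "s < d" for a b s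
 proof -
  have "dist (x + a *R v + b *R w) x \<le> norm (a *R v) + norm (b *R w)"
   using norm_triangle_ineq[of "a *R v" "b *R w"] by (simp add: dist_norm algebra_simps)
  also have "\<dots> \<le> s * norm v + s * norm w" using that by (simp add: add_mono mult_right_mono)
  also have "\<dots> \<le> s * (norm v + norm w + 1)" using that by (simp add: algebra_simps)
  also have "\<dots> < d * (norm v + norm w + 1)" using that nv by simp
  finally show ?thesis using nv by (simp add: d_def)
 qed
 have "\<bar>f (x + s *R v + s *R w) - f (x + s *R v) - f (x + s *R w) + f x - s\<^sup>2 * h x\<bar> \<le> s\<^sup>2 * e"
  if s: "0 < s" "s < d" for s
 proof -
  \<comment> \<open>The second difference is the increment of this function. One mean value step in
    the direction \<open>v\<close> and a second in the direction \<open>w\<close> turn it into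
    \<open>s\<^sup>2\<close> times a second derivative at a point of the parallelogram.\<close>
  define \<phi> where "\<phi> = (\<lambda>a. f (x + a *R v + s *R w) - f (x + a *R v))"
  have "(\<phi> has_real_derivative (g (x + a *R v + s *R w) - g (x + a *R v))) (at a)" if a: "0 \<le> a" "a \<le> s" for a
  proof -
   have "((\<lambda>a. f (x + a *R v + c *R w)) has_derivative (\<lambda>t. t * g (x + a *R v + c *R w))) (at a)" if "0 \<le> c" "c \<le> s" for c
   proof -
    let ?p = "x + a *R v + c *R w"
    have "?p \<in> U" using inb[of a s c] r(2) s a that by auto
    note fd = smooth_on_has_derivative[OF assms(3) this]
    have "((\<lambda>a. x + a *R v + c *R w) has_derivative (\<lambda>t. t *R v)) (at a)"
     by (auto intro!: derivative_eq_intros)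
    from has_derivative_compose[OF this fd]
    show ?thesis by (simp add: g_def linear_scale[OF has_derivative_linear[OF fd]])
   qed
   from this[of s] this[of 0] s show ?thesis
    by (auto simp: \<phi>_def has_field_derivative_def algebra_simps intro!: derivative_eq_intros)
  qed
  from MVT2[OF s(1) this] obtain a where a: "0 < a" "a < s"
   and "\<phi> s - \<phi> 0 = s * (g (x + a *R v + s *R w) - g (x + a *R v))" by auto
  moreover
  have "((\<lambda>b. g (x + a *R v + b *R w)) has_real_derivative h (x + a *R v + b *R w)) (at b)" if b: "0 \<le> b" "b \<le> s" for b
  proof -
   let ?p = "x + a *R v + b *R w"
   have "?p \<in> U" using inb[of a s b] r(2) s a b by auto
   note fd = smooth_on_has_derivative[OF sg this]
   have "((\<lambda>b. x + a *R v + b *R w) has_derivative (\<lambda>t. t *R w)) (at b)"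
    by (auto intro!: derivative_eq_intros)
   from has_derivative_compose[OF this fd]
   show ?thesis by (simp add: h_def linear_scale[OF has_derivative_linear[OF fd]] has_field_derivative_def mult.commute[of _ "dd g ?p w"])
  qed
  from MVT2[OF s(1) this] obtain b where b: "0 < b" "b < s"
   and "g (x + a *R v + s *R w) - g (x + a *R v) = s * h (x + a *R v + b *R w)" by auto
  ultimately have "\<phi> s - \<phi> 0 = s\<^sup>2 * h (x + a *R v + b *R w)" by (simp add: power2_eq_square)
  hence *: "f (x + s *R v + s *R w) - f (x + s *R v) - f (x + s *R w) + f x - s\<^sup>2 * h x
   = s\<^sup>2 * (h (x + a *R v + b *R w) - h x)" by (simp add: \<phi>_def algebra_simps)
  have "\<bar>h (x + a *R v + b *R w) - h x\<bar> \<le> e" using r(2)[OF inb[of a s b]] a b s by auto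
  thus ?thesis unfolding * abs_mult by (simp add: mult_left_mono)
 qed
 thus ?thesis using d unfolding h_def g_def by blast
qed

text \<open>Both orders of differentiation are limits of the same second difference, which does not
  change when \<open>v\<close> and \<open>w\<close> are exchanged. The tolerance is one third of the
  supposed gap, and two such errors cannot fill it.\<close>

lemma frechet_symmetric_real:
 fixes f :: "'a::real_normed_vector \<Rightarrow> real"
 assumes "open U" "x \<in> U" "smooth_on U f"
 shows "dd (\<lambda>y. dd f y v) x w
    = dd (\<lambda>y. dd f y w) x v" (is "?a = ?b")
proof (rule ccontr)
 assume "?a \<noteq> ?b"
 hence e: "\<bar>?a - ?b\<bar> / 3 > 0" by simp
 obtain d1 where d1: "d1 > 0" "\<And>s. 0 < s ==> s < d1 ==>
  \<bar>f (x + s *R v + s *R w) - f (x + s *R v) - f (x + s *R w) + f x - s\<^sup>2 * ?a\<bar> \<le> s\<^sup>2 * (\<bar>?a - ?b\<bar> / 3)"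
  using second_difference[OF assms e, of v w] by blast
 obtain d2 where d2: "d2 > 0" "\<And>s. 0 < s ==> s < d2 ==>
  \<bar>f (x + s *R w + s *R v) - f (x + s *R w) - f (x + s *R v) + f x - s\<^sup>2 * ?b\<bar> \<le> s\<^sup>2 * (\<bar>?a - ?b\<bar> / 3)"
  using second_difference[OF assms e, of w v] by blast
 define s where "s = min d1 d2 / 2"
 have s: "0 < s" "s < d1" "s < d2" using d1(1) d2(1) unfolding s_def by auto
 have "x + s *R w + s *R v = x + s *R v + s *R w" by simp
 hence "\<bar>s\<^sup>2 * ?a - s\<^sup>2 * ?b\<bar> \<le> 2 * (s\<^sup>2 * (\<bar>?a - ?b\<bar> / 3))"
  using d1(2)[OF s(1,2)] d2(2)[OF s(1,3)] by (simp only:)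
 hence "s\<^sup>2 * \<bar>?a - ?b\<bar> \<le> s\<^sup>2 * (2 * \<bar>?a - ?b\<bar> / 3)"
  by (simp add: right_diff_distrib[symmetric] abs_mult)
 hence "\<bar>?a - ?b\<bar> \<le> 2 * \<bar>?a - ?b\<bar> / 3" using s(1) by (simp add: mult_le_cancel_left_pos)
 thus False using e by simp
qed

lemma frechet_linear:
 assumes "bounded_linear h" "f differentiable (at x)"
 shows "dd (\<lambda>x. h (f x)) x v = h (dd f x v)"
 using frechet_eqI[OF bounded_linear.has_derivative[OF assms(1)]] assms(2) frechet_derivative_works by metis

lemma frechet_symmetric:
 fixes f :: "'a::real_normed_vector \<Rightarrow> 'b::euclidean_space"
 assumes "open U" "x \<in> U" "smooth_on U f"
 shows "dd (\<lambda>y. dd f y v) x w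
    = dd (\<lambda>y. dd f y w) x v"
proof (rule euclidean_eqI)
 fix b :: 'b
 have *: "dd (\<lambda>y. dd f y v) x w \<bullet> b
  = dd (\<lambda>y. dd (\<lambda>z. f z \<bullet> b) y v) x w" for v w
 proof -
  have "dd (\<lambda>y. dd f y v) x w \<bullet> b
   = dd (\<lambda>y. dd f y v \<bullet> b) x w"
   by (rule frechet_linear[OF bounded_linear_inner_left, symmetric])
    (rule smooth_onD[OF smooth_on_frechet[OF assms(3)] assms(2)])
  also have "\<dots> = dd (\<lambda>y. dd (\<lambda>z. f z \<bullet> b) y v) x w"
   by (rule fun_cong[OF frechet_cong[OF assms(1,2)]])
    (rule frechet_linear[OF bounded_linear_inner_left smooth_onD[OF assms(3)], symmetric])
  finally show ?thesis .
 qed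
 show "dd (\<lambda>y. dd f y v) x w \<bullet> b
  = dd (\<lambda>y. dd f y w) x v \<bullet> b"
  unfolding * by (rule frechet_symmetric_real[OF assms(1,2) smooth_on_linear[OF bounded_linear_inner_left assms(1,3)]])
qed

section \<open>Smoothness of flows\<close>

text \<open>The norm need not be differentiable at zero, so the argument runs with the squared norm
  plus \<open>e\<^sup>2\<close>, damped by an exponential. The rate \<open>L + 1\<close> instead of
  \<open>L\<close> pays for the cross term, by 2 n e \<le> n^2 + e^2.\<close>

lemma gronwall_pos:
 fixes u :: "real \<Rightarrow> 'a::real_inner"
 assumes "0 \<le> t" "0 \<le> L" "0 \<le> e"
  and der: "\<And>s. 0 \<le> s ==> s \<le> t ==> (u has_vector_derivative u' s) (at s)"
  and bd: "\<And>s. 0 \<le> s ==> s \<le> t ==> norm (u' s) \<le> L * norm (u s) + e"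
 shows "norm (u t) \<le> (norm (u 0) + e) * exp ((L + 1) * t)"
proof -
 define E where "E = (\<lambda>s. (u s \<bullet> u s + e\<^sup>2) * exp (- (2 * (L + 1)) * s))"
 have "E t \<le> E 0"
 proof (rule DERIV_nonpos_imp_nonincreasing[OF assms(1)])
  fix s assume s: "0 \<le> s" "s \<le> t"
  let ?d = "((u s \<bullet> u' s + u' s \<bullet> u s) - (u s \<bullet> u s + e\<^sup>2) * (2 * (L + 1))) * exp (- (2 * (L + 1)) * s)"
  have "((\<lambda>s. u s \<bullet> u s) has_vector_derivative (u s \<bullet> u' s + u' s \<bullet> u s)) (at s)"
   by (rule bounded_bilinear.has_vector_derivative[OF bounded_bilinear_inner der[OF s] der[OF s]])
  hence "((\<lambda>s. u s \<bullet> u s) has_real_derivative (u s \<bullet> u' s + u' s \<bullet> u s)) (at s)"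
   by (simp add: has_real_derivative_iff_has_vector_derivative)
  hence "(E has_real_derivative ?d) (at s)"
   unfolding E_def by (auto intro!: derivative_eq_intros simp: algebra_simps)
  moreover have "?d \<le> 0"
  proof (rule mult_nonpos_nonneg)
   define n where "n = norm (u s)"
   have "u s \<bullet> u' s \<le> n * (L * n + e)"
    unfolding n_def by (rule order_trans[OF norm_cauchy_schwarz mult_left_mono[OF bd[OF s] norm_ge_zero]])
   hence "u s \<bullet> u' s \<le> L * n\<^sup>2 + n * e" by (simp add: algebra_simps power2_eq_square)
   moreover have "2 * (n * e) \<le> n\<^sup>2 + e\<^sup>2"
    using sum_squares_bound[of n e] by simp
   moreover have "0 \<le> L * e\<^sup>2" "0 \<le> n\<^sup>2" "0 \<le> e\<^sup>2" using assms(2) by simp_all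
   moreover have "(u s \<bullet> u s + e\<^sup>2) * (2 * (L + 1)) = 2 * (L * n\<^sup>2) + 2 * (L * e\<^sup>2) + 2 * n\<^sup>2 + 2 * e\<^sup>2"
    by (simp add: n_def dot_square_norm algebra_simps)
   ultimately show "u s \<bullet> u' s + u' s \<bullet> u s - (u s \<bullet> u s + e\<^sup>2) * (2 * (L + 1)) \<le> 0"
    unfolding inner_commute[of "u' s"] by linarith
  qed simp
  ultimately show "\<exists>y. (E has_real_derivative y) (at s) \<and> y \<le> 0" by blast
 qed
 hence "(u t \<bullet> u t + e\<^sup>2) * exp (- (2 * (L + 1)) * t) * exp (2 * (L + 1) * t) \<le> (u 0 \<bullet> u 0 + e\<^sup>2) * exp (2 * (L + 1) * t)"
  unfolding E_def by (intro mult_right_mono) simp_all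
 moreover have "exp (- (2 * (L + 1)) * t) * exp (2 * (L + 1) * t) = 1"
 proof -
  have "- (2 * (L + 1)) * t + 2 * (L + 1) * t = 0" by (simp add: algebra_simps)
  thus ?thesis unfolding exp_add[symmetric] by simp
 qed
 ultimately have "(norm (u t))\<^sup>2 + e\<^sup>2 \<le> ((norm (u 0))\<^sup>2 + e\<^sup>2) * exp (2 * (L + 1) * t)"
  by (simp only: mult.assoc[of _ "exp (- (2 * (L + 1)) * t)"] mult_1_right dot_square_norm)
 also have "\<dots> \<le> (norm (u 0) + e)\<^sup>2 * exp (2 * (L + 1) * t)"
  using assms(3) by (intro mult_right_mono) (auto simp: power2_sum)
 also have "\<dots> = ((norm (u 0) + e) * exp ((L + 1) * t))\<^sup>2"
  by (simp add: power_mult_distrib exp_double[symmetric] mult.assoc)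
 finally have "(norm (u t))\<^sup>2 \<le> ((norm (u 0) + e) * exp ((L + 1) * t))\<^sup>2"
  using zero_le_power2[of e] by linarith
 thus ?thesis by (rule power2_le_imp_le) (use assms(3) in auto)
qed

lemma gronwall:
 fixes u :: "real \<Rightarrow> 'a::real_inner"
 assumes "0 \<le> L" "0 \<le> e"
  and der: "\<And>s. s \<in> closed_segment 0 t ==> (u has_vector_derivative u' s) (at s)"
  and bd: "\<And>s. s \<in> closed_segment 0 t ==> norm (u' s) \<le> L * norm (u s) + e"
 shows "norm (u t) \<le> (norm (u 0) + e) * exp ((L + 1) * \<bar>t\<bar>)"
proof (cases "0 \<le> t")
 case True
 thus ?thesis using gronwall_pos[OF True assms(1,2), of u u'] der bd
  by (simp add: closed_segment_eq_real_ivl)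
next
 case False
 have "((\<lambda>s. u (- s)) has_vector_derivative - u' (- s)) (at s)" if "0 \<le> s" "s \<le> - t" for s
 proof -
  have "(u has_vector_derivative u' (- s)) (at (- s))"
   using der[of "- s"] that False by (simp add: closed_segment_eq_real_ivl)
  moreover have "(uminus has_vector_derivative - 1) (at s)"
   by (auto intro!: derivative_eq_intros)
  ultimately show ?thesis
   using vector_diff_chain_at[of uminus "- 1" s u "u' (- s)"] by (simp add: o_def)
 qed
 from gronwall_pos[OF _ assms(1,2) this, of "- t"] bd False
 show ?thesis by (simp add: closed_segment_eq_real_ivl)
qed

section \<open>Thickenings of compact sets, the contraction argument and uniform
  linearization\<close>

lemma thickening_eq:
 fixes K :: "'a::real_normed_vector set"
 shows "(\<Union>x\<in>K. cball x r) = (\<Union>x\<in>K. \<Union>y\<in>cball 0 r. {x + y})"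
  "(\<Union>x\<in>K. ball x r) = (\<Union>x\<in>K. \<Union>y\<in>ball 0 r. {x + y})"
proof -
 have "(\<Union>y\<in>S. {x + y}) = (+) x ` S" for x :: 'a and S by auto
 thus "(\<Union>x\<in>K. cball x r) = (\<Union>x\<in>K. \<Union>y\<in>cball 0 r. {x + y})"
  "(\<Union>x\<in>K. ball x r) = (\<Union>x\<in>K. \<Union>y\<in>ball 0 r. {x + y})" by simp_all
qed

lemma compact_thickening:
 fixes K :: "'a::euclidean_space set"
 assumes "compact K"
 shows "compact (\<Union>x\<in>K. cball x r)"
 unfolding thickening_eq by (rule compact_sums'[OF assms compact_cball])

lemma convex_thickening:
 fixes K :: "'a::real_normed_vector set"
 assumes "convex K"
 shows "convex (\<Union>x\<in>K. cball x r)" "convex (\<Union>x\<in>K. ball x r)"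
 unfolding thickening_eq by (intro convex_sums assms convex_cball convex_ball)+

text \<open>A contraction on bounded continuous functions. The right-hand side is defined and
  Lipschitz on the whole space, so no solution can leave its domain, and the time interval is fixed
  in advance by \<open>L * T \<le> 1 / 2\<close>.\<close>

lemma picard:
 fixes g :: "real \<Rightarrow> 'b::euclidean_space \<Rightarrow> 'b"
 assumes T: "0 < T" and L: "0 \<le> L" "L * T \<le> 1 / 2"
  and cont: "continuous_on ({-T..T} \<times> UNIV) (\<lambda>p. g (fst p) (snd p))"
  and lip: "\<And>t v w. t \<in> {-T..T} ==> norm (g t v - g t w) \<le> L * norm (v - w)"
 shows "\<exists>y. y 0 = y0 \<and> (\<forall>t\<in>{-T<..<T}. (y has_vector_derivative g t (y t)) (at t))"
proof -
 \<comment> \<open>Clamping time to the interval makes every iterate a bounded continuous function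
   on the whole line, an element of the complete space in which the fixed point is sought.\<close>
 define c where "c t = max (- T) (min T t)" for t
 have c: "c t \<in> {-T..T}" for t using T by (auto simp: c_def)
 have cid: "c t = t" if "t \<in> {-T..T}" for t using that by (auto simp: c_def)
 have cc: "continuous_on UNIV c" unfolding c_def by (intro continuous_intros)
 \<comment> \<open>The integral runs from the left end \<open>-T\<close>; subtracting its value at
   \<open>0\<close> in \<open>\<Phi>\<close> moves the initial time to \<open>0\<close>.\<close>
 define H where "H z t = integral {-T..t} (\<lambda>s. g s (apply_bcontfun z s))" for z :: "real \<Rightarrow>\<^sub>C 'b" and t
 have ch: "continuous_on {-T..T} (\<lambda>s. g s (apply_bcontfun z s))" for z :: "real \<Rightarrow>\<^sub>C 'b"
 proof -
  have "continuous_on {-T..T} (\<lambda>s. (s, apply_bcontfun z s))" by (intro continuous_intros) auto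
  from continuous_on_compose2[OF cont this] show ?thesis by auto
 qed
 have Hd: "(H z has_vector_derivative g t (apply_bcontfun z t)) (at t within {-T..T})" if "t \<in> {-T..T}" for z t
  unfolding H_def by (rule integral_has_vector_derivative[OF ch that])
 have Hc: "continuous_on {-T..T} (H z)" for z
  using Hd by (meson continuous_on_eq_continuous_within has_vector_derivative_continuous)
 define \<Phi> where "\<Phi> z = Bcontfun (\<lambda>t. y0 + (H z (c t) - H z 0))" for z
 have bc: "(\<lambda>t. y0 + (H z (c t) - H z 0)) \<in> bcontfun" for z
 proof -
  have "continuous_on UNIV (\<lambda>t. H z (c t))"
   by (rule continuous_on_compose2[OF Hc cc]) (use c in auto)
  moreover have "bounded (H z ` {-T..T})"
   by (intro compact_imp_bounded compact_continuous_image Hc) simp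
  then obtain B where "\<forall>t\<in>{-T..T}. norm (H z t) \<le> B" unfolding bounded_iff by auto
  hence "norm (H z (c t)) \<le> B" for t using c by auto
  hence "norm (y0 + (H z (c t) - H z 0)) \<le> norm y0 + (B + norm (H z 0))" for t
   by (smt (verit) norm_triangle_ineq norm_triangle_ineq4)
  ultimately show ?thesis by (intro bcontfun_normI) (auto intro!: continuous_intros)
 qed
 have \<Phi>: "apply_bcontfun (\<Phi> z) t = y0 + (H z (c t) - H z 0)" for z t
  unfolding \<Phi>_def using bc by (simp add: Bcontfun_inverse)
 have "dist (\<Phi> z) (\<Phi> w) \<le> 1 / 2 * dist z w" for z w
 proof (rule dist_bound)
  fix t
  have "norm ((H z (c t) - H w (c t)) - (H z 0 - H w 0)) \<le> (L * dist z w) * norm (c t - 0)"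
  proof (rule differentiable_bound[where S = "{-T..T}"])
   fix s assume s: "s \<in> {-T..T}"
   have D: "((\<lambda>t. H z t - H w t) has_vector_derivative (g s (apply_bcontfun z s) - g s (apply_bcontfun w s))) (at s within {-T..T})"
    by (intro has_vector_derivative_diff Hd s)
   thus "((\<lambda>t. H z t - H w t) has_derivative (\<lambda>r. r *R (g s (apply_bcontfun z s) - g s (apply_bcontfun w s)))) (at s within {-T..T})"
    by (simp add: has_vector_derivative_def)
   have "norm (g s (apply_bcontfun z s) - g s (apply_bcontfun w s)) \<le> L * dist z w"
    using lip[OF s, of "apply_bcontfun z s" "apply_bcontfun w s"]
     mult_left_mono[OF norm_bounded[of "z - w" s] L(1)] by (simp add: dist_norm)
   thus "onorm (\<lambda>r. r *R (g s (apply_bcontfun z s) - g s (apply_bcontfun w s))) \<le> L * dist z w"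
    by (simp add: onorm_scaleR_left bounded_linear_ident onorm_id)
  qed (use c T in auto)
  also have "\<dots> \<le> (L * dist z w) * T"
   using c[of t] L(1) by (intro mult_left_mono) auto
  also have "\<dots> \<le> 1 / 2 * dist z w"
   using mult_right_mono[OF L(2), of "dist z w"] by (simp add: algebra_simps)
  finally show "dist (apply_bcontfun (\<Phi> z) t) (apply_bcontfun (\<Phi> w) t) \<le> 1 / 2 * dist z w"
   by (simp add: \<Phi> dist_norm algebra_simps)
 qed
 then obtain z where z: "\<Phi> z = z" using banach_fix_type[of "1/2" \<Phi>] by auto
 define y where "y = apply_bcontfun z"
 have y: "y t = y0 + (H z (c t) - H z 0)" for t unfolding y_def using \<Phi>[of z t] z by simp
 have "(y has_vector_derivative g t (y t)) (at t)" if t: "t \<in> {-T<..<T}" for t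
 proof -
  have "(H z has_vector_derivative g t (apply_bcontfun z t)) (at t within {-T<..<T})"
   by (rule has_vector_derivative_within_subset[OF Hd]) (use t in auto)
  hence "(H z has_vector_derivative g t (y t)) (at t)"
   using t by (simp add: y_def at_within_open[OF t])
  hence "((\<lambda>t. y0 + (H z t - H z 0)) has_vector_derivative g t (y t)) (at t)"
   by (auto intro!: derivative_eq_intros)
  thus ?thesis
   by (rule has_vector_derivative_transform_within_open[of _ _ _ "{-T<..<T}"]) (use t cid in \<open>auto simp: y\<close>)
 qed
 moreover have "y 0 = y0" using y[of 0] cid[of 0] T by simp
 ultimately show ?thesis by blast
qed

lemma Ck_on_continuous: "Ck_on k U f ==> continuous_on U f"
proof (induction k)
 case (Suc k)
 show ?case by (rule Suc.IH[OF Ck_on_SucD[OF Suc.prems]])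
qed simp

lemma onorm_le_basis:
 fixes D :: "'a::euclidean_space \<Rightarrow> 'b::real_normed_vector"
 assumes "linear D"
 shows "onorm D \<le> (\<Sum>b\<in>Basis. norm (D b))"
proof (rule onorm_bound)
 fix x
 have "D x = D (\<Sum>b\<in>Basis. (x \<bullet> b) *R b)" by (simp add: euclidean_representation)
 also have "\<dots> = (\<Sum>b\<in>Basis. (x \<bullet> b) *R D b)"
  by (simp add: linear_sum[OF assms] linear_scale[OF assms])
 also have "norm \<dots> \<le> (\<Sum>b\<in>Basis. norm x * norm (D b))"
  by (rule sum_norm_le) (simp add: mult_right_mono Basis_le_norm)
 finally show "norm (D x) \<le> (\<Sum>b\<in>Basis. norm (D b)) * norm x"
  by (simp add: sum_distrib_left mult.commute)
qed (simp add: sum_nonneg)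

text \<open>One radius serves all base points of \<open>K\<close>: the derivatives in basis
  directions are uniformly continuous on a compact thickening, and the sum of their variations
  bounds the operator norm in the mean value inequality.\<close>

lemma uniform_differentiability:
 fixes f :: "'a::euclidean_space \<Rightarrow> 'b::real_normed_vector"
 assumes "open W" "Ck_on (Suc k) W f" "compact K" "K \<subseteq> W" "e > 0"
 shows "\<exists>d>0. \<forall>q\<in>K. \<forall>h. norm h < d \<longrightarrow> q + h \<in> W \<and>
  norm (f (q + h) - f q - dd f q h) \<le> e * norm h"
proof -
 obtain d0 where d0: "d0 > 0" "(\<Union>x\<in>K. cball x d0) \<subseteq> W"
  using compact_subset_open_imp_cball_epsilon_subset[OF assms(3,1,4)] by blast
 define K' where "K' = (\<Union>x\<in>K. cball x d0)"
 have cK: "compact K'" unfolding K'_def by (rule compact_thickening[OF assms(3)])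
 have K'W: "K' \<subseteq> W" using d0 by (simp add: K'_def)
 define N where "N = real DIM('a)"
 have N: "N > 0" by (simp add: N_def)
 have uc: "uniformly_continuous_on K' (\<lambda>x. dd f x b)" for b
 proof (rule compact_uniformly_continuous[OF _ cK])
  show "continuous_on K' (\<lambda>x. dd f x b)"
   by (rule continuous_on_subset[OF Ck_on_continuous K'W]) (use assms(2) in auto)
 qed
 have "\<exists>d>0. \<forall>x\<in>K'. \<forall>y\<in>K'. dist y x < d \<longrightarrow> norm (dd f y b - dd f x b) < e / N" for b
 proof -
  have "e / N > 0" using assms(5) N by simp
  with uc[of b]
  show ?thesis unfolding uniformly_continuous_on_def dist_norm by blast
 qed
 then obtain db where db: "\<And>b. db b > 0" "\<And>b x y. x \<in> K' ==> y \<in> K' ==> dist y x < db b ==>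
   norm (dd f y b - dd f x b) < e / N" by metis
 define d where "d = min d0 (Min (db ` (Basis::'a set)))"
 have d: "d > 0" using d0(1) db(1) by (simp add: d_def)
 have dbm: "d \<le> db b" if "b \<in> Basis" for b using that by (simp add: d_def min.coboundedI2)
 have diff: "(f has_derivative dd f x) (at x)" if "x \<in> W" for x
  using assms(2) that by (simp add: frechet_derivative_works[symmetric])
 have "q + h \<in> W \<and> norm (f (q + h) - f q - dd f q h) \<le> e * norm h"
  if q: "q \<in> K" and h: "norm h < d" for q h
 proof
  have sub: "q + t *R h \<in> K'" if "t \<in> {0..1}" for t
  proof -
   have "norm (t *R h) \<le> norm h" using that by (simp add: mult_left_le_one_le)
   thus ?thesis using q h by (auto simp: K'_def d_def dist_norm intro!: bexI[of _ q])
  qed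
  show "q + h \<in> W" using sub[of 1] K'W by auto
  define S where "S = (\<lambda>t. q + t *R h) ` {0..1}"
  have "norm (f (q + h) - f q - dd f q (q + h - q)) \<le> norm (q + h - q) * e"
  proof (rule differentiable_bound_linearization[where S = S])
   fix x assume "x \<in> S"
   then obtain t where t: "t \<in> {0..1}" "x = q + t *R h" by (auto simp: S_def)
   have xK: "x \<in> K'" using sub t by auto
   have qK: "q \<in> K'" using sub[of 0] by auto
   show "(f has_derivative dd f x) (at x within S)"
    using diff xK K'W has_derivative_at_withinI by blast
   have "norm (t *R h) \<le> norm h" using t by (simp add: mult_left_le_one_le)
   hence dx: "dist x q < d" using t h by (simp add: dist_norm)
   have lin: "linear (\<lambda>v. dd f x v - dd f q v)"
    using diff[of x] diff[of q] xK qK K'W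
    by (intro linear_compose_sub has_derivative_linear) auto
   have "onorm (\<lambda>v. dd f x v - dd f q v)
    \<le> (\<Sum>b\<in>Basis. norm (dd f x b - dd f q b))"
    by (rule onorm_le_basis[OF lin])
   also have "\<dots> \<le> (\<Sum>b\<in>(Basis::'a set). e / N)"
    by (rule sum_mono) (use db(2)[OF qK xK] dx dbm in \<open>smt (verit)\<close>)
   also have "\<dots> = e" using N by (simp add: N_def)
   finally show "onorm (dd f x - dd f q) \<le> e"
    by (simp add: fun_diff_def)
  next
   show "q \<in> S" by (auto simp: S_def image_iff intro!: bexI[of _ 0])
  qed (auto simp: S_def)
  thus "norm (f (q + h) - f q - dd f q h) \<le> e * norm h" by (simp add: mult.commute)
 qed
 thus ?thesis using d by blast
qed

text \<open>Through this the Lipschitz constant of the right-hand side in the unknown also bounds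
  its derivative, so the variational equation inherits the constant \<open>L\<close> and with it the
  same restriction on time.\<close>

lemma derivative_lipschitz_bound:
 fixes F :: "'a::real_normed_vector \<Rightarrow> 'b::real_normed_vector"
 assumes "(F has_derivative D) (at v)" "open S" "v \<in> S"
  and lip: "\<And>w. w \<in> S ==> norm (F w - F v) \<le> L * norm (w - v)"
 shows "norm (D h) \<le> L * norm h"
proof -
 have "((\<lambda>s. v + s *R h) has_derivative (\<lambda>s. s *R h)) (at 0)" by (auto intro!: derivative_eq_intros)
 from has_derivative_compose[OF this, of F D] assms(1)
 have "((\<lambda>s. F (v + s *R h)) has_derivative (\<lambda>s. D (s *R h))) (at 0)" by simp
 hence "((\<lambda>s. norm (F (v + s *R h) - F v - D (s *R h)) / norm s) \<longlongrightarrow> 0) (at 0)"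
  unfolding has_derivative_at by simp
 moreover have "norm (F (v + s *R h) - F v - D (s *R h)) / norm s
  = norm ((F (v + s *R h) - F v) /\<^sub>R s - D h)" if "s \<noteq> 0" for s
 proof -
  have "F (v + s *R h) - F v - D (s *R h) = s *R ((F (v + s *R h) - F v) /\<^sub>R s - D h)"
   using that by (simp add: scaleR_diff_right linear_scale[OF has_derivative_linear[OF assms(1)]])
  thus ?thesis using that by simp
 qed
 ultimately have "((\<lambda>s. norm ((F (v + s *R h) - F v) /\<^sub>R s - D h)) \<longlongrightarrow> 0) (at 0)"
  by (subst LIM_equal[where g = "\<lambda>s. norm (F (v + s *R h) - F v - D (s *R h)) / norm s"]) auto
 hence "((\<lambda>s. norm ((F (v + s *R h) - F v) /\<^sub>R s)) \<longlongrightarrow> norm (D h)) (at 0)"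
  by (intro tendsto_norm) (simp add: LIM_zero_iff tendsto_norm_zero_iff)
 moreover have "eventually (\<lambda>s. norm ((F (v + s *R h) - F v) /\<^sub>R s) \<le> L * norm h) (at 0)"
 proof -
  have "eventually (\<lambda>s. v + s *R h \<in> S) (at 0)"
  proof (rule topological_tendstoD[OF _ assms(2)])
   show "((\<lambda>s. v + s *R h) \<longlongrightarrow> v) (at 0)"
    by (rule tendsto_eq_intros refl | simp)+
  qed (rule assms(3))
  moreover have "eventually (\<lambda>s::real. s \<noteq> 0) (at 0)" by (simp add: eventually_at_filter)
  ultimately show ?thesis
  proof (eventually_elim)
   case (elim s)
   from lip[OF elim(1)] elim(2) show ?case by (auto simp: divide_simps mult_ac)
  qed
 qed
 ultimately show ?thesis by (rule tendsto_upperbound) simp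
qed

text \<open>Solutions \<open>u (t, x)\<close> are given, with a parameter \<open>x\<close>. Time and
  parameter may both enter the equation, and the initial value may be any function of
  \<open>x\<close>, because the derivatives of \<open>u\<close> in \<open>x\<close> satisfy a system
  of just this kind.\<close>

locale ode_param =
 fixes B :: "'a::euclidean_space set" and Y :: "'b::euclidean_space set" and T L :: real
  and f :: "(real \<times> 'a) \<times> 'b \<Rightarrow> 'b" and u :: "real \<times> 'a \<Rightarrow> 'b"
 assumes B: "open B" and Y: "open Y" and T: "0 < T" and L: "0 \<le> L"
  and f_cont: "continuous_on (({-T<..<T} \<times> B) \<times> Y) f"
  and lip: "\<And>t x v w. t \<in> {-T<..<T} ==> x \<in> B ==> v \<in> Y ==> w \<in> Y ==>
   norm (f ((t, x), v) - f ((t, x), w)) \<le> L * norm (v - w)"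
  and uY: "\<And>t x. t \<in> {-T<..<T} ==> x \<in> B ==> u (t, x) \<in> Y"
  and ode: "\<And>t x. t \<in> {-T<..<T} ==> x \<in> B ==>
   ((\<lambda>s. u (s, x)) has_vector_derivative f ((t, x), u (t, x))) (at t)"
  and init: "continuous_on B (\<lambda>x. u (0, x))"
begin

lemma curve_continuous:
 assumes "x \<in> B"
 shows "continuous_on {-T<..<T} (\<lambda>t. u (t, x))"
 using ode[OF _ assms] has_vector_derivative_continuous
 by (intro continuous_at_imp_continuous_on) blast

lemma exp_bound:
 assumes "t \<in> {-T<..<T}" "0 \<le> c"
 shows "c * exp ((L + 1) * \<bar>t\<bar>) \<le> c * exp ((L + 1) * T)"
 using assms L by (intro mult_left_mono) auto

text \<open>A Gronwall estimate for the difference of two solutions; the inhomogeneous term is the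
  change of \<open>f\<close> with the parameter along the reference solution, which is uniformly
  small by compactness.\<close>

lemma uniform_in_time:
 assumes x0: "x0 \<in> B" and t1: "t1 < T" and e: "e > 0"
 shows "\<exists>d>0. \<forall>x. norm (x - x0) < d \<longrightarrow> x \<in> B \<and> (\<forall>t\<in>{-t1..t1}. norm (u (t, x) - u (t, x0)) < e)"
proof -
 have I: "{-t1..t1} \<subseteq> {-T<..<T}" using t1 by auto
 obtain r where r: "r > 0" "cball x0 r \<subseteq> B" using B x0 open_contains_cball by blast
 define h where "h = (\<lambda>p. f ((fst p, snd p), u (fst p, x0)))"
 have "continuous_on ({-t1..t1} \<times> cball x0 r) (\<lambda>p. u (fst p, x0))"
  by (rule continuous_on_compose2[OF curve_continuous[OF x0]]) (use I in \<open>auto intro!: continuous_intros\<close>)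
 hence "continuous_on ({-t1..t1} \<times> cball x0 r) h"
  unfolding h_def
  by (intro continuous_on_compose2[OF f_cont]) (use I r uY x0 in \<open>auto intro!: continuous_intros\<close>)
 hence "uniformly_continuous_on ({-t1..t1} \<times> cball x0 r) h"
  by (rule compact_uniformly_continuous) (intro compact_Times compact_cball compact_Icc)
 \<comment> \<open>Initial error and inhomogeneity are each at most \<open>e1\<close>; after the
   Gronwall factor they add up to half of \<open>e\<close>.\<close>
 moreover define e1 where "e1 = e / (4 * exp ((L + 1) * T))"
 have e1: "e1 > 0" using e by (simp add: e1_def)
 ultimately obtain d1 where d1: "d1 > 0" "\<And>p q. p \<in> {-t1..t1} \<times> cball x0 r ==> q \<in> {-t1..t1} \<times> cball x0 r
   ==> dist q p < d1 ==> dist (h q) (h p) < e1"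
  unfolding uniformly_continuous_on_def by metis
 obtain d2 where d2: "d2 > 0" "\<And>x. x \<in> B ==> dist x x0 < d2 ==> dist (u (0, x)) (u (0, x0)) < e1"
  using init x0 e1 unfolding continuous_on_iff by metis
 have "x \<in> B \<and> (\<forall>t\<in>{-t1..t1}. norm (u (t, x) - u (t, x0)) < e)"
  if x: "norm (x - x0) < min r (min d1 d2)" for x
 proof (intro conjI ballI)
  show xB: "x \<in> B" using x r by (auto simp: dist_norm norm_minus_commute)
  fix t assume t: "t \<in> {-t1..t1}"
  have seg: "s \<in> {-t1..t1}" if "s \<in> closed_segment 0 t" for s
   using that t by (auto simp: closed_segment_eq_real_ivl split: if_splits)
  have "norm (u (t, x) - u (t, x0)) \<le> (norm (u (0, x) - u (0, x0)) + e1) * exp ((L + 1) * \<bar>t\<bar>)"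
  proof (rule gronwall[OF L less_imp_le[OF e1]])
   fix s assume s: "s \<in> closed_segment 0 t"
   note sI = subsetD[OF I seg[OF s]]
   show "((\<lambda>t. u (t, x) - u (t, x0)) has_vector_derivative f ((s, x), u (s, x)) - f ((s, x0), u (s, x0))) (at s)"
    by (intro has_vector_derivative_diff ode sI xB x0)
   have "norm (f ((s, x), u (s, x0)) - f ((s, x0), u (s, x0))) < e1"
    using d1(2)[of "(s, x0)" "(s, x)"] seg[OF s] x r(1)
    by (simp add: h_def dist_norm norm_minus_commute norm_Pair)
   moreover have "norm (f ((s, x), u (s, x)) - f ((s, x), u (s, x0))) \<le> L * norm (u (s, x) - u (s, x0))"
    by (intro lip uY sI xB x0)
   ultimately show "norm (f ((s, x), u (s, x)) - f ((s, x0), u (s, x0))) \<le> L * norm (u (s, x) - u (s, x0)) + e1"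
    using norm_triangle_ineq[of "f ((s, x), u (s, x)) - f ((s, x), u (s, x0))" "f ((s, x), u (s, x0)) - f ((s, x0), u (s, x0))"] by simp
  qed
  also have "\<dots> \<le> (e1 + e1) * exp ((L + 1) * \<bar>t\<bar>)"
   using d2(2)[OF xB] x by (intro mult_right_mono) (auto simp: dist_norm)
  also have "\<dots> \<le> (e1 + e1) * exp ((L + 1) * T)" by (rule exp_bound) (use t I e1 in auto)
  also have "\<dots> < e" using e by (simp add: e1_def)
  finally show "norm (u (t, x) - u (t, x0)) < e" .
 qed
 moreover have "min r (min d1 d2) > 0" using r(1) d1(1) d2(1) by simp
 ultimately show ?thesis by blast
qed

lemma continuous: "continuous_on ({-T<..<T} \<times> B) u"
proof (rule continuous_at_imp_continuous_on, safe)
 fix t0 x0 assume t0: "t0 \<in> {-T<..<T}" and x0: "x0 \<in> B"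
 define t1 where "t1 = (\<bar>t0\<bar> + T) / 2"
 have t1: "\<bar>t0\<bar> < t1" "t1 < T" using t0 by (auto simp: t1_def)
 show "isCont u (t0, x0)"
  unfolding continuous_at_eps_delta
 proof (intro allI impI)
  fix e :: real assume e: "e > 0"
  obtain d where d: "d > 0" "\<And>x. norm (x - x0) < d ==> x \<in> B \<and> (\<forall>t\<in>{-t1..t1}. norm (u (t, x) - u (t, x0)) < e / 2)"
   using uniform_in_time[OF x0 t1(2), of "e/2"] e by auto
  have "isCont (\<lambda>t. u (t, x0)) t0"
   using ode[OF t0 x0] by (rule has_vector_derivative_continuous)
  then obtain d' where d': "d' > 0" "\<And>t. dist t t0 < d' ==> dist (u (t, x0)) (u (t0, x0)) < e / 2"
   unfolding continuous_at_eps_delta using e by (metis half_gt_zero)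
  show "\<exists>d>0. \<forall>p. dist p (t0, x0) < d \<longrightarrow> dist (u p) (u (t0, x0)) < e"
  proof (intro exI[of _ "min d (min d' (t1 - \<bar>t0\<bar>))"] conjI allI impI)
   fix p :: "real \<times> 'a" assume p: "dist p (t0, x0) < min d (min d' (t1 - \<bar>t0\<bar>))"
   obtain t x where px: "p = (t, x)" by (cases p)
   have "dist t t0 \<le> dist p (t0, x0)" "dist x x0 \<le> dist p (t0, x0)"
    using dist_fst_le[of p "(t0, x0)"] dist_snd_le[of p "(t0, x0)"] by (auto simp: px)
   hence "dist t t0 < d'" "t \<in> {-t1..t1}" "norm (x - x0) < d"
    using p by (auto simp: dist_norm)
   hence "norm (u (t, x) - u (t, x0)) < e / 2" "norm (u (t, x0) - u (t0, x0)) < e / 2"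
    using d d' by (auto simp: dist_norm)
   thus "dist (u p) (u (t0, x0)) < e"
    using norm_triangle_ineq[of "u (t, x) - u (t, x0)" "u (t, x0) - u (t0, x0)"] by (simp add: px dist_norm)
  qed (use d d' t1 in auto)
 qed
qed

lemma fibre_derivative_bound:
 assumes "f differentiable (at ((t, x), u (t, x)))" "t \<in> {-T<..<T}" "x \<in> B"
 shows "norm (dd f ((t, x), u (t, x)) ((0, 0), k)) \<le> L * norm k"
proof -
 have "((\<lambda>v. ((t, x), v)) has_derivative (\<lambda>k. ((0, 0), k))) (at (u (t, x)))"
  by (auto intro!: derivative_eq_intros simp: zero_prod_def)
 from has_derivative_compose[OF this] assms(1)[unfolded frechet_derivative_works]
 have "((\<lambda>v. f ((t, x), v)) has_derivative (\<lambda>k. dd f ((t, x), u (t, x)) ((0, 0), k))) (at (u (t, x)))"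
  by blast
 thus ?thesis
  by (rule derivative_lipschitz_bound[OF _ Y]) (use lip uY assms in auto)
qed

text \<open>The difference of two solutions minus the solution of the linearized equation satisfies
  that equation up to an error small relative to \<open>norm h\<close>, and Gronwall makes this
  uniform in time. The margin between \<open>t2\<close> and \<open>t1\<close> keeps a closed time
  interval inside the domain of \<open>w\<close>.\<close>

lemma variation_bound:
 assumes f: "Ck_on (Suc 0) (({-T<..<T} \<times> B) \<times> Y) f"
  and x0: "x0 \<in> B" and t: "t2 < t1" "t1 < T" and e: "e > 0"
  and u0: "((\<lambda>x. u (0, x)) has_derivative D0) (at x0)"
  and w0: "\<And>h. w h 0 = D0 h"
  and w: "\<And>h t. t \<in> {-t1<..<t1} ==>
    (w h has_vector_derivative dd f ((t, x0), u (t, x0)) ((0, h), w h t)) (at t)"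
 shows "\<exists>d>0. \<forall>h. norm h < d \<longrightarrow> x0 + h \<in> B \<and>
   (\<forall>t\<in>{-t2..t2}. norm (u (t, x0 + h) - u (t, x0) - w h t) \<le> e * norm h)"
proof -
 define W where "W = ({-T<..<T} \<times> B) \<times> Y"
 have W: "open W" unfolding W_def by (intro open_Times B Y open_greaterThanLessThan)
 have I: "{-t2..t2} \<subseteq> {-T<..<T}" "{-t2..t2} \<subseteq> {-t1<..<t1}" using t by auto
 define \<gamma> where "\<gamma> t = ((t, x0), u (t, x0))" for t
 have \<gamma>W: "\<gamma> t \<in> W" if "t \<in> {-t2..t2}" for t
  using that I uY x0 by (auto simp: \<gamma>_def W_def)
 have c\<gamma>: "continuous_on {-t2..t2} \<gamma>" unfolding \<gamma>_def
  by (intro continuous_intros continuous_on_subset[OF curve_continuous[OF x0] I(1)])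
 have K: "compact (\<gamma> ` {-t2..t2})" by (intro compact_continuous_image c\<gamma> compact_Icc)
 have KW: "\<gamma> ` {-t2..t2} \<subseteq> W" using \<gamma>W by auto
 have fW: "Ck_on (Suc 0) W f" using f by (simp add: W_def)
 have fd: "(f has_derivative dd f q) (at q)" if "q \<in> W" for q
  using fW that by (simp add: frechet_derivative_works[symmetric])
 have lin: "linear (dd f q)" if "q \<in> W" for q
  using fd[OF that] by (rule has_derivative_linear)
 have "\<exists>C. \<forall>q\<in>\<gamma> ` {-t2..t2}. norm (dd f q b) \<le> C" for b
 proof -
  have "continuous_on W (\<lambda>q. dd f q b)" using fW unfolding Ck_on.simps by blast
  hence "bounded ((\<lambda>q. dd f q b) ` (\<gamma> ` {-t2..t2}))"
   by (intro compact_imp_bounded compact_continuous_image K) (use KW continuous_on_subset in blast)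
  thus ?thesis unfolding bounded_iff by auto
 qed
 then obtain Cb where Cb: "\<And>b q. q \<in> \<gamma> ` {-t2..t2} ==> norm (dd f q b) \<le> Cb b" by metis
 \<comment> \<open>The extra \<open>1\<close> absorbs the linearization error, whose factor
   \<open>e1\<close> is at most \<open>1\<close>.\<close>
 define C where "C = (\<Sum>b\<in>Basis. \<bar>Cb b\<bar>) + 1"
 have C: "C > 0" unfolding C_def by (smt (verit) sum_nonneg abs_ge_zero)
 have Cbd: "norm (dd f (\<gamma> t) v) \<le> (C - 1) * norm v" if "t \<in> {-t2..t2}" for t v
 proof -
  have "norm (dd f (\<gamma> t) v) \<le> onorm (dd f (\<gamma> t)) * norm v"
   by (rule onorm[OF has_derivative_bounded_linear[OF fd[OF \<gamma>W[OF that]]]])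
  moreover have "onorm (dd f (\<gamma> t)) \<le> (\<Sum>b\<in>Basis. norm (dd f (\<gamma> t) b))"
   by (rule onorm_le_basis[OF lin[OF \<gamma>W[OF that]]])
  moreover have "\<dots> \<le> C - 1" unfolding C_def
   using Cb[OF imageI[OF that]] by (auto intro!: sum_mono order_trans[OF _ abs_ge_self])
  ultimately show ?thesis by (meson mult_right_mono norm_ge_zero order_trans)
 qed
 have Lbd: "norm (dd f (\<gamma> t) (0, k)) \<le> L * norm k" if "t \<in> {-t2..t2}" for t k
  unfolding \<gamma>_def zero_prod_def
  by (rule fibre_derivative_bound) (use that I x0 fd[OF \<gamma>W[OF that]] in \<open>auto simp: \<gamma>_def frechet_derivative_works\<close>)
 define X where "X = exp ((L + 1) * T)"
 have X: "X > 0" by (simp add: X_def)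
 obtain c0 where c0: "c0 > 0" "\<And>h. norm (D0 h) \<le> c0 * norm h"
  using bounded_linear.pos_bounded[OF has_derivative_bounded_linear[OF u0]] by (auto simp: mult.commute)
 \<comment> \<open>Gronwall factor of a preliminary rough estimate: the two solutions differ by at
   most \<open>C2 * norm h\<close>. Only then is the linearization error known to be small relative
   to \<open>norm h\<close>.\<close>
 define C2 where "C2 = (c0 + 1 + C) * exp ((C + 1) * T)"
 have C2: "C2 > 0" using c0 C by (simp add: C2_def)
 \<comment> \<open>The final error has the contributions \<open>e1\<close> from the initial value
   and \<open>e1 * (1 + C2)\<close> from the linearization, both multiplied by the Gronwall factor
   \<open>X\<close>.\<close>
 define e1 where "e1 = min 1 (e / ((2 + C2) * X))"
 have e1: "e1 > 0" "e1 \<le> 1" using e C2 X by (auto simp: e1_def)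
 obtain d0 where d0: "d0 > 0" "\<And>q h. q \<in> \<gamma> ` {-t2..t2} ==> norm h < d0 ==> q + h \<in> W \<and>
  norm (f (q + h) - f q - dd f q h) \<le> e1 * norm h"
  using uniform_differentiability[OF W fW K KW e1(1)] by blast
 obtain d1 where d1: "d1 > 0" "\<And>x. norm (x - x0) < d1 ==> x \<in> B \<and> (\<forall>t\<in>{-t2..t2}. norm (u (t, x) - u (t, x0)) < d0 / 2)"
  using uniform_in_time[OF x0, of t2 "d0/2"] d0(1) t by auto
 obtain d2 where d2: "d2 > 0" "\<And>x. norm (x - x0) < d2 ==> norm (u (0, x) - u (0, x0) - D0 (x - x0)) \<le> e1 * norm (x - x0)"
  using u0 e1(1) unfolding has_derivative_at_alt by blast
 have "x0 + h \<in> B \<and> (\<forall>t\<in>{-t2..t2}. norm (u (t, x0 + h) - u (t, x0) - w h t) \<le> e * norm h)"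
  if h: "norm h < min (d0 / 2) (min d1 d2)" for h
 proof (intro conjI ballI)
  show xB: "x0 + h \<in> B" using d1(2)[of "x0 + h"] h by simp
  fix t assume t: "t \<in> {-t2..t2}"
  have seg: "s \<in> {-t2..t2}" if "s \<in> closed_segment 0 t'" "t' \<in> {-t2..t2}" for s t'
   using that by (auto simp: closed_segment_eq_real_ivl split: if_splits)
  define \<Delta> where "\<Delta> s = u (s, x0 + h) - u (s, x0)" for s
  define \<eta> where "\<eta> s = (((0, h), \<Delta> s) :: (real \<times> 'a) \<times> 'b)" for s
  have \<eta>n: "norm (\<eta> s) \<le> norm h + norm (\<Delta> s)" for s
   unfolding \<eta>_def by (rule order_trans[OF norm_Pair_le]) (simp add: norm_Pair)
  have \<Delta>d: "(\<Delta> has_vector_derivative f (\<gamma> s + \<eta> s) - f (\<gamma> s)) (at s)" if "s \<in> {-t2..t2}" for s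
   unfolding \<Delta>_def \<gamma>_def \<eta>_def using that I xB x0
   by (auto intro!: has_vector_derivative_diff ode)
  have small: "norm (f (\<gamma> s + \<eta> s) - f (\<gamma> s) - dd f (\<gamma> s) (\<eta> s)) \<le> e1 * norm (\<eta> s)" if "s \<in> {-t2..t2}" for s
  proof -
   have "norm (\<Delta> s) < d0 / 2" using d1(2)[of "x0 + h"] h that by (simp add: \<Delta>_def)
   hence "norm (\<eta> s) < d0" using \<eta>n[of s] h by simp
   thus ?thesis using d0(2) that by blast
  qed
  have \<Delta>0: "norm (\<Delta> 0) \<le> (c0 + 1) * norm h"
  proof -
   have "norm (\<Delta> 0 - D0 h) \<le> e1 * norm h" using d2(2)[of "x0 + h"] h by (simp add: \<Delta>_def)
   also have "\<dots> \<le> 1 * norm h" using e1 by (intro mult_right_mono) auto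
   finally show ?thesis using c0(2)[of h] norm_triangle_ineq2[of "\<Delta> 0" "D0 h"] by (simp add: algebra_simps)
  qed
  have \<Delta>bd: "norm (\<Delta> s) \<le> C2 * norm h" if s: "s \<in> {-t2..t2}" for s
  proof -
   have "norm (\<Delta> s) \<le> (norm (\<Delta> 0) + C * norm h) * exp ((C + 1) * \<bar>s\<bar>)"
   proof (rule gronwall[OF less_imp_le[OF C], of _ s])
    fix r assume "r \<in> closed_segment 0 s"
    note r = seg[OF this s]
    show "(\<Delta> has_vector_derivative f (\<gamma> r + \<eta> r) - f (\<gamma> r)) (at r)" by (rule \<Delta>d[OF r])
    have "norm (f (\<gamma> r + \<eta> r) - f (\<gamma> r)) \<le> norm (dd f (\<gamma> r) (\<eta> r)) + e1 * norm (\<eta> r)"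
     using small[OF r] norm_triangle_ineq2[of "f (\<gamma> r + \<eta> r) - f (\<gamma> r)" "dd f (\<gamma> r) (\<eta> r)"] by simp
    also have "\<dots> \<le> (C - 1) * norm (\<eta> r) + 1 * norm (\<eta> r)"
     using Cbd[OF r, of "\<eta> r"] e1(2) by (intro add_mono mult_right_mono) auto
    also have "\<dots> = C * norm (\<eta> r)" by (simp add: algebra_simps)
    also have "\<dots> \<le> C * (norm h + norm (\<Delta> r))" using \<eta>n C by (intro mult_left_mono) auto
    finally show "norm (f (\<gamma> r + \<eta> r) - f (\<gamma> r)) \<le> C * norm (\<Delta> r) + C * norm h" by (simp add: algebra_simps)
   qed (use C in auto)
   also have "\<dots> \<le> ((c0 + 1) * norm h + C * norm h) * exp ((C + 1) * T)"
    using \<Delta>0 C subsetD[OF I(1) s] c0 by (intro mult_mono add_mono) (auto intro!: add_nonneg_nonneg)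
   finally show ?thesis by (simp add: C2_def algebra_simps)
  qed
  define r where "r s = \<Delta> s - w h s" for s
  have "norm (r t) \<le> (norm (r 0) + e1 * (1 + C2) * norm h) * exp ((L + 1) * \<bar>t\<bar>)"
  proof (rule gronwall[OF L, of _ t])
   fix s assume "s \<in> closed_segment 0 t"
   note s = seg[OF this t]
   show "(r has_vector_derivative (f (\<gamma> s + \<eta> s) - f (\<gamma> s)) - dd f (\<gamma> s) ((0, h), w h s)) (at s)"
    unfolding r_def by (intro has_vector_derivative_diff \<Delta>d s) (use w s I in \<open>auto simp: \<gamma>_def\<close>)
   have "((0, h), w h s) = \<eta> s - (0, r s)" by (simp add: \<eta>_def r_def)
   hence "(f (\<gamma> s + \<eta> s) - f (\<gamma> s)) - dd f (\<gamma> s) ((0, h), w h s)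
    = (f (\<gamma> s + \<eta> s) - f (\<gamma> s) - dd f (\<gamma> s) (\<eta> s)) + dd f (\<gamma> s) (0, r s)"
    by (simp add: linear_diff[OF lin[OF \<gamma>W[OF s]]])
   hence "norm ((f (\<gamma> s + \<eta> s) - f (\<gamma> s)) - dd f (\<gamma> s) ((0, h), w h s))
    \<le> e1 * norm (\<eta> s) + L * norm (r s)"
    using norm_triangle_mono[OF small[OF s] Lbd[OF s, of "r s"]] by (simp only:)
   also have "e1 * norm (\<eta> s) \<le> e1 * (norm h + C2 * norm h)"
    using \<eta>n[of s] \<Delta>bd[OF s] e1 by (intro mult_left_mono) auto
   finally show "norm ((f (\<gamma> s + \<eta> s) - f (\<gamma> s)) - dd f (\<gamma> s) ((0, h), w h s)) \<le> L * norm (r s) + e1 * (1 + C2) * norm h"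
    by (simp add: algebra_simps)
  qed (use e1 C2 in auto)
  also have "\<dots> \<le> (e1 * norm h + e1 * (1 + C2) * norm h) * exp ((L + 1) * \<bar>t\<bar>)"
   using d2(2)[of "x0 + h"] h by (intro mult_right_mono add_right_mono) (auto simp: r_def \<Delta>_def w0)
  also have "\<dots> \<le> (e1 * norm h + e1 * (1 + C2) * norm h) * X"
   unfolding X_def by (rule exp_bound) (use t I e1 C2 in auto)
  also have "\<dots> = (e1 * ((2 + C2) * X)) * norm h" by (simp add: algebra_simps)
  also have "\<dots> \<le> e * norm h"
  proof (rule mult_right_mono)
   have "e1 \<le> e / ((2 + C2) * X)" by (simp add: e1_def)
   thus "e1 * ((2 + C2) * X) \<le> e" using C2 X by (simp add: pos_le_divide_eq)
  qed simp
  finally show "norm (u (t, x0 + h) - u (t, x0) - w h t) \<le> e * norm h" by (simp add: r_def \<Delta>_def)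
 qed
 moreover have "min (d0 / 2) (min d1 d2) > 0" using d0(1) d1(1) d2(1) by simp
 ultimately show ?thesis by blast
qed

text \<open>Joint differentiability comes from three separate facts: the variation in
  \<open>x\<close> is uniform in \<open>t\<close>, the curve through \<open>x0\<close> is
  differentiable in \<open>t\<close>, and the variation is continuous in \<open>t\<close>.\<close>

lemma total_derivative:
 assumes f: "Ck_on (Suc 0) (({-T<..<T} \<times> B) \<times> Y) f"
  and x0: "x0 \<in> B" and t0: "t0 \<in> {-t1<..<t1}" and t1: "t1 < T"
  and u0: "((\<lambda>x. u (0, x)) has_derivative D0) (at x0)"
  and w0: "\<And>b. b \<in> Basis ==> w b 0 = D0 b"
  and w: "\<And>b t. b \<in> Basis ==> t \<in> {-t1<..<t1} ==>
    (w b has_vector_derivative dd f ((t, x0), u (t, x0)) ((0, b), w b t)) (at t)"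
 shows "(u has_derivative (\<lambda>v. fst v *R f ((t0, x0), u (t0, x0)) + (\<Sum>b\<in>Basis. (snd v \<bullet> b) *R w b t0))) (at (t0, x0))"
proof -
 define wh where "wh h t = (\<Sum>b\<in>Basis. (h \<bullet> b) *R w b t)" for h t
 have whd: "(wh h has_vector_derivative dd f ((t, x0), u (t, x0)) ((0, h), wh h t)) (at t)"
  if t: "t \<in> {-t1<..<t1}" for h t
 proof -
  let ?D = "dd f ((t, x0), u (t, x0))"
  have "linear ?D"
   by (rule linear_frechet_derivative) (use f uY[of t x0] x0 t t1 in auto)
  hence "?D ((0, h), wh h t) = (\<Sum>b\<in>Basis. (h \<bullet> b) *R ?D ((0, b), w b t))"
  proof -
   have "((0, h), wh h t) = (\<Sum>b\<in>Basis. (h \<bullet> b) *R ((0::real, b), w b t))"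
    by (simp add: prod_eq_iff fst_sum snd_sum wh_def euclidean_representation)
   thus ?thesis using \<open>linear ?D\<close> by (simp add: linear_sum linear_scale del: scaleR_Pair)
  qed
  moreover have "(wh h has_vector_derivative (\<Sum>b\<in>Basis. (h \<bullet> b) *R ?D ((0, b), w b t))) (at t)"
   unfolding wh_def
   by (intro has_vector_derivative_sum has_vector_derivative_scaleR[of "\<lambda>_. _" 0, simplified] w t) 
  ultimately show ?thesis by simp
 qed
 have wh0: "wh h 0 = D0 h" for h
 proof -
  have "D0 h = D0 (\<Sum>b\<in>Basis. (h \<bullet> b) *R b)" by (simp add: euclidean_representation)
  thus ?thesis unfolding wh_def using has_derivative_linear[OF u0] w0 by (simp add: linear_sum linear_scale)
 qed
 define t2 where "t2 = (\<bar>t0\<bar> + t1) / 2"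
 have t2: "\<bar>t0\<bar> < t2" "t2 < t1" using t0 by (auto simp: t2_def)
 have t0T: "t0 \<in> {-T<..<T}" using t0 t1 by auto
 have bl: "bounded_linear (\<lambda>h. wh h t0)" unfolding wh_def
  by (intro bounded_linear_sum bounded_linear_scaleR_const bounded_linear_inner_left)
 define F where "F = f ((t0, x0), u (t0, x0))"
 have "(u has_derivative (\<lambda>v. fst v *R F + wh (snd v) t0)) (at (t0, x0))"
  unfolding has_derivative_at_alt
 proof (intro conjI allI impI)
  show "bounded_linear (\<lambda>v. fst v *R F + wh (snd v) t0)"
   by (intro bounded_linear_add bounded_linear_scaleR_const bounded_linear_fst bounded_linear_compose[OF bl bounded_linear_snd])
  fix e :: real assume e: "e > 0"
  obtain d where d: "d > 0" "\<And>h. norm h < d ==> x0 + h \<in> B \<and>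
    (\<forall>t\<in>{-t2..t2}. norm (u (t, x0 + h) - u (t, x0) - wh h t) \<le> e / 3 * norm h)"
   using variation_bound[OF f x0 t2(2) t1 _ u0 wh0 whd, of "e/3"] e by auto
  obtain d' where d': "d' > 0" "\<And>t. norm (t - t0) < d' ==> norm (u (t, x0) - u (t0, x0) - (t - t0) *R F) \<le> e / 3 * norm (t - t0)"
   using ode[OF t0T x0] e unfolding has_vector_derivative_def has_derivative_at_alt F_def
   by (metis divide_pos_pos zero_less_numeral)
  have "\<exists>d>0. \<forall>t. \<bar>t - t0\<bar> < d \<longrightarrow> norm (w b t - w b t0) < e / (3 * real DIM('a))" if "b \<in> Basis" for b
  proof -
   have "isCont (w b) t0" using w[OF that t0] by (rule has_vector_derivative_continuous)
   thus ?thesis unfolding continuous_at_eps_delta using e by (auto simp: dist_norm)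
  qed
  then obtain db where db: "\<And>b. b \<in> Basis ==> db b > 0" "\<And>b t. b \<in> Basis ==> \<bar>t - t0\<bar> < db b ==> norm (w b t - w b t0) < e / (3 * real DIM('a))"
   by metis
  define d'' where "d'' = Min (db ` (Basis::'a set))"
  have d'': "d'' > 0" using db(1) by (simp add: d''_def)
  have whc: "norm (wh h t - wh h t0) \<le> e / 3 * norm h" if "\<bar>t - t0\<bar> < d''" for h t
  proof -
   have "wh h t - wh h t0 = (\<Sum>b\<in>Basis. (h \<bullet> b) *R (w b t - w b t0))"
    by (simp add: wh_def sum_subtractf scaleR_diff_right)
   also have "norm \<dots> \<le> (\<Sum>b\<in>(Basis::'a set). norm h * (e / (3 * real DIM('a))))"
   proof (rule sum_norm_le)
    fix b :: 'a assume b: "b \<in> Basis"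
    hence "d'' \<le> db b" by (simp add: d''_def)
    hence "norm (w b t - w b t0) \<le> e / (3 * real DIM('a))"
     by (intro less_imp_le[OF db(2)[OF b]]) (use that in linarith)
    thus "norm ((h \<bullet> b) *R (w b t - w b t0)) \<le> norm h * (e / (3 * real DIM('a)))"
     unfolding norm_scaleR by (intro mult_mono Basis_le_norm b) auto
   qed
   also have "\<dots> = e / 3 * norm h" by simp
   finally show ?thesis .
  qed
  show "\<exists>d>0. \<forall>y. norm (y - (t0, x0)) < d \<longrightarrow>
   norm (u y - u (t0, x0) - (fst (y - (t0, x0)) *R F + wh (snd (y - (t0, x0))) t0)) \<le> e * norm (y - (t0, x0))"
  proof (intro exI[of _ "min (min d d') (min d'' (t2 - \<bar>t0\<bar>))"] conjI allI impI)
   fix y :: "real \<times> 'a" assume y: "norm (y - (t0, x0)) < min (min d d') (min d'' (t2 - \<bar>t0\<bar>))"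
   define t where "t = fst y"
   define h where "h = snd y - x0"
   have ye: "y = (t, x0 + h)" by (simp add: t_def h_def prod_eq_iff)
   have n: "\<bar>t - t0\<bar> \<le> norm (y - (t0, x0))" "norm h \<le> norm (y - (t0, x0))"
    using norm_fst_le[of "t - t0" h] norm_snd_le[of h "t - t0"] by (auto simp: ye)
   have tt: "t \<in> {-t2..t2}" using n(1) y by auto
   have 1: "norm (u (t, x0 + h) - u (t, x0) - wh h t) \<le> e / 3 * norm h" using d(2)[of h] n(2) y tt by auto
   have 2: "norm (u (t, x0) - u (t0, x0) - (t - t0) *R F) \<le> e / 3 * \<bar>t - t0\<bar>" using d'(2)[of t] n(1) y by auto
   have 3: "norm (wh h t - wh h t0) \<le> e / 3 * norm h" using whc n(1) y by auto
   \<comment> \<open>Go from \<open>x0\<close> to \<open>x0 + h\<close> at the new time, then from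
     \<open>t0\<close> to \<open>t\<close> on the reference curve, and move the linear term back to
     \<open>t0\<close>; each part costs a third of \<open>e\<close>.\<close>
   have "u y - u (t0, x0) - (fst (y - (t0, x0)) *R F + wh (snd (y - (t0, x0))) t0)
    = (u (t, x0 + h) - u (t, x0) - wh h t) + (u (t, x0) - u (t0, x0) - (t - t0) *R F) + (wh h t - wh h t0)"
    by (simp add: ye)
   also have "norm \<dots> \<le> e / 3 * norm h + e / 3 * \<bar>t - t0\<bar> + e / 3 * norm h"
    by (intro norm_triangle_mono 1 2 3)
   also have "\<dots> \<le> e / 3 * norm (y - (t0, x0)) + e / 3 * norm (y - (t0, x0)) + e / 3 * norm (y - (t0, x0))"
    using n e by (intro add_mono mult_left_mono) auto
   finally show "norm (u y - u (t0, x0) - (fst (y - (t0, x0)) *R F + wh (snd (y - (t0, x0))) t0)) \<le> e * norm (y - (t0, x0))"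
    by simp
  qed (use d(1) d'(1) d'' t2 in auto)
 qed
 thus ?thesis by (simp add: F_def wh_def)
qed

end

lemma affine_continuous:
 fixes A :: "'a::topological_space \<times> 'b::euclidean_space \<Rightarrow> 'b"
 assumes "continuous_on S A" "\<And>c. continuous_on S (C c)"
 shows "continuous_on S (\<lambda>p. A p + (\<Sum>c\<in>Basis. (snd p \<bullet> c) *R C c p))"
 by (intro continuous_intros assms)

text \<open>The time derivative is the right-hand side itself. Each derivative in the parameter
  solves the variational equation, which is affine in the unknown, lives on the whole space and has
  the same Lipschitz constant, so the induction hypothesis applies to it with
  \<open>Y = UNIV\<close>.\<close>

theorem ode_param_Ck:
 fixes B :: "'a::euclidean_space set" and Y :: "'b::euclidean_space set"
 assumes B: "open B" and Y: "open Y" and T: "0 < T" and L: "0 \<le> L" "L * T \<le> 1 / 2"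
  and f: "Ck_on k (({-T<..<T} \<times> B) \<times> Y) f"
  and lip: "\<And>t x v w. t \<in> {-T<..<T} ==> x \<in> B ==> v \<in> Y ==> w \<in> Y ==>
   norm (f ((t, x), v) - f ((t, x), w)) \<le> L * norm (v - w)"
  and uY: "\<And>t x. t \<in> {-T<..<T} ==> x \<in> B ==> u (t, x) \<in> Y"
  and ode: "\<And>t x. t \<in> {-T<..<T} ==> x \<in> B ==>
   ((\<lambda>s. u (s, x)) has_vector_derivative f ((t, x), u (t, x))) (at t)"
  and init: "Ck_on k B (\<lambda>x. u (0, x))"
 shows "Ck_on k ({-T<..<T} \<times> B) u"
 using Y T L(2) f lip uY ode init
proof (induction k arbitrary: Y T f u)
 case (0 Y T f u)
 interpret ode_param B Y T L f u
  by unfold_locales (use B L(1) 0 in auto)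
 show ?case using continuous by simp
next
 case (Suc k Y T f u)
 note T = Suc.prems(2) and LT = Suc.prems(3) and f = Suc.prems(4) and uY = Suc.prems(6) and u0 = Suc.prems(8)
 have oW: "open (({-T<..<T} \<times> B) \<times> Y)" by (intro open_Times B Suc.prems(1) open_greaterThanLessThan)
 have oI: "open ({-s<..<s} \<times> B)" for s :: real by (intro open_Times B open_greaterThanLessThan)
 interpret ode_param B Y T L f u
  by unfold_locales (use B L(1) Suc.prems(1,2,5-7) Ck_on_continuous[OF f] Ck_on_continuous[OF u0] in auto)
 have uk: "Ck_on k ({-T<..<T} \<times> B) u"
  by (rule Suc.IH[OF Suc.prems(1-3) Ck_on_SucD[OF f] Suc.prems(5-7) Ck_on_SucD[OF u0]])
 define q where "q p = (p, u p)" for p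
 have qW: "q p \<in> ({-T<..<T} \<times> B) \<times> Y" if "p \<in> {-T<..<T} \<times> B" for p
  using that uY by (auto simp: q_def)
 have fdiff: "f differentiable (at (q p))" if "p \<in> {-T<..<T} \<times> B" for p
  using f qW[OF that] by auto
 have qk: "Ck_on k ({-T<..<T} \<times> B) q"
 proof -
  have bl: "bounded_linear (\<lambda>p::real \<times> 'a. (p, 0::'b))" "bounded_linear (\<lambda>v. (0::real \<times> 'a, v::'b))"
   by (intro bounded_linear_Pair bounded_linear_ident bounded_linear_zero)+
  from Ck_on_add[OF oI Ck_on_linear[OF bl(1) oI Ck_on_id] Ck_on_linear[OF bl(2) oI uk]]
  show ?thesis by (simp add: q_def[abs_def])
 qed
 have qim: "q ` ({-T<..<T} \<times> B) \<subseteq> ({-T<..<T} \<times> B) \<times> Y" using qW by blast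
 have dk: "Ck_on k ({-T<..<T} \<times> B) (\<lambda>p. dd f (q p) v)" for v
  by (rule Ck_on_compose[OF oI oW qim qk]) (use f in \<open>unfold Ck_on.simps, blast\<close>)
 have lin: "linear (dd f (q p))" if "p \<in> {-T<..<T} \<times> B" for p
  by (rule linear_frechet_derivative[OF fdiff[OF that]])
 have expand: "dd f (q p) ((0, b), v) = dd f (q p) ((0, b), 0)
   + (\<Sum>c\<in>Basis. (v \<bullet> c) *R dd f (q p) ((0, 0), c))" if p: "p \<in> {-T<..<T} \<times> B" for p b v
 proof -
  have "((0::real, b), v) = ((0, b), 0) + (\<Sum>c\<in>Basis. (v \<bullet> c) *R ((0, 0), c))"
   by (simp add: prod_eq_iff fst_sum snd_sum euclidean_representation)
  thus ?thesis by (simp add: linear_add[OF lin[OF p]] linear_sum[OF lin[OF p]] linear_scale[OF lin[OF p]] del: scaleR_Pair add_Pair)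
 qed
 have fib: "norm (dd f (q p) ((0, b), v) - dd f (q p) ((0, b), w)) \<le> L * norm (v - w)"
  if p: "p \<in> {-T<..<T} \<times> B" for p b v w
 proof -
  have "((0::real, b), v) - ((0, b), w) = ((0, 0), v - w)" by (simp add: zero_prod_def)
  hence "dd f (q p) ((0, b), v) - dd f (q p) ((0, b), w) = dd f (q p) ((0, 0), v - w)"
   by (metis linear_diff[OF lin[OF p]])
  thus ?thesis using fibre_derivative_bound[of "fst p" "snd p" "v - w"] fdiff[OF p] p by (auto simp: q_def zero_prod_def)
 qed
 \<comment> \<open>Solving the variational equation by \<open>picard\<close> needs continuity on a
   closed time interval, hence the detour through \<open>t1 < T\<close>.\<close>
 have main: "Ck_on (Suc k) ({-t1<..<t1} \<times> B) u" if t1: "0 < t1" "t1 < T" for t1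
 proof -
  have I1: "{-t1<..<t1} \<times> B \<subseteq> {-T<..<T} \<times> B" "{-t1..t1} \<times> B \<subseteq> {-T<..<T} \<times> B" using t1 by auto
  have "\<exists>y. y 0 = dd (\<lambda>x. u (0, x)) x b \<and>
   (\<forall>t\<in>{-t1<..<t1}. (y has_vector_derivative dd f (q (t, x)) ((0, b), y t)) (at t))"
   if x: "x \<in> B" for x b
  proof (rule picard[OF t1(1) L(1)])
   show "L * t1 \<le> 1 / 2" using LT mult_left_mono[of t1 T L] L(1) t1 by linarith
   have c: "continuous_on ({-t1..t1} \<times> (UNIV::'b set)) (\<lambda>p. dd f (q (fst p, x)) v)" for v
    by (rule continuous_on_compose2[OF Ck_on_continuous[OF dk[of v]]])
     (use I1 x in \<open>auto intro!: continuous_intros\<close>)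
   have "continuous_on ({-t1..t1} \<times> UNIV) (\<lambda>p. dd f (q (fst p, x)) ((0, b), 0)
    + (\<Sum>c\<in>Basis. (snd p \<bullet> c) *R dd f (q (fst p, x)) ((0, 0), c)))"
    by (rule affine_continuous[OF c c])
   thus "continuous_on ({-t1..t1} \<times> UNIV) (\<lambda>p. dd f (q (fst p, x)) ((0, b), snd p))"
    by (rule continuous_on_eq, intro expand[symmetric]) (use x I1 in auto)
  qed (intro fib, use x t1 in auto)
  note ex = this
  \<comment> \<open>Any solution will do: \<open>total_derivative\<close> identifies it with the
    derivative of \<open>u\<close> in the direction \<open>b\<close>.\<close>
  define y where "y b x = (SOME y. y 0 = dd (\<lambda>x. u (0, x)) x b \<and>
   (\<forall>t\<in>{-t1<..<t1}. (y has_vector_derivative dd f (q (t, x)) ((0, b), y t)) (at t)))" for b x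
  have y: "y b x 0 = dd (\<lambda>x. u (0, x)) x b \<and>
   (\<forall>t\<in>{-t1<..<t1}. (y b x has_vector_derivative dd f (q (t, x)) ((0, b), y b x t)) (at t))"
   if "x \<in> B" for x b
   unfolding y_def by (rule someI_ex[OF ex[OF that]])
  hence y0: "\<And>x b. x \<in> B ==> y b x 0 = dd (\<lambda>x. u (0, x)) x b"
   and yd: "\<And>x b t. x \<in> B ==> t \<in> {-t1<..<t1} ==>
    (y b x has_vector_derivative dd f (q (t, x)) ((0, b), y b x t)) (at t)"
   by blast+
  define w where "w b p = y b (snd p) (fst p)" for b p
  have wk: "Ck_on k ({-t1<..<t1} \<times> B) (w b)" for b
  proof (rule Suc.IH[where Y = UNIV and f = "\<lambda>z. dd f (q (fst z)) ((0, b), snd z)"])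
   let ?W = "({-t1<..<t1} \<times> B) \<times> (UNIV::'b set)"
   have o: "open ?W" by (intro open_Times oI open_UNIV)
   have c: "Ck_on k ?W (\<lambda>z. dd f (q (fst z)) v)" for v
    by (rule Ck_on_compose[OF o oI[of T] _ Ck_on_linear[OF bounded_linear_fst o Ck_on_id] dk]) (use I1 in auto)
   show "Ck_on k ?W (\<lambda>z. dd f (q (fst z)) ((0, b), snd z))"
   proof (rule Ck_on_cong[OF o])
    show "Ck_on k ?W (\<lambda>z. dd f (q (fst z)) ((0, b), 0)
     + (\<Sum>e\<in>Basis. (snd z \<bullet> e) *R dd f (q (fst z)) ((0, 0), e)))"
     by (intro Ck_on_add[OF o] Ck_on_sum[OF o] c Ck_on_bilinear[OF bounded_bilinear_scaleR o]
      Ck_on_linear[OF bounded_linear_inner_left o] Ck_on_linear[OF bounded_linear_snd o] Ck_on_id)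
   qed (intro expand[symmetric], use I1 in auto)
   show "L * t1 \<le> 1 / 2" using LT mult_left_mono[of t1 T L] L(1) t1 by linarith
   show "Ck_on k B (\<lambda>x. w b (0, x))"
    by (rule Ck_on_cong[OF B, of "\<lambda>x. dd (\<lambda>x. u (0, x)) x b"]) (use u0 y0 in \<open>auto simp: w_def\<close>)
  next
   fix t x v v' assume "t \<in> {-t1<..<t1}" "x \<in> B"
   thus "norm (dd f (q (fst ((t, x), v))) ((0, b), snd ((t, x), v))
    - dd f (q (fst ((t, x), v'))) ((0, b), snd ((t, x), v'))) \<le> L * norm (v - v')"
    unfolding fst_conv snd_conv by (intro fib) (use t1 in auto)
  qed (use t1 yd in \<open>auto simp: w_def\<close>)
  have D: "(u has_derivative (\<lambda>v. fst v *R f (q p) + (\<Sum>b\<in>Basis. (snd v \<bullet> b) *R w b p))) (at p)"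
   if p: "p \<in> {-t1<..<t1} \<times> B" for p
  proof -
   obtain t x where px: "p = (t, x)" by (cases p)
   have x: "x \<in> B" and t: "t \<in> {-t1<..<t1}" using p by (auto simp: px)
   have "(u has_derivative (\<lambda>v. fst v *R f ((t, x), u (t, x)) + (\<Sum>b\<in>Basis. (snd v \<bullet> b) *R y b x t))) (at (t, x))"
   proof (rule total_derivative[OF _ x t t1(2)])
    show "Ck_on (Suc 0) (({-T<..<T} \<times> B) \<times> Y) f" using f by (auto intro!: Ck_on_continuous[of k])
    show "((\<lambda>x. u (0, x)) has_derivative dd (\<lambda>x. u (0, x)) x) (at x)"
     using u0 x by (simp add: frechet_derivative_works[symmetric])
   qed (use y0[OF x] yd[OF x] in \<open>auto simp: q_def\<close>)
   thus ?thesis by (simp add: px q_def w_def)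
  qed
  have fq: "Ck_on k ({-t1<..<t1} \<times> B) (\<lambda>p. f (q p))"
   by (rule Ck_on_subset[OF Ck_on_compose[OF oI oW qim qk Ck_on_SucD[OF f]] I1(1)])
  have "Ck_on k ({-t1<..<t1} \<times> B) (\<lambda>p. dd u p v)" for v
  proof (rule Ck_on_cong[OF oI])
   show "Ck_on k ({-t1<..<t1} \<times> B) (\<lambda>p. fst v *R f (q p) + (\<Sum>b\<in>Basis. (snd v \<bullet> b) *R w b p))"
    by (intro Ck_on_add[OF oI] Ck_on_sum[OF oI] Ck_on_bilinear[OF bounded_bilinear_scaleR oI] Ck_on_const fq wk)
  qed (use frechet_eqI[OF D] in auto)
  thus ?thesis unfolding Ck_on.simps differentiable_def using D by blast
 qed
 show ?case
 proof (rule Ck_on_local)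
  fix p :: "real \<times> 'a" assume p: "p \<in> {-T<..<T} \<times> B"
  define t1 where "t1 = (\<bar>fst p\<bar> + T) / 2"
  have "0 < t1" "t1 < T" "\<bar>fst p\<bar> < t1" using p T by (auto simp: t1_def)
  thus "\<exists>V. open V \<and> p \<in> V \<and> Ck_on (Suc k) V u"
   using main[of t1] oI[of t1] p by (intro exI[of _ "{-t1<..<t1} \<times> B"]) auto
 qed
qed

text \<open>One time and one neighbourhood for all of \<open>K\<close>, which later is a point or a
  segment of a fibre. Outside a convex compact thickening the field is replaced by its value at the
  nearest point; this projection does not increase distances, so the new field is globally
  Lipschitz, and short trajectories from near \<open>K\<close> never notice the change.\<close>

theorem local_flow:
 fixes X :: "'a::euclidean_space \<Rightarrow> 'a"
 assumes "open W" "smooth_on W X" "compact K" "convex K" "K \<noteq> {}" "K \<subseteq> W"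
 obtains T U \<phi> where "T > 0" "open U" "K \<subseteq> U" "U \<subseteq> W" "smooth_on ({-T<..<T} \<times> U) (\<lambda>p. \<phi> (fst p) (snd p))"
  "\<And>x. x \<in> U ==> \<phi> 0 x = x"
  "\<And>t x. t \<in> {-T<..<T} ==> x \<in> U ==> \<phi> t x \<in> W"
  "\<And>t x. t \<in> {-T<..<T} ==> x \<in> U ==> ((\<lambda>s. \<phi> s x) has_vector_derivative X (\<phi> t x)) (at t)"
  "\<And>s t x. t \<in> {-T<..<T} ==> s \<in> {-T<..<T} ==> s + t \<in> {-T<..<T} ==> x \<in> U ==> \<phi> t x \<in> U
   ==> \<phi> s (\<phi> t x) = \<phi> (s + t) x"
proof -
 obtain R where R: "R > 0" "(\<Union>x\<in>K. cball x R) \<subseteq> W"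
  using compact_subset_open_imp_cball_epsilon_subset[OF assms(3,1,6)] by blast
 define K2 where "K2 = (\<Union>x\<in>K. cball x R)"
 define Y where "Y = (\<Union>x\<in>K. ball x R)"
 define U where "U = (\<Union>x\<in>K. ball x (R / 2))"
 have K2: "compact K2" "convex K2" "K2 \<noteq> {}" "K2 \<subseteq> W"
  using compact_thickening[OF assms(3)] convex_thickening[OF assms(4)] assms(5) R by (auto simp: K2_def)
 have YK: "Y \<subseteq> K2" "open Y" and UY: "U \<subseteq> Y" "open U" "K \<subseteq> U" using R(1) by (auto simp: Y_def K2_def U_def)
 have fd: "(X has_derivative dd X x) (at x)" if "x \<in> W" for x
  by (rule smooth_on_has_derivative[OF assms(2) that])
 have "\<exists>C. \<forall>x\<in>K2. norm (dd X x b) \<le> C" for b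
 proof -
  have "bounded ((\<lambda>x. dd X x b) ` K2)"
   by (intro compact_imp_bounded compact_continuous_image K2 continuous_on_subset[OF smooth_on_continuous[OF smooth_on_frechet[OF assms(2)]]])
  thus ?thesis unfolding bounded_iff by auto
 qed
 then obtain Cb where Cb: "\<And>b x. x \<in> K2 ==> norm (dd X x b) \<le> Cb b" by metis
 define L where "L = (\<Sum>b\<in>Basis. \<bar>Cb b\<bar>)"
 have L: "L \<ge> 0" by (simp add: L_def sum_nonneg)
 have lipK: "norm (X x - X y) \<le> L * norm (x - y)" if "x \<in> K2" "y \<in> K2" for x y
 proof (rule differentiable_bound[OF K2(2) _ _ that])
  fix z assume z: "z \<in> K2"
  show "(X has_derivative dd X z) (at z within K2)"
   using fd z K2(4) has_derivative_at_withinI by blast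
  have "onorm (dd X z) \<le> (\<Sum>b\<in>Basis. norm (dd X z b))"
   by (rule onorm_le_basis) (use fd z K2(4) has_derivative_linear in blast)
  also have "\<dots> \<le> L" unfolding L_def by (intro sum_mono order_trans[OF Cb[OF z] abs_ge_self])
  finally show "onorm (dd X z) \<le> L" .
 qed
 have "bounded (X ` K2)"
  by (intro compact_imp_bounded compact_continuous_image K2 continuous_on_subset[OF smooth_on_continuous[OF assms(2)]])
 then obtain M where M: "M > 0" "\<And>x. x \<in> K2 ==> norm (X x) \<le> M" unfolding bounded_pos by auto
 \<comment> \<open>The first bound makes \<open>picard\<close> applicable. The second limits the
   distance travelled to \<open>R / 4\<close>, so that a trajectory from the \<open>R / 2\<close>
   neighbourhood \<open>U\<close> stays in the \<open>R\<close> neighbourhood \<open>Y\<close>,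
   where the modified field is \<open>X\<close>.\<close>
 define T where "T = min (1 / (2 * (L + 1))) (R / (4 * M))"
 have T: "T > 0" using L R(1) M(1) by (simp add: T_def)
 have LT: "L * T \<le> 1 / 2"
 proof -
  have "L * T \<le> (L + 1) * (1 / (2 * (L + 1)))" using L T by (intro mult_mono) (auto simp: T_def)
  also have "\<dots> = 1 / 2" using L by (simp add: field_simps)
  finally show ?thesis .
 qed
 have MT: "M * T \<le> R / 4"
 proof -
  have "T \<le> R / (4 * M)" by (simp add: T_def)
  thus ?thesis using M(1) by (simp add: field_simps)
 qed
 define P where "P = closest_point K2"
 have P: "P x \<in> K2" for x unfolding P_def by (intro closest_point_in_set K2 compact_imp_closed)
 have Pid: "P x = x" if "x \<in> K2" for x unfolding P_def by (rule closest_point_self[OF that])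
 have Plip: "norm (X (P v) - X (P w)) \<le> L * norm (v - w)" for v w
 proof -
  have "norm (P v - P w) \<le> norm (v - w)"
   unfolding P_def dist_norm[symmetric] by (intro closest_point_lipschitz K2 compact_imp_closed)
  thus ?thesis using lipK[OF P[of v] P[of w]] mult_left_mono[OF _ L] by (meson order_trans)
 qed
 have Xc: "continuous_on UNIV (\<lambda>v. X (P v))"
  using smooth_on_continuous[OF assms(2)] P K2(4)
  by (intro continuous_on_compose2[of W X UNIV P] continuous_on_closest_point[OF K2(2) compact_imp_closed[OF K2(1)] K2(3), folded P_def]) auto
 have "\<exists>y. y 0 = x \<and> (\<forall>t\<in>{-T<..<T}. (y has_vector_derivative X (P (y t))) (at t))" for x
  by (rule picard[OF T L LT]) (auto intro!: continuous_on_compose2[OF Xc] continuous_intros Plip)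
 then obtain y where y0: "\<And>x. y x 0 = x"
  and yd: "\<And>x t. t \<in> {-T<..<T} ==> (y x has_vector_derivative X (P (y x t))) (at t)" by metis
 define \<phi> where "\<phi> t x = y x t" for t x
 have near: "norm (\<phi> t x - x) \<le> R / 4" if t: "t \<in> {-T<..<T}" for t x
 proof -
  have "norm (\<phi> t x - \<phi> 0 x) \<le> M * norm (t - 0)"
  proof (rule differentiable_bound[where S = "{-T<..<T}"])
   fix s assume s: "s \<in> {-T<..<T}"
   show "((\<lambda>s. \<phi> s x) has_derivative (\<lambda>r. r *R X (P (y x s)))) (at s within {-T<..<T})"
    using yd[OF s, of x] unfolding \<phi>_def has_vector_derivative_def by (rule has_derivative_at_withinI)
   show "onorm (\<lambda>r. r *R X (P (y x s))) \<le> M"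
    using M(2)[OF P] by (simp add: onorm_scaleR_left bounded_linear_ident onorm_id)
  qed (use t T in auto)
  also have "\<dots> \<le> M * T" using t M(1) by (intro mult_left_mono) auto
  finally show ?thesis using MT y0 by (simp add: \<phi>_def)
 qed
 have inY: "\<phi> t x \<in> Y" if t: "t \<in> {-T<..<T}" and x: "x \<in> U" for t x
 proof -
  obtain k where k: "k \<in> K" "dist k x < R / 2" using x by (auto simp: U_def)
  have "dist k (\<phi> t x) \<le> dist k x + dist x (\<phi> t x)" by (rule dist_triangle)
  also have "\<dots> < R" using k near[OF t, of x] R(1) by (simp add: dist_norm norm_minus_commute)
  finally show ?thesis using k by (auto simp: Y_def)
 qed
 have sm: "smooth_on ({-T<..<T} \<times> U) (\<lambda>p. \<phi> (fst p) (snd p))"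
  unfolding smooth_on_def
 proof
  fix k
  have o: "open (({-T<..<T} \<times> U) \<times> Y)" by (intro open_Times UY YK open_greaterThanLessThan)
  show "Ck_on k ({-T<..<T} \<times> U) (\<lambda>p. \<phi> (fst p) (snd p))"
  proof (rule ode_param_Ck[OF UY(2) YK(2) T L LT, where f = "\<lambda>z. X (snd z)"])
   show "Ck_on k (({-T<..<T} \<times> U) \<times> Y) (\<lambda>z. X (snd z))"
    by (rule Ck_on_compose[OF o assms(1) _ Ck_on_linear[OF bounded_linear_snd o Ck_on_id]])
     (use YK K2 assms(2) in \<open>auto simp: smooth_on_def\<close>)
  next
   fix t x assume *: "t \<in> {-T<..<T}" "x \<in> U"
   thus "((\<lambda>s. \<phi> (fst (s, x)) (snd (s, x))) has_vector_derivative X (snd ((t, x), \<phi> (fst (t, x)) (snd (t, x))))) (at t)"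
    using yd[OF *(1), of x] Pid inY[OF *] YK(1) by (auto simp: \<phi>_def)
  next
   show "Ck_on k U (\<lambda>x. \<phi> (fst (0, x)) (snd (0, x)))"
    by (simp add: \<phi>_def y0 Ck_on_id)
  qed (use inY in \<open>auto intro!: lipK subsetD[OF YK(1)]\<close>)
 qed
 show thesis
 proof (rule that[OF T UY(2,3) _ sm])
  show "U \<subseteq> W" using UY YK K2 by auto
  show "\<phi> 0 x = x" for x by (simp add: \<phi>_def y0)
  show "\<phi> t x \<in> W" if "t \<in> {-T<..<T}" "x \<in> U" for t x using inY[OF that] YK K2 by auto
  show "((\<lambda>s. \<phi> s x) has_vector_derivative X (\<phi> t x)) (at t)" if "t \<in> {-T<..<T}" "x \<in> U" for t x
   using yd[OF that(1), of x] Pid inY[OF that] YK(1) by (auto simp: \<phi>_def)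
  show "\<phi> s (\<phi> t x) = \<phi> (s + t) x" if st: "t \<in> {-T<..<T}" "s \<in> {-T<..<T}" "s + t \<in> {-T<..<T}" for s t x
  proof -
   \<comment> \<open>Both terms solve the same autonomous equation in \<open>r\<close> and agree at
     \<open>r = 0\<close>.\<close>
   define d where "d r = \<phi> r (\<phi> t x) - \<phi> (r + t) x" for r
   have "norm (d s) \<le> (norm (d 0) + 0) * exp ((L + 1) * \<bar>s\<bar>)"
   proof (rule gronwall[OF L])
    fix r assume "r \<in> closed_segment 0 s"
    hence r: "r \<in> {-T<..<T}" "r + t \<in> {-T<..<T}" using st by (auto simp: closed_segment_eq_real_ivl split: if_splits)
    have "((\<lambda>r. r + t) has_vector_derivative 1) (at r)" by (auto intro!: derivative_eq_intros)
    from vector_diff_chain_at[OF this yd[OF r(2), of x]]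
    show "(d has_vector_derivative X (P (\<phi> r (\<phi> t x))) - X (P (\<phi> (r + t) x))) (at r)"
     unfolding d_def \<phi>_def by (intro has_vector_derivative_diff yd r(1)) (simp add: o_def)
    show "norm (X (P (\<phi> r (\<phi> t x))) - X (P (\<phi> (r + t) x))) \<le> L * norm (d r) + 0"
     using Plip by (simp add: d_def)
   qed simp
   moreover have "d 0 = 0" by (simp add: d_def \<phi>_def y0)
   ultimately show ?thesis by (simp add: d_def)
  qed
 qed
qed

section \<open>Diffeomorphisms and tensor fields\<close>

lemma dd_compose:
 assumes "f differentiable (at x)" "g differentiable (at (f x))"
 shows "dd (\<lambda>z. g (f z)) x v = dd g (f x) (dd f x v)"
 using frechet_eqI[OF has_derivative_compose[OF assms[unfolded frechet_derivative_works]]] by simp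

lemma dd_linear: "f differentiable (at x) ==> linear (dd f x)"
 by (rule linear_frechet_derivative)

lemmas dd_lin = dd_linear[OF smooth_onD]

lemma dd_matrix:
 fixes f :: "real ^ 'n \<Rightarrow> real ^ 'm"
 assumes "f differentiable (at x)"
 shows "dd f x v = jacobian f (at x) *v v"
 unfolding jacobian_def by (simp add: dd_linear[OF assms] matrix_works)

text \<open>Continuity of the derivative is known direction by direction only; summing over a basis
  bounds the operator norm, in which the general criterion for local injectivity is
  formulated.\<close>

lemma local_injectivity:
 fixes f :: "real ^ 'n \<Rightarrow> real ^ 'n"
 assumes "open U" "smooth_on U f" "x0 \<in> U" "\<And>v. dd f x0 v = 0 ==> v = 0"
 shows "\<exists>r>0. ball x0 r \<subseteq> U \<and> inj_on f (ball x0 r)"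
proof -
 have lin: "linear (dd f x)" if "x \<in> U" for x
  by (rule dd_lin[OF assms(2) that])
 have "inj (dd f x0)" using lin[OF assms(3)] assms(4) by (simp add: linear_injective_0)
 then obtain g' where g': "linear g'" "g' \<circ> dd f x0 = id"
  using linear_injective_left_inverse[OF lin[OF assms(3)]] by auto
 have c: "continuous_on U (\<lambda>x. dd f x b)" for b
  by (rule smooth_on_continuous[OF smooth_on_frechet[OF assms(2)]])
 show ?thesis
 proof (rule has_derivative_locally_injective[of x0 U g' "dd f" f])
  show "bounded_linear g'" using g'(1) by (rule linear_conv_bounded_linear[THEN iffD1])
  show "(f has_derivative dd f x) (at x)" if "x \<in> U" for x by (rule smooth_on_has_derivative[OF assms(2) that])
  fix e :: real assume e: "e > 0"
  let ?N = "real DIM(real ^ 'n)"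
  have "\<exists>d>0. \<forall>x. dist x x0 < d \<longrightarrow> x \<in> U \<and> norm (dd f x b - dd f x0 b) < e / (?N + 1)" for b
  proof -
   obtain r where r: "r > 0" "ball x0 r \<subseteq> U" using assms(1,3) openE by blast
   have pos: "e / (?N + 1) > 0" using e by simp
   obtain d where d: "d > 0" "\<And>x. x \<in> U ==> dist x x0 < d ==> dist (dd f x b) (dd f x0 b) < e / (?N + 1)"
    using c[of b] assms(3) pos unfolding continuous_on_iff by blast
   show ?thesis using r d by (intro exI[of _ "min r d"]) (auto simp: dist_commute dist_norm subset_iff)
  qed
  then obtain db where db: "\<And>b. db b > 0" "\<And>b x. dist x x0 < db b ==> x \<in> U \<and> norm (dd f x b - dd f x0 b) < e / (?N + 1)"
   by metis
  define d where "d = Min (db ` (Basis :: (real ^ 'n) set))"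
  have "onorm (\<lambda>v. dd f x v - dd f x0 v) < e" if x: "dist x0 x < d" for x
  proof -
   have dx: "dist x x0 < db b" if "b \<in> Basis" for b
   proof -
    have "d \<le> db b" using that by (simp add: d_def)
    thus ?thesis using x by (simp add: dist_commute)
   qed
   obtain b0 :: "real ^ 'n" where "b0 \<in> Basis" using nonempty_Basis by blast
   hence "x \<in> U" using db(2)[OF dx] by blast
   hence "linear (\<lambda>v. dd f x v - dd f x0 v)" by (intro linear_compose_sub lin assms(3))
   hence "onorm (\<lambda>v. dd f x v - dd f x0 v) \<le> (\<Sum>b\<in>Basis. norm (dd f x b - dd f x0 b))" by (rule onorm_le_basis)
   also have "\<dots> \<le> (\<Sum>b\<in>(Basis :: (real ^ 'n) set). e / (?N + 1))"
    using db(2)[OF dx] by (intro sum_mono) (simp add: less_imp_le)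
   also have "\<dots> = ?N * (e / (?N + 1))" by simp
   also have "\<dots> < e" using e by (simp add: field_simps)
   finally show ?thesis .
  qed
  moreover have "d > 0" using db(1) by (simp add: d_def)
  ultimately show "\<exists>d>0. \<forall>x. dist x0 x < d \<longrightarrow> onorm (\<lambda>v. dd f x v - dd f x0 v) < e" by blast
 qed (use assms g' in auto)
qed

text \<open>Cramer's rule rather than a matrix inverse: the entries are visibly rational in
  \<open>A\<close>, so the solution of a smoothly varying system is smooth.\<close>

definition solve :: "real ^ 'n ^ 'n \<Rightarrow> real ^ 'n \<Rightarrow> real ^ 'n" where
 "solve A b = (\<chi> k. det (\<chi> i j. if j = k then b $ i else A $ i $ j) / det A)"

lemma solve_iff: "det A \<noteq> 0 ==> A *v x = b \<longleftrightarrow> x = solve A b"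
 unfolding solve_def by (rule cramer)

lemma solve_linear:
 assumes "det A \<noteq> 0"
 shows "linear (solve A)"
proof (rule linearI)
 have s: "A *v solve A b = b" for b using solve_iff[OF assms] by blast
 show "solve A (x + y) = solve A x + solve A y" for x y
  by (rule solve_iff[OF assms, THEN iffD1, symmetric]) (simp add: s matrix_vector_right_distrib)
 show "solve A (c *R x) = c *R solve A x" for c x
  by (rule solve_iff[OF assms, THEN iffD1, symmetric]) (simp add: s matrix_vector_mult_scaleR)
qed

text \<open>Invariance of domain gives the open image and the continuity of the inverse
  \<open>g\<close>. Since \<open>g\<close> has the derivative \<open>solve (J (g y))\<close>,
  continuity of \<open>g\<close> makes it C^1, this makes its derivative C^1, and so on.\<close>

lemma diffeoI:
 fixes f :: "real ^ 'n \<Rightarrow> real ^ 'n"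
 assumes U: "open U" and f: "smooth_on U f" and inj: "inj_on f U"
  and ker: "\<And>x v. x \<in> U ==> dd f x v = 0 ==> v = 0"
 shows "diffeo_onto_image U f"
proof -
 define g where "g = inv_into U f"
 have fc: "continuous_on U f" by (rule smooth_on_continuous[OF f])
 have im: "open (f ` V)" if "open V" "V \<subseteq> U" for V
  by (rule invariance_of_domain[OF continuous_on_subset[OF fc that(2)] that(1) inj_on_subset[OF inj that(2)]])
 have oW: "open (f ` U)" by (rule im) (use U in auto)
 have gf: "g (f x) = x" if "x \<in> U" for x unfolding g_def by (rule inv_into_f_f[OF inj that])
 have fg: "f (g y) = y" "g y \<in> U" if "y \<in> f ` U" for y
  using that unfolding g_def by (auto simp: f_inv_into_f inv_into_into)
 have gc: "continuous_on (f ` U) g"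
  unfolding continuous_on_open_vimage[OF oW]
 proof (intro allI impI)
  fix V :: "(real ^ 'n) set" assume "open V"
  have "g -` V \<inter> f ` U = f ` (U \<inter> V)" using gf by auto
  thus "open (g -` V \<inter> f ` U)" using im[of "U \<inter> V"] U \<open>open V\<close> by auto
 qed
 define J where "J x = jacobian f (at x)" for x
 have dJ: "dd f x v = J x *v v" if "x \<in> U" for x v
  unfolding J_def by (rule dd_matrix[OF smooth_onD[OF f that]])
 have det: "det (J x) \<noteq> 0" if "x \<in> U" for x
 proof -
  have "\<forall>v. J x *v v = 0 \<longrightarrow> v = 0" using ker[OF that] dJ[OF that] by auto
  then obtain B where "B ** J x = mat 1" using matrix_left_invertible_ker by blast
  hence "invertible (J x)" unfolding invertible_def using matrix_left_right_inverse by blast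
  thus ?thesis by (simp add: invertible_det_nz)
 qed
 have sol: "solve (J x) (dd f x v) = v" "dd f x (solve (J x) v) = v" if "x \<in> U" for x v
  using solve_iff[OF det[OF that], of v "J x *v v"] solve_iff[OF det[OF that], of "solve (J x) v" v]
  unfolding dJ[OF that] by simp_all
 have gD: "(g has_derivative solve (J (g y))) (at y)" if y: "y \<in> f ` U" for y
 proof (rule has_derivative_inverse_basic[where f' = "dd f (g y)" and T = "f ` U"])
  show "(f has_derivative dd f (g y)) (at (g y))" by (rule smooth_on_has_derivative[OF f fg(2)[OF y]])
  show "bounded_linear (solve (J (g y)))"
   using solve_linear[OF det[OF fg(2)[OF y]]] by (rule linear_conv_bounded_linear[THEN iffD1])
  show "solve (J (g y)) \<circ> dd f (g y) = id" using sol fg(2)[OF y] by auto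
  show "isCont g y" using gc y unfolding continuous_on_eq_continuous_at[OF oW] by blast
 qed (use oW y fg in auto)
 have Js: "smooth_on U (\<lambda>x. solve (J x) v)" for v
 proof -
  have e: "J x $ i $ j = dd f x (axis j 1) $ i" for x i j by (simp add: J_def jacobian_def matrix_def)
  have s: "smooth_on U (\<lambda>x. J x $ i $ j)" for i j
   unfolding e by (intro smooth_on_nth U smooth_on_frechet f)
  have s2: "smooth_on U (\<lambda>x. if j = k then v $ i else J x $ i $ j)" for i j k
   by (cases "j = k") (simp_all add: s smooth_on_const)
  show ?thesis unfolding solve_def
   by (intro smooth_on_lambda smooth_on_divide smooth_on_det U) (auto simp: s s2 det)
 qed
 have "Ck_on k (f ` U) g" for k
 proof (induction k)
  case 0 show ?case using gc by simp
 next
  case (Suc k)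
  have "Ck_on k (f ` U) (\<lambda>y. dd g y v)" for v
  proof (rule Ck_on_cong[OF oW])
   show "Ck_on k (f ` U) (\<lambda>y. solve (J (g y)) v)"
    by (rule Ck_on_compose[OF oW U _ Suc]) (use fg Js in \<open>auto simp: smooth_on_def\<close>)
  qed (simp add: frechet_eqI[OF gD])
  thus ?case unfolding Ck_on.simps differentiable_def using gD by blast
 qed
 hence "smooth_on (f ` U) g" by (simp add: smooth_on_def)
 thus ?thesis unfolding diffeo_onto_image_def g_def using U oW inj f by simp
qed

lemma local_diffeo:
 fixes f :: "real ^ 'n \<Rightarrow> real ^ 'n"
 assumes "open U" "smooth_on U f" "x0 \<in> U" "\<And>v. dd f x0 v = 0 ==> v = 0"
 shows "\<exists>V. open V \<and> x0 \<in> V \<and> V \<subseteq> U \<and> diffeo_onto_image V f"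
proof -
 define J where "J x = jacobian f (at x)" for x
 have e: "J x $ i $ j = dd f x (axis j 1) $ i" for x i j by (simp add: J_def jacobian_def matrix_def)
 have dJ: "dd f x v = J x *v v" if "x \<in> U" for x v
  unfolding J_def by (rule dd_matrix[OF smooth_onD[OF assms(2) that]])
 have "smooth_on U (\<lambda>x. det (J x))"
  by (intro smooth_on_det assms(1)) (unfold e, intro smooth_on_nth assms(1) smooth_on_frechet assms(2))
 hence c: "continuous_on U (\<lambda>x. det (J x))" by (rule smooth_on_continuous)
 have iff: "det (J x) \<noteq> 0 \<longleftrightarrow> (\<forall>v. dd f x v = 0 \<longrightarrow> v = 0)" if "x \<in> U" for x
  unfolding dJ[OF that] matrix_left_invertible_ker[symmetric] invertible_det_nz[symmetric] invertible_def
  using matrix_left_right_inverse by blast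
 define S where "S = {x \<in> U. det (J x) \<noteq> 0}"
 have "S = (\<lambda>x. det (J x)) -` (- {0}) \<inter> U" by (auto simp: S_def)
 hence oS: "open S" using c continuous_on_open_vimage[OF assms(1)] by (metis open_Compl closed_singleton)
 have "x0 \<in> S" using iff[OF assms(3)] assms(3,4) by (auto simp: S_def)
 then obtain r where r: "r > 0" "ball x0 r \<subseteq> S" "inj_on f (ball x0 r)"
  using local_injectivity[OF oS smooth_on_subset[OF assms(2)], of x0] assms(4) by (auto simp: S_def)
 have "diffeo_onto_image (ball x0 r) f"
 proof (rule diffeoI[OF open_ball smooth_on_subset[OF assms(2)] r(3)])
  show "ball x0 r \<subseteq> U" using r(2) by (auto simp: S_def)
  show "v = 0" if "x \<in> ball x0 r" "dd f x v = 0" for x v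
   using iff[of x] that r(2) by (auto simp: S_def)
 qed
 thus ?thesis using r by (intro exI[of _ "ball x0 r"]) (auto simp: S_def)
qed

lemma diffeoD:
 assumes "diffeo_onto_image U f"
 shows "open U" "open (f ` U)" "inj_on f U" "smooth_on U f" "smooth_on (f ` U) (inv_into U f)"
 using assms by (auto simp: diffeo_onto_image_def)

lemma diffeo_ker:
 fixes f :: "'a::euclidean_space \<Rightarrow> 'a"
 assumes "diffeo_onto_image U f" "x \<in> U" "dd f x v = 0"
 shows "v = 0"
proof -
 note d = diffeoD[OF assms(1)]
 have "dd (\<lambda>z. inv_into U f (f z)) x v = dd (inv_into U f) (f x) (dd f x v)"
  by (rule dd_compose) (use d assms(2) smooth_onD in auto)
 moreover have "dd (\<lambda>z. inv_into U f (f z)) x = dd (\<lambda>z. z) x"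
  by (rule frechet_cong[OF d(1) assms(2)]) (simp add: d(3))
 ultimately have "v = dd (inv_into U f) (f x) 0" using assms(3) by simp
 thus ?thesis
  using linear_0[OF dd_lin[OF d(5)], of "f x"] assms(2) by simp
qed

lemma diffeo_surj:
 fixes f :: "'a::euclidean_space \<Rightarrow> 'a"
 assumes "diffeo_onto_image U f" "x \<in> U"
 shows "\<exists>v. dd f x v = w"
proof -
 have lin: "linear (dd f x)" by (rule dd_lin[OF diffeoD(4)[OF assms(1)] assms(2)])
 have "inj (dd f x)" using lin diffeo_ker[OF assms] by (simp add: linear_injective_0)
 hence "surj (dd f x)" using lin linear_injective_imp_surjective by blast
 thus ?thesis by (metis surjE)
qed

lemma diffeo_subset:
 fixes f :: "real ^ 'n \<Rightarrow> real ^ 'n"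
 assumes "diffeo_onto_image U f" "open V" "V \<subseteq> U"
 shows "diffeo_onto_image V f"
 using diffeoD[OF assms(1)] diffeo_ker[OF assms(1)] assms
 by (intro diffeoI) (auto intro: smooth_on_subset inj_on_subset)

lemma diffeo_compose:
 fixes f g :: "real ^ 'n \<Rightarrow> real ^ 'n"
 assumes f: "diffeo_onto_image U f" and g: "diffeo_onto_image W g" and "f ` U \<subseteq> W"
 shows "diffeo_onto_image U (\<lambda>x. g (f x))"
proof (rule diffeoI)
 show "smooth_on U (\<lambda>x. g (f x))"
  by (rule smooth_on_compose[OF diffeoD(1)[OF f] diffeoD(1)[OF g] assms(3) diffeoD(4)[OF f] diffeoD(4)[OF g]])
 show "inj_on (\<lambda>x. g (f x)) U"
  using comp_inj_on[OF diffeoD(3)[OF f] inj_on_subset[OF diffeoD(3)[OF g] assms(3)]] by (simp add: o_def)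
 show "v = 0" if "x \<in> U" "dd (\<lambda>x. g (f x)) x v = 0" for x v
 proof -
  have "dd g (f x) (dd f x v) = 0"
   using that dd_compose[of f x g v] smooth_onD[OF diffeoD(4)[OF f]] smooth_onD[OF diffeoD(4)[OF g]] assms(3)
   by auto
  thus ?thesis using diffeo_ker[OF g] diffeo_ker[OF f] that assms(3) by blast
 qed
qed (rule diffeoD(1)[OF f])

lemma diffeo_inverse:
 fixes f :: "real ^ 'n \<Rightarrow> real ^ 'n"
 assumes "diffeo_onto_image U f"
 shows "diffeo_onto_image (f ` U) (inv_into U f)"
  and "\<And>x. x \<in> U ==> inv_into U f (f x) = x" and "\<And>y. y \<in> f ` U ==> f (inv_into U f y) = y"
  and "\<And>x v. x \<in> U ==> dd (inv_into U f) (f x) (dd f x v) = v"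
  and "\<And>y v. y \<in> f ` U ==> dd f (inv_into U f y) (dd (inv_into U f) y v) = v"
  and "\<And>y. y \<in> f ` U ==> inv_into U f y \<in> U" and "inv_into U f ` (f ` U) = U"
proof -
 note d = diffeoD[OF assms]
 show 1: "inv_into U f (f x) = x" if "x \<in> U" for x using d(3) that by simp
 show 2: "f (inv_into U f y) = y" if "y \<in> f ` U" for y using that by (rule f_inv_into_f)
 show 3: "inv_into U f y \<in> U" if "y \<in> f ` U" for y using that by (rule inv_into_into)
 show 7: "inv_into U f ` (f ` U) = U" using 1 by force
 show 4: "dd (inv_into U f) (f x) (dd f x v) = v" if "x \<in> U" for x v
 proof -
  have "dd (\<lambda>z. inv_into U f (f z)) x v = dd (inv_into U f) (f x) (dd f x v)"
   by (rule dd_compose) (use d that smooth_onD in auto)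
  moreover have "dd (\<lambda>z. inv_into U f (f z)) x = dd (\<lambda>z. z) x"
   by (rule frechet_cong[OF d(1) that]) (simp add: 1)
  ultimately show ?thesis by simp
 qed
 show 5: "dd f (inv_into U f y) (dd (inv_into U f) y v) = v" if "y \<in> f ` U" for y v
 proof -
  have "dd (\<lambda>z. f (inv_into U f z)) y v = dd f (inv_into U f y) (dd (inv_into U f) y v)"
   by (rule dd_compose) (rule smooth_onD[OF d(5) that], rule smooth_onD[OF d(4) 3[OF that]])
  moreover have "dd (\<lambda>z. f (inv_into U f z)) y = dd (\<lambda>z. z) y"
   by (rule frechet_cong[OF d(2) that]) (simp add: 2)
  ultimately show ?thesis by simp
 qed
 show "diffeo_onto_image (f ` U) (inv_into U f)"
 proof (rule diffeoI[OF d(2,5)])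
  show "inj_on (inv_into U f) (f ` U)" by (rule inj_on_inv_into) simp
  show "v = 0" if "y \<in> f ` U" "dd (inv_into U f) y v = 0" for y v
   using 5[OF that(1), of v] that(2) linear_0[OF dd_lin[OF d(4) 3[OF that(1)]]] by simp
 qed
qed

section \<open>Tensor fields and their Lie derivatives\<close>

lemma tensor_app_sum: "tensor_app T v w = (\<Sum>i\<in>UNIV. \<Sum>j\<in>UNIV. v $ i * T $ i $ j * w $ j)"
 by (simp add: tensor_app_def inner_vec_def matrix_vector_mult_def sum_distrib_left mult.assoc)

lemma tensor_app_linear:
 "tensor_app (T + S) v w = tensor_app T v w + tensor_app S v w"
 "tensor_app (T - S) v w = tensor_app T v w - tensor_app S v w"
 "tensor_app (c *R T) v w = c * tensor_app T v w"
 "tensor_app 0 v w = 0"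
 "tensor_app T (v + v') w = tensor_app T v w + tensor_app T v' w"
 "tensor_app T (v - v') w = tensor_app T v w - tensor_app T v' w"
 "tensor_app T (c *R v) w = c * tensor_app T v w"
 "tensor_app T (- v) w = - tensor_app T v w"
 "tensor_app T 0 w = 0"
 "tensor_app T v (w + w') = tensor_app T v w + tensor_app T v w'"
 "tensor_app T v (w - w') = tensor_app T v w - tensor_app T v w'"
 "tensor_app T v (c *R w) = c * tensor_app T v w"
 "tensor_app T v (- w) = - tensor_app T v w"
 "tensor_app T v 0 = 0"
 by (simp_all add: tensor_app_sum sum.distrib sum_subtractf sum_distrib_left sum_negf algebra_simps)

lemma tensor_app_sum_tensor: "tensor_app (\<Sum>i\<in>I. T i) v w = (\<Sum>i\<in>I. tensor_app (T i) v w)"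
 by (induction I rule: infinite_finite_induct) (simp_all add: tensor_app_linear)

lemma tensor_app_sum_left: "tensor_app T (\<Sum>i\<in>I. v i) w = (\<Sum>i\<in>I. tensor_app T (v i) w)"
 by (induction I rule: infinite_finite_induct) (simp_all add: tensor_app_linear)

lemma tensor_app_sum_right: "tensor_app T v (\<Sum>i\<in>I. w i) = (\<Sum>i\<in>I. tensor_app T v (w i))"
 by (induction I rule: infinite_finite_induct) (simp_all add: tensor_app_linear)

lemma tensor_app_axis: "tensor_app T (axis i 1) (axis j 1) = T $ i $ j"
proof -
 have "(axis i 1 :: point) $ k * T $ k $ l * (axis j 1 :: point) $ l
  = (if l = j then if k = i then T $ i $ j else 0 else 0)" for k l
  by (simp add: axis_def)
 thus ?thesis by (simp add: tensor_app_sum)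
qed

lemma tensor_eqI:
 assumes "\<And>v w. tensor_app T v w = tensor_app S v w"
 shows "T = S"
 using assms[of "axis _ 1" "axis _ 1"] by (simp add: vec_eq_iff tensor_app_axis)

lemma has_derivative_tensor_app:
 assumes "(T has_derivative T') (at x)" "(a has_derivative a') (at x)" "(b has_derivative b') (at x)"
 shows "((\<lambda>z. tensor_app (T z) (a z) (b z)) has_derivative
  (\<lambda>u. tensor_app (T' u) (a x) (b x) + tensor_app (T x) (a' u) (b x) + tensor_app (T x) (a x) (b' u))) (at x)"
proof -
 have 1: "((\<lambda>z. T z $ i $ j) has_derivative (\<lambda>u. T' u $ i $ j)) (at x)" for i j
  by (intro bounded_linear.has_derivative[OF bounded_linear_vec_nth] assms(1))
 have 2: "((\<lambda>z. a z $ i) has_derivative (\<lambda>u. a' u $ i)) (at x)" "((\<lambda>z. b z $ i) has_derivative (\<lambda>u. b' u $ i)) (at x)" for i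
  by (intro bounded_linear.has_derivative[OF bounded_linear_vec_nth] assms)+
 show ?thesis unfolding tensor_app_sum
 proof (rule has_derivative_eq_rhs)
  show "((\<lambda>z. \<Sum>i\<in>UNIV. \<Sum>j\<in>UNIV. a z $ i * T z $ i $ j * b z $ j) has_derivative
   (\<lambda>u. \<Sum>i\<in>UNIV. \<Sum>j\<in>UNIV. a x $ i * T x $ i $ j * b' u $ j + (a x $ i * T' u $ i $ j + a' u $ i * T x $ i $ j) * b x $ j)) (at x)"
   by (intro has_derivative_sum has_derivative_mult 1 2)
 qed (simp add: sum.distrib algebra_simps)
qed

lemma dd_tensor_app:
 assumes "T differentiable (at x)" "a differentiable (at x)" "b differentiable (at x)"
 shows "dd (\<lambda>z. tensor_app (T z) (a z) (b z)) x u = tensor_app (dd T x u) (a x) (b x)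
  + tensor_app (T x) (dd a x u) (b x) + tensor_app (T x) (a x) (dd b x u)"
 using frechet_eqI[OF has_derivative_tensor_app[OF assms[unfolded frechet_derivative_works]]] by simp

lemma dd_const [simp]: "dd (\<lambda>z. c) x v = 0"
 by (simp add: frechet_eqI[OF has_derivative_const])

lemma smooth_on_tensor_app [smooth]:
 "open U ==> smooth_on U T ==> smooth_on U a ==> smooth_on U b ==> smooth_on U (\<lambda>z. tensor_app (T z) (a z) (b z))"
 unfolding tensor_app_sum by (intro smooth_on_sum smooth_on_mult smooth_on_nth)

lemma dd_vec_nth: "f differentiable (at x) ==> dd (\<lambda>z. f z $ i) x v = dd f x v $ i"
 by (rule frechet_linear[OF bounded_linear_vec_nth])

lemma differentiable_vec_nth: "f differentiable (at x) ==> (\<lambda>z. f z $ i) differentiable (at x)"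
 unfolding differentiable_def using bounded_linear.has_derivative[OF bounded_linear_vec_nth] by blast

lemma dd_expand_axis:
 fixes f :: "real ^ 'n \<Rightarrow> 'b::real_normed_vector"
 assumes "f differentiable (at x)"
 shows "dd f x v = (\<Sum>i\<in>UNIV. v $ i *R dd f x (axis i 1))"
proof -
 have "dd f x v = dd f x (\<Sum>i\<in>UNIV. v $ i *R axis i 1)"
  using basis_expansion[of v] by (simp add: scalar_mult_eq_scaleR)
 thus ?thesis by (simp add: linear_sum[OF dd_linear[OF assms]] linear_scale[OF dd_linear[OF assms]])
qed

text \<open>The coordinate-free form of the definition: the bracket of \<open>V\<close> with a
  constant field \<open>v\<close> is minus \<open>dd V x v\<close>, so this is the Leibniz rule for
  L_V.\<close>

lemma lie_app:
 assumes "T differentiable (at x)" "V differentiable (at x)"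
 shows "tensor_app (\<L> V T x) v w
  = tensor_app (dd T x (V x)) v w + tensor_app (T x) (dd V x v) w + tensor_app (T x) v (dd V x w)"
proof -
 define A where "A i = dd V x (axis i 1)" for i
 have l: "\<L> V T x $ i $ j = dd T x (V x) $ i $ j + (\<Sum>k\<in>UNIV. T x $ k $ j * A i $ k) + (\<Sum>k\<in>UNIV. T x $ i $ k * A j $ k)" for i j
  unfolding lie_derivative_def A_def
  by (simp add: dd_vec_nth[OF differentiable_vec_nth[OF assms(1)]] dd_vec_nth[OF assms(1)])
 have dV: "dd V x v = (\<Sum>i\<in>UNIV. v $ i *R A i)" for v
  unfolding A_def by (rule dd_expand_axis[OF assms(2)])
 have 1: "tensor_app (T x) (dd V x v) w = (\<Sum>i\<in>UNIV. \<Sum>j\<in>UNIV. v $ i * (\<Sum>k\<in>UNIV. T x $ k $ j * A i $ k) * w $ j)"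
  unfolding dV tensor_app_sum_left tensor_app_linear
 proof (rule sum.cong[OF refl])
  fix i
  have "tensor_app (T x) (A i) w = (\<Sum>j\<in>UNIV. \<Sum>k\<in>UNIV. A i $ k * T x $ k $ j * w $ j)"
   unfolding tensor_app_sum by (rule sum.swap)
  thus "v $ i * tensor_app (T x) (A i) w = (\<Sum>j\<in>UNIV. v $ i * (\<Sum>k\<in>UNIV. T x $ k $ j * A i $ k) * w $ j)"
   by (simp add: sum_distrib_left sum_distrib_right mult_ac)
 qed
 have 2: "tensor_app (T x) v (dd V x w) = (\<Sum>i\<in>UNIV. \<Sum>j\<in>UNIV. v $ i * (\<Sum>k\<in>UNIV. T x $ i $ k * A j $ k) * w $ j)"
  unfolding dV tensor_app_sum_right tensor_app_linear
  by (subst sum.swap) (simp add: tensor_app_sum sum_distrib_left sum_distrib_right mult_ac)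
 show ?thesis unfolding 1 2 unfolding tensor_app_sum l
  by (simp add: sum.distrib algebra_simps)
qed

lemma smooth_on_lie [smooth]:
 assumes "open U" "smooth_on U V" "smooth_on U T"
 shows "smooth_on U (\<L> V T)"
proof -
 have 1: "smooth_on U (\<lambda>x. T x $ i $ j)" for i j by (intro smooth_on_nth assms)
 have "smooth_on U (\<lambda>x. \<chi> i j. dd (\<lambda>z. T z $ i $ j) x (V x)
   + (\<Sum>k\<in>UNIV. T x $ k $ j * dd V x (axis i 1) $ k)
   + (\<Sum>k\<in>UNIV. T x $ i $ k * dd V x (axis j 1) $ k))"
  by (intro smooth_on_lambda smooth_on_add smooth_on_sum smooth_on_mult smooth_on_nth smooth_on_frechet_field smooth_on_frechet 1 assms)
 thus ?thesis by (simp add: lie_derivative_def[abs_def])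
qed

lemma smooth_on_lie_iter [smooth]:
 assumes "open U" "smooth_on U V" "smooth_on U T"
 shows "smooth_on U ((\<L> V ^^ k) T)"
 by (induction k) (simp_all add: smooth_on_lie[OF assms(1,2)] assms(3))

lemma lie_cong:
 assumes "open U" "x \<in> U" "\<And>y. y \<in> U ==> T y = S y" "\<And>y. y \<in> U ==> V y = W y"
 shows "\<L> V T x = \<L> W S x"
proof -
 have "dd V x = dd W x" by (rule frechet_cong[OF assms(1,2,4)])
 moreover have "dd (\<lambda>z. T z $ i $ j) x = dd (\<lambda>z. S z $ i $ j) x" for i j
  by (rule frechet_cong[OF assms(1,2)]) (simp add: assms(3))
 ultimately show ?thesis
  by (simp add: lie_derivative_def assms(3)[OF assms(2)] assms(4)[OF assms(2)])
qed

lemma lie_iter_cong: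
 assumes "open U" "\<And>y. y \<in> U ==> T y = S y" "\<And>y. y \<in> U ==> V y = W y" "x \<in> U"
 shows "(\<L> V ^^ k) T x = (\<L> W ^^ k) S x"
 using assms(4)
proof (induction k arbitrary: x)
 case (Suc k)
 show ?case using lie_cong[OF assms(1) Suc.prems Suc.IH assms(3)] by simp
qed (simp add: assms(2))

lemma dd_scaleR:
 assumes "f differentiable (at x)" "T differentiable (at x)"
 shows "dd (\<lambda>z. f z *R T z) x u = dd f x u *R T x + f x *R dd T x u"
 using frechet_eqI[OF has_derivative_scaleR[OF assms[unfolded frechet_derivative_works]]] by (simp add: add.commute)

lemma dd_sum:
 assumes "\<And>i. i \<in> I ==> T i differentiable (at x)"
 shows "dd (\<lambda>z. \<Sum>i\<in>I. T i z) x u = (\<Sum>i\<in>I. dd (T i) x u)"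
 using frechet_eqI[OF has_derivative_sum[of I T "\<lambda>i. dd (T i) x" "at x"]] assms
 by (simp add: frechet_derivative_works[symmetric])

lemma dd_diff:
 assumes "f differentiable (at x)" "T differentiable (at x)"
 shows "dd (\<lambda>z. f z - T z) x u = dd f x u - dd T x u"
 using frechet_eqI[OF has_derivative_diff[OF assms[unfolded frechet_derivative_works]]] by simp

lemma dd_mult:
 fixes f g :: "'a::real_normed_vector \<Rightarrow> real"
 assumes "f differentiable (at x)" "g differentiable (at x)"
 shows "dd (\<lambda>z. f z * g z) x u = dd f x u * g x + f x * dd g x u"
 using dd_scaleR[OF assms] by simp

lemma dd_minus:
 assumes "f differentiable (at x)"
 shows "dd (\<lambda>z. - f z) x u = - dd f x u"
 using dd_diff[of "\<lambda>z. 0" x f] assms by simp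

lemma dd_divide:
 fixes f g :: "'a::real_normed_vector \<Rightarrow> real"
 assumes "f differentiable (at x)" "g differentiable (at x)" "g x \<noteq> 0"
 shows "dd (\<lambda>z. f z / g z) x u = (dd f x u * g x - f x * dd g x u) / (g x)\<^sup>2"
 using frechet_eqI[OF has_derivative_divide'[OF assms(1,2)[unfolded frechet_derivative_works] assms(3)]]
 by (simp add: power2_eq_square)

lemma lie_combination:
 assumes "open U" "x \<in> U" "smooth_on U V" "\<And>j. j \<in> I ==> smooth_on U (c j)" "\<And>j. j \<in> I ==> smooth_on U (S j)"
 shows "\<L> V (\<lambda>z. \<Sum>j\<in>I. c j z *R S j z) x
  = (\<Sum>j\<in>I. dd (c j) x (V x) *R S j x + c j x *R \<L> V (S j) x)"
proof (rule tensor_eqI)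
 fix v w
 have dV: "V differentiable (at x)" by (rule smooth_onD[OF assms(3,2)])
 have dc: "c j differentiable (at x)" "S j differentiable (at x)" if "j \<in> I" for j
  using that assms smooth_onD by blast+
 have dcS: "(\<lambda>z. c j z *R S j z) differentiable (at x)" if "j \<in> I" for j
  by (rule smooth_onD[OF smooth_on_scaleR[OF assms(1)] assms(2)]) (use that assms in auto)
 have dT: "(\<lambda>z. \<Sum>j\<in>I. c j z *R S j z) differentiable (at x)"
  by (rule smooth_onD[OF _ assms(2)]) (use assms in \<open>intro smooth_on_sum smooth_on_scaleR\<close>)
 have e: "dd (\<lambda>z. \<Sum>j\<in>I. c j z *R S j z) x (V x) = (\<Sum>j\<in>I. dd (\<lambda>z. c j z *R S j z) x (V x))"
  by (rule dd_sum[OF dcS])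
 have "tensor_app (\<L> V (\<lambda>z. \<Sum>j\<in>I. c j z *R S j z) x) v w
  = (\<Sum>j\<in>I. tensor_app (dd (c j) x (V x) *R S j x + c j x *R dd (S j) x (V x)) v w
    + tensor_app (c j x *R S j x) (dd V x v) w + tensor_app (c j x *R S j x) v (dd V x w))"
  unfolding lie_app[OF dT dV] e tensor_app_sum_tensor sum.distrib[symmetric]
  by (intro sum.cong refl) (simp add: dd_scaleR dc)
 also have "\<dots> = tensor_app (\<Sum>j\<in>I. dd (c j) x (V x) *R S j x + c j x *R \<L> V (S j) x) v w"
  unfolding tensor_app_sum_tensor
  by (intro sum.cong refl) (simp add: tensor_app_linear lie_app dc dV algebra_simps)
 finally show "tensor_app (\<L> V (\<lambda>z. \<Sum>j\<in>I. c j z *R S j z) x) v w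
  = tensor_app (\<Sum>j\<in>I. dd (c j) x (V x) *R S j x + c j x *R \<L> V (S j) x) v w" .
qed

definition annihilates :: "point set \<Rightarrow> (point \<Rightarrow> point) \<Rightarrow> (point \<Rightarrow> tensor) \<Rightarrow> bool" where
 "annihilates N V T \<longleftrightarrow> (\<forall>x\<in>N. \<forall>w. tensor_app (T x) (V x) w = 0 \<and> tensor_app (T x) w (V x) = 0)"

definition symmetric_on :: "point set \<Rightarrow> (point \<Rightarrow> tensor) \<Rightarrow> bool" where
 "symmetric_on N T \<longleftrightarrow> (\<forall>x\<in>N. \<forall>v w. tensor_app (T x) v w = tensor_app (T x) w v)"

text \<open>Differentiate \<open>tensor_app (T y) (V y) w = 0\<close> along \<open>V\<close>: since
  the bracket of \<open>V\<close> with itself vanishes, the terms that appear are those of the Lie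
  derivative contracted with \<open>V\<close>.\<close>

lemma annihilates_lie:
 assumes "open N" "smooth_on N V" "smooth_on N T" "annihilates N V T"
 shows "annihilates N V (\<L> V T)"
 unfolding annihilates_def
proof (intro ballI allI conjI)
 fix x w assume x: "x \<in> N"
 note d = smooth_onD[OF assms(2) x] smooth_onD[OF assms(3) x]
 have z: "tensor_app (T x) (V x) w = 0" "tensor_app (T x) w (V x) = 0" for w
  using assms(4) x by (auto simp: annihilates_def)
 have "dd (\<lambda>y. tensor_app (T y) (V y) w) x (V x) = dd (\<lambda>y. 0 :: real) x (V x)"
  by (rule fun_cong[OF frechet_cong[OF assms(1) x]]) (use assms(4) in \<open>auto simp: annihilates_def\<close>)
 moreover have "dd (\<lambda>y. tensor_app (T y) w (V y)) x (V x) = dd (\<lambda>y. 0 :: real) x (V x)"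
  by (rule fun_cong[OF frechet_cong[OF assms(1) x]]) (use assms(4) in \<open>auto simp: annihilates_def\<close>)
 ultimately show "tensor_app (\<L> V T x) (V x) w = 0" "tensor_app (\<L> V T x) w (V x) = 0"
  using d z by (simp_all add: lie_app dd_tensor_app tensor_app_linear)
qed

lemma annihilates_lie_iter:
 assumes "open N" "smooth_on N V" "smooth_on N T" "annihilates N V T"
 shows "annihilates N V ((\<L> V ^^ k) T)"
proof (induction k)
 case (Suc k)
 thus ?case using annihilates_lie[OF assms(1,2) smooth_on_lie_iter[OF assms(1-3)]] by simp
qed (simp add: assms)

lemma symmetric_lie:
 assumes "open N" "smooth_on N V" "smooth_on N T" "symmetric_on N T"
 shows "symmetric_on N (\<L> V T)"
 unfolding symmetric_on_def
proof (intro ballI allI)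
 fix x v w assume x: "x \<in> N"
 note d = smooth_onD[OF assms(2) x] smooth_onD[OF assms(3) x]
 have "dd (\<lambda>y. tensor_app (T y) v w) x (V x) = dd (\<lambda>y. tensor_app (T y) w v) x (V x)"
  by (rule fun_cong[OF frechet_cong[OF assms(1) x]]) (use assms(4) in \<open>auto simp: symmetric_on_def\<close>)
 hence "tensor_app (dd T x (V x)) v w = tensor_app (dd T x (V x)) w v"
  using d by (simp add: dd_tensor_app tensor_app_linear)
 thus "tensor_app (\<L> V T x) v w = tensor_app (\<L> V T x) w v"
  using assms(4) x d by (simp add: lie_app symmetric_on_def)
qed

lemma symmetric_lie_iter:
 assumes "open N" "smooth_on N V" "smooth_on N T" "symmetric_on N T"
 shows "symmetric_on N ((\<L> V ^^ k) T)"
proof (induction k)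
 case (Suc k)
 thus ?case using symmetric_lie[OF assms(1,2) smooth_on_lie_iter[OF assms(1-3)]] by simp
qed (simp add: assms)

text \<open>The terms with the derivative of \<open>f\<close> are products with a contraction of
  \<open>T\<close> with \<open>V\<close>, which vanishes. This is why the scale of \<open>V\<close>
  does not affect the flag.\<close>

lemma lie_rescale:
 assumes "V differentiable (at x)" "T differentiable (at x)" "f differentiable (at x)"
  and "\<And>w. tensor_app (T x) (V x) w = 0" "\<And>w. tensor_app (T x) w (V x) = 0"
 shows "\<L> (\<lambda>z. f z *R V z) T x = f x *R \<L> V T x"
proof (rule tensor_eqI)
 fix v w
 have d: "(\<lambda>z. f z *R V z) differentiable (at x)"
  using has_derivative_scaleR[OF assms(3,1)[unfolded frechet_derivative_works]] unfolding differentiable_def by blast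
 show "tensor_app (\<L> (\<lambda>z. f z *R V z) T x) v w = tensor_app (f x *R \<L> V T x) v w"
  unfolding tensor_app_linear lie_app[OF assms(2) d] lie_app[OF assms(2,1)] dd_scaleR[OF assms(3,1)]
   linear_scale[OF dd_linear[OF assms(2)]]
  by (simp add: tensor_app_linear assms(4,5) algebra_simps)
qed

lemma lie_iter_rescale:
 assumes N: "open N" and g: "smooth_on N g" and V: "smooth_on N V" and f: "smooth_on N f" and r: "smooth_on N r"
  and ann: "annihilates N V g"
 shows "\<exists>c. (\<forall>j. smooth_on N (c j)) \<and> (\<forall>x\<in>N. (\<L> (\<lambda>z. f z *R V z) ^^ k) (\<lambda>z. r z *R g z) x
  = (\<Sum>j\<le>k. c j x *R (\<L> V ^^ j) g x))"
proof (induction k)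
 case 0
 show ?case using r by (intro exI[of _ "\<lambda>j. r"]) simp
next
 case (Suc k)
 then obtain c where c: "\<And>j. smooth_on N (c j)"
  and e: "\<And>x. x \<in> N ==> (\<L> (\<lambda>z. f z *R V z) ^^ k) (\<lambda>z. r z *R g z) x
   = (\<Sum>j\<le>k. c j x *R (\<L> V ^^ j) g x)" by blast
 define S where "S j = (\<L> V ^^ j) g" for j
 have S: "smooth_on N (S j)" "annihilates N V (S j)" for j
  unfolding S_def using smooth_on_lie_iter[OF N V g] annihilates_lie_iter[OF N V g ann] by auto
 \<comment> \<open>Coefficients after one more step: the old ones differentiated along
   \<open>V\<close>, plus the old ones shifted by one since each tensor moves on to the next,
   everything times the new scale \<open>f\<close>.\<close>
 define c' where "c' j z = f z * ((if j \<le> k then dd (c j) z (V z) else 0) + (if j = 0 then 0 else c (j - 1) z))" for j z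
 have "smooth_on N (c' j)" for j
  unfolding c'_def by (cases "j \<le> k"; cases "j = 0")
   (simp_all, (intro smooth_on_mult smooth_on_add smooth_on_frechet_field smooth_on_const N f c V)+)
 moreover have "(\<L> (\<lambda>z. f z *R V z) ^^ Suc k) (\<lambda>z. r z *R g z) x = (\<Sum>j\<le>Suc k. c' j x *R S j x)" if x: "x \<in> N" for x
 proof -
  define T where "T z = (\<Sum>j\<le>k. c j z *R S j z)" for z
  have T: "smooth_on N T" unfolding T_def by (intro smooth_on_sum smooth_on_scaleR N c S)
  have "annihilates N V T"
   using S(2) by (simp add: annihilates_def T_def tensor_app_sum_tensor tensor_app_linear)
  have "(\<L> (\<lambda>z. f z *R V z) ^^ Suc k) (\<lambda>z. r z *R g z) x = \<L> (\<lambda>z. f z *R V z) T x"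
   using lie_cong[OF N x, of "(\<L> (\<lambda>z. f z *R V z) ^^ k) (\<lambda>z. r z *R g z)" T] e by (simp add: T_def S_def)
  also have "\<dots> = f x *R \<L> V T x"
   by (rule lie_rescale) (use smooth_onD x V T f \<open>annihilates N V T\<close> in \<open>auto simp: annihilates_def\<close>)
  also have "\<L> V T x = (\<Sum>j\<le>k. dd (c j) x (V x) *R S j x + c j x *R \<L> V (S j) x)"
   unfolding T_def by (rule lie_combination[OF N x V c S(1)])
  also have "\<dots> = (\<Sum>j\<le>k. dd (c j) x (V x) *R S j x) + (\<Sum>j\<le>k. c j x *R S (Suc j) x)"
   by (simp add: sum.distrib S_def)
  also have "(\<Sum>j\<le>k. dd (c j) x (V x) *R S j x) = (\<Sum>j\<le>Suc k. (if j \<le> k then dd (c j) x (V x) else 0) *R S j x)"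
   by simp
  also have "(\<Sum>j\<le>k. c j x *R S (Suc j) x) = (\<Sum>j\<le>Suc k. (if j = 0 then 0 else c (j - 1) x) *R S j x)"
   by (subst sum.atMost_Suc_shift) simp
  finally show ?thesis
   unfolding c'_def by (simp only: sum.distrib[symmetric] scaleR_sum_right scaleR_add_left[symmetric] scaleR_scaleR)
 qed
 ultimately show ?case unfolding S_def by blast
qed

section \<open>The flag of Lie derivatives\<close>

definition flag :: "(point \<Rightarrow> tensor) \<Rightarrow> (point \<Rightarrow> point) \<Rightarrow> point \<Rightarrow> nat \<Rightarrow> tensor set" where
 "flag g V x k = span ((\<lambda>j. (\<L> V ^^ j) g x) ` {..<k})"

lemma flag_rescale_subset:
 assumes N: "open N" "smooth_on N g" "smooth_on N V" "smooth_on N f" "smooth_on N r" "annihilates N V g"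
  and x: "x \<in> N" and h: "\<And>y. y \<in> N ==> h y = r y *R g y" and W: "\<And>y. y \<in> N ==> W y = f y *R V y"
 shows "flag h W x k \<subseteq> flag g V x k"
 unfolding flag_def
proof (rule span_minimal[OF _ subspace_span], safe)
 fix j assume j: "j < k"
 obtain c where "(\<L> (\<lambda>z. f z *R V z) ^^ j) (\<lambda>z. r z *R g z) x = (\<Sum>i\<le>j. c i x *R (\<L> V ^^ i) g x)"
  using lie_iter_rescale[OF N, of j] x by blast
 moreover have "(\<L> W ^^ j) h x = (\<L> (\<lambda>z. f z *R V z) ^^ j) (\<lambda>z. r z *R g z) x"
  by (rule lie_iter_cong[OF N(1) h W x])
 moreover have "(\<Sum>i\<le>j. c i x *R (\<L> V ^^ i) g x) \<in> span ((\<lambda>j. (\<L> V ^^ j) g x) ` {..<k})"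
  by (intro span_sum span_scale span_base) (use j in auto)
 ultimately show "(\<L> W ^^ j) h x \<in> span ((\<lambda>j. (\<L> V ^^ j) g x) ` {..<k})" by simp
qed

text \<open>The second inclusion is the first one for the reciprocal scales.\<close>

lemma flag_rescale:
 assumes N: "open N" "smooth_on N g" "smooth_on N V" "smooth_on N f" "smooth_on N r" "annihilates N V g"
  and x: "x \<in> N" and h: "\<And>y. y \<in> N ==> h y = r y *R g y" and W: "\<And>y. y \<in> N ==> W y = f y *R V y"
  and nz: "\<And>y. y \<in> N ==> f y \<noteq> 0" "\<And>y. y \<in> N ==> r y \<noteq> 0"
 shows "flag h W x k = flag g V x k"
proof
 show "flag h W x k \<subseteq> flag g V x k" by (rule flag_rescale_subset[OF N x h W])
 show "flag g V x k \<subseteq> flag h W x k"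
 proof (rule flag_rescale_subset[OF N(1) _ _ smooth_on_inverse[OF N(1,4) nz(1)] smooth_on_inverse[OF N(1,5) nz(2)] _ x])
  show "smooth_on N h"
   by (rule smooth_on_cong[OF N(1) _ smooth_on_scaleR[OF N(1,5,2)]]) (simp add: h)
  show "smooth_on N W"
   by (rule smooth_on_cong[OF N(1) _ smooth_on_scaleR[OF N(1,4,3)]]) (simp add: W)
  show "annihilates N W h" using N(6) by (simp add: annihilates_def h W tensor_app_linear)
 qed (use h W nz in auto)
qed

section \<open>Pullbacks and the invariance of the flag\<close>

lemma pullback_app:
 assumes "\<phi> differentiable (at x)"
 shows "tensor_app (pullback \<phi> h x) v w = tensor_app (h (\<phi> x)) (dd \<phi> x v) (dd \<phi> x w)"
proof -
 have "v \<bullet> (transpose A *v u) = (A *v v) \<bullet> u" for A :: "real ^ 4 ^ 4" and u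
  by (metis dot_lmul_matrix inner_commute transpose_matrix_vector)
 thus ?thesis
  by (simp add: tensor_app_def pullback_def dd_matrix[OF assms] matrix_vector_mul_assoc[symmetric])
qed

lemma smooth_on_pullback:
 assumes "open U" "open W" "\<phi> ` U \<subseteq> W" "smooth_on U \<phi>" "smooth_on W h"
 shows "smooth_on U (pullback \<phi> h)"
proof (rule smooth_on_vec[OF assms(1)], rule smooth_on_vec[OF assms(1)])
 fix i j :: 4
 show "smooth_on U (\<lambda>x. pullback \<phi> h x $ i $ j)"
 proof (rule smooth_on_cong[OF assms(1)])
  show "smooth_on U (\<lambda>x. tensor_app (h (\<phi> x)) (dd \<phi> x (axis i 1)) (dd \<phi> x (axis j 1)))"
   by (intro smooth_on_tensor_app smooth_on_frechet assms smooth_on_compose[OF assms(1-5)])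
 qed (simp add: pullback_app[symmetric] smooth_onD[OF assms(4)] tensor_app_axis)
qed

text \<open>The term with second derivatives of \<open>f\<close> is turned by their symmetry into a
  derivative along \<open>V\<close>. In this form it enters both the naturality of Lie derivatives
  and that of brackets.\<close>

lemma dd_field:
 fixes f :: "'a::euclidean_space \<Rightarrow> 'b::euclidean_space"
 assumes "open U" "x \<in> U" "smooth_on U f" "V differentiable (at x)"
 shows "dd (\<lambda>z. dd f z (V z)) x v = dd f x (dd V x v) + dd (\<lambda>z. dd f z v) x (V x)"
proof -
 have df: "f differentiable (at z)" if "z \<in> U" for z using smooth_onD[OF assms(3) that] .
 have d2: "(\<lambda>z. dd f z b) differentiable (at x)" for b
  by (rule smooth_onD[OF smooth_on_frechet[OF assms(3)] assms(2)])
 have dV: "(\<lambda>z. V z \<bullet> b) differentiable (at x)" "dd (\<lambda>z. V z \<bullet> b) x v = dd V x v \<bullet> b" for b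
  using bounded_linear.has_derivative[OF bounded_linear_inner_left assms(4)[unfolded frechet_derivative_works]]
   frechet_linear[OF bounded_linear_inner_left assms(4)] unfolding differentiable_def by blast+
 have dp: "(\<lambda>z. (V z \<bullet> b) *R dd f z b) differentiable (at x)" for b
  using has_derivative_scaleR[OF dV(1)[unfolded frechet_derivative_works] d2[unfolded frechet_derivative_works]]
  unfolding differentiable_def by blast
 have "dd (\<lambda>z. dd f z (V z)) x = dd (\<lambda>z. \<Sum>b\<in>Basis. (V z \<bullet> b) *R dd f z b) x"
  by (rule frechet_cong[OF assms(1,2)]) (rule frechet_expand[OF df])
 hence "dd (\<lambda>z. dd f z (V z)) x v = (\<Sum>b\<in>Basis. (dd V x v \<bullet> b) *R dd f x b + (V x \<bullet> b) *R dd (\<lambda>z. dd f z b) x v)"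
  by (simp add: dd_sum[OF dp] dd_scaleR[OF dV(1) d2] dV(2))
 also have "\<dots> = dd f x (dd V x v) + (\<Sum>b\<in>Basis. (V x \<bullet> b) *R dd (\<lambda>z. dd f z v) x b)"
  unfolding sum.distrib frechet_expand[OF df[OF assms(2)], of "dd V x v", symmetric]
  using frechet_symmetric[OF assms(1-3), of _ v] by simp
 also have "(\<Sum>b\<in>Basis. (V x \<bullet> b) *R dd (\<lambda>z. dd f z v) x b) = dd (\<lambda>z. dd f z v) x (V x)"
  by (rule frechet_expand[OF d2, symmetric])
 finally show ?thesis .
qed

lemma lie_pullback:
 assumes U: "open U" "x \<in> U" and W: "open W" "\<phi> ` U \<subseteq> W" and \<phi>: "smooth_on U \<phi>" and h: "smooth_on W h"
  and V: "smooth_on U V" and X: "smooth_on W X" and VX: "\<And>z. z \<in> U ==> dd \<phi> z (V z) = X (\<phi> z)"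
 shows "\<L> V (pullback \<phi> h) x = pullback \<phi> (\<L> X h) x"
proof (rule tensor_eqI)
 fix v w
 have \<phi>x: "\<phi> x \<in> W" using W U by auto
 note d\<phi> = smooth_onD[OF \<phi> U(2)] and dh = smooth_onD[OF h \<phi>x]
  and dV = smooth_onD[OF V U(2)] and dX = smooth_onD[OF X \<phi>x]
  and dP = smooth_onD[OF smooth_on_pullback[OF U(1) W \<phi> h] U(2)]
 have d2: "(\<lambda>z. dd \<phi> z b) differentiable (at x)" for b
  by (rule smooth_onD[OF smooth_on_frechet[OF \<phi>] U(2)])
 have dh\<phi>: "(\<lambda>z. h (\<phi> z)) differentiable (at x)"
  by (rule smooth_onD[OF smooth_on_compose[OF U(1) W \<phi> h] U(2)])
 \<comment> \<open>Differentiating the relation between \<open>V\<close> and \<open>X\<close>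
   expresses the second derivative of \<open>\<phi>\<close> along \<open>V\<close>, the only term
   without a counterpart on the other side.\<close>
 have key: "dd (\<lambda>z. dd \<phi> z v) x (V x) = dd X (\<phi> x) (dd \<phi> x v) - dd \<phi> x (dd V x v)" for v
 proof -
  have "dd (\<lambda>z. dd \<phi> z (V z)) x = dd (\<lambda>z. X (\<phi> z)) x"
   by (rule frechet_cong[OF U]) (rule VX)
  thus ?thesis using dd_field[OF U \<phi> dV, of v] dd_compose[OF d\<phi> dX, of v] by (simp add: algebra_simps)
 qed
 have "dd (\<lambda>z. tensor_app (pullback \<phi> h z) v w) x
  = dd (\<lambda>z. tensor_app (h (\<phi> z)) (dd \<phi> z v) (dd \<phi> z w)) x"
  by (rule frechet_cong[OF U]) (rule pullback_app[OF smooth_onD[OF \<phi>]])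
 hence "tensor_app (dd (pullback \<phi> h) x (V x)) v w
  = dd (\<lambda>z. tensor_app (h (\<phi> z)) (dd \<phi> z v) (dd \<phi> z w)) x (V x)"
  using dd_tensor_app[OF dP, of "\<lambda>z. v" "\<lambda>z. w" "V x"] by (simp add: tensor_app_linear)
 also have "\<dots> = tensor_app (dd h (\<phi> x) (X (\<phi> x))) (dd \<phi> x v) (dd \<phi> x w)
  + tensor_app (h (\<phi> x)) (dd X (\<phi> x) (dd \<phi> x v) - dd \<phi> x (dd V x v)) (dd \<phi> x w)
  + tensor_app (h (\<phi> x)) (dd \<phi> x v) (dd X (\<phi> x) (dd \<phi> x w) - dd \<phi> x (dd V x w))"
  by (simp add: dd_tensor_app[OF dh\<phi> d2 d2] dd_compose[OF d\<phi> dh] VX[OF U(2)] key)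
 finally show "tensor_app (\<L> V (pullback \<phi> h) x) v w = tensor_app (pullback \<phi> (\<L> X h) x) v w"
  by (simp add: lie_app[OF dP dV] pullback_app[OF d\<phi>] lie_app[OF dh dX] tensor_app_linear)
qed

lemma lie_iter_pullback:
 assumes U: "open U" and W: "open W" "\<phi> ` U \<subseteq> W" and \<phi>: "smooth_on U \<phi>" and h: "smooth_on W h"
  and V: "smooth_on U V" and X: "smooth_on W X" and VX: "\<And>z. z \<in> U ==> dd \<phi> z (V z) = X (\<phi> z)"
  and x: "x \<in> U"
 shows "(\<L> V ^^ k) (pullback \<phi> h) x = pullback \<phi> ((\<L> X ^^ k) h) x"
 using x
proof (induction k arbitrary: x)
 case (Suc k)
 have "(\<L> V ^^ Suc k) (pullback \<phi> h) x = \<L> V (pullback \<phi> ((\<L> X ^^ k) h)) x"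
  unfolding funpow.simps o_apply by (rule lie_cong[OF U Suc.prems Suc.IH refl])
 also have "\<dots> = pullback \<phi> (\<L> X ((\<L> X ^^ k) h)) x"
  by (rule lie_pullback[OF U Suc.prems W \<phi> smooth_on_lie_iter[OF W(1) X h] V X VX])
 finally show ?case by simp
qed simp

definition pull_tensor :: "real ^ 4 ^ 4 \<Rightarrow> tensor \<Rightarrow> tensor" where
 "pull_tensor A T = transpose A ** T ** A"

lemma pull_tensor_app: "tensor_app (pull_tensor A T) v w = tensor_app T (A *v v) (A *v w)"
proof -
 have "v \<bullet> (transpose A *v u) = (A *v v) \<bullet> u" for u
  by (metis dot_lmul_matrix inner_commute transpose_matrix_vector)
 thus ?thesis
  by (simp add: tensor_app_def pull_tensor_def matrix_vector_mul_assoc[symmetric])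
qed

lemma linear_pull_tensor: "linear (pull_tensor A)"
 by (rule linearI) (rule tensor_eqI, simp add: pull_tensor_app tensor_app_linear)+

lemma flag_transport:
 assumes U: "open U" and W: "open W" "\<phi> ` U \<subseteq> W" and \<phi>: "smooth_on U \<phi>" and h: "smooth_on W h" and X: "smooth_on W X"
  and g: "smooth_on U g" and V: "smooth_on U V" and f: "smooth_on U f" and r: "smooth_on U r"
  and nz: "\<And>z. z \<in> U ==> f z \<noteq> 0" "\<And>z. z \<in> U ==> r z \<noteq> 0"
  and pull: "\<And>z. z \<in> U ==> pullback \<phi> h z = r z *R g z" and VX: "\<And>z. z \<in> U ==> dd \<phi> z (V z) = f z *R X (\<phi> z)"
  and ann: "annihilates U V g" and x: "x \<in> U"
 shows "flag g V x k = pull_tensor (jacobian \<phi> (at x)) ` flag h X (\<phi> x) k"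
proof -
 \<comment> \<open>\<open>V'\<close> is related to \<open>X\<close> by \<open>\<phi>\<close> without
   a factor; \<open>flag_rescale\<close> accounts for \<open>f\<close> and \<open>r\<close>.\<close>
 define V' where "V' z = inverse (f z) *R V z" for z
 have i: "smooth_on U (\<lambda>z. inverse (f z))" by (rule smooth_on_inverse[OF U f nz(1)])
 have V': "smooth_on U V'" unfolding V'_def by (rule smooth_on_scaleR[OF U i V])
 have "flag (pullback \<phi> h) V' x k = flag g V x k"
  by (rule flag_rescale[OF U g V i r ann x pull V'_def]) (use nz in auto)
 moreover have "dd \<phi> z (V' z) = X (\<phi> z)" if "z \<in> U" for z
  using linear_scale[OF dd_lin[OF \<phi> that]] VX[OF that] nz(1)[OF that] by (simp add: V'_def)
 hence "(\<L> V' ^^ j) (pullback \<phi> h) x = pull_tensor (jacobian \<phi> (at x)) ((\<L> X ^^ j) h (\<phi> x))" for j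
  using lie_iter_pullback[OF U W \<phi> h V' X _ x, of j] by (simp add: pull_tensor_def pullback_def)
 hence "flag (pullback \<phi> h) V' x k = span (pull_tensor (jacobian \<phi> (at x)) ` (\<lambda>j. (\<L> X ^^ j) h (\<phi> x)) ` {..<k})"
  by (simp add: flag_def image_image)
 ultimately show ?thesis unfolding flag_def linear_span_image[OF linear_pull_tensor] by simp
qed

text \<open>Independence of the first \<open>n\<close> tensors, phrased by the growth of the flag
  alone; in this form its invariance under rescaling and diffeomorphisms is immediate.\<close>

definition flag_indep :: "(point \<Rightarrow> tensor) \<Rightarrow> (point \<Rightarrow> point) \<Rightarrow> point \<Rightarrow> nat \<Rightarrow> bool" where
 "flag_indep g V x n \<longleftrightarrow> (\<forall>k<n. flag g V x k \<noteq> flag g V x (Suc k))"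

text \<open>Five is the number of factors of \<open>Gamma\<close>. When \<open>Gamma\<close> has
  rank one, these vectors form, modulo \<open>V\<close>, the line that is its image.\<close>

definition flag_null :: "(point \<Rightarrow> tensor) \<Rightarrow> (point \<Rightarrow> point) \<Rightarrow> point \<Rightarrow> point \<Rightarrow> bool" where
 "flag_null g V x v \<longleftrightarrow> (\<forall>T\<in>flag g V x 5. tensor_app T v v = 0)"

lemma flag_null_iff: "flag_null g V x v \<longleftrightarrow> (\<forall>k<5. tensor_app ((\<L> V ^^ k) g x) v v = 0)"
proof
 show "\<forall>k<5. tensor_app ((\<L> V ^^ k) g x) v v = 0" if "flag_null g V x v"
  using that unfolding flag_null_def flag_def by (auto intro: span_base)
 assume *: "\<forall>k<5. tensor_app ((\<L> V ^^ k) g x) v v = 0"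
 have "subspace {T. tensor_app T v v = 0}" by (simp add: subspace_def tensor_app_linear)
 hence "span ((\<lambda>j. (\<L> V ^^ j) g x) ` {..<5}) \<subseteq> {T. tensor_app T v v = 0}"
  by (intro span_minimal) (use * in auto)
 thus "flag_null g V x v" unfolding flag_null_def flag_def by auto
qed

lemma flag_Suc_eq: "flag g V x k = flag g V x (Suc k) \<longleftrightarrow> (\<L> V ^^ k) g x \<in> flag g V x k"
proof
 let ?T = "\<lambda>j. (\<L> V ^^ j) g x"
 show "?T k \<in> flag g V x k" if "flag g V x k = flag g V x (Suc k)"
  unfolding that unfolding flag_def by (rule span_base) simp
 show "flag g V x k = flag g V x (Suc k)" if "?T k \<in> flag g V x k"
  using that unfolding flag_def lessThan_Suc image_insert by (simp add: span_redundant)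
qed

lemma flag_transport_consequences:
 assumes \<phi>: "diffeo_onto_image U \<phi>" and x: "x \<in> U"
  and fl: "\<And>k. flag g V x k = pull_tensor (jacobian \<phi> (at x)) ` flag h X (\<phi> x) k"
 shows "flag_indep g V x n \<longleftrightarrow> flag_indep h X (\<phi> x) n"
  and "flag_null g V x v \<longleftrightarrow> flag_null h X (\<phi> x) (dd \<phi> x v)"
  and "flag g V x 1 = flag g V x 2 \<longleftrightarrow> flag h X (\<phi> x) 1 = flag h X (\<phi> x) 2"
proof -
 have d: "dd \<phi> x v = jacobian \<phi> (at x) *v v" for v
  by (rule dd_matrix[OF smooth_onD[OF diffeoD(4)[OF \<phi>] x]])
 have "inj (pull_tensor (jacobian \<phi> (at x)))"
 proof (rule injI, rule tensor_eqI)
  fix T S v w assume e: "pull_tensor (jacobian \<phi> (at x)) T = pull_tensor (jacobian \<phi> (at x)) S"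
  obtain v' w' where "dd \<phi> x v' = v" "dd \<phi> x w' = w" using diffeo_surj[OF \<phi> x] by metis
  thus "tensor_app T v w = tensor_app S v w"
   using arg_cong[OF e, of "\<lambda>T. tensor_app T v' w'"] by (simp add: pull_tensor_app d)
 qed
 thus "flag_indep g V x n \<longleftrightarrow> flag_indep h X (\<phi> x) n" "flag g V x 1 = flag g V x 2 \<longleftrightarrow> flag h X (\<phi> x) 1 = flag h X (\<phi> x) 2"
  unfolding flag_indep_def fl by (simp_all add: inj_image_eq_iff)
 show "flag_null g V x v \<longleftrightarrow> flag_null h X (\<phi> x) (dd \<phi> x v)"
  unfolding flag_null_def fl by (simp add: pull_tensor_app d)
qed

lemma exhaust_6:
 fixes x :: 6
 shows "x = 1 \<or> x = 2 \<or> x = 3 \<or> x = 4 \<or> x = 5 \<or> x = 6"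
proof (induct x)
 case (of_int z)
 hence "z = 0 \<or> z = 1 \<or> z = 2 \<or> z = 3 \<or> z = 4 \<or> z = 5" by (simp, presburger)
 thus ?case by auto
qed

section \<open>Linear algebra of \<open>\<Gamma>\<close>\<close>

lemma forall_6: "(\<forall>i::6. P i) \<longleftrightarrow> P 1 \<and> P 2 \<and> P 3 \<and> P 4 \<and> P 5 \<and> P 6"
 by (metis exhaust_6)

lemma UNIV_6: "(UNIV :: 6 set) = {1, 2, 3, 4, 5, 6}"
 using exhaust_6 by auto

lemma sum_6: "sum f (UNIV :: 6 set) = f 1 + f 2 + f 3 + f 4 + f 5 + f 6"
 unfolding UNIV_6 by (simp add: ac_simps)

lemma vector_6 [simp]:
 "(vector [a, b, c, d, e, f] :: 'a::zero ^ 6) $ 1 = a"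
 "(vector [a, b, c, d, e, f] :: 'a ^ 6) $ 2 = b"
 "(vector [a, b, c, d, e, f] :: 'a ^ 6) $ 3 = c"
 "(vector [a, b, c, d, e, f] :: 'a ^ 6) $ 4 = d"
 "(vector [a, b, c, d, e, f] :: 'a ^ 6) $ 5 = e"
 "(vector [a, b, c, d, e, f] :: 'a ^ 6) $ 6 = f"
 unfolding vector_def by simp_all

lemma vector_4 [simp]:
 "(vector [a, b, c, d] :: 'a::zero ^ 4) $ 1 = a"
 "(vector [a, b, c, d] :: 'a ^ 4) $ 2 = b"
 "(vector [a, b, c, d] :: 'a ^ 4) $ 3 = c"
 "(vector [a, b, c, d] :: 'a ^ 4) $ 4 = d"
 unfolding vector_def by simp_all

text \<open>Ordered and indexed, so that repetitions count as dependence and the condition can be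
  compared step by step with the growth of a flag.\<close>

definition indep :: "(nat \<Rightarrow> 'a::real_vector) \<Rightarrow> nat \<Rightarrow> bool" where
 "indep T n \<longleftrightarrow> (\<forall>k<n. T k \<notin> span (T ` {..<k}))"

lemma span_image_lessThan: "span (T ` {..<n :: nat}) = {\<Sum>k<n. c k *R T k |c. True}"
proof
 have "subspace {\<Sum>k<n. c k *R T k |c. True}"
  unfolding subspace_def
 proof (intro conjI ballI allI)
  show "0 \<in> {\<Sum>k<n. c k *R T k |c. True}" by (intro CollectI exI[of _ "\<lambda>k. 0"]) simp
 next
  fix x y assume "x \<in> {\<Sum>k<n. c k *R T k |c. True}" "y \<in> {\<Sum>k<n. c k *R T k |c. True}"
  then obtain c d where "x = (\<Sum>k<n. c k *R T k)" "y = (\<Sum>k<n. d k *R T k)" by blast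
  thus "x + y \<in> {\<Sum>k<n. c k *R T k |c. True}"
   by (intro CollectI exI[of _ "\<lambda>k. c k + d k"]) (simp add: scaleR_add_left sum.distrib)
 next
  fix r x assume "x \<in> {\<Sum>k<n. c k *R T k |c. True}"
  then obtain c where "x = (\<Sum>k<n. c k *R T k)" by blast
  thus "r *R x \<in> {\<Sum>k<n. c k *R T k |c. True}"
   by (intro CollectI exI[of _ "\<lambda>k. r * c k"]) (simp add: scaleR_sum_right)
 qed
 moreover have "T k \<in> {\<Sum>k<n. c k *R T k |c. True}" if "k < n" for k
 proof (intro CollectI exI[of _ "\<lambda>j. if j = k then 1 else 0"] conjI TrueI)
  have "(\<Sum>j<n. (if j = k then 1 else 0) *R T j) = (\<Sum>j<n. if j = k then T j else 0)"
   by (rule sum.cong) auto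
  thus "T k = (\<Sum>j<n. (if j = k then 1 else 0) *R T j)" using that by simp
 qed
 ultimately show "span (T ` {..<n}) \<subseteq> {\<Sum>k<n. c k *R T k |c. True}" by (intro span_minimal) auto
 show "{\<Sum>k<n. c k *R T k |c. True} \<subseteq> span (T ` {..<n})"
 proof safe
  fix c :: "nat \<Rightarrow> real"
  show "(\<Sum>k<n. c k *R T k) \<in> span (T ` {..<n})"
   by (rule span_sum, rule span_scale, rule span_base) simp
 qed
qed

lemma indep_iff: "indep T n \<longleftrightarrow> (\<forall>c. (\<Sum>k<n. c k *R T k) = 0 \<longrightarrow> (\<forall>k<n. c k = 0))"
proof (induction n)
 case (Suc n)
 have *: "indep T (Suc n) \<longleftrightarrow> indep T n \<and> T n \<notin> span (T ` {..<n})" by (auto simp: indep_def less_Suc_eq)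
 show ?case
 proof
  assume "indep T (Suc n)"
  hence i: "\<And>c. (\<Sum>k<n. c k *R T k) = 0 ==> \<forall>k<n. c k = 0" and n: "T n \<notin> span (T ` {..<n})"
   using * Suc by auto
  show "\<forall>c. (\<Sum>k<Suc n. c k *R T k) = 0 \<longrightarrow> (\<forall>k<Suc n. c k = 0)"
  proof (intro allI impI)
   fix c k assume c: "(\<Sum>k<Suc n. c k *R T k) = 0" and k: "k < Suc n"
   have "c n = 0"
   proof (rule ccontr)
    assume "c n \<noteq> 0"
    moreover have "c n *R T n = - (\<Sum>k<n. c k *R T k)" using c by (simp add: eq_neg_iff_add_eq_0 add.commute)
    hence "inverse (c n) *R (c n *R T n) = (\<Sum>k<n. (- (inverse (c n) * c k)) *R T k)"
     by (simp add: scaleR_sum_right sum_negf)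
    ultimately have "T n = (\<Sum>k<n. (- (inverse (c n) * c k)) *R T k)" by simp
    hence "T n \<in> {\<Sum>k<n. c k *R T k |c. True}"
     by (intro CollectI exI[of _ "\<lambda>k. - (inverse (c n) * c k)"]) simp
    thus False using n unfolding span_image_lessThan by blast
   qed
   thus "c k = 0" using i[of c] c k by (auto simp: less_Suc_eq)
  qed
 next
  assume a: "\<forall>c. (\<Sum>k<Suc n. c k *R T k) = 0 \<longrightarrow> (\<forall>k<Suc n. c k = 0)"
  have "indep T n" unfolding Suc
  proof (intro allI impI)
   fix c k assume c: "(\<Sum>k<n. c k *R T k) = 0" "k < n"
   hence "(\<Sum>k<n. (if k = n then 0 else c k) *R T k) = 0" by simp
   thus "c k = 0" using a[rule_format, of "\<lambda>k. if k = n then 0 else c k" k] c by simp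
  qed
  moreover have "T n \<notin> span (T ` {..<n})"
  proof
   assume "T n \<in> span (T ` {..<n})"
   then obtain c where c: "T n = (\<Sum>k<n. c k *R T k)" unfolding span_image_lessThan by blast
   have "(\<Sum>k<n. (if k = n then -1 else c k) *R T k) = T n" unfolding c by (rule sum.cong) auto
   thus False using a[rule_format, of "\<lambda>k. if k = n then -1 else c k" n] by simp
  qed
  ultimately show "indep T (Suc n)" using * by blast
 qed
qed (simp add: indep_def)

lemma flag_indep_iff: "flag_indep g V x n \<longleftrightarrow> indep (\<lambda>k. (\<L> V ^^ k) g x) n"
 unfolding flag_indep_def flag_Suc_eq unfolding flag_def indep_def ..

lemma indep_linear_image:
 assumes "linear f" "\<And>v. v \<in> span (T ` {..<n}) ==> f v = 0 ==> v = 0"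
 shows "indep (\<lambda>k. f (T k)) n \<longleftrightarrow> indep T n"
proof -
 have "(\<Sum>k<n. c k *R f (T k)) = f (\<Sum>k<n. c k *R T k)" for c
  by (simp add: linear_sum[OF assms(1)] linear_scale[OF assms(1)])
 moreover have "f (\<Sum>k<n. c k *R T k) = 0 \<longleftrightarrow> (\<Sum>k<n. c k *R T k) = 0" for c
  using assms(2)[of "\<Sum>k<n. c k *R T k"] linear_0[OF assms(1)] unfolding span_image_lessThan by auto
 ultimately show ?thesis unfolding indep_iff by simp
qed

lemma sum_less_6: "(\<Sum>k<6. f k) = f 0 + f 1 + f 2 + f 3 + f 4 + f (5::nat)"
 by (simp add: eval_nat_numeral)

lemma all_less_6: "(\<forall>k<6. P k) \<longleftrightarrow> P 0 \<and> P 1 \<and> P 2 \<and> P 3 \<and> P 4 \<and> P (5::nat)"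
 by (auto simp: eval_nat_numeral All_less_Suc)

lemma det6_indep:
 fixes R :: "nat \<Rightarrow> real ^ 6"
 shows "det (vector [R 0, R 1, R 2, R 3, R 4, R 5] :: real ^ 6 ^ 6) \<noteq> 0 \<longleftrightarrow> indep R 6"
proof -
 let ?A = "vector [R 0, R 1, R 2, R 3, R 4, R 5] :: real ^ 6 ^ 6"
 have "det ?A \<noteq> 0 \<longleftrightarrow> (\<forall>c. (\<Sum>i\<in>UNIV. c i *s row i ?A) = 0 \<longrightarrow> (\<forall>i. c i = 0))"
  unfolding invertible_det_nz[symmetric] invertible_right_inverse matrix_right_invertible_independent_rows ..
 also have "\<dots> \<longleftrightarrow> (\<forall>c. c 1 *R R 0 + c 2 *R R 1 + c 3 *R R 2 + c 4 *R R 3 + c 5 *R R 4 + c 6 *R R 5 = 0 \<longrightarrow>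
   c 1 = 0 \<and> c 2 = 0 \<and> c 3 = 0 \<and> c 4 = 0 \<and> c 5 = 0 \<and> c (6::6) = 0)"
  by (simp add: sum_6 forall_6 row_def scalar_mult_eq_scaleR vec_lambda_eta)
 also have "\<dots> \<longleftrightarrow> indep R 6"
  unfolding indep_iff sum_less_6 all_less_6
 proof
  assume *: "\<forall>c. c 1 *R R 0 + c 2 *R R 1 + c 3 *R R 2 + c 4 *R R 3 + c 5 *R R 4 + c 6 *R R 5 = 0 \<longrightarrow>
   c 1 = 0 \<and> c 2 = 0 \<and> c 3 = 0 \<and> c 4 = 0 \<and> c 5 = 0 \<and> c (6::6) = 0"
  show "\<forall>c. c 0 *R R 0 + c 1 *R R 1 + c 2 *R R 2 + c 3 *R R 3 + c 4 *R R 4 + c 5 *R R 5 = 0 \<longrightarrow>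
   c 0 = 0 \<and> c 1 = 0 \<and> c 2 = 0 \<and> c 3 = 0 \<and> c 4 = 0 \<and> c (5::nat) = 0"
  proof
   fix c :: "nat \<Rightarrow> real"
   let ?d = "vector [c 0, c 1, c 2, c 3, c 4, c 5] :: real ^ 6"
   show "c 0 *R R 0 + c 1 *R R 1 + c 2 *R R 2 + c 3 *R R 3 + c 4 *R R 4 + c 5 *R R 5 = 0 \<longrightarrow>
    c 0 = 0 \<and> c 1 = 0 \<and> c 2 = 0 \<and> c 3 = 0 \<and> c 4 = 0 \<and> c 5 = 0"
    using *[rule_format, of "\<lambda>i. ?d $ i"] by simp
  qed
 next
  assume *: "\<forall>c. c 0 *R R 0 + c 1 *R R 1 + c 2 *R R 2 + c 3 *R R 3 + c 4 *R R 4 + c 5 *R R 5 = 0 \<longrightarrow>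
   c 0 = 0 \<and> c 1 = 0 \<and> c 2 = 0 \<and> c 3 = 0 \<and> c 4 = 0 \<and> c (5::nat) = 0"
  show "\<forall>c. c 1 *R R 0 + c 2 *R R 1 + c 3 *R R 2 + c 4 *R R 3 + c 5 *R R 4 + c 6 *R R 5 = 0 \<longrightarrow>
   c 1 = 0 \<and> c 2 = 0 \<and> c 3 = 0 \<and> c 4 = 0 \<and> c 5 = 0 \<and> c (6::6) = 0"
  proof
   fix c :: "6 \<Rightarrow> real"
   let ?d = "\<lambda>k::nat. if k = 0 then c 1 else if k = 1 then c 2 else if k = 2 then c 3 else if k = 3 then c 4 else if k = 4 then c 5 else c 6"
   show "c 1 *R R 0 + c 2 *R R 1 + c 3 *R R 2 + c 4 *R R 3 + c 5 *R R 4 + c 6 *R R 5 = 0 \<longrightarrow>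
    c 1 = 0 \<and> c 2 = 0 \<and> c 3 = 0 \<and> c 4 = 0 \<and> c 5 = 0 \<and> c (6::6) = 0"
    using *[rule_format, of ?d] by simp
  qed
 qed
 finally show ?thesis .
qed

definition symm :: "real ^ 3 ^ 3 \<Rightarrow> bool" where
 "symm A \<longleftrightarrow> (\<forall>i j. A $ i $ j = A $ j $ i)"

lemma sym_coords_linear: "linear sym_coords"
 by (rule linearI) (simp_all add: sym_coords_def vec_eq_iff forall_6)

lemma sym_coords_eq_0:
 assumes "symm A" "sym_coords A = 0"
 shows "A = 0"
proof -
 have "A $ 2 $ 1 = A $ 1 $ 2" "A $ 3 $ 1 = A $ 1 $ 3" "A $ 3 $ 2 = A $ 2 $ 3"
  using assms(1) by (auto simp: symm_def)
 moreover have "sym_coords A $ i = 0" for i using assms(2) by simp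
 from this[of 1] this[of 2] this[of 3] this[of 4] this[of 5] this[of 6]
 have "A $ 1 $ 1 = 0" "A $ 1 $ 2 = 0" "A $ 1 $ 3 = 0" "A $ 2 $ 2 = 0" "A $ 2 $ 3 = 0" "A $ 3 $ 3 = 0"
  by (simp_all add: sym_coords_def)
 ultimately show ?thesis by (simp add: vec_eq_iff forall_3)
qed

definition unsym_coords :: "real ^ 6 \<Rightarrow> real ^ 3 ^ 3" where
 "unsym_coords v = vector [vector [v $ 1, v $ 2, v $ 3], vector [v $ 2, v $ 4, v $ 5], vector [v $ 3, v $ 5, v $ 6]]"

lemma unsym_coords: "symm (unsym_coords v)" "sym_coords (unsym_coords v) = v"
 by (simp_all add: unsym_coords_def symm_def sym_coords_def vec_eq_iff forall_6 forall_3)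

lemma symm_subspace: "subspace {A. symm A}"
 by (auto simp: subspace_def symm_def)

lemma span_symm: "(\<And>k. k < n ==> symm (M k)) ==> X \<in> span (M ` {..<n}) ==> symm X"
 using span_minimal[OF _ symm_subspace, of "M ` {..<n}"] by auto

lemma indep_sym_coords:
 assumes "\<And>k. k < n ==> symm (M k)"
 shows "indep (\<lambda>k. sym_coords (M k)) n \<longleftrightarrow> indep M n"
 by (rule indep_linear_image[OF sym_coords_linear]) (use span_symm[of n M] sym_coords_eq_0 assms in blast)

lemma wedge6_indep:
 assumes "\<And>k. k < 6 ==> symm (M k)"
 shows "wedge6 (M 0) (M 1) (M 2) (M 3) (M 4) (M 5) \<noteq> 0 \<longleftrightarrow> indep M 6"
proof -
 have "indep (\<lambda>k. sym_coords (M k)) 6 \<longleftrightarrow> indep M 6" by (rule indep_sym_coords[OF assms])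
 with det6_indep[of "\<lambda>k. sym_coords (M k)"] show ?thesis unfolding wedge6_def by simp
qed

text \<open>Brings the determinant into the shape in which linearity in a single row is available;
  only the last factor is varied.\<close>

lemma wedge6_rows:
 "wedge6 A B C D E F = det (\<chi> i. if i = 6 then sym_coords F else
   (vector [sym_coords A, sym_coords B, sym_coords C, sym_coords D, sym_coords E, 0] :: real ^ 6 ^ 6) $ i)"
proof -
 have "\<forall>i. (vector [sym_coords A, sym_coords B, sym_coords C, sym_coords D, sym_coords E, sym_coords F] :: real ^ 6 ^ 6) $ i
  = (\<chi> i. if i = 6 then sym_coords F else
   (vector [sym_coords A, sym_coords B, sym_coords C, sym_coords D, sym_coords E, 0] :: real ^ 6 ^ 6) $ i) $ i"
  unfolding forall_6 by simp
 thus ?thesis unfolding wedge6_def by (intro arg_cong[where f = det] vec_eq_iff[THEN iffD2])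
qed

lemma linear_wedge6: "linear (wedge6 A B C D E)"
 unfolding wedge6_rows
proof (rule linearI)
 fix x y r
 show "det (\<chi> i. if i = 6 then sym_coords (x + y) else (vector [sym_coords A, sym_coords B, sym_coords C, sym_coords D, sym_coords E, 0] :: real ^ 6 ^ 6) $ i)
  = det (\<chi> i. if i = 6 then sym_coords x else (vector [sym_coords A, sym_coords B, sym_coords C, sym_coords D, sym_coords E, 0] :: real ^ 6 ^ 6) $ i)
  + det (\<chi> i. if i = 6 then sym_coords y else (vector [sym_coords A, sym_coords B, sym_coords C, sym_coords D, sym_coords E, 0] :: real ^ 6 ^ 6) $ i)"
  unfolding linear_add[OF sym_coords_linear] by (rule det_row_add)
 show "det (\<chi> i. if i = 6 then sym_coords (r *R x) else (vector [sym_coords A, sym_coords B, sym_coords C, sym_coords D, sym_coords E, 0] :: real ^ 6 ^ 6) $ i)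
  = r *R det (\<chi> i. if i = 6 then sym_coords x else (vector [sym_coords A, sym_coords B, sym_coords C, sym_coords D, sym_coords E, 0] :: real ^ 6 ^ 6) $ i)"
  unfolding linear_scale[OF sym_coords_linear] scalar_mult_eq_scaleR[symmetric] real_scaleR_def by (rule det_row_mul)
qed

section \<open>The symmetric matrix of a fivefold exterior product\<close>

definition tr_pair :: "real ^ 3 ^ 3 \<Rightarrow> real ^ 3 ^ 3 \<Rightarrow> real" where
 "tr_pair G X = (\<Sum>i\<in>UNIV. \<Sum>j\<in>UNIV. G $ i $ j * X $ i $ j)"

lemma wedge5_symm: "symm (wedge5 A B C D E)"
proof -
 have "sym_unit i j = sym_unit j i" for i j
  unfolding sym_unit_def by (simp only: add.commute)
 hence "wedge6 A B C D E (sym_unit i j) = wedge6 A B C D E (sym_unit j i)" for i j by (simp only:)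
 thus ?thesis by (simp add: symm_def wedge5_def)
qed

lemma sym_unit_symm: "symm (sym_unit i j)"
 unfolding symm_def sym_unit_def by (simp add: conj_commute add.commute)

lemma wedge6_tr_pair:
 assumes "symm X"
 shows "wedge6 A B C D E X = tr_pair (wedge5 A B C D E) X"
proof -
 have "(\<Sum>i\<in>UNIV. \<Sum>j\<in>UNIV. X $ i $ j *R sym_unit i j) = X"
 proof -
  have "X $ 2 $ 1 = X $ 1 $ 2" "X $ 3 $ 1 = X $ 1 $ 3" "X $ 3 $ 2 = X $ 2 $ 3"
   using assms by (auto simp: symm_def)
  thus ?thesis unfolding vec_eq_iff forall_3 sum_3 by (simp add: sym_unit_def)
 qed
 hence "wedge6 A B C D E X = wedge6 A B C D E (\<Sum>i\<in>UNIV. \<Sum>j\<in>UNIV. X $ i $ j *R sym_unit i j)" by simp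
 also have "\<dots> = tr_pair (wedge5 A B C D E) X"
  by (simp add: linear_sum[OF linear_wedge6] linear_scale[OF linear_wedge6] tr_pair_def wedge5_def mult.commute)
 finally show ?thesis .
qed

context
 fixes M :: "nat \<Rightarrow> real ^ 3 ^ 3" and G
 assumes M: "\<And>k. k < 5 ==> symm (M k)"
 defines "G \<equiv> wedge5 (M 0) (M 1) (M 2) (M 3) (M 4)"
begin

text \<open>Pairing with \<open>G\<close> is the product with a sixth factor, which is nonzero
  exactly when the six matrices are independent. So for independent factors the kernel of the
  pairing on symmetric matrices is their span.\<close>

lemma tr_pair_indep:
 assumes "symm X"
 shows "tr_pair G X \<noteq> 0 \<longleftrightarrow> indep M 5 \<and> X \<notin> span (M ` {..<5})"
proof -
 define M' where "M' k = (if k = 5 then X else M k)" for k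
 have "wedge6 (M' 0) (M' 1) (M' 2) (M' 3) (M' 4) (M' 5) \<noteq> 0 \<longleftrightarrow> indep M' 6"
  by (rule wedge6_indep) (use M assms in \<open>auto simp: M'_def less_Suc_eq eval_nat_numeral\<close>)
 moreover have "indep M' 6 \<longleftrightarrow> (\<forall>k<5. M' k \<notin> span (M' ` {..<k})) \<and> M' 5 \<notin> span (M' ` {..<5})"
  unfolding indep_def using less_Suc_eq[of _ 5] by auto
 moreover have "M' ` {..<k} = M ` {..<k}" if "k \<le> 5" for k
  using that by (intro image_cong) (auto simp: M'_def)
 hence "(\<forall>k<5. M' k \<notin> span (M' ` {..<k})) \<and> M' 5 \<notin> span (M' ` {..<5}) \<longleftrightarrow> indep M 5 \<and> X \<notin> span (M ` {..<5})"
  unfolding indep_def by (simp add: M'_def)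
 moreover have "wedge6 (M' 0) (M' 1) (M' 2) (M' 3) (M' 4) (M' 5) = tr_pair G X"
  using wedge6_tr_pair[OF assms] by (simp add: M'_def G_def)
 ultimately show ?thesis by simp
qed

lemma tr_pair_sym_unit: "tr_pair G (sym_unit i j) = G $ i $ j"
proof -
 have "tr_pair G (sym_unit i j) = wedge6 (M 0) (M 1) (M 2) (M 3) (M 4) (sym_unit i j)"
  unfolding G_def by (rule wedge6_tr_pair[OF sym_unit_symm, symmetric])
 thus ?thesis by (simp add: G_def wedge5_def)
qed

text \<open>Symmetric matrices have dimension six, so five of them leave some symmetric matrix
  outside their span; it pairs nontrivially with \<open>G\<close>.\<close>

lemma wedge5_indep: "G \<noteq> 0 \<longleftrightarrow> indep M 5"
proof
 assume "G \<noteq> 0"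
 then obtain i j where "G $ i $ j \<noteq> 0" by (auto simp: vec_eq_iff)
 thus "indep M 5" using tr_pair_indep[OF sym_unit_symm] tr_pair_sym_unit by metis
next
 assume i: "indep M 5"
 have "dim (sym_coords ` M ` {..<5}) \<le> card (sym_coords ` M ` {..<(5::nat)})"
  by (rule dim_le_card') simp
 also have "\<dots> \<le> 5" using card_image_le[of "{..<5::nat}" "sym_coords \<circ> M"] by (simp add: image_comp)
 finally have d5: "dim (sym_coords ` M ` {..<5}) \<le> 5" .
 have "span (sym_coords ` M ` {..<5}) \<noteq> UNIV"
 proof
  assume "span (sym_coords ` M ` {..<5}) = UNIV"
  hence "dim (sym_coords ` M ` {..<5}) = dim (UNIV :: (real ^ 6) set)" by (metis dim_span)
  thus False using d5 by simp
 qed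
 then obtain v where v: "v \<notin> span (sym_coords ` M ` {..<5})" by auto
 have "unsym_coords v \<notin> span (M ` {..<5})"
  using v unsym_coords(2)[of v] unfolding linear_span_image[OF sym_coords_linear] by (metis imageI)
 hence "tr_pair G (unsym_coords v) \<noteq> 0" using tr_pair_indep[OF unsym_coords(1)] i by blast
 thus "G \<noteq> 0" by (auto simp: tr_pair_def)
qed

end

lemma minors_adjugate:
 "adjugate A = 0 \<longleftrightarrow> (\<forall>i j k l. A $ i $ k * A $ j $ l = A $ i $ l * A $ j $ k)"
proof
 assume "adjugate A = 0"
 hence *: "det (\<chi> k l. if k = j then (if l = i then 1 else 0) else A $ k $ l) = 0" for i j
  by (simp add: adjugate_def vec_eq_iff)
 note * = *[of 1 1] *[of 1 2] *[of 1 3] *[of 2 1] *[of 2 2] *[of 2 3] *[of 3 1] *[of 3 2] *[of 3 3]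
 hence "A $ 1 $ 1 * A $ 2 $ 2 = A $ 1 $ 2 * A $ 2 $ 1" "A $ 1 $ 1 * A $ 2 $ 3 = A $ 1 $ 3 * A $ 2 $ 1"
  "A $ 1 $ 2 * A $ 2 $ 3 = A $ 1 $ 3 * A $ 2 $ 2" "A $ 1 $ 1 * A $ 3 $ 2 = A $ 1 $ 2 * A $ 3 $ 1"
  "A $ 1 $ 1 * A $ 3 $ 3 = A $ 1 $ 3 * A $ 3 $ 1" "A $ 1 $ 2 * A $ 3 $ 3 = A $ 1 $ 3 * A $ 3 $ 2"
  "A $ 2 $ 1 * A $ 3 $ 2 = A $ 2 $ 2 * A $ 3 $ 1" "A $ 2 $ 1 * A $ 3 $ 3 = A $ 2 $ 3 * A $ 3 $ 1"
  "A $ 2 $ 2 * A $ 3 $ 3 = A $ 2 $ 3 * A $ 3 $ 2"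
  by (simp_all add: det_3)
 thus "\<forall>i j k l. A $ i $ k * A $ j $ l = A $ i $ l * A $ j $ k"
  unfolding forall_3 by (simp add: mult.commute)
next
 assume *: "\<forall>i j k l. A $ i $ k * A $ j $ l = A $ i $ l * A $ j $ k"
 have "adjugate A $ i $ j = 0" for i j
  using exhaust_3[of i] exhaust_3[of j]
  by (elim disjE) (simp_all add: adjugate_def det_3 *[rule_format, of 1 1 2 2] *[rule_format, of 1 1 2 3]
   *[rule_format, of 1 2 2 3] *[rule_format, of 1 1 3 2] *[rule_format, of 1 1 3 3] *[rule_format, of 1 2 3 3]
   *[rule_format, of 2 1 3 2] *[rule_format, of 2 1 3 3] *[rule_format, of 2 2 3 3])
 thus "adjugate A = 0" by (simp add: vec_eq_iff)
qed

lemma rank_one_iff: "rank (A :: real ^ 3 ^ 3) = 1 \<longleftrightarrow> A \<noteq> 0 \<and> adjugate A = 0"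
proof
 assume r: "rank A = 1"
 have "A \<noteq> 0" using r by auto
 moreover obtain B where B: "rows A \<subseteq> span B" "card B = 1"
  using basis_exists[of "rows A"] r by (metis row_rank_def)
 then obtain u where "rows A \<subseteq> span {u}" by (metis card_1_singletonE)
 hence "\<exists>c. row i A = c *R u" for i
  unfolding span_singleton rows_def by auto
 then obtain c where c: "\<And>i. row i A = c i *R u" by metis
 have "A $ i $ j = c i * u $ j" for i j
  using arg_cong[OF c[of i], of "\<lambda>v. v $ j"] by (simp add: row_def)
 hence "adjugate A = 0" unfolding minors_adjugate by simp
 ultimately show "A \<noteq> 0 \<and> adjugate A = 0" ..
next
 assume A: "A \<noteq> 0 \<and> adjugate A = 0"
 then obtain a b where ab: "A $ a $ b \<noteq> 0" by (auto simp: vec_eq_iff)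
 have "row i A = (A $ i $ b / A $ a $ b) *R row a A" for i
 proof -
  have "A $ i $ j * A $ a $ b = A $ i $ b * A $ a $ j" for j
   using A unfolding minors_adjugate by blast
  thus ?thesis using ab by (simp add: vec_eq_iff row_def field_simps)
 qed
 hence "rows A \<subseteq> span {row a A}"
  unfolding rows_def span_singleton by blast
 hence "dim (rows A) \<le> 1" using dim_le_card[of "rows A" "{row a A}"] by simp
 moreover have "rank A \<noteq> 0" using A unfolding rank_eq_0 by blast
 ultimately show "rank A = 1" unfolding row_rank_def by linarith
qed

definition quad :: "real ^ 3 ^ 3 \<Rightarrow> real ^ 3 \<Rightarrow> real" where
 "quad X v = (\<Sum>i\<in>UNIV. \<Sum>j\<in>UNIV. X $ i $ j * v $ i * v $ j)"

lemma linear_tr_pair: "linear (tr_pair G)"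
 by (rule linearI) (simp_all add: tr_pair_def sum.distrib sum_distrib_left algebra_simps)

lemma linear_quad: "linear (\<lambda>X. quad X v)"
 by (rule linearI) (simp_all add: quad_def sum.distrib sum_distrib_left algebra_simps)

text \<open>For symmetric \<open>G\<close> with vanishing minors, G_ji G_li = G_ii G_jl. Hence the
  quadratic form of \<open>M k\<close> on the column \<open>i\<close> is G_ii times the pairing of
  \<open>G\<close> with \<open>M k\<close>, a product with a repeated factor.\<close>

lemma wedge5_column_null:
 fixes M :: "nat \<Rightarrow> real ^ 3 ^ 3"
 assumes M: "\<And>k. k < 5 ==> symm (M k)" and k: "k < 5"
  and adj: "adjugate (wedge5 (M 0) (M 1) (M 2) (M 3) (M 4)) = 0"
 shows "quad (M k) (\<chi> j. wedge5 (M 0) (M 1) (M 2) (M 3) (M 4) $ j $ i) = 0"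
proof -
 define G where "G = wedge5 (M 0) (M 1) (M 2) (M 3) (M 4)"
 have s: "G $ i $ j = G $ j $ i" for i j using wedge5_symm unfolding G_def symm_def by blast
 have "G $ j $ i * G $ l $ i = G $ i $ i * G $ j $ l" for j l
  using adj[folded G_def, unfolded minors_adjugate, rule_format, of j i i l] s by (metis mult.commute)
 hence "quad (M k) (\<chi> j. G $ j $ i) = (\<Sum>j\<in>UNIV. \<Sum>l\<in>UNIV. M k $ j $ l * (G $ i $ i * G $ j $ l))"
  by (simp add: quad_def mult.assoc)
 also have "\<dots> = G $ i $ i * tr_pair G (M k)"
  by (simp add: tr_pair_def sum_distrib_left mult_ac)
 also have "tr_pair G (M k) = 0"
  using tr_pair_indep[of M, OF M M[OF k]] span_base[of "M k" "M ` {..<5}"] k unfolding G_def by blast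
 finally show ?thesis by (simp add: G_def)
qed

text \<open>One direction is a nonzero column. For the other, evaluation at \<open>v\<close> and
  pairing with \<open>G\<close> are functionals on a six-dimensional space that vanish on the same
  five-dimensional subspace; so they are proportional, and \<open>G\<close> is a multiple of the
  square of \<open>v\<close>.\<close>

lemma wedge5_rank_one:
 fixes M :: "nat \<Rightarrow> real ^ 3 ^ 3"
 assumes M: "\<And>k. k < 5 ==> symm (M k)" and nz: "wedge5 (M 0) (M 1) (M 2) (M 3) (M 4) \<noteq> 0"
 shows "adjugate (wedge5 (M 0) (M 1) (M 2) (M 3) (M 4)) = 0 \<longleftrightarrow> (\<exists>v. v \<noteq> 0 \<and> (\<forall>k<5. quad (M k) v = 0))"
proof
 define G where "G = wedge5 (M 0) (M 1) (M 2) (M 3) (M 4)"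
 have i5: "indep M 5" using wedge5_indep[of M, OF M] nz by blast
 have s: "G $ i $ j = G $ j $ i" for i j using wedge5_symm unfolding G_def symm_def by blast
 {
  assume adj: "adjugate (wedge5 (M 0) (M 1) (M 2) (M 3) (M 4)) = 0"
  obtain i j where "G $ j $ i \<noteq> 0" using nz by (auto simp: vec_eq_iff G_def)
  hence "(\<chi> j. G $ j $ i) \<noteq> 0" by (auto simp: vec_eq_iff)
  thus "\<exists>v. v \<noteq> 0 \<and> (\<forall>k<5. quad (M k) v = 0)"
   using wedge5_column_null[OF M _ adj, of _ i] unfolding G_def by blast
 next
  assume "\<exists>v. v \<noteq> 0 \<and> (\<forall>k<5. quad (M k) v = 0)"
  then obtain v where v: "v \<noteq> 0" "\<And>k. k < 5 ==> quad (M k) v = 0" by blast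
  obtain a b where ab: "G $ a $ b \<noteq> 0" using nz by (auto simp: vec_eq_iff G_def)
  define X0 where "X0 = sym_unit a b"
  have X0: "symm X0" "tr_pair G X0 \<noteq> 0" using ab tr_pair_sym_unit[of M, OF M] by (simp_all add: X0_def sym_unit_symm G_def)
  have M0: "tr_pair G (M k) = 0" if "k < 5" for k
   using tr_pair_indep[of M, OF M M[OF that]] span_base[of "M k" "M ` {..<5}"] that unfolding G_def by blast
  have key: "tr_pair G X * quad X0 v = quad X v * tr_pair G X0" if X: "symm X" for X
  proof -
   define Y where "Y = X - (tr_pair G X / tr_pair G X0) *R X0"
   have "symm Y" using X X0(1) by (simp add: Y_def symm_def)
   moreover have "tr_pair G Y = 0" using X0(2)
    by (simp add: Y_def linear_diff[OF linear_tr_pair] linear_scale[OF linear_tr_pair])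
   ultimately have "Y \<in> span (M ` {..<5})" using tr_pair_indep[of M, OF M] i5 unfolding G_def by blast
   moreover have "subspace {X. quad X v = 0}"
    by (simp add: subspace_def linear_add[OF linear_quad] linear_scale[OF linear_quad] linear_0[OF linear_quad])
   ultimately have "quad Y v = 0" using span_minimal[of "M ` {..<5}" "{X. quad X v = 0}"] v(2) by auto
   hence "quad X v = (tr_pair G X / tr_pair G X0) * quad X0 v"
    by (simp add: Y_def linear_diff[OF linear_quad] linear_scale[OF linear_quad])
   thus ?thesis using X0(2) by simp
  qed
  have q: "quad (sym_unit i j) v = v $ i * v $ j" for i j
   using exhaust_3[of i] exhaust_3[of j] by (elim disjE) (simp_all add: quad_def sum_3 sym_unit_def field_simps)
  have G: "G $ i $ j * quad X0 v = v $ i * v $ j * tr_pair G X0" for i j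
   using key[OF sym_unit_symm, of i j] tr_pair_sym_unit[of M, OF M] by (simp add: q G_def)
  obtain i where "v $ i \<noteq> 0" using v(1) by (auto simp: vec_eq_iff)
  hence "quad X0 v \<noteq> 0" using G[of i i] X0(2) by auto
  hence "G $ i $ j = v $ i * v $ j * (tr_pair G X0 / quad X0 v)" for i j
   using G[of i j] by (simp add: field_simps)
  thus "adjugate (wedge5 (M 0) (M 1) (M 2) (M 3) (M 4)) = 0"
   unfolding G_def[symmetric] minors_adjugate by (simp add: mult_ac)
 }
qed

section \<open>From matrices in a frame back to tensors\<close>

lemma frame_expand:
 assumes "det (vector [u, e $ 1, e $ 2, e $ 3] :: real ^ 4 ^ 4) \<noteq> 0"
 shows "\<exists>c0 c. w = c0 *R u + (\<Sum>i\<in>UNIV. c $ i *R (e :: point ^ 3) $ i)"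
  and "(\<Sum>i\<in>UNIV. c $ i *R e $ i) \<in> span {u} ==> c = (0 :: real ^ 3)"
proof -
 define A where "A = (vector [u, e $ 1, e $ 2, e $ 3] :: real ^ 4 ^ 4)"
 have d: "det (transpose A) \<noteq> 0" using assms by (simp add: A_def)
 have ex: "transpose A *v v = v $ 1 *R u + v $ 2 *R e $ 1 + v $ 3 *R e $ 2 + v $ 4 *R e $ 3" for v
  by (simp add: A_def matrix_vector_mult_def transpose_def sum_4 vec_eq_iff mult.commute)
 have "w = transpose A *v solve (transpose A) w" using solve_iff[OF d] by metis
 thus "\<exists>c0 c. w = c0 *R u + (\<Sum>i\<in>UNIV. c $ i *R e $ i)"
  unfolding ex by (intro exI[of _ "solve (transpose A) w $ 1"] exI[of _ "vector [solve (transpose A) w $ 2, solve (transpose A) w $ 3, solve (transpose A) w $ 4]"])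
   (simp add: sum_3 add.assoc)
 assume "(\<Sum>i\<in>UNIV. c $ i *R e $ i) \<in> span {u}"
 then obtain k where "(\<Sum>i\<in>UNIV. c $ i *R e $ i) = k *R u" unfolding span_singleton by auto
 hence "transpose A *v vector [- k, c $ 1, c $ 2, c $ 3] = 0" unfolding ex by (simp add: sum_3 algebra_simps)
 hence "vector [- k, c $ 1, c $ 2, c $ 3] = (0 :: real ^ 4)"
  using solve_iff[OF d] linear_0[OF solve_linear[OF d]] by metis
 hence "(vector [- k, c $ 1, c $ 2, c $ 3] :: real ^ 4) $ i = 0" for i by simp
 from this[of 2] this[of 3] this[of 4] show "c = 0" by (simp add: vec_eq_iff forall_3)
qed

lemma linear_frame_matrix: "linear (frame_matrix e)"
 by (rule linearI) (simp_all add: frame_matrix_def vec_eq_iff tensor_app_linear)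

lemma quad_frame_matrix: "quad (frame_matrix e T) c = tensor_app T (\<Sum>i\<in>UNIV. c $ i *R e $ i) (\<Sum>i\<in>UNIV. c $ i *R e $ i)"
 unfolding tensor_app_sum_left unfolding tensor_app_sum_right
 by (simp add: quad_def frame_matrix_def tensor_app_linear mult_ac)

lemma frame_matrix_eq_0:
 assumes d: "det (vector [u, e $ 1, e $ 2, e $ 3] :: real ^ 4 ^ 4) \<noteq> 0"
  and T: "\<And>w. tensor_app T u w = 0" "\<And>w. tensor_app T w u = 0" and 0: "frame_matrix e T = 0"
 shows "T = 0"
proof (rule tensor_eqI)
 fix v w
 have z: "tensor_app T (e $ i) (e $ j) = 0" for i j
  using 0 by (simp add: frame_matrix_def vec_eq_iff)
 obtain c0 c where v: "v = c0 *R u + (\<Sum>i\<in>UNIV. c $ i *R e $ i)" using frame_expand(1)[OF d] by blast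
 obtain d0 d where w: "w = d0 *R u + (\<Sum>i\<in>UNIV. d $ i *R e $ i)" using frame_expand(1)[OF d] by blast
 show "tensor_app T v w = tensor_app 0 v w"
  unfolding v w by (simp add: tensor_app_linear T tensor_app_sum_left tensor_app_sum_right z)
qed

text \<open>The dictionary between \<open>Gamma\<close> and the flag: \<open>frame_matrix\<close> is
  injective on tensors that annihilate \<open>V\<close>, so the linear algebra of matrices
  transfers. The last item supplies null vectors that depend on the point as smoothly as
  \<open>Gamma\<close> does.\<close>

lemma Gamma_flag:
 assumes N: "open N" "smooth_on N V" "smooth_on N g" "annihilates N V g" "symmetric_on N g" and x: "x \<in> N"
  and d: "det (vector [V x, E x $ 1, E x $ 2, E x $ 3] :: real ^ 4 ^ 4) \<noteq> 0"
 shows "Gamma g V E x \<noteq> 0 \<longleftrightarrow> flag_indep g V x 5"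
  and "Gamma_osc g V E x \<noteq> 0 \<longleftrightarrow> flag_indep g V x 6"
  and "Gamma g V E x \<noteq> 0 ==> adjugate (Gamma g V E x) = 0 \<longleftrightarrow> (\<exists>w. w \<notin> span {V x} \<and> flag_null g V x w)"
  and "adjugate (Gamma g V E x) = 0 ==> flag_null g V x (\<Sum>j\<in>UNIV. Gamma g V E x $ j $ i *R E x $ j)"
proof -
 define T where "T k = (\<L> V ^^ k) g x" for k
 define M where "M k = frame_matrix (E x) (T k)" for k
 have ann: "tensor_app (T k) (V x) w = 0" "tensor_app (T k) w (V x) = 0" for k w
  using annihilates_lie_iter[OF N(1-4)] x unfolding annihilates_def T_def by blast+
 have sym: "tensor_app (T k) v w = tensor_app (T k) w v" for k v w
  using symmetric_lie_iter[OF N(1-3,5)] x unfolding symmetric_on_def T_def by blast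
 have M: "symm (M k)" for k using sym by (simp add: M_def symm_def frame_matrix_def)
 have sub: "subspace {T. \<forall>w. tensor_app T (V x) w = 0 \<and> tensor_app T w (V x) = 0}"
  by (simp add: subspace_def tensor_app_linear)
 have MT: "indep M n \<longleftrightarrow> flag_indep g V x n" for n
  unfolding flag_indep_iff M_def T_def[symmetric]
 proof (rule indep_linear_image[OF linear_frame_matrix])
  fix S assume S: "S \<in> span (T ` {..<n})" "frame_matrix (E x) S = 0"
  have "S \<in> {T. \<forall>w. tensor_app T (V x) w = 0 \<and> tensor_app T w (V x) = 0}"
   using span_minimal[OF _ sub, of "T ` {..<n}"] ann S(1) by auto
  thus "S = 0" using frame_matrix_eq_0[OF d _ _ S(2)] by blast
 qed
 have G: "Gamma g V E x = wedge5 (M 0) (M 1) (M 2) (M 3) (M 4)"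
  by (simp only: Gamma_def lie_jet_def M_def T_def)
 show 1: "Gamma g V E x \<noteq> 0 \<longleftrightarrow> flag_indep g V x 5" unfolding G MT[symmetric] by (rule wedge5_indep[OF M])
 have O: "Gamma_osc g V E x = wedge6 (M 0) (M 1) (M 2) (M 3) (M 4) (M 5)"
  by (simp only: Gamma_osc_def lie_jet_def M_def T_def)
 show "Gamma_osc g V E x \<noteq> 0 \<longleftrightarrow> flag_indep g V x 6" unfolding O MT[symmetric] by (rule wedge6_indep[OF M])
 show "flag_null g V x (\<Sum>j\<in>UNIV. Gamma g V E x $ j $ i *R E x $ j)" if "adjugate (Gamma g V E x) = 0" for i
  unfolding flag_null_iff T_def[symmetric]
  using wedge5_column_null[of M, OF M _ that[unfolded G], of _ i] unfolding M_def[of _] quad_frame_matrix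
  by (simp add: G[unfolded M_def])
 show "adjugate (Gamma g V E x) = 0 \<longleftrightarrow> (\<exists>w. w \<notin> span {V x} \<and> flag_null g V x w)" if "Gamma g V E x \<noteq> 0"
  unfolding G wedge5_rank_one[of M, OF M that[unfolded G]] flag_null_iff T_def[symmetric]
 proof
  assume "\<exists>v. v \<noteq> 0 \<and> (\<forall>k<5. quad (M k) v = 0)"
  then obtain v where v: "v \<noteq> 0" "\<forall>k<5. quad (M k) v = 0" by blast
  thus "\<exists>w. w \<notin> span {V x} \<and> (\<forall>k<5. tensor_app (T k) w w = 0)"
   using frame_expand(2)[OF d, of v] by (intro exI[of _ "\<Sum>i\<in>UNIV. v $ i *R E x $ i"]) (auto simp: M_def quad_frame_matrix)
 next
  assume "\<exists>w. w \<notin> span {V x} \<and> (\<forall>k<5. tensor_app (T k) w w = 0)"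
  then obtain w where w: "w \<notin> span {V x}" "\<forall>k<5. tensor_app (T k) w w = 0" by blast
  obtain c0 c where c: "w = c0 *R V x + (\<Sum>i\<in>UNIV. c $ i *R E x $ i)" using frame_expand(1)[OF d] by blast
  have "c \<noteq> 0" using w(1) c by (auto simp: span_singleton)
  moreover have "quad (M k) c = tensor_app (T k) w w" for k
   unfolding M_def quad_frame_matrix c by (simp add: tensor_app_linear ann)
  ultimately show "\<exists>v. v \<noteq> 0 \<and> (\<forall>k<5. quad (M k) v = 0)" using w(2) by auto
 qed
qed

lemma degenerate_lorentzianD:
 assumes "degenerate_lorentzian N g V"
 shows "smooth_on N g" "smooth_on N V" "annihilates N V g" "symmetric_on N g" "\<And>x. x \<in> N ==> V x \<noteq> 0"
  "\<And>x v. x \<in> N ==> (\<forall>w. tensor_app (g x) v w = 0) \<longleftrightarrow> v \<in> span {V x}"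
proof -
 show "smooth_on N g" "smooth_on N V" "\<And>x. x \<in> N ==> V x \<noteq> 0" using assms by (auto simp: degenerate_lorentzian_def)
 have s: "tensor_app (g x) v w = tensor_app (g x) w v" if "x \<in> N" for x v w
 proof -
  have "tensor_app (g x) v w = v \<bullet> (transpose (g x) *v w)" using assms that by (simp add: degenerate_lorentzian_def tensor_app_def)
  also have "\<dots> = tensor_app (g x) w v" by (metis dot_lmul_matrix inner_commute transpose_matrix_vector tensor_app_def)
  finally show ?thesis .
 qed
 thus "symmetric_on N g" by (auto simp: symmetric_on_def)
 have k: "(\<forall>w. tensor_app (g x) w v = 0) \<longleftrightarrow> v \<in> span {V x}" if "x \<in> N" for x v
 proof -
  have "(\<forall>w. tensor_app (g x) w v = 0) \<longleftrightarrow> g x *v v = 0"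
   unfolding tensor_app_def by (metis inner_eq_zero_iff inner_zero_right)
  also have "\<dots> \<longleftrightarrow> v \<in> {v. g x *v v = 0}" by simp
  also have "{v. g x *v v = 0} = span {V x}" using assms that unfolding degenerate_lorentzian_def by blast
  finally show ?thesis .
 qed
 thus "(\<forall>w. tensor_app (g x) v w = 0) \<longleftrightarrow> v \<in> span {V x}" if "x \<in> N" for x v
  using s[OF that] k[OF that] by metis
 show "annihilates N V g" unfolding annihilates_def using s k span_base[of "V _" "{V _}"] by (metis singletonI)
qed

text \<open>Multiples of \<open>v\<close> can be subtracted until the first component vanishes, so
  only the entries with indices 2, 3, 4 matter. Applied with \<open>total_field\<close>, whose first
  component is 1.\<close>

lemma tensor_ext_transverse:
 assumes "\<And>w. tensor_app T v w = 0" "\<And>w. tensor_app T w v = 0" "\<And>w. tensor_app S v w = 0" "\<And>w. tensor_app S w v = 0"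
  and v: "v $ 1 = 1" and e: "\<And>i j. i \<in> {2, 3, 4} ==> j \<in> {2, 3, 4} ==> T $ i $ j = S $ i $ j"
 shows "T = S"
proof (rule tensor_eqI)
 fix a b
 have red: "tensor_app U a b = tensor_app U (a - a $ 1 *R v) (b - b $ 1 *R v)"
  if "\<And>w. tensor_app U v w = 0" "\<And>w. tensor_app U w v = 0" for U
  by (simp add: tensor_app_linear that)
 define a' b' where "a' = a - a $ 1 *R v" "b' = b - b $ 1 *R v"
 have "a' $ 1 = 0" "b' $ 1 = 0" using v by (simp_all add: a'_b'_def)
 hence "tensor_app T a' b' = tensor_app S a' b'"
  using e by (simp add: tensor_app_sum sum_4)
 thus "tensor_app T a b = tensor_app S a b"
  using red[OF assms(1,2)] red[OF assms(3,4)] by (simp add: a'_b'_def)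
qed

section \<open>The metric of an equation\<close>

lemma total_field_nth [simp]:
 "total_field F z $ 1 = 1" "total_field F z $ 2 = z $ 3" "total_field F z $ 3 = z $ 4" "total_field F z $ 4 = F z"
 by (simp_all add: total_field_def)

lemma smooth_on_coord [smooth]: "open U ==> smooth_on U (\<lambda>z :: real ^ 'n. z $ i)"
 by (rule smooth_on_nth[OF _ smooth_on_id])

lemma dd_coord [simp]: "dd (\<lambda>z :: real ^ 'n. z $ i) x v = v $ i"
 by (rule fun_cong[OF frechet_eqI]) (rule bounded_linear.has_derivative[OF bounded_linear_vec_nth has_derivative_ident])

lemma theta_app: "theta1 z \<bullet> v = v $ 2 - z $ 3 * v $ 1" "theta2 z \<bullet> v = v $ 3 - z $ 4 * v $ 1"
 "theta3 F z \<bullet> v = v $ 4 - partial 4 F z / 3 * v $ 3 + ode_K F z * v $ 2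
   + (z $ 4 * partial 4 F z / 3 - F z - z $ 3 * ode_K F z) * v $ 1"
 by (simp_all add: theta1_def theta2_def theta3_def inner_vec_def sum_4)

lemma ode_metric_app: "tensor_app (ode_metric F z) v w
 = (theta1 z \<bullet> v) * (theta3 F z \<bullet> w) + (theta3 F z \<bullet> v) * (theta1 z \<bullet> w) - (theta2 z \<bullet> v) * (theta2 z \<bullet> w)"
 by (simp add: tensor_app_sum ode_metric_def inner_vec_def sum_4 algebra_simps)

lemma theta_total: "theta1 z \<bullet> total_field F z = 0" "theta2 z \<bullet> total_field F z = 0" "theta3 F z \<bullet> total_field F z = 0"
 by (simp_all add: theta_app algebra_simps)

lemma ode_annihilates: "annihilates D (total_field F) (ode_metric F)"
 by (simp add: annihilates_def ode_metric_app theta_total)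

lemma ode_symmetric: "symmetric_on D (ode_metric F)"
 by (simp add: symmetric_on_def ode_metric_app mult.commute)

lemma ode_kernel: "(\<forall>w. tensor_app (ode_metric F z) v w = 0) \<longleftrightarrow> v \<in> span {total_field F z}"
proof
 assume *: "\<forall>w. tensor_app (ode_metric F z) v w = 0"
 have ax: "theta1 z \<bullet> axis 2 1 = 1" "theta1 z \<bullet> axis 3 1 = 0" "theta1 z \<bullet> axis 4 1 = 0" "theta2 z \<bullet> axis 2 1 = 0"
  "theta2 z \<bullet> axis 3 1 = 1" "theta2 z \<bullet> axis 4 1 = 0" "theta3 F z \<bullet> axis 4 1 = 1"
  unfolding theta_app by (simp_all add: axis_def)
 have 1: "theta1 z \<bullet> v = 0" using *[rule_format, of "axis 4 1"] by (simp add: ode_metric_app ax)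
 hence 2: "theta2 z \<bullet> v = 0" using *[rule_format, of "axis 3 1"] by (simp add: ode_metric_app ax)
 hence 3: "theta3 F z \<bullet> v = 0" using 1 *[rule_format, of "axis 2 1"] by (simp add: ode_metric_app ax)
 have "v = v $ 1 *R total_field F z"
  unfolding vec_eq_iff forall_4 using 1 2 3 by (simp add: theta_app algebra_simps)
 thus "v \<in> span {total_field F z}" by (metis span_base span_scale singletonI)
next
 assume "v \<in> span {total_field F z}"
 then obtain k where "v = k *R total_field F z" by (auto simp: span_singleton)
 thus "\<forall>w. tensor_app (ode_metric F z) v w = 0" by (simp add: ode_metric_app theta_total)
qed

definition sigma :: "point \<Rightarrow> tensor" where
 "sigma z = (\<chi> i j. 2 * theta1 z $ i * theta1 z $ j)"

lemma sigma_app: "tensor_app (sigma z) v w = 2 * (theta1 z \<bullet> v) * (theta1 z \<bullet> w)"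
 by (simp add: tensor_app_sum sigma_def inner_vec_def sum_4 algebra_simps)

lemma sigma_annihilates: "annihilates D (total_field F) sigma"
 by (simp add: annihilates_def sigma_app theta_total)

section \<open>Iterated Lie derivatives of the metric of an equation\<close>

definition sg :: "(point \<Rightarrow> real) \<Rightarrow> nat \<Rightarrow> point \<Rightarrow> tensor" where
 "sg F k = (\<L> (total_field F) ^^ k) sigma"

lemma sg0: "sg F 0 z $ 2 $ 2 = 2" "sg F 0 z $ 2 $ 3 = 0" "sg F 0 z $ 2 $ 4 = 0" "sg F 0 z $ 3 $ 3 = 0" "sg F 0 z $ 3 $ 4 = 0" "sg F 0 z $ 4 $ 4 = 0"
 by (simp_all add: sg_def sigma_def theta1_def)

lemma ode_metric_comp: "ode_metric F z $ 2 $ 2 = 2 * ode_K F z" "ode_metric F z $ 2 $ 3 = - partial 4 F z / 3"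
 "ode_metric F z $ 3 $ 2 = - partial 4 F z / 3" "ode_metric F z $ 2 $ 4 = 1" "ode_metric F z $ 4 $ 2 = 1"
 "ode_metric F z $ 3 $ 3 = - 1" "ode_metric F z $ 3 $ 4 = 0" "ode_metric F z $ 4 $ 3 = 0" "ode_metric F z $ 4 $ 4 = 0"
 by (simp_all add: ode_metric_def theta1_def theta2_def theta3_def)

text \<open>For \<open>j < 6\<close> a frame of the tensors annihilating the total derivative, in
  which the iterated Lie derivatives of the metric become triangular.\<close>

definition jb :: "(point \<Rightarrow> real) \<Rightarrow> nat \<Rightarrow> point \<Rightarrow> tensor" where
 "jb F j = (case j of 0 \<Rightarrow> ode_metric F | Suc i \<Rightarrow> sg F i)"

lemma jb_simps: "jb F 0 = ode_metric F" "jb F (Suc i) = sg F i"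
 by (simp_all add: jb_def)

context
 fixes D :: "point set" and F :: "point \<Rightarrow> real"
 assumes ode: "third_order_ode D F"
begin

lemma ode_open: "open D" and ode_smooth: "smooth_on D F"
 using ode by (auto simp: third_order_ode_def)

lemma smooth_total_field: "smooth_on D (total_field F)"
proof (rule smooth_on_vec[OF ode_open])
 fix i
 show "smooth_on D (\<lambda>z. total_field F z $ i)"
  using exhaust_4[of i] by (elim disjE) (simp_all add: smooth_on_const smooth_on_coord ode_open ode_smooth)
qed

lemma smooth_partial: "smooth_on D f ==> smooth_on D (partial i f)"
 unfolding partial_def[abs_def] by (rule smooth_on_frechet)

lemma smooth_total_deriv: "smooth_on D f ==> smooth_on D (total_deriv F f)"
 unfolding total_deriv_def[abs_def] by (rule smooth_on_frechet_field[OF ode_open _ smooth_total_field])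

lemma smooth_ode_K: "smooth_on D (ode_K F)"
 unfolding ode_K_def[abs_def]
 by (intro smooth_on_diff smooth_on_divide smooth_on_power smooth_total_deriv smooth_partial ode_smooth ode_open smooth_on_const) auto

lemma smooth_wuenschmann: "smooth_on D (wuenschmann F)"
 unfolding wuenschmann_def[abs_def]
 by (intro smooth_on_diff smooth_on_add smooth_on_mult smooth_total_deriv smooth_partial ode_smooth smooth_ode_K ode_open smooth_on_const)

lemma total_deriv_const: "(\<And>z. z \<in> D ==> f z = c) ==> z \<in> D ==> total_deriv F f z = 0"
 unfolding total_deriv_def using frechet_cong[OF ode_open, of z f "\<lambda>z. c"] by simp

lemma dd_total_field:
 assumes "z \<in> D"
 shows "dd (total_field F) z v $ 1 = 0" "dd (total_field F) z v $ 2 = v $ 3"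
  "dd (total_field F) z v $ 3 = v $ 4" "dd (total_field F) z v $ 4 = dd F z v"
 using dd_vec_nth[OF smooth_onD[OF smooth_total_field assms], symmetric] by simp_all

lemma lie_total_comp:
 assumes "z \<in> D"
 shows "\<L> (total_field F) T z $ i $ j = total_deriv F (\<lambda>z. T z $ i $ j) z
  + ((if i = 3 then T z $ 2 $ j else 0) + (if i = 4 then T z $ 3 $ j else 0) + T z $ 4 $ j * partial i F z)
  + ((if j = 3 then T z $ i $ 2 else 0) + (if j = 4 then T z $ i $ 3 else 0) + T z $ i $ 4 * partial j F z)"
 unfolding lie_derivative_def
 by (simp add: sum_4 dd_total_field[OF assms] total_deriv_def partial_def axis_def)

lemma smooth_ode_metric: "smooth_on D (ode_metric F)"
proof -
 have t1: "smooth_on D (\<lambda>z. theta1 z $ i)" for i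
  using exhaust_4[of i] by (elim disjE) (simp_all add: theta1_def smooth_on_const smooth_on_minus smooth_on_coord ode_open)
 have t2: "smooth_on D (\<lambda>z. theta2 z $ i)" for i
  using exhaust_4[of i] by (elim disjE) (simp_all add: theta2_def smooth_on_const smooth_on_minus smooth_on_coord ode_open)
 have t3: "smooth_on D (\<lambda>z. theta3 F z $ i)" for i
  using exhaust_4[of i]
  by (elim disjE; simp add: theta3_def;
   (intro smooth_on_diff smooth_on_minus smooth_on_mult smooth_on_divide smooth_partial ode_smooth smooth_ode_K smooth_on_const smooth_on_coord ode_open)?) auto
 show ?thesis unfolding ode_metric_def[abs_def]
  by (intro smooth_on_lambda smooth_on_diff smooth_on_add smooth_on_mult t1 t2 t3 ode_open)
qed

lemma smooth_sigma: "smooth_on D sigma"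
proof -
 have t1: "smooth_on D (\<lambda>z. theta1 z $ i)" for i
  using exhaust_4[of i] by (elim disjE) (simp_all add: theta1_def smooth_on_const smooth_on_minus smooth_on_coord ode_open)
 show ?thesis unfolding sigma_def[abs_def] by (intro smooth_on_lambda smooth_on_mult t1 ode_open smooth_on_const)
qed

lemma sg_sym: "z \<in> D ==> sg F k z $ i $ j = sg F k z $ j $ i"
proof -
 have "symmetric_on D sigma" by (simp add: symmetric_on_def sigma_app mult.commute)
 from symmetric_lie_iter[OF ode_open smooth_total_field smooth_sigma this]
 show "z \<in> D ==> sg F k z $ i $ j = sg F k z $ j $ i"
  unfolding symmetric_on_def sg_def by (metis tensor_app_axis)
qed

context
 fixes z assumes z: "z \<in> D"
begin

lemma sg_step: "sg F (Suc n) z $ i $ j = total_deriv F (\<lambda>z. sg F n z $ i $ j) z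
  + ((if i = 3 then sg F n z $ 2 $ j else 0) + (if i = 4 then sg F n z $ 3 $ j else 0) + sg F n z $ 4 $ j * partial i F z)
  + ((if j = 3 then sg F n z $ i $ 2 else 0) + (if j = 4 then sg F n z $ i $ 3 else 0) + sg F n z $ i $ 4 * partial j F z)"
 using lie_total_comp[OF z, of "sg F n" i j] by (simp add: sg_def)

lemmas sg_lower = sg_sym[OF z, of _ 3 2] sg_sym[OF z, of _ 4 2] sg_sym[OF z, of _ 4 3]

end

text \<open>Give the indices 2, 3, 4 the weights 0, 1, 2. L_V takes dy - p dx to dp - q dx and this
  to dq - F dx, so in the k-th derivative of \<open>sigma\<close> the entries of weight above k
  vanish and those of weight k are constants, twice a binomial coefficient. Constancy is what the
  next step needs, as the total derivatives of these entries vanish.\<close>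

lemma sg1:
 assumes "z \<in> D"
 shows "sg F 1 z $ 2 $ 3 = 2" "sg F 1 z $ 2 $ 4 = 0" "sg F 1 z $ 3 $ 3 = 0" "sg F 1 z $ 3 $ 4 = 0" "sg F 1 z $ 4 $ 4 = 0"
 using sg_step[OF assms, of 0] sg_lower[OF assms, of 0] by (simp_all add: sg0 total_deriv_const[of "\<lambda>_. c" c for c, OF refl assms])

lemma sg2:
 assumes "z \<in> D"
 shows "sg F 2 z $ 2 $ 4 = 2" "sg F 2 z $ 3 $ 3 = 4" "sg F 2 z $ 3 $ 4 = 0" "sg F 2 z $ 4 $ 4 = 0"
 using sg_step[OF assms, of 1, unfolded Suc_1] sg_lower[OF assms, of 1] by (simp_all add: sg1[OF assms] total_deriv_const[OF sg1(2) assms]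
  total_deriv_const[OF sg1(3) assms] total_deriv_const[OF sg1(4) assms] total_deriv_const[OF sg1(5) assms] del: One_nat_def)

lemma sg3:
 assumes "z \<in> D"
 shows "sg F 3 z $ 3 $ 4 = 6" "sg F 3 z $ 4 $ 4 = 0"
 using sg_step[OF assms, of 2] sg_lower[OF assms, of 2]
 by (simp_all add: sg2[OF assms] total_deriv_const[OF sg2(3) assms] total_deriv_const[OF sg2(4) assms])

lemma sg4:
 assumes "z \<in> D"
 shows "sg F 4 z $ 4 $ 4 = 12"
 using sg_step[OF assms, of 3] sg_lower[OF assms, of 3] by (simp add: sg3[OF assms] total_deriv_const[OF sg3(2) assms])

text \<open>Here the formulas for \<open>ode_K\<close> and \<open>wuenschmann\<close> find their
  explanation: the entry 23 forces the first and the entry 22 the second.\<close>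

lemma lie_ode_metric:
 assumes z: "z \<in> D"
 shows "\<L> (total_field F) (ode_metric F) z
  = (2 / 3 * partial 4 F z) *R ode_metric F z + wuenschmann F z *R sigma z"
proof (rule tensor_ext_transverse[where v = "total_field F z"])
 have a: "annihilates D (total_field F) (\<L> (total_field F) (ode_metric F))"
  by (rule annihilates_lie[OF ode_open smooth_total_field smooth_ode_metric ode_annihilates])
 show "tensor_app (\<L> (total_field F) (ode_metric F) z) (total_field F z) w = 0"
  "tensor_app (\<L> (total_field F) (ode_metric F) z) w (total_field F z) = 0" for w
  using a z by (auto simp: annihilates_def)
 show "tensor_app ((2 / 3 * partial 4 F z) *R ode_metric F z + wuenschmann F z *R sigma z) (total_field F z) w = 0"
  "tensor_app ((2 / 3 * partial 4 F z) *R ode_metric F z + wuenschmann F z *R sigma z) w (total_field F z) = 0" for w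
  using ode_annihilates sigma_annihilates z by (auto simp: annihilates_def tensor_app_linear)
 fix i j :: 4
 assume ij: "i \<in> {2, 3, 4}" "j \<in> {2, 3, 4}"
 have dK: "ode_K F differentiable (at z)" "partial 4 F differentiable (at z)"
  using smooth_onD[OF smooth_ode_K z] smooth_onD[OF smooth_partial[OF ode_smooth] z] .
 have t22: "total_deriv F (\<lambda>z. ode_metric F z $ 2 $ 2) z = 2 * total_deriv F (ode_K F) z"
  unfolding ode_metric_comp total_deriv_def using dd_scaleR[OF _ dK(1), of "\<lambda>z. 2"] by simp
 have "dd (\<lambda>z. - partial 4 F z / 3) z v = - dd (partial 4 F) z v / 3" for v
  using frechet_linear[OF bounded_linear_mult_right[of "- 1 / 3"] dK(2), of v] by simp
 hence t23: "total_deriv F (\<lambda>z. ode_metric F z $ 2 $ 3) z = - total_deriv F (partial 4 F) z / 3"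
  "total_deriv F (\<lambda>z. ode_metric F z $ 3 $ 2) z = - total_deriv F (partial 4 F) z / 3"
  unfolding ode_metric_comp total_deriv_def by simp_all
 have t0: "total_deriv F (\<lambda>z. ode_metric F z $ 2 $ 4) z = 0" "total_deriv F (\<lambda>z. ode_metric F z $ 4 $ 2) z = 0"
  "total_deriv F (\<lambda>z. ode_metric F z $ 3 $ 3) z = 0" "total_deriv F (\<lambda>z. ode_metric F z $ 3 $ 4) z = 0"
  "total_deriv F (\<lambda>z. ode_metric F z $ 4 $ 3) z = 0" "total_deriv F (\<lambda>z. ode_metric F z $ 4 $ 4) z = 0"
  unfolding ode_metric_comp total_deriv_def by simp_all
 have K: "2 * ode_K F z = total_deriv F (partial 4 F) z / 3 - 2 / 9 * (partial 4 F z)\<^sup>2 - partial 3 F z"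
  by (simp add: ode_K_def)
 have s: "sigma z $ 2 $ 2 = 2" "sigma z $ 2 $ 3 = 0" "sigma z $ 2 $ 4 = 0" "sigma z $ 3 $ 2 = 0" "sigma z $ 3 $ 3 = 0"
  "sigma z $ 3 $ 4 = 0" "sigma z $ 4 $ 2 = 0" "sigma z $ 4 $ 3 = 0" "sigma z $ 4 $ 4 = 0"
  by (simp_all add: sigma_def theta1_def)
 show "\<L> (total_field F) (ode_metric F) z $ i $ j
  = ((2 / 3 * partial 4 F z) *R ode_metric F z + wuenschmann F z *R sigma z) $ i $ j"
  using ij K unfolding lie_total_comp[OF z]
  by (elim insertE emptyE, simp_all only: t22 t23 t0) (simp_all add: t22 t23 t0 ode_metric_comp s wuenschmann_def power2_eq_square algebra_simps)
qed simp

lemma smooth_jb: "smooth_on D (jb F j)"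
 by (cases j) (simp_all add: jb_simps sg_def smooth_ode_metric smooth_on_lie_iter[OF ode_open smooth_total_field smooth_sigma])

text \<open>The coefficient \<open>wuenschmann F\<close> enters with the first derivative and from
  then on stays in front of the newest frame element, as L_V takes each later element exactly to the
  next.\<close>

lemma ode_jets: "\<exists>c. (\<forall>j. smooth_on D (c j)) \<and> (\<forall>z\<in>D. c k z = (if k = 0 then 1 else wuenschmann F z)) \<and>
  (\<forall>z\<in>D. (\<L> (total_field F) ^^ k) (ode_metric F) z = (\<Sum>j\<le>k. c j z *R jb F j z))"
proof (induction k)
 case 0
 show ?case by (intro exI[of _ "\<lambda>j z. 1"]) (simp add: jb_simps smooth_on_const)
next
 case (Suc k)
 then obtain c where c: "\<And>j. smooth_on D (c j)" and lead: "\<And>z. z \<in> D ==> c k z = (if k = 0 then 1 else wuenschmann F z)"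
  and e: "\<And>z. z \<in> D ==> (\<L> (total_field F) ^^ k) (ode_metric F) z = (\<Sum>j\<le>k. c j z *R jb F j z)" by blast
 define p where "p j z = (if j = 0 then 2 / 3 * partial 4 F z else 0)" for j :: nat and z
 define q where "q j z = (if j = 0 then wuenschmann F z else 1)" for j :: nat and z
 have p: "smooth_on D (p j)" for j unfolding p_def
  by (cases "j = 0") (simp_all add: smooth_on_const smooth_on_mult[OF ode_open] smooth_partial ode_smooth smooth_on_divide[OF ode_open])
 have q: "smooth_on D (q j)" for j unfolding q_def
  by (cases "j = 0") (simp_all add: smooth_on_const smooth_wuenschmann)
 have l: "\<L> (total_field F) (jb F j) z = p j z *R jb F j z + q j z *R jb F (Suc j) z" if "z \<in> D" for j z
  by (cases j) (simp_all add: jb_simps sg_def p_def q_def lie_ode_metric[OF that])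
 define a where "a j z = (if j \<le> k then dd (c j) z (total_field F z) + c j z * p j z else 0)" for j z
 define b where "b j z = (if j = 0 then 0 else c (j - 1) z * q (j - 1) z)" for j z
 have "smooth_on D (a j)" for j unfolding a_def
  by (cases "j \<le> k") (simp_all add: smooth_on_const smooth_on_add[OF ode_open] smooth_on_mult[OF ode_open] c p smooth_on_frechet_field[OF ode_open c smooth_total_field])
 moreover have "smooth_on D (b j)" for j unfolding b_def
  by (cases "j = 0") (simp_all add: smooth_on_const smooth_on_mult[OF ode_open] c q)
 ultimately have sm: "smooth_on D (\<lambda>z. a j z + b j z)" for j by (intro smooth_on_add ode_open)
 have "(\<L> (total_field F) ^^ Suc k) (ode_metric F) z = (\<Sum>j\<le>Suc k. (a j z + b j z) *R jb F j z)" if z: "z \<in> D" for z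
 proof -
  have "(\<L> (total_field F) ^^ Suc k) (ode_metric F) z = \<L> (total_field F) (\<lambda>z. \<Sum>j\<le>k. c j z *R jb F j z) z"
   unfolding funpow.simps o_apply by (rule lie_cong[OF ode_open z e refl])
  also have "\<dots> = (\<Sum>j\<le>k. dd (c j) z (total_field F z) *R jb F j z + c j z *R \<L> (total_field F) (jb F j) z)"
   by (rule lie_combination[OF ode_open z smooth_total_field c smooth_jb])
  also have "\<dots> = (\<Sum>j\<le>k. (dd (c j) z (total_field F z) + c j z * p j z) *R jb F j z) + (\<Sum>j\<le>k. (c j z * q j z) *R jb F (Suc j) z)"
   unfolding sum.distrib[symmetric] by (intro sum.cong refl) (simp add: l[OF z] algebra_simps)
  also have "(\<Sum>j\<le>k. (dd (c j) z (total_field F z) + c j z * p j z) *R jb F j z) = (\<Sum>j\<le>Suc k. a j z *R jb F j z)"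
   by (simp add: a_def)
  also have "(\<Sum>j\<le>k. (c j z * q j z) *R jb F (Suc j) z) = (\<Sum>j\<le>Suc k. b j z *R jb F j z)"
   by (subst sum.atMost_Suc_shift) (simp add: b_def)
  finally show ?thesis by (simp only: sum.distrib[symmetric] scaleR_add_left)
 qed
 moreover have "a (Suc k) z + b (Suc k) z = (if Suc k = 0 then 1 else wuenschmann F z)" if "z \<in> D" for z
  using lead[OF that] by (simp add: a_def b_def q_def)
 ultimately show ?case using sm by (intro exI[of _ "\<lambda>j z. a j z + b j z"]) blast
qed

lemma ode_flag_null:
 assumes z: "z \<in> D"
 shows "flag_null (ode_metric F) (total_field F) z (axis 4 1)"
 unfolding flag_null_iff
proof (intro allI impI)
 fix k :: nat assume k: "k < 5"
 \<comment> \<open>The entry 44 has the highest weight and first appears in the fourth derivative of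
   \<open>sigma\<close>, that is in \<open>jb F 5\<close>.\<close>
 have j: "jb F j z $ 4 $ 4 = 0" if "j < 5" for j
 proof -
  have "j = 0 \<or> j = Suc 0 \<or> j = Suc 1 \<or> j = Suc 2 \<or> j = Suc 3" using that by arith
  thus ?thesis using sg0 sg1[OF z] sg2[OF z] sg3[OF z] by (elim disjE) (simp_all only: jb_simps ode_metric_comp)
 qed
 obtain c where "(\<L> (total_field F) ^^ k) (ode_metric F) z = (\<Sum>j\<le>k. c j z *R jb F j z)"
  using ode_jets[of k] z by blast
 thus "tensor_app ((\<L> (total_field F) ^^ k) (ode_metric F) z) (axis 4 1) (axis 4 1) = 0"
  using j k by (simp add: tensor_app_sum_tensor tensor_app_linear tensor_app_axis)
qed

lemma jb_indep:
 assumes z: "z \<in> D"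
 shows "indep (\<lambda>j. jb F j z) 6"
 unfolding indep_def
proof (intro allI impI)
 fix k :: nat assume k: "k < 6"
 have sep: "jb F k z \<notin> span ((\<lambda>j. jb F j z) ` {..<k})" if l: "linear l" and "l (jb F k z) \<noteq> 0" "\<And>j. j < k ==> l (jb F j z) = 0" for l :: "tensor \<Rightarrow> real"
 proof
  assume "jb F k z \<in> span ((\<lambda>j. jb F j z) ` {..<k})"
  moreover have "subspace {T. l T = 0}" by (simp add: subspace_def linear_add[OF l] linear_scale[OF l] linear_0[OF l])
  ultimately have "jb F k z \<in> {T. l T = 0}"
   using span_minimal[of "(\<lambda>j. jb F j z) ` {..<k}" "{T. l T = 0}"] that(3) by auto
  thus False using that(2) by simp
 qed
 note S = sg0 sg1[OF z] sg2[OF z] sg3[OF z] sg4[OF z] ode_metric_comp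
 have jb: "jb F 0 z = ode_metric F z" "jb F 1 z = sg F 0 z" "jb F 2 z = sg F 1 z" "jb F 3 z = sg F 2 z" "jb F 4 z = sg F 3 z" "jb F 5 z = sg F 4 z"
  by (simp_all add: jb_def eval_nat_numeral)
 \<comment> \<open>The \<open>k\<close>-th functional vanishes on the earlier frame elements but not
   on the \<open>k\<close>-th. For \<open>k > 0\<close> it reads entries of weight
   \<open>k - 1\<close>, corrected by the entry 24 where the metric itself contributes; for
   \<open>k = 3\<close> the entries 24 and 33 of the metric, 1 and -1, cancel.\<close>
 define l where "l T = (if k = 0 then T $ 2 $ 4 else if k = 1 then T $ 2 $ 2 - 2 * ode_K F z * T $ 2 $ 4
  else if k = 2 then T $ 2 $ 3 + partial 4 F z / 3 * T $ 2 $ 4 else if k = 3 then T $ 2 $ 4 + T $ 3 $ 3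
  else if k = 4 then T $ 3 $ 4 else T $ 4 $ 4)" for T :: tensor
 have k6: "k = 0 \<or> k = 1 \<or> k = 2 \<or> k = 3 \<or> k = 4 \<or> k = 5" using k by arith
 show "jb F k z \<notin> span ((\<lambda>j. jb F j z) ` {..<k})"
 proof (rule sep[of l])
  show "linear l" by (rule linearI) (simp_all add: l_def algebra_simps)
  show "l (jb F k z) \<noteq> 0" using k6 by (elim disjE) (simp_all add: l_def jb jb[unfolded One_nat_def] S S[unfolded One_nat_def])
  fix j assume "j < k"
  with k6 have "j = 0 \<or> k \<ge> 2 \<and> j = 1 \<or> k \<ge> 3 \<and> j = 2 \<or> k \<ge> 4 \<and> j = 3 \<or> k = 5 \<and> j = 4" by arith
  thus "l (jb F j z) = 0" using k6 \<open>j < k\<close>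
   by (elim disjE conjE) (simp_all add: l_def jb jb[unfolded One_nat_def] S S[unfolded One_nat_def])
 qed
qed

lemma ode_flag_indep:
 assumes z: "z \<in> D" and W: "wuenschmann F z \<noteq> 0"
 shows "flag_indep (ode_metric F) (total_field F) z 6"
 unfolding flag_indep_iff indep_def
proof (intro allI impI notI)
 define T where "T k = (\<L> (total_field F) ^^ k) (ode_metric F) z" for k
 fix k :: nat assume k: "k < 6" and "(\<L> (total_field F) ^^ k) (ode_metric F) z \<in> span ((\<lambda>k. (\<L> (total_field F) ^^ k) (ode_metric F) z) ` {..<k})"
 hence k': "T k \<in> span (T ` {..<k})" by (simp add: T_def[abs_def])
 have ex: "\<exists>c. T i = (\<Sum>j\<le>i. c j *R jb F j z) \<and> c i \<noteq> 0" for i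
 proof -
  obtain c where "T i = (\<Sum>j\<le>i. c j z *R jb F j z)" "c i z = (if i = 0 then 1 else wuenschmann F z)"
   using ode_jets[of i] z unfolding T_def by blast
  thus ?thesis using W by (intro exI[of _ "\<lambda>j. c j z"]) auto
 qed
 have "T i \<in> span ((\<lambda>j. jb F j z) ` {..<k})" if "i < k" for i
 proof -
  obtain c where "T i = (\<Sum>j\<le>i. c j *R jb F j z)" using ex by blast
  moreover have "(\<Sum>j\<le>i. c j *R jb F j z) \<in> span ((\<lambda>j. jb F j z) ` {..<k})"
   by (rule span_sum, rule span_scale, rule span_base) (use that in auto)
  ultimately show ?thesis by simp
 qed
 hence "span (T ` {..<k}) \<subseteq> span ((\<lambda>j. jb F j z) ` {..<k})" by (intro span_minimal) auto
 hence Tk: "T k \<in> span ((\<lambda>j. jb F j z) ` {..<k})" using k' by blast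
 obtain c where c: "T k = (\<Sum>j\<le>k. c j *R jb F j z)" "c k \<noteq> 0" using ex by blast
 have "T k = (\<Sum>j<k. c j *R jb F j z) + c k *R jb F k z" unfolding c(1) lessThan_Suc_atMost[symmetric] by simp
 hence "c k *R jb F k z = T k - (\<Sum>j<k. c j *R jb F j z)" by simp
 moreover have "T k - (\<Sum>j<k. c j *R jb F j z) \<in> span ((\<lambda>j. jb F j z) ` {..<k})"
  by (intro span_diff Tk span_sum span_scale span_base) auto
 ultimately have "inverse (c k) *R (c k *R jb F k z) \<in> span ((\<lambda>j. jb F j z) ` {..<k})" by (simp add: span_scale)
 hence "jb F k z \<in> span ((\<lambda>j. jb F j z) ` {..<k})" using c(2) by simp
 thus False using jb_indep[OF z] k unfolding indep_def by blast
qed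

lemma ode_flag_proportional:
 assumes z: "z \<in> D"
 shows "flag (ode_metric F) (total_field F) z 1 = flag (ode_metric F) (total_field F) z 2 \<longleftrightarrow> wuenschmann F z = 0"
proof
 assume *: "flag (ode_metric F) (total_field F) z 1 = flag (ode_metric F) (total_field F) z 2"
 show "wuenschmann F z = 0"
 proof (rule ccontr)
  assume "wuenschmann F z \<noteq> 0"
  from ode_flag_indep[OF z this] * show False unfolding flag_indep_def by (auto simp: eval_nat_numeral dest!: spec[of _ 1])
 qed
next
 assume "wuenschmann F z = 0"
 hence "\<L> (total_field F) (ode_metric F) z \<in> flag (ode_metric F) (total_field F) z 1"
  unfolding lie_ode_metric[OF z] flag_def by (simp add: span_scale span_base)
 thus "flag (ode_metric F) (total_field F) z 1 = flag (ode_metric F) (total_field F) z 2"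
  using flag_Suc_eq[of "ode_metric F" "total_field F" z 1] by (simp add: eval_nat_numeral)
qed

end

text \<open>Where the Wuenschmann invariant is nonzero the triangular relation of
  \<open>ode_jets\<close> can be inverted.\<close>

lemma jb_in_flag:
 assumes ode: "third_order_ode D F" and z: "z \<in> D" and W: "wuenschmann F z \<noteq> 0"
 shows "jb F k z \<in> flag (ode_metric F) (total_field F) z (Suc k)"
proof (induction k rule: less_induct)
 case (less k)
 define T where "T k = (\<L> (total_field F) ^^ k) (ode_metric F) z" for k
 obtain c where c: "T k = (\<Sum>j\<le>k. c j z *R jb F j z)" "c k z = (if k = 0 then 1 else wuenschmann F z)"
  using ode_jets[OF ode, of k] z unfolding T_def by blast
 have nz: "c k z \<noteq> 0" using c(2) W by auto
 have mono: "flag (ode_metric F) (total_field F) z i \<subseteq> flag (ode_metric F) (total_field F) z j" if "i \<le> j" for i j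
  unfolding flag_def by (rule span_mono) (use that in auto)
 have "T k = (\<Sum>j<k. c j z *R jb F j z) + c k z *R jb F k z"
  unfolding c(1) lessThan_Suc_atMost[symmetric] by simp
 hence "c k z *R jb F k z = T k - (\<Sum>j<k. c j z *R jb F j z)" by simp
 moreover have "T k - (\<Sum>j<k. c j z *R jb F j z) \<in> flag (ode_metric F) (total_field F) z (Suc k)"
 proof -
  have "jb F j z \<in> flag (ode_metric F) (total_field F) z (Suc k)" if "j < k" for j
   using less[OF that] mono[of "Suc j" "Suc k"] that by auto
  moreover have "T k \<in> flag (ode_metric F) (total_field F) z (Suc k)"
   unfolding flag_def T_def by (rule span_base) auto
  ultimately show ?thesis unfolding flag_def by (intro span_diff span_sum span_scale) auto
 qed
 ultimately have "inverse (c k z) *R (c k z *R jb F k z) \<in> flag (ode_metric F) (total_field F) z (Suc k)"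
  unfolding flag_def by (simp add: span_scale)
 thus ?case using nz by simp
qed

lemma contact_plane_iff: "v \<in> contact_plane z \<longleftrightarrow> (\<exists>a b. v = a *R total_field F z + b *R axis 4 1)"
proof
 assume "v \<in> contact_plane z"
 hence "v $ 2 = z $ 3 * v $ 1" "v $ 3 = z $ 4 * v $ 1" by (auto simp: contact_plane_def theta_app)
 hence "v = v $ 1 *R total_field F z + (v $ 4 - v $ 1 * F z) *R axis 4 1"
  by (simp add: vec_eq_iff forall_4 axis_def)
 thus "\<exists>a b. v = a *R total_field F z + b *R axis 4 1" by blast
next
 assume "\<exists>a b. v = a *R total_field F z + b *R axis 4 1"
 thus "v \<in> contact_plane z" by (auto simp: contact_plane_def theta_app axis_def)
qed

text \<open>Modulo the total derivative, two tensors suffice: \<open>sigma\<close> kills the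
  component along d/dy, and then its second derivative, whose entries 34 and 44 vanish, kills the
  one along d/dp.\<close>

lemma ode_null_contact:
 assumes ode: "third_order_ode D F" and z: "z \<in> D" and W: "wuenschmann F z \<noteq> 0"
  and null: "flag_null (ode_metric F) (total_field F) z w"
 shows "w \<in> contact_plane z"
proof -
 define u where "u = w - w $ 1 *R total_field F z"
 have u1: "u $ 1 = 0" by (simp add: u_def)
 have q: "tensor_app (sg F k z) u u = 0" if "k < 4" for k
 proof -
  have "flag (ode_metric F) (total_field F) z (Suc (Suc k)) \<subseteq> flag (ode_metric F) (total_field F) z 5"
   unfolding flag_def by (rule span_mono) (use that in auto)
  hence "sg F k z \<in> flag (ode_metric F) (total_field F) z 5"
   using jb_in_flag[OF ode z W, of "Suc k"] by (auto simp: jb_simps)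
  hence "tensor_app (sg F k z) w w = 0" using null by (simp add: flag_null_def)
  moreover have "tensor_app (sg F k z) (total_field F z) v = 0" "tensor_app (sg F k z) v (total_field F z) = 0" for v
   using annihilates_lie_iter[OF ode_open[OF ode] smooth_total_field[OF ode] smooth_sigma[OF ode] sigma_annihilates, of k] z
   by (auto simp: annihilates_def sg_def)
  ultimately show ?thesis by (simp add: u_def tensor_app_linear)
 qed
 have e: "tensor_app (sg F k z) u u = sg F k z $ 2 $ 2 * (u $ 2)\<^sup>2 + 2 * sg F k z $ 2 $ 3 * u $ 2 * u $ 3
  + 2 * sg F k z $ 2 $ 4 * u $ 2 * u $ 4 + sg F k z $ 3 $ 3 * (u $ 3)\<^sup>2 + 2 * sg F k z $ 3 $ 4 * u $ 3 * u $ 4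
  + sg F k z $ 4 $ 4 * (u $ 4)\<^sup>2" for k
  using sg_sym[OF ode z, of k 3 2] sg_sym[OF ode z, of k 4 2] sg_sym[OF ode z, of k 4 3]
  by (simp add: tensor_app_sum sum_4 u1 power2_eq_square algebra_simps)
 have u2: "u $ 2 = 0" using q[of 0] by (simp add: e sg0)
 have u3: "u $ 3 = 0" using q[of 2] by (simp add: e u2 sg2[OF ode z])
 have "w = w $ 1 *R total_field F z + u $ 4 *R axis 4 1"
  using u2 u3 by (simp add: u_def vec_eq_iff forall_4 axis_def)
 thus ?thesis using contact_plane_iff by blast
qed

section \<open>Conformal isometries and the invariants of the flag\<close>

lemma lie_proportional_flag: "lie_proportional {x} g V \<longleftrightarrow> flag g V x 1 = flag g V x 2"
proof -
 have "flag g V x 1 = flag g V x 2 \<longleftrightarrow> \<L> V g x \<in> flag g V x 1"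
  using flag_Suc_eq[of g V x 1] by (simp add: eval_nat_numeral)
 also have "\<dots> \<longleftrightarrow> lie_proportional {x} g V"
  by (auto simp: flag_def lie_proportional_def span_singleton lessThan_Suc)
 finally show ?thesis by simp
qed

text \<open>A conformal isometry preserves the kernel of the metric, hence carries \<open>V\<close>
  to a multiple of the total derivative; as that has first component 1, the multiple can be read off
  and is smooth.\<close>

lemma isometry_flags:
 assumes N: "degenerate_lorentzian N g V" and U: "U \<subseteq> N" and iso: "ode_isometry g U \<phi> D F"
 obtains f where "smooth_on U f" "\<And>x. x \<in> U ==> f x \<noteq> 0"
  "\<And>x. x \<in> U ==> dd \<phi> x (V x) = f x *R total_field F (\<phi> x)"
  "\<And>x k. x \<in> U ==> flag g V x k = pull_tensor (jacobian \<phi> (at x)) ` flag (ode_metric F) (total_field F) (\<phi> x) k"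
proof -
 note NN = degenerate_lorentzianD[OF N]
 obtain r where ode: "third_order_ode D F" and \<phi>: "diffeo_onto_image U \<phi>" and im: "\<phi> ` U \<subseteq> D"
  and r: "smooth_on U r" "\<And>x. x \<in> U ==> r x \<noteq> 0" "\<And>x. x \<in> U ==> pullback \<phi> (ode_metric F) x = r x *R g x"
  using iso unfolding ode_isometry_def by blast
 note d = diffeoD[OF \<phi>]
 define f where "f x = dd \<phi> x (V x) $ 1" for x
 have V: "smooth_on U V" and g: "smooth_on U g" using NN smooth_on_subset U by blast+
 have f: "smooth_on U f" unfolding f_def by (intro smooth_on_nth smooth_on_frechet_field d V)
 have VX: "dd \<phi> x (V x) = f x *R total_field F (\<phi> x)" if x: "x \<in> U" for x
 proof -
  have "tensor_app (ode_metric F (\<phi> x)) (dd \<phi> x (V x)) w = 0" for w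
  proof -
   obtain w' where w': "dd \<phi> x w' = w" using diffeo_surj[OF \<phi> x] by blast
   have "tensor_app (pullback \<phi> (ode_metric F) x) (V x) w' = 0"
    using NN(3) x U r(3)[OF x] by (auto simp: annihilates_def tensor_app_linear)
   thus ?thesis using pullback_app[OF smooth_onD[OF d(4) x]] w' by simp
  qed
  hence "dd \<phi> x (V x) \<in> span {total_field F (\<phi> x)}" using ode_kernel by blast
  then obtain k where k: "dd \<phi> x (V x) = k *R total_field F (\<phi> x)" by (auto simp: span_singleton)
  hence "f x = k" by (simp add: f_def)
  thus ?thesis using k by simp
 qed
 have nz: "f x \<noteq> 0" if "x \<in> U" for x
  using VX[OF that] diffeo_ker[OF \<phi> that, of "V x"] NN(5) that U by auto
 have "flag g V x k = pull_tensor (jacobian \<phi> (at x)) ` flag (ode_metric F) (total_field F) (\<phi> x) k" if "x \<in> U" for x k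
  by (rule flag_transport[OF d(1) ode_open[OF ode] im d(4) smooth_ode_metric[OF ode] smooth_total_field[OF ode] g V f r(1) nz r(2) r(3) VX _ that])
   (use NN(3) U in \<open>auto simp: annihilates_def\<close>)
 from that[OF f nz VX this] show thesis .
qed

lemma isometry_consequences:
 assumes N: "open N" "degenerate_lorentzian N g V" and U: "U \<subseteq> N" and iso: "ode_isometry g U \<phi> D F" and x: "x \<in> U"
 shows "lie_proportional {x} g V \<longleftrightarrow> wuenschmann F (\<phi> x) = 0"
  and "wuenschmann F (\<phi> x) \<noteq> 0 ==> flag_indep g V x 6"
  and "\<exists>w. w \<notin> span {V x} \<and> flag_null g V x w"
  and "flag_null g V x w \<longleftrightarrow> flag_null (ode_metric F) (total_field F) (\<phi> x) (dd \<phi> x w)"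
proof -
 obtain f where f: "smooth_on U f" "\<And>x. x \<in> U ==> f x \<noteq> 0"
  "\<And>x. x \<in> U ==> dd \<phi> x (V x) = f x *R total_field F (\<phi> x)"
  "\<And>x k. x \<in> U ==> flag g V x k = pull_tensor (jacobian \<phi> (at x)) ` flag (ode_metric F) (total_field F) (\<phi> x) k"
  using isometry_flags[OF N(2) U iso] by blast
 have ode: "third_order_ode D F" and \<phi>: "diffeo_onto_image U \<phi>" and z: "\<phi> x \<in> D"
  using iso x unfolding ode_isometry_def by auto
 note t = flag_transport_consequences[OF \<phi> x f(4)[OF x]]
 show "lie_proportional {x} g V \<longleftrightarrow> wuenschmann F (\<phi> x) = 0"
  unfolding lie_proportional_flag t(3) by (rule ode_flag_proportional[OF ode z])
 show "flag_indep g V x 6" if "wuenschmann F (\<phi> x) \<noteq> 0"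
  unfolding t(1) by (rule ode_flag_indep[OF ode z that])
 show n: "flag_null g V x w \<longleftrightarrow> flag_null (ode_metric F) (total_field F) (\<phi> x) (dd \<phi> x w)" for w by (rule t(2))
 obtain w where w: "dd \<phi> x w = axis 4 1" using diffeo_surj[OF \<phi> x] by blast
 have "w \<notin> span {V x}"
 proof
  assume "w \<in> span {V x}"
  then obtain k where "w = k *R V x" by (auto simp: span_singleton)
  hence "axis 4 1 = (k * f x) *R total_field F (\<phi> x)"
   using w f(3)[OF x] linear_scale[OF dd_lin[OF diffeoD(4)[OF \<phi>] x]] by simp
  hence "(axis 4 1 :: point) $ i = ((k * f x) *R total_field F (\<phi> x)) $ i" for i
   by (rule arg_cong[where f = "\<lambda>v. v $ i"])
  from this[of 1] this[of 4] show False by (auto simp: axis_def)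
 qed
 moreover have "flag_null g V x w" unfolding n w by (rule ode_flag_null[OF ode z])
 ultimately show "\<exists>w. w \<notin> span {V x} \<and> flag_null g V x w" by blast
qed

text \<open>The contact equivalence is the transition map between the two jet spaces. The hypotheses
  are stated on the source, where two isometries can be compared.\<close>

lemma contact_relatedI:
 fixes \<phi>1 \<phi>2 :: "point \<Rightarrow> point"
 assumes 1: "diffeo_onto_image U \<phi>1" and 2: "diffeo_onto_image U \<phi>2"
  and V1: "\<And>x. x \<in> U ==> \<exists>m. m \<noteq> 0 \<and> dd \<phi>1 x (V x) = m *R total_field F1 (\<phi>1 x)"
  and V2: "\<And>x. x \<in> U ==> \<exists>m. m \<noteq> 0 \<and> dd \<phi>2 x (V x) = m *R total_field F2 (\<phi>2 x)"
  and P: "\<And>x w. x \<in> U ==> dd \<phi>1 x w \<in> contact_plane (\<phi>1 x) \<longleftrightarrow> dd \<phi>2 x w \<in> contact_plane (\<phi>2 x)"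
 shows "contact_related U \<phi>1 F1 \<phi>2 F2"
proof -
 define c where "c z = \<phi>2 (inv_into U \<phi>1 z)" for z
 note i = diffeo_inverse[OF 1]
 have cd: "diffeo_onto_image (\<phi>1 ` U) c"
  unfolding c_def by (rule diffeo_compose[OF i(1) 2]) (simp add: i(7))
 have cx: "c (\<phi>1 x) = \<phi>2 x" if "x \<in> U" for x by (simp add: c_def i(2)[OF that])
 have D: "dd c (\<phi>1 x) (dd \<phi>1 x w) = dd \<phi>2 x w" if x: "x \<in> U" for x w
 proof -
  have "dd c (\<phi>1 x) (dd \<phi>1 x w) = dd \<phi>2 (inv_into U \<phi>1 (\<phi>1 x)) (dd (inv_into U \<phi>1) (\<phi>1 x) (dd \<phi>1 x w))"
   unfolding c_def by (rule dd_compose) (use i(2)[OF x] x smooth_onD[OF diffeoD(4)[OF i(1)]] smooth_onD[OF diffeoD(4)[OF 2]] in auto)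
  thus ?thesis by (simp add: i(2,4)[OF x])
 qed
 have "dd c z ` contact_plane z = contact_plane (c z) \<and>
    (\<exists>\<mu>. \<mu> \<noteq> 0 \<and> dd c z (total_field F1 z) = \<mu> *R total_field F2 (c z))"
  if z: "z \<in> \<phi>1 ` U" for z
 proof
  obtain x where x: "x \<in> U" and zx: "z = \<phi>1 x" using z by blast
  show "dd c z ` contact_plane z = contact_plane (c z)"
  proof
   show "dd c z ` contact_plane z \<subseteq> contact_plane (c z)"
   proof
    fix v assume "v \<in> dd c z ` contact_plane z"
    then obtain u where u: "u \<in> contact_plane z" "v = dd c z u" by blast
    obtain w where w: "dd \<phi>1 x w = u" using diffeo_surj[OF 1 x] by blast
    thus "v \<in> contact_plane (c z)" using P[OF x, of w] D[OF x, of w] u by (simp add: zx cx[OF x])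
   qed
   show "contact_plane (c z) \<subseteq> dd c z ` contact_plane z"
   proof
    fix v assume v: "v \<in> contact_plane (c z)"
    obtain w where w: "dd \<phi>2 x w = v" using diffeo_surj[OF 2 x] by blast
    hence "dd \<phi>1 x w \<in> contact_plane z" using P[OF x, of w] v by (simp add: zx cx[OF x])
    moreover have "v = dd c z (dd \<phi>1 x w)" using D[OF x, of w] w zx by simp
    ultimately show "v \<in> dd c z ` contact_plane z" by blast
   qed
  qed
  obtain m n where m: "m \<noteq> 0" "dd \<phi>1 x (V x) = m *R total_field F1 z" and n: "n \<noteq> 0" "dd \<phi>2 x (V x) = n *R total_field F2 (c z)"
   using V1[OF x] V2[OF x] by (auto simp: zx cx[OF x])
  have lin: "linear (dd c z)" by (rule dd_lin[OF diffeoD(4)[OF cd] z])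
  have "m *R dd c z (total_field F1 z) = n *R total_field F2 (c z)"
   using D[OF x, of "V x"] unfolding m(2) n(2) zx[symmetric] by (simp only: linear_scale[OF lin])
  hence "inverse m *R (m *R dd c z (total_field F1 z)) = (n / m) *R total_field F2 (c z)"
   by (simp add: divide_inverse_commute)
  thus "\<exists>\<mu>. \<mu> \<noteq> 0 \<and> dd c z (total_field F1 z) = \<mu> *R total_field F2 (c z)"
   using m(1) n(1) by (intro exI[of _ "n / m"]) simp
 qed
 thus ?thesis unfolding contact_related_def contact_equivalence_def using cd cx by (intro exI[of _ c]) auto
qed

section \<open>The equation of a field of null directions\<close>

abbreviation e4 :: point where "e4 \<equiv> axis 4 1"
abbreviation E4 :: "point \<Rightarrow> point" where "E4 \<equiv> \<lambda>_. e4"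

definition null_dir :: "(point \<Rightarrow> real) \<Rightarrow> point \<Rightarrow> point" where
 "null_dir b z = vector [1, b z, z $ 4, 0]"

definition null_dir' :: "(point \<Rightarrow> real) \<Rightarrow> point \<Rightarrow> point" where
 "null_dir' b z = vector [0, dd b z e4, 1, 0]"

text \<open>The bracket of \<open>null_dir\<close> with \<open>null_dir'\<close> and that of
  \<open>e4\<close> with \<open>null_dir'\<close> are both multiples of the second coordinate field,
  which lies outside the distribution. This is the ratio of the two multiples.\<close>

definition null_coeff :: "(point \<Rightarrow> real) \<Rightarrow> point \<Rightarrow> real" where
 "null_coeff b z = (dd (\<lambda>y. dd b y e4) z (null_dir b z) - dd b z (null_dir' b z)) / dd (\<lambda>y. dd b y e4) z e4"

text \<open>The Cauchy characteristic of the rank-three distribution annihilated by \<open>null_form\<close>; the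
 formula for \<open>null_coeff\<close> is what makes the distribution invariant under it.\<close>

definition char_field :: "(point \<Rightarrow> real) \<Rightarrow> point \<Rightarrow> point" where
 "char_field b z = null_dir b z - null_coeff b z *R e4"

definition null_form :: "(point \<Rightarrow> real) \<Rightarrow> point \<Rightarrow> point" where
 "null_form b z = vector [z $ 4 * dd b z e4 - b z, 1, - dd b z e4, 0]"

lemma e4_nth [simp]: "e4 $ 1 = 0" "e4 $ 2 = 0" "e4 $ 3 = 0" "e4 $ 4 = 1"
 by (simp_all add: axis_def)

lemma null_nth [simp]:
 "null_dir b z $ 1 = 1" "null_dir b z $ 2 = b z" "null_dir b z $ 3 = z $ 4" "null_dir b z $ 4 = 0"
 "null_dir' b z $ 1 = 0" "null_dir' b z $ 2 = dd b z e4" "null_dir' b z $ 3 = 1" "null_dir' b z $ 4 = 0"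
 "null_form b z $ 1 = z $ 4 * dd b z e4 - b z" "null_form b z $ 2 = 1" "null_form b z $ 3 = - dd b z e4" "null_form b z $ 4 = 0"
 "char_field b z $ 1 = 1" "char_field b z $ 2 = b z" "char_field b z $ 3 = z $ 4" "char_field b z $ 4 = - null_coeff b z"
 by (simp_all add: null_dir_def null_dir'_def null_form_def char_field_def)

lemma smooth_on_4:
 fixes f :: "'a::real_normed_vector \<Rightarrow> point"
 assumes "open U" "smooth_on U (\<lambda>z. f z $ 1)" "smooth_on U (\<lambda>z. f z $ 2)" "smooth_on U (\<lambda>z. f z $ 3)" "smooth_on U (\<lambda>z. f z $ 4)"
 shows "smooth_on U f"
proof (rule smooth_on_vec[OF assms(1)])
 fix i show "smooth_on U (\<lambda>z. f z $ i)" using exhaust_4[of i] assms by auto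
qed

lemma inner_4: "(v :: point) \<bullet> w = v $ 1 * w $ 1 + v $ 2 * w $ 2 + v $ 3 * w $ 3 + v $ 4 * w $ 4"
 by (simp add: inner_vec_def sum_4)

text \<open>The condition \<open>nd\<close> says that \<open>null_dir\<close>, its first two
  derivatives along \<open>e4\<close>, and \<open>e4\<close> itself form a frame.\<close>

locale null_field =
 fixes S :: "point set" and b :: "point \<Rightarrow> real"
 assumes S: "open S" and b: "smooth_on S b"
  and nd: "\<And>z. z \<in> S ==> dd (\<lambda>y. dd b y e4) z e4 \<noteq> 0"
begin

lemma smooth_b4: "smooth_on S (\<lambda>z. dd b z e4)"
 by (rule smooth_on_frechet[OF b])

lemma smooth_null_dir: "smooth_on S (null_dir b)" "smooth_on S (null_dir' b)"
 by (rule smooth_on_4[OF S]; simp add: smooth_on_const smooth_on_coord S b smooth_b4)+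

lemma smooth_null_coeff: "smooth_on S (null_coeff b)"
 unfolding null_coeff_def[abs_def]
 by (intro smooth_on_divide smooth_on_diff smooth_on_frechet_field smooth_on_frechet S b smooth_b4 smooth_null_dir nd smooth_on_const)

lemma smooth_char_field: "smooth_on S (char_field b)"
 unfolding char_field_def[abs_def]
 by (intro smooth_on_diff smooth_on_scaleR smooth_null_dir smooth_null_coeff S smooth_on_const)

lemma smooth_null_form: "smooth_on S (null_form b)"
 by (rule smooth_on_4[OF S]; simp; intro smooth_on_diff smooth_on_minus smooth_on_mult smooth_on_const smooth_on_coord S b smooth_b4)

lemma null_form_inner:
 "null_form b z \<bullet> e4 = 0" "null_form b z \<bullet> null_dir b z = 0" "null_form b z \<bullet> char_field b z = 0"
 by (simp_all add: inner_4)

lemma dd_char_field: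
 assumes "z \<in> S"
 shows "dd (char_field b) z v $ 1 = 0" "dd (char_field b) z v $ 2 = dd b z v" "dd (char_field b) z v $ 3 = v $ 4"
  "dd (char_field b) z v $ 4 = - dd (null_coeff b) z v"
 using dd_vec_nth[OF smooth_onD[OF smooth_char_field assms], symmetric]
  dd_minus[OF smooth_onD[OF smooth_null_coeff assms]] by simp_all

lemma dd_null_form:
 assumes "z \<in> S"
 shows "dd (null_form b) z v $ 1 = v $ 4 * dd b z e4 + z $ 4 * dd (\<lambda>y. dd b y e4) z v - dd b z v"
  "dd (null_form b) z v $ 2 = 0" "dd (null_form b) z v $ 3 = - dd (\<lambda>y. dd b y e4) z v" "dd (null_form b) z v $ 4 = 0"
proof -
 note d = smooth_onD[OF smooth_null_form assms] smooth_onD[OF smooth_b4 assms]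
  smooth_onD[OF b assms]
 have c: "(\<lambda>z :: point. z $ 4) differentiable (at z)" by (rule differentiable_vec_nth) simp
 have m: "(\<lambda>z. z $ 4 * dd b z e4) differentiable (at z)"
  by (rule smooth_onD[OF smooth_on_mult[OF S smooth_on_coord[OF S] smooth_b4] assms])
 note n = dd_vec_nth[OF d(1), symmetric]
 show "dd (null_form b) z v $ 1 = v $ 4 * dd b z e4 + z $ 4 * dd (\<lambda>y. dd b y e4) z v - dd b z v"
  unfolding n by (simp add: dd_diff[OF m d(3)] dd_mult[OF c d(2)])
 show "dd (null_form b) z v $ 2 = 0" "dd (null_form b) z v $ 3 = - dd (\<lambda>y. dd b y e4) z v" "dd (null_form b) z v $ 4 = 0"
  unfolding n by (simp_all add: dd_minus[OF d(2)])
qed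

text \<open>The left side is the Lie derivative of \<open>null_form\<close> along
  \<open>char_field\<close>; being a multiple of \<open>null_form\<close>, it makes the kernel
  invariant under the flow.\<close>

lemma char_field_invariance:
 assumes z: "z \<in> S"
 shows "dd (null_form b) z (char_field b z) \<bullet> w + null_form b z \<bullet> dd (char_field b) z w
  = dd b z (axis 2 1) * (null_form b z \<bullet> w)"
proof -
 define b1 b2 b3 b4 b44 l where "b1 = dd b z (axis 1 1)" and "b2 = dd b z (axis 2 1)" and "b3 = dd b z (axis 3 1)"
  and "b4 = dd b z e4" and "b44 = dd (\<lambda>y. dd b y e4) z e4" and "l = null_coeff b z"
 have db: "dd b z v = v $ 1 * b1 + v $ 2 * b2 + v $ 3 * b3 + v $ 4 * b4" for v
  unfolding dd_expand_axis[OF smooth_onD[OF b z], of v] by (simp add: sum_4 b1_def b2_def b3_def b4_def)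
 have lin: "linear (dd (\<lambda>y. dd b y e4) z)" by (rule dd_lin[OF smooth_b4 z])
 have "dd (\<lambda>y. dd b y e4) z (char_field b z) = dd (\<lambda>y. dd b y e4) z (null_dir b z) - l * b44"
  by (simp add: char_field_def linear_diff[OF lin] linear_scale[OF lin] l_def b44_def)
 \<comment> \<open>The definition of \<open>null_coeff\<close> enters here: it trades the derivative
   along \<open>null_dir\<close> of the slope of \<open>b\<close> for the derivative of
   \<open>b\<close> along \<open>null_dir'\<close>.\<close>
 also have "l * b44 = dd (\<lambda>y. dd b y e4) z (null_dir b z) - dd b z (null_dir' b z)"
  using nd[OF z] by (simp add: l_def null_coeff_def b44_def)
 finally have d4: "dd (\<lambda>y. dd b y e4) z (char_field b z) = b4 * b2 + b3"
  by (simp add: db[of "null_dir' b z"] b4_def)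
 show ?thesis
  unfolding inner_4 dd_null_form[OF z] dd_char_field[OF z] d4 null_nth db[of w] db[of "char_field b z"]
  by (simp add: b4_def[symmetric] b2_def[symmetric] l_def[symmetric] algebra_simps)
qed

end

section \<open>Flows transverse to a coordinate hyperplane\<close>

lemma zero_propagation:
 fixes h c :: "real \<Rightarrow> real"
 assumes der: "\<And>s. s \<in> closed_segment p q ==> (h has_vector_derivative c s * h s) (at s)"
  and c: "\<And>s. s \<in> closed_segment p q ==> \<bar>c s\<bar> \<le> C" and C: "0 \<le> C" and 0: "h p = 0"
 shows "h q = 0"
proof -
 define u where "u s = h (p + s)" for s
 have seg: "p + s \<in> closed_segment p q" if "s \<in> closed_segment 0 (q - p)" for s
  using that by (auto simp: closed_segment_eq_real_ivl split: if_splits)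
 have "norm (u (q - p)) \<le> (norm (u 0) + 0) * exp ((C + 1) * \<bar>q - p\<bar>)"
 proof (rule gronwall[OF C])
  fix s assume "s \<in> closed_segment 0 (q - p)"
  note s = seg[OF this]
  have "((\<lambda>s. p + s) has_vector_derivative 1) (at s)" by (auto intro!: derivative_eq_intros)
  from vector_diff_chain_at[OF this der[OF s]]
  show "(u has_vector_derivative c (p + s) * h (p + s)) (at s)" by (simp add: u_def[abs_def] o_def)
  show "norm (c (p + s) * h (p + s)) \<le> C * norm (u s) + 0"
   using mult_right_mono[OF c[OF s], of "\<bar>h (p + s)\<bar>"] by (simp add: u_def abs_mult)
 qed simp
 thus ?thesis using 0 by (simp add: u_def)
qed

text \<open>Along a field whose \<open>k\<close>-th component is 1 that coordinate measures time.
  Used with \<open>k = 1\<close> for \<open>char_field\<close> and with \<open>k = 4\<close> to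
  straighten \<open>V\<close>.\<close>

locale unit_flow =
 fixes S :: "point set" and Z :: "point \<Rightarrow> point" and k :: 4 and T :: real and U0 :: "point set" and \<phi> :: "real \<Rightarrow> point \<Rightarrow> point"
 assumes S: "open S" and Z: "smooth_on S Z" "\<And>z. z \<in> S ==> Z z $ k = 1" and T: "T > 0" and U0: "open U0" "U0 \<subseteq> S" and \<phi>: "smooth_on ({-T<..<T} \<times> U0) (\<lambda>p. \<phi> (fst p) (snd p))"
  and \<phi>0: "\<And>x. x \<in> U0 ==> \<phi> 0 x = x"
  and \<phi>S: "\<And>t x. t \<in> {-T<..<T} ==> x \<in> U0 ==> \<phi> t x \<in> S"
  and \<phi>d: "\<And>t x. t \<in> {-T<..<T} ==> x \<in> U0 ==> ((\<lambda>s. \<phi> s x) has_vector_derivative Z (\<phi> t x)) (at t)"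
  and \<phi>g: "\<And>s t x. t \<in> {-T<..<T} ==> s \<in> {-T<..<T} ==> s + t \<in> {-T<..<T} ==> x \<in> U0 ==> \<phi> t x \<in> U0
   ==> \<phi> s (\<phi> t x) = \<phi> (s + t) x"
begin

definition \<Phi> :: "real \<times> point \<Rightarrow> point" where "\<Phi> p = \<phi> (fst p) (snd p)"

definition Dom :: "(real \<times> point) set" where "Dom = {-T<..<T} \<times> U0"

lemma Dom_open: "open Dom" unfolding Dom_def by (intro open_Times U0 open_greaterThanLessThan)

lemma \<Phi>_smooth: "smooth_on Dom \<Phi>" using \<phi> by (simp add: Dom_def \<Phi>_def[abs_def])

lemma \<Phi>_O: "p \<in> Dom ==> \<Phi> p \<in> S" using \<phi>S by (auto simp: Dom_def \<Phi>_def)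

lemma \<Phi>_time: "p \<in> Dom ==> dd \<Phi> p (s, 0) = s *R Z (\<Phi> p)"
proof -
 assume p: "p \<in> Dom"
 obtain t x where px: "p = (t, x)" by (cases p)
 have tx: "t \<in> {-T<..<T}" "x \<in> U0" using p by (auto simp: px Dom_def)
 have lin: "linear (dd \<Phi> p)" by (rule dd_lin[OF \<Phi>_smooth p])
 have "((\<lambda>s. (s, x)) has_derivative (\<lambda>r. (r, 0))) (at t)" by (auto intro!: derivative_eq_intros)
 from has_derivative_compose[OF this] smooth_on_has_derivative[OF \<Phi>_smooth p]
 have "((\<lambda>s. \<Phi> (s, x)) has_derivative (\<lambda>r. dd \<Phi> p (r, 0))) (at t)" by (simp add: px)
 moreover have "((\<lambda>s. \<Phi> (s, x)) has_derivative (\<lambda>r. r *R Z (\<Phi> p))) (at t)"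
  using \<phi>d[OF tx] by (simp add: \<Phi>_def px has_vector_derivative_def)
 ultimately show ?thesis using has_derivative_unique by metis
qed

lemma \<phi>_coord: assumes "t \<in> {-T<..<T}" "x \<in> U0" shows "\<phi> t x $ k = x $ k + t"
proof -
 have "((\<lambda>s. \<phi> s x $ k - s) has_vector_derivative 0) (at s within {-T<..<T})" if "s \<in> {-T<..<T}" for s
 proof -
  have "((\<lambda>s. \<phi> s x $ k) has_vector_derivative Z (\<phi> s x) $ k) (at s)"
   by (rule bounded_linear.has_vector_derivative[OF bounded_linear_vec_nth \<phi>d[OF that assms(2)]])
  hence "((\<lambda>s. \<phi> s x $ k) has_vector_derivative 1) (at s)"
   using Z(2)[OF \<phi>S[OF that assms(2)]] by simp
  hence "((\<lambda>s. \<phi> s x $ k - s) has_vector_derivative 1 - 1) (at s)"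
   by (intro has_vector_derivative_diff has_vector_derivative_id)
  thus ?thesis by (simp add: has_vector_derivative_at_within)
 qed
 then obtain c where "\<And>s. s \<in> {-T<..<T} ==> \<phi> s x $ k - s = c"
  using has_vector_derivative_zero_constant[of "{-T<..<T}" "\<lambda>s. \<phi> s x $ k - s"] by auto
 from this[OF assms(1)] this[of 0] show ?thesis using T \<phi>0[OF assms(2)] by simp
qed

definition Q :: "point set" where "Q = {z \<in> U0. \<bar>z $ k\<bar> < T}"

text \<open>Follows the flow back to the hyperplane where the \<open>k\<close>-th coordinate
  vanishes; the components of the result are first integrals of \<open>Z\<close>.\<close>

definition \<pi> :: "point \<Rightarrow> point" where "\<pi> z = \<Phi> (- (z $ k), z)"

lemma Q_open: "open Q"
proof -
 have "open {z :: point. \<bar>z $ k\<bar> < T}" by (intro open_Collect_less continuous_intros)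
 moreover have "Q = U0 \<inter> {z. \<bar>z $ k\<bar> < T}" by (auto simp: Q_def)
 ultimately show ?thesis using U0(1) by auto
qed

lemma QDom: "z \<in> Q ==> (- (z $ k), z) \<in> Dom" by (auto simp: Q_def Dom_def)

lemma smooth_pair: "smooth_on Q (\<lambda>z. (- (z $ k), z))"
 by (intro smooth_on_Pair smooth_on_minus smooth_on_coord smooth_on_id Q_open)

lemma \<pi>_smooth: "smooth_on Q \<pi>"
 unfolding \<pi>_def[abs_def] by (rule smooth_on_compose[OF Q_open Dom_open _ smooth_pair \<Phi>_smooth]) (use QDom in auto)

lemma \<pi>_O: "z \<in> Q ==> \<pi> z \<in> S" using \<Phi>_O[OF QDom] by (simp add: \<pi>_def)

lemma \<pi>_1: "z \<in> Q ==> \<pi> z $ k = 0" using \<phi>_coord[of "- (z $ k)" z] by (simp add: \<pi>_def \<Phi>_def Q_def abs_less_iff)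

lemma dd_\<pi>: "z \<in> Q ==> dd \<pi> z v = dd \<Phi> (- (z $ k), z) (0, v) - v $ k *R Z (\<pi> z)"
proof -
 assume z: "z \<in> Q"
 have d: "(\<lambda>z :: point. (- (z $ k), z)) differentiable (at z)" by (rule smooth_onD[OF smooth_pair z])
 have "((\<lambda>z :: point. (- (z $ k), z)) has_derivative (\<lambda>v. (- (v $ k), v))) (at z)"
  by (intro has_derivative_Pair has_derivative_minus has_derivative_ident bounded_linear.has_derivative[OF bounded_linear_vec_nth])
 hence "dd (\<lambda>z :: point. (- (z $ k), z)) z v = (- (v $ k), v)" by (simp add: frechet_eqI)
 hence "dd \<pi> z v = dd \<Phi> (- (z $ k), z) (- (v $ k), v)"
  unfolding \<pi>_def[abs_def] using dd_compose[OF d smooth_onD[OF \<Phi>_smooth QDom[OF z]]] by simp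
 also have "\<dots> = dd \<Phi> (- (z $ k), z) ((0, v) + (- (v $ k), 0))" by simp
 also have "\<dots> = dd \<Phi> (- (z $ k), z) (0, v) + dd \<Phi> (- (z $ k), z) (- (v $ k), 0)"
  by (rule linear_add[OF dd_lin[OF \<Phi>_smooth QDom[OF z]]])
 finally show ?thesis using \<Phi>_time[OF QDom[OF z]] by (simp add: \<pi>_def)
qed

lemma \<pi>_invariant: "z \<in> Q ==> dd \<pi> z (Z z) = 0"
proof -
 assume z: "z \<in> Q"
 hence zU: "z \<in> U0" by (simp add: Q_def)
 have c: "isCont (\<lambda>t. \<phi> t z) 0" using \<phi>d[of 0 z] T zU by (intro has_vector_derivative_continuous) auto
 have ev: "eventually (\<lambda>t. \<phi> t z \<in> Q) (at 0)"
  using c Q_open z unfolding continuous_at by (intro topological_tendstoD) (auto simp: \<phi>0[OF zU])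
 then obtain d where d: "d > 0" "\<And>t. \<bar>t\<bar> < d ==> t \<noteq> 0 ==> \<phi> t z \<in> Q" unfolding eventually_at by (auto simp: dist_real_def)
 have const: "\<pi> (\<phi> t z) = \<pi> z" if t: "t \<in> {- min d (T - \<bar>z $ k\<bar>)<..<min d (T - \<bar>z $ k\<bar>)}" for t
 proof (cases "t = 0")
  case True thus ?thesis by (simp add: \<phi>0[OF zU])
 next
  case False
  hence q: "\<phi> t z \<in> Q" using d(2)[of t] t by auto
  have tT: "t \<in> {-T<..<T}" using t by auto
  have "\<phi> (- (z $ k + t)) (\<phi> t z) = \<phi> (- (z $ k + t) + t) z"
   by (rule \<phi>g) (use t tT q zU z in \<open>auto simp: Q_def\<close>)
  thus ?thesis by (simp add: \<pi>_def \<Phi>_def \<phi>_coord[OF tT zU])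
 qed
 have o: "0 \<in> {- min d (T - \<bar>z $ k\<bar>)<..<min d (T - \<bar>z $ k\<bar>)}" using d z by (auto simp: Q_def)
 have "((\<lambda>t. \<pi> (\<phi> t z)) has_derivative (\<lambda>r. dd \<pi> z (r *R Z z))) (at 0)"
 proof -
  have "((\<lambda>t. \<phi> t z) has_derivative (\<lambda>r. r *R Z z)) (at 0)"
   using \<phi>d[of 0 z] T zU by (simp add: has_vector_derivative_def \<phi>0)
  from has_derivative_compose[OF this, of \<pi>] smooth_on_has_derivative[OF \<pi>_smooth z]
  show ?thesis by (simp add: \<phi>0[OF zU])
 qed
 moreover have "((\<lambda>t. \<pi> (\<phi> t z)) has_derivative (\<lambda>r. 0)) (at 0)"
  by (rule has_derivative_transform_within_open[OF has_derivative_const[of "\<pi> z"] open_greaterThanLessThan o]) (use const in auto)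
 ultimately have "(\<lambda>r. dd \<pi> z (r *R Z z)) = (\<lambda>r. 0)" by (rule has_derivative_unique)
 from fun_cong[OF this, of 1] show ?thesis by simp
qed

end

locale null_flow = null_field + unit_flow S "char_field b" 1 T U0 \<phi> for T U0 \<phi>
begin

text \<open>The value \<open>h\<close> of \<open>null_form\<close> on a vector transported by the
  flow satisfies a homogeneous linear equation by \<open>char_field_invariance\<close>, so it
  vanishes at one time exactly if at another.\<close>

lemma null_form_kernel:
 assumes z: "z \<in> Q"
 shows "null_form b (\<pi> z) \<bullet> dd \<pi> z v = 0 \<longleftrightarrow> null_form b z \<bullet> v = 0"
proof -
 define h where "h t = null_form b (\<Phi> (t, z)) \<bullet> dd \<Phi> (t, z) (0, v)" for t
 define c where "c t = dd b (\<Phi> (t, z)) (axis 2 1)" for t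
 have zU: "z \<in> U0" and z1: "\<bar>z $ 1\<bar> < T" using z by (auto simp: Q_def)
 have D: "(t, z) \<in> Dom" if "t \<in> {-T<..<T}" for t using that zU by (simp add: Dom_def)
 have hd: "(h has_vector_derivative c t * h t) (at t)" if t: "t \<in> {-T<..<T}" for t
 proof -
  define p where "p = (t, z)"
  have p: "p \<in> Dom" using D[OF t] by (simp add: p_def)
  note S' = \<Phi>_O[OF p]
  have inc: "((\<lambda>s. (s, z)) has_derivative (\<lambda>r. (r, 0))) (at t)" by (auto intro!: derivative_eq_intros)
  have J: "smooth_on Dom (\<lambda>p. dd \<Phi> p (0, v))" by (rule smooth_on_frechet[OF \<Phi>_smooth])
  \<comment> \<open>The linearized equation for transported vectors, obtained by exchanging the
    derivatives in time and in the initial point.\<close>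
  have Jd: "((\<lambda>s. dd \<Phi> (s, z) (0, v)) has_vector_derivative dd (char_field b) (\<Phi> p) (dd \<Phi> p (0, v))) (at t)"
  proof -
   have "((\<lambda>s. dd \<Phi> (s, z) (0, v)) has_derivative (\<lambda>r. dd (\<lambda>p. dd \<Phi> p (0, v)) p (r, 0))) (at t)"
    using has_derivative_compose[OF inc] smooth_on_has_derivative[OF J p] unfolding p_def by blast
   moreover have "dd (\<lambda>p. dd \<Phi> p (0, v)) p (r, 0) = r *R dd (char_field b) (\<Phi> p) (dd \<Phi> p (0, v))" for r
   proof -
    have "dd (\<lambda>p. dd \<Phi> p (0, v)) p (r, 0) = dd (\<lambda>p. dd \<Phi> p (r, 0)) p (0, v)"
     by (rule frechet_symmetric[OF Dom_open p \<Phi>_smooth])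
    also have "dd (\<lambda>p. dd \<Phi> p (r, 0)) p = dd (\<lambda>p. r *R char_field b (\<Phi> p)) p"
     by (rule frechet_cong[OF Dom_open p \<Phi>_time])
    also have "dd (\<lambda>p. r *R char_field b (\<Phi> p)) p (0, v) = r *R dd (\<lambda>p. char_field b (\<Phi> p)) p (0, v)"
     by (rule frechet_linear[OF bounded_linear_scaleR_right])
      (rule smooth_onD[OF smooth_on_compose[OF Dom_open S _ \<Phi>_smooth smooth_char_field] p], use \<Phi>_O in auto)
    also have "dd (\<lambda>p. char_field b (\<Phi> p)) p (0, v) = dd (char_field b) (\<Phi> p) (dd \<Phi> p (0, v))"
     by (rule dd_compose[OF smooth_onD[OF \<Phi>_smooth p] smooth_onD[OF smooth_char_field S']])
    finally show ?thesis .
   qed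
   ultimately show ?thesis by (simp add: has_vector_derivative_def)
  qed
  have nd': "((\<lambda>s. null_form b (\<Phi> (s, z))) has_vector_derivative dd (null_form b) (\<Phi> p) (char_field b (\<Phi> p))) (at t)"
  proof -
   have "((\<lambda>s. \<Phi> (s, z)) has_derivative (\<lambda>r. dd \<Phi> p (r, 0))) (at t)"
    using has_derivative_compose[OF inc] smooth_on_has_derivative[OF \<Phi>_smooth p] unfolding p_def by blast
   from has_derivative_compose[OF this, of "null_form b"] smooth_on_has_derivative[OF smooth_null_form S']
   have "((\<lambda>s. null_form b (\<Phi> (s, z))) has_derivative (\<lambda>r. dd (null_form b) (\<Phi> p) (dd \<Phi> p (r, 0)))) (at t)"
    by (simp add: p_def)
   thus ?thesis
    by (simp add: has_vector_derivative_def \<Phi>_time[OF p] linear_scale[OF dd_lin[OF smooth_null_form S']])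
  qed
  from bounded_bilinear.has_vector_derivative[OF bounded_bilinear_inner nd' Jd]
  show ?thesis using char_field_invariance[OF S', of "dd \<Phi> p (0, v)"] unfolding h_def[abs_def] c_def p_def by (simp add: add.commute)
 qed
 have cc: "continuous_on {-T<..<T} c"
 proof -
  have "continuous_on {-T<..<T} (\<lambda>t. \<Phi> (t, z))"
   by (rule continuous_on_compose2[OF smooth_on_continuous[OF \<Phi>_smooth]]) (use D in \<open>auto intro!: continuous_intros\<close>)
  thus ?thesis unfolding c_def
   by (rule continuous_on_compose2[OF smooth_on_continuous[OF smooth_on_frechet[OF b]]]) (use D \<Phi>_O in auto)
 qed
 have sub: "closed_segment 0 (- (z $ 1)) \<subseteq> {-T<..<T}" using z1 T by (auto simp: closed_segment_eq_real_ivl split: if_splits)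
 have "bounded (c ` closed_segment 0 (- (z $ 1)))"
  by (intro compact_imp_bounded compact_continuous_image continuous_on_subset[OF cc sub] compact_segment)
 then obtain C where C: "C > 0" "\<And>t. t \<in> closed_segment 0 (- (z $ 1)) ==> \<bar>c t\<bar> \<le> C" unfolding bounded_pos by auto
 have "h 0 = 0 \<longleftrightarrow> h (- (z $ 1)) = 0"
 proof
  show "h (- (z $ 1)) = 0" if "h 0 = 0"
   by (rule zero_propagation[OF hd C(2) _ that]) (use sub C in auto)
  show "h 0 = 0" if "h (- (z $ 1)) = 0"
   by (rule zero_propagation[OF hd C(2) _ that]) (use sub C in \<open>auto simp: closed_segment_commute\<close>)
 qed
 moreover have "h 0 = null_form b z \<bullet> v"
 proof -
  have p0: "(0, z) \<in> Dom" using D T by simp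
  have inc: "((\<lambda>z. (0::real, z)) has_derivative (\<lambda>v. (0, v))) (at z)" by (auto intro!: derivative_eq_intros simp: zero_prod_def)
  have di: "(\<lambda>z. (0::real, z)) differentiable (at z)" using inc by (rule differentiableI)
  have "dd (\<lambda>z. \<Phi> (0, z)) z v = dd \<Phi> (0, z) (dd (\<lambda>z. (0::real, z)) z v)"
   using dd_compose[OF di, of \<Phi> v] smooth_onD[OF \<Phi>_smooth p0] by simp
  hence "dd (\<lambda>z. \<Phi> (0, z)) z v = dd \<Phi> (0, z) (0, v)" unfolding frechet_eqI[OF inc] .
  moreover have "dd (\<lambda>z. \<Phi> (0, z)) z = dd (\<lambda>z. z) z"
   by (rule frechet_cong[OF U0(1) zU]) (simp add: \<Phi>_def \<phi>0)
  ultimately show ?thesis by (simp add: h_def \<Phi>_def \<phi>0[OF zU])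
 qed
 moreover have "h (- (z $ 1)) = null_form b (\<pi> z) \<bullet> dd \<pi> z v"
  unfolding dd_\<pi>[OF z] by (simp add: h_def \<pi>_def inner_diff_right null_form_inner)
 ultimately show ?thesis by simp
qed

end

text \<open>Charts are needed around a whole segment of a fibre of \<open>V\<close>, not just around a point: gauge
 transformations must compare two points of the same fibre in one chart.\<close>

definition slab :: "real \<Rightarrow> real \<Rightarrow> real \<Rightarrow> point set" where
 "slab s1 s2 r = {z. \<bar>z $ 1\<bar> < r \<and> \<bar>z $ 2\<bar> < r \<and> \<bar>z $ 3\<bar> < r \<and> s1 - r < z $ 4 \<and> z $ 4 < s2 + r}"

lemma open_slab: "open (slab s1 s2 r)"
 unfolding slab_def by (intro open_Collect_conj open_Collect_less continuous_intros)

lemma slab_axis: "r > 0 ==> s1 \<le> s ==> s \<le> s2 ==> s *R e4 \<in> slab s1 s2 r"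
 by (simp add: slab_def)

lemma slab_mono: "r \<le> r' ==> slab s1 s2 r \<subseteq> slab s1 s2 r'"
 by (auto simp: slab_def)

lemma segment_axis:
 assumes "s1 \<le> s2"
 shows "compact ((\<lambda>s. s *R e4) ` {s1..s2})" "convex ((\<lambda>s. s *R e4) ` {s1..s2})" "(\<lambda>s. s *R e4) ` {s1..s2} \<noteq> {}"
proof -
 show "compact ((\<lambda>s. s *R e4) ` {s1..s2})"
  by (intro compact_continuous_image continuous_intros compact_Icc)
 show "convex ((\<lambda>s. s *R e4) ` {s1..s2})"
  by (rule convex_linear_image) (auto intro: linearI simp: scaleR_add_left)
qed (use assms in auto)

text \<open>A tube lemma around a whole segment of the fourth axis, with time as an additional
  direction.\<close>

lemma thicken_pair:
 fixes P :: "(real \<times> point) set"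
 assumes "open P" "s1 \<le> s2" "\<And>s. s1 \<le> s ==> s \<le> s2 ==> (0, s *R e4) \<in> P"
 shows "\<exists>r>0. \<forall>t z. \<bar>t\<bar> < r \<longrightarrow> z \<in> slab s1 s2 r \<longrightarrow> (t, z) \<in> P"
proof -
 let ?K = "{0 :: real} \<times> ((\<lambda>s. s *R e4) ` {s1..s2})"
 have "compact ?K" by (intro compact_Times segment_axis assms(2)) simp
 moreover have "?K \<subseteq> P" using assms(3) by auto
 ultimately obtain e where e: "e > 0" "(\<Union>x\<in>?K. ball x e) \<subseteq> P"
  using compact_subset_open_imp_ball_epsilon_subset[OF _ assms(1)] by blast
 \<comment> \<open>A fifth of \<open>e\<close> for each of the five coordinates of
   \<open>(t, z)\<close>.\<close>
 have "(t, z) \<in> P" if t: "\<bar>t\<bar> < e / 5" and z: "z \<in> slab s1 s2 (e / 5)" for t z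
 proof -
  define s where "s = max s1 (min s2 (z $ 4))"
  have s: "s \<in> {s1..s2}" using assms(2) by (auto simp: s_def)
  have "norm ((0, s *R e4) - (t, z)) \<le> norm (0 - t) + norm (s *R e4 - z)"
   using norm_Pair_le[of "0 - t" "s *R e4 - z"] by simp
  also have "norm (s *R e4 - z) \<le> (\<Sum>i\<in>UNIV. \<bar>(s *R e4 - z) $ i\<bar>)" by (rule norm_le_l1_cart)
  also have "\<dots> = \<bar>z $ 1\<bar> + \<bar>z $ 2\<bar> + \<bar>z $ 3\<bar> + \<bar>s - z $ 4\<bar>" by (simp add: sum_4)
  also have "\<bar>s - z $ 4\<bar> < e / 5" using z e(1) assms(2) unfolding slab_def s_def by (auto simp: max_def min_def)
  finally have "dist (0, s *R e4) (t, z) < e" using t z by (simp add: dist_norm slab_def)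
  hence "(t, z) \<in> ball (0, s *R e4) e" by simp
  moreover have "(0, s *R e4) \<in> ?K" using s by blast
  ultimately show ?thesis using e(2) by blast
 qed
 thus ?thesis using e(1) by (intro exI[of _ "e / 5"]) auto
qed

lemma thicken:
 assumes "open P" "s1 \<le> s2" "\<And>s. s1 \<le> s ==> s \<le> s2 ==> s *R e4 \<in> P"
 shows "\<exists>r>0. slab s1 s2 r \<subseteq> P"
proof -
 have "\<exists>r>0. \<forall>t z. \<bar>t\<bar> < r \<longrightarrow> z \<in> slab s1 s2 r \<longrightarrow> (t, z) \<in> (UNIV :: real set) \<times> P"
  by (rule thicken_pair) (use assms in \<open>auto intro: open_Times\<close>)
 then obtain r where "r > 0" "\<And>t z. \<bar>t\<bar> < r ==> z \<in> slab s1 s2 r ==> z \<in> P" by auto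
 from this(1) this(2)[of 0] show ?thesis by (intro exI[of _ r]) auto
qed

lemma inj_on_derivative_nonzero:
 fixes f :: "real \<Rightarrow> real"
 assumes "\<And>s. s \<in> closed_segment p q ==> (f has_real_derivative f' s) (at s)"
  and "\<And>s. s \<in> closed_segment p q ==> f' s \<noteq> 0" and "f p = f q"
 shows "p = q"
proof -
 have *: False if pq: "p < q" "f p = f q" "\<And>s. p \<le> s ==> s \<le> q ==> (f has_real_derivative f' s) (at s)"
  "\<And>s. p \<le> s ==> s \<le> q ==> f' s \<noteq> 0" for p q
 proof -
  obtain z where "p < z" "z < q" "f q - f p = (q - p) * f' z" using MVT2[OF pq(1,3)] by blast
  thus False using pq(1,2) pq(4)[of z] by simp
 qed
 show ?thesis
 proof (cases "p = q")
  case False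
  then consider "p < q" | "q < p" by linarith
  thus ?thesis
  proof cases
   case 1 thus ?thesis using *[of p q] assms by (simp add: closed_segment_eq_real_ivl)
  next
   case 2 thus ?thesis using *[of q p] assms by (simp add: closed_segment_eq_real_ivl)
  qed
 qed
qed

lemma dd_curve:
 assumes "f differentiable (at (c t))" "(c has_vector_derivative v) (at t)"
 shows "((\<lambda>s. f (c s)) has_vector_derivative dd f (c t) v) (at t)"
proof -
 from has_derivative_compose[OF assms(2)[unfolded has_vector_derivative_def] assms(1)[unfolded frechet_derivative_works]]
 show ?thesis unfolding has_vector_derivative_def by (simp add: linear_scale[OF dd_linear[OF assms(1)]])
qed

lemma open_nonzero:
 fixes f :: "point \<Rightarrow> real"
 assumes "open A" "continuous_on A f"
 shows "open {z \<in> A. f z \<noteq> 0}"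
proof -
 have "{z \<in> A. f z \<noteq> 0} = f -` (- {0}) \<inter> A" by auto
 thus ?thesis using assms continuous_on_open_vimage[OF assms(1)] by (metis open_Compl closed_singleton)
qed

section \<open>The jet chart and the equation of a field of directions\<close>

context null_flow
begin

text \<open>The jet coordinates \<open>x, y, p, q\<close> of the equation: up to a function, \<open>null_form\<close> is \<open>dY - P dX\<close>.\<close>

definition X where "X z = dd b (\<pi> z) e4"
definition P where "P z = - (\<pi> z $ 3)"
definition Y where "Y z = \<pi> z $ 2 - \<pi> z $ 3 * X z"

lemma XYP_smooth: "smooth_on Q X" "smooth_on Q P" "smooth_on Q Y"
proof -
 show X: "smooth_on Q X" unfolding X_def[abs_def]
  by (rule smooth_on_compose[OF Q_open S _ \<pi>_smooth smooth_b4]) (use \<pi>_O in auto)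
 show "smooth_on Q P" "smooth_on Q Y" unfolding P_def[abs_def] Y_def[abs_def]
  by (intro smooth_on_minus smooth_on_diff smooth_on_mult smooth_on_nth X \<pi>_smooth Q_open)+
qed

lemma dd_XYP:
 assumes z: "z \<in> Q"
 shows "dd X z v = dd (\<lambda>y. dd b y e4) (\<pi> z) (dd \<pi> z v)" "dd P z v = - (dd \<pi> z v $ 3)"
  "dd Y z v = dd \<pi> z v $ 2 - dd \<pi> z v $ 3 * X z - \<pi> z $ 3 * dd X z v" "dd \<pi> z v $ 1 = 0"
proof -
 note d\<pi> = smooth_onD[OF \<pi>_smooth z] and dX = smooth_onD[OF XYP_smooth(1) z]
 note dn = differentiable_vec_nth[OF d\<pi>]
 show "dd X z v = dd (\<lambda>y. dd b y e4) (\<pi> z) (dd \<pi> z v)"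
  unfolding X_def[abs_def] by (rule dd_compose[OF d\<pi> smooth_onD[OF smooth_b4 \<pi>_O[OF z]]])
 show "dd P z v = - (dd \<pi> z v $ 3)" unfolding P_def[abs_def] by (simp add: dd_minus[OF dn] dd_vec_nth[OF d\<pi>])
 have m: "(\<lambda>z. \<pi> z $ 3 * X z) differentiable (at z)"
  by (rule smooth_onD[OF smooth_on_mult[OF Q_open smooth_on_nth[OF Q_open \<pi>_smooth] XYP_smooth(1)] z])
 show "dd Y z v = dd \<pi> z v $ 2 - dd \<pi> z v $ 3 * X z - \<pi> z $ 3 * dd X z v"
  unfolding Y_def[abs_def] by (simp add: dd_diff[OF dn m] dd_mult[OF dn dX] dd_vec_nth[OF d\<pi>])
 have "dd (\<lambda>z. \<pi> z $ 1) z = dd (\<lambda>z. 0 :: real) z" by (rule frechet_cong[OF Q_open z]) (rule \<pi>_1)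
 thus "dd \<pi> z v $ 1 = 0" using dd_vec_nth[OF d\<pi>, of 1 v] by simp
qed

text \<open>On the hyperplane \<open>z $ 1 = 0\<close> the form \<open>null_form\<close> restricts
  to dz2 - b4 dz3, with b4 the derivative of \<open>b\<close> along \<open>e4\<close>. The Legendre
  transform X = b4, P = -z3, Y = z2 - z3 b4 makes it dY - P dX, and \<open>null_form_kernel\<close>
  carries this along the flow.\<close>

lemma contact_form_kernel:
 assumes z: "z \<in> Q"
 shows "dd Y z v = P z * dd X z v \<longleftrightarrow> null_form b z \<bullet> v = 0"
proof -
 have "null_form b (\<pi> z) \<bullet> dd \<pi> z v = dd Y z v - P z * dd X z v"
  using dd_XYP[OF z] by (simp add: inner_4 P_def X_def)
 thus ?thesis using null_form_kernel[OF z, of v] by simp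
qed

lemma XYP_invariant:
 assumes "z \<in> Q"
 shows "dd X z (char_field b z) = 0" "dd P z (char_field b z) = 0"
 using \<pi>_invariant[OF assms] linear_0[OF dd_lin[OF smooth_b4 \<pi>_O[OF assms]]]
 by (simp_all add: dd_XYP[OF assms])

lemma at_section:
 assumes z: "z \<in> U0" and z1: "z $ 1 = 0"
 shows "z \<in> Q" "\<pi> z = z" "dd \<pi> z v = v - v $ 1 *R char_field b z"
proof -
 show Q: "z \<in> Q" using z z1 T by (simp add: Q_def)
 show p: "\<pi> z = z" using \<phi>0[OF z] by (simp add: \<pi>_def \<Phi>_def z1)
 have p0: "(0, z) \<in> Dom" using z T by (simp add: Dom_def)
 have inc: "((\<lambda>z. (0::real, z)) has_derivative (\<lambda>v. (0, v))) (at z)" by (auto intro!: derivative_eq_intros simp: zero_prod_def)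
 have di: "(\<lambda>z. (0::real, z)) differentiable (at z)" using inc by (rule differentiableI)
 have "dd (\<lambda>z. \<Phi> (0, z)) z v = dd \<Phi> (0, z) (dd (\<lambda>z. (0::real, z)) z v)"
  using dd_compose[OF di, of \<Phi> v] smooth_onD[OF \<Phi>_smooth p0] by simp
 hence "dd (\<lambda>z. \<Phi> (0, z)) z v = dd \<Phi> (0, z) (0, v)" unfolding frechet_eqI[OF inc] .
 moreover have "dd (\<lambda>z. \<Phi> (0, z)) z = dd (\<lambda>z. z) z"
  by (rule frechet_cong[OF U0(1) z]) (simp add: \<Phi>_def \<phi>0)
 ultimately show "dd \<pi> z v = v - v $ 1 *R char_field b z"
  using dd_\<pi>[OF Q, of v] by (simp add: z1 p)
qed

definition Q1 where "Q1 = {z \<in> Q. dd X z e4 \<noteq> 0}"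

lemma Q1_open: "open Q1"
 unfolding Q1_def by (intro open_nonzero Q_open smooth_on_continuous[OF smooth_on_frechet[OF XYP_smooth(1)]])

lemma Q1Q: "Q1 \<subseteq> Q" by (auto simp: Q1_def)

text \<open>The ratio is forced: the image of \<open>e4\<close> is to be a multiple of the total
  derivative, along which dp = q dx.\<close>

definition q where "q z = dd P z e4 / dd X z e4"

lemma q_smooth: "smooth_on Q1 q"
 unfolding q_def[abs_def]
 by (intro smooth_on_divide Q1_open smooth_on_frechet smooth_on_subset[OF XYP_smooth(1) Q1Q] smooth_on_subset[OF XYP_smooth(2) Q1Q])
  (simp add: Q1_def)

definition Q2 where "Q2 = {z \<in> Q1. dd q z (char_field b z) \<noteq> 0}"

lemma Q_sub: "Q \<subseteq> S" using U0(2) by (auto simp: Q_def)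

lemma Q2_open: "open Q2"
 unfolding Q2_def
 by (intro open_nonzero Q1_open smooth_on_continuous smooth_on_frechet_field q_smooth
  smooth_on_subset[OF smooth_char_field order_trans[OF Q1Q Q_sub]])

lemma Q2Q: "Q2 \<subseteq> Q" "Q2 \<subseteq> Q1" "Q2 \<subseteq> U0" by (auto simp: Q2_def Q1_def Q_def)

text \<open>On the hyperplane the derivative of \<open>X\<close> along \<open>e4\<close> is the
  quantity in \<open>nd\<close>. The derivative of \<open>P\<close> along \<open>e4\<close> vanishes
  there but changes at unit rate along \<open>char_field\<close>, because \<open>P\<close> is a
  first integral and the third component of \<open>char_field\<close> is \<open>z $ 4\<close>; hence
  \<open>q\<close> changes too.\<close>

lemma section_Q2:
 assumes z: "z \<in> U0" and z1: "z $ 1 = 0"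
 shows "z \<in> Q2"
proof -
 note s = at_section[OF z z1]
 have zS: "z \<in> S" using z U0 by auto
 have X4: "dd X z e4 = dd (\<lambda>y. dd b y e4) z e4" by (simp add: dd_XYP[OF s(1)] s)
 have q1: "z \<in> Q1" using s(1) nd[OF zS] by (simp add: Q1_def X4)
 have P4: "dd P z e4 = 0" by (simp add: dd_XYP[OF s(1)] s)
 note dX = smooth_onD[OF smooth_on_frechet[OF XYP_smooth(1)] s(1)]
 note dP = smooth_onD[OF smooth_on_frechet[OF XYP_smooth(2)] s(1)]
 have "dd (\<lambda>z. dd P z (char_field b z)) z = dd (\<lambda>z. 0 :: real) z"
  by (rule frechet_cong[OF Q_open s(1)]) (rule XYP_invariant)
 hence "dd P z (dd (char_field b) z e4) + dd (\<lambda>z. dd P z e4) z (char_field b z) = 0"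
  using dd_field[OF Q_open s(1) XYP_smooth(2) smooth_onD[OF smooth_char_field zS], of e4] by simp
 moreover have "dd P z (dd (char_field b) z e4) = - 1"
  unfolding dd_XYP[OF s(1)] s(3) by (simp add: dd_char_field[OF zS])
 ultimately have L: "dd (\<lambda>z. dd P z e4) z (char_field b z) = 1" by simp
 have "dd q z (char_field b z) = (1 * dd X z e4 - 0) / (dd X z e4)\<^sup>2"
  unfolding q_def[abs_def] using dd_divide[OF dP dX, of e4 e4 "char_field b z"] q1 by (simp add: L P4 Q1_def)
 thus ?thesis using q1 by (simp add: Q2_def Q1_def)
qed

definition \<Psi> :: "point \<Rightarrow> point" where "\<Psi> z = vector [X z, Y z, P z, q z]"

lemma \<Psi>_nth [simp]: "\<Psi> z $ 1 = X z" "\<Psi> z $ 2 = Y z" "\<Psi> z $ 3 = P z" "\<Psi> z $ 4 = q z"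
 by (simp_all add: \<Psi>_def)

lemma \<Psi>_smooth: "smooth_on Q2 \<Psi>"
 by (rule smooth_on_4[OF Q2_open]; simp; rule smooth_on_subset, rule XYP_smooth q_smooth, rule Q2Q)

lemma dd_\<Psi>:
 assumes z: "z \<in> Q2"
 shows "dd \<Psi> z v $ 1 = dd X z v" "dd \<Psi> z v $ 2 = dd Y z v" "dd \<Psi> z v $ 3 = dd P z v" "dd \<Psi> z v $ 4 = dd q z v"
 using dd_vec_nth[OF smooth_onD[OF \<Psi>_smooth z], symmetric] by simp_all

text \<open>Injectivity is obtained in two steps. \<open>X\<close>, \<open>Y\<close>,
  \<open>P\<close> determine the point \<open>\<pi> z\<close>, as \<open>X\<close> has nonzero
  derivative along the fibre; then \<open>q\<close> determines the position on the characteristic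
  curve, as it has nonzero derivative there.\<close>

lemma chart_theorem:
 assumes s12: "s1 \<le> s2" and seg: "\<And>s. s1 \<le> s ==> s \<le> s2 ==> s *R e4 \<in> U0"
 shows "\<exists>r>0. slab s1 s2 r \<subseteq> S \<and> diffeo_onto_image (slab s1 s2 r) \<Psi> \<and>
  (\<exists>F. third_order_ode (\<Psi> ` slab s1 s2 r) F \<and> (\<forall>z\<in>slab s1 s2 r.
    dd \<Psi> z (null_dir b z) \<in> contact_plane (\<Psi> z) \<and> (\<exists>m. m \<noteq> 0 \<and> dd \<Psi> z e4 = m *R total_field F (\<Psi> z))))"
proof -
 have oP: "open {p \<in> Dom. \<Phi> p \<in> A \<and> snd p \<in> A}" if "open A" for A
 proof -
  have "open (\<Phi> -` A \<inter> Dom)" using smooth_on_continuous[OF \<Phi>_smooth] that continuous_on_open_vimage[OF Dom_open] by blast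
  moreover have "open ((UNIV :: real set) \<times> A)" by (intro open_Times open_UNIV that)
  moreover have "{p \<in> Dom. \<Phi> p \<in> A \<and> snd p \<in> A} = (\<Phi> -` A \<inter> Dom) \<inter> (UNIV \<times> A)" by auto
  ultimately show ?thesis by auto
 qed
 have \<Phi>0: "\<Phi> (0, z) = z" if "z \<in> U0" for z using \<phi>0[OF that] by (simp add: \<Phi>_def)
 have D0: "(0, z) \<in> Dom" if "z \<in> U0" for z using that T by (simp add: Dom_def)
 \<comment> \<open>Two radii: flowing from the slab of radius \<open>r2\<close> for short times
   stays in \<open>Q2\<close>, and from the slab of radius \<open>r1\<close> one lands in the slab
   of radius \<open>r2\<close>, so that the flow can be restarted at \<open>\<pi> z\<close>.\<close>
 have "\<exists>r>0. \<forall>t z. \<bar>t\<bar> < r \<longrightarrow> z \<in> slab s1 s2 r \<longrightarrow> (t, z) \<in> {p \<in> Dom. \<Phi> p \<in> Q2 \<and> snd p \<in> Q2}"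
  by (rule thicken_pair[OF oP[OF Q2_open] s12]) (use seg D0 \<Phi>0 section_Q2 in auto)
 then obtain r2 where r2: "r2 > 0" "\<And>t z. \<bar>t\<bar> < r2 ==> z \<in> slab s1 s2 r2 ==> (t, z) \<in> Dom \<and> \<Phi> (t, z) \<in> Q2 \<and> z \<in> Q2" by auto
 have "\<exists>r>0. \<forall>t z. \<bar>t\<bar> < r \<longrightarrow> z \<in> slab s1 s2 r \<longrightarrow> (t, z) \<in> {p \<in> Dom. \<Phi> p \<in> slab s1 s2 r2 \<and> snd p \<in> slab s1 s2 r2}"
  by (rule thicken_pair[OF oP[OF open_slab] s12]) (use seg D0 \<Phi>0 slab_axis r2(1) in auto)
 then obtain r1 where r1: "r1 > 0" "\<And>t z. \<bar>t\<bar> < r1 ==> z \<in> slab s1 s2 r1 ==> (t, z) \<in> Dom \<and> \<Phi> (t, z) \<in> slab s1 s2 r2" by auto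
 define r where "r = min r1 r2"
 have r: "r > 0" "r \<le> r1" "r \<le> r2" using r1 r2 by (auto simp: r_def)
 let ?B = "slab s1 s2 r"
 have B2: "z \<in> Q2" "\<bar>z $ 1\<bar> < r" "z \<in> slab s1 s2 r2" "z \<in> Q" "z \<in> U0" if "z \<in> ?B" for z
 proof -
  show 1: "z \<in> slab s1 s2 r2" using slab_mono[OF r(3)] that by auto
  show "z \<in> Q2" using r2(2)[of 0 z] r2(1) 1 by auto
  thus "z \<in> Q" "z \<in> U0" using Q2Q by auto
  show "\<bar>z $ 1\<bar> < r" using that by (simp add: slab_def)
 qed
 have \<pi>B: "\<pi> z \<in> slab s1 s2 r2" "\<pi> z \<in> Q2" "\<pi> z \<in> U0" "(t, \<pi> z) \<in> Dom" "\<Phi> (t, \<pi> z) \<in> Q2" if z: "z \<in> ?B" and t: "\<bar>t\<bar> < r" for z t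
 proof -
  have "z \<in> slab s1 s2 r1" using slab_mono[OF r(2)] z by auto
  thus 1: "\<pi> z \<in> slab s1 s2 r2" using r1(2)[of "- (z $ 1)" z] B2(2)[OF z] r by (simp add: \<pi>_def)
  show "\<pi> z \<in> Q2" "(t, \<pi> z) \<in> Dom" "\<Phi> (t, \<pi> z) \<in> Q2" using r2(2)[OF _ 1, of t] t r by auto
  thus "\<pi> z \<in> U0" using Q2Q by auto
 qed
 have rT: "r \<le> T"
 proof (rule ccontr)
  assume "\<not> r \<le> T"
  hence "(T, s1 *R e4) \<in> Dom" using r2(2)[of T "s1 *R e4"] slab_axis[OF r2(1), of s1 s1 s2] s12 r T by auto
  thus False by (simp add: Dom_def)
 qed
 have retrace: "z = \<Phi> (z $ 1, \<pi> z)" if z: "z \<in> ?B" for z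
 proof -
  have "\<phi> (z $ 1) (\<phi> (- (z $ 1)) z) = \<phi> (z $ 1 + - (z $ 1)) z"
   by (rule \<phi>g) (use B2[OF z] rT \<pi>B(3)[OF z B2(2)[OF z]] T in \<open>auto simp: \<pi>_def \<Phi>_def\<close>)
  thus ?thesis using \<phi>0[OF B2(5)[OF z]] by (simp add: \<pi>_def \<Phi>_def)
 qed
 have inj: "inj_on \<Psi> ?B"
 proof (rule inj_onI)
  fix z z' assume z: "z \<in> ?B" and z': "z' \<in> ?B" and e: "\<Psi> z = \<Psi> z'"
  have eX: "X z = X z'" and eY: "Y z = Y z'" and eP: "P z = P z'" and eq: "q z = q z'"
   using arg_cong[OF e, of "\<lambda>v. v $ 1"] arg_cong[OF e, of "\<lambda>v. v $ 2"] arg_cong[OF e, of "\<lambda>v. v $ 3"] arg_cong[OF e, of "\<lambda>v. v $ 4"] by simp_all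
  have 3: "\<pi> z $ 3 = \<pi> z' $ 3" using eP by (simp add: P_def)
  have 2: "\<pi> z $ 2 = \<pi> z' $ 2" using eY eX 3 by (simp add: Y_def)
  have 1: "\<pi> z $ 1 = \<pi> z' $ 1" using \<pi>_1 B2 z z' by simp
  have 4: "\<pi> z $ 4 = \<pi> z' $ 4"
  proof (rule inj_on_derivative_nonzero)
   define c where "c s = \<pi> z + (s - \<pi> z $ 4) *R e4" for s
   have c4: "c (\<pi> z $ 4) = \<pi> z" "c (\<pi> z' $ 4) = \<pi> z'"
    using 1 2 3 by (simp_all add: c_def vec_eq_iff forall_4)
   show "dd b (c (\<pi> z $ 4)) e4 = dd b (c (\<pi> z' $ 4)) e4" using eX by (simp add: X_def c4)
   fix s assume s: "s \<in> closed_segment (\<pi> z $ 4) (\<pi> z' $ 4)"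
   have "c s \<in> slab s1 s2 r2"
    using \<pi>B(1)[OF z B2(2)[OF z]] \<pi>B(1)[OF z' B2(2)[OF z']] s
    by (auto simp: slab_def c_def closed_segment_eq_real_ivl split: if_splits)
   hence cS: "c s \<in> S" using r2(2)[of 0 "c s"] r2(1) Q2Q Q_sub by auto
   have "(c has_vector_derivative e4) (at s)" unfolding c_def by (auto intro!: derivative_eq_intros)
   from dd_curve[OF smooth_onD[OF smooth_b4 cS] this]
   show "((\<lambda>s. dd b (c s) e4) has_real_derivative dd (\<lambda>y. dd b y e4) (c s) e4) (at s)"
    by (simp add: has_real_derivative_iff_has_vector_derivative)
   show "dd (\<lambda>y. dd b y e4) (c s) e4 \<noteq> 0" by (rule nd[OF cS])
  qed
  have u: "\<pi> z = \<pi> z'" using 1 2 3 4 by (simp add: vec_eq_iff forall_4)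
  have "z $ 1 = z' $ 1"
  proof (rule inj_on_derivative_nonzero)
   show "q (\<Phi> (z $ 1, \<pi> z)) = q (\<Phi> (z' $ 1, \<pi> z))" using retrace[OF z] retrace[OF z'] u eq by simp
   fix s assume "s \<in> closed_segment (z $ 1) (z' $ 1)"
   hence s: "\<bar>s\<bar> < r" using B2(2)[OF z] B2(2)[OF z'] by (auto simp: closed_segment_eq_real_ivl split: if_splits)
   note m = \<pi>B[OF z s]
   have "((\<lambda>s. \<Phi> (s, \<pi> z)) has_vector_derivative char_field b (\<Phi> (s, \<pi> z))) (at s)"
    using \<phi>d[of s "\<pi> z"] m(4) by (simp add: \<Phi>_def Dom_def)
   from dd_curve[OF _ this, of q] smooth_onD[OF q_smooth] m(5) Q2Q
   show "((\<lambda>s. q (\<Phi> (s, \<pi> z))) has_real_derivative dd q (\<Phi> (s, \<pi> z)) (char_field b (\<Phi> (s, \<pi> z)))) (at s)"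
    by (auto simp: has_real_derivative_iff_has_vector_derivative)
   show "dd q (\<Phi> (s, \<pi> z)) (char_field b (\<Phi> (s, \<pi> z))) \<noteq> 0" using m(5) by (simp add: Q2_def)
  qed
  thus "z = z'" using retrace[OF z] retrace[OF z'] u by simp
 qed
 have ker: "v = 0" if z: "z \<in> ?B" and v: "dd \<Psi> z v = 0" for z v
 proof -
  note zQ = B2(4)[OF z]
  have X0: "dd X z v = 0" and Y0: "dd Y z v = 0" and P0: "dd P z v = 0" and q0: "dd q z v = 0"
   using dd_\<Psi>[OF B2(1)[OF z], of v] v by simp_all
  have w3: "dd \<pi> z v $ 3 = 0" using P0 by (simp add: dd_XYP[OF zQ])
  have w2: "dd \<pi> z v $ 2 = 0" using Y0 X0 w3 by (simp add: dd_XYP(3)[OF zQ])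
  have w: "dd \<pi> z v = dd \<pi> z v $ 4 *R e4" using dd_XYP(4)[OF zQ, of v] w2 w3 by (simp add: vec_eq_iff forall_4)
  have "dd (\<lambda>y. dd b y e4) (\<pi> z) (dd \<pi> z v $ 4 *R e4) = 0" using X0 w by (simp add: dd_XYP(1)[OF zQ])
  hence "dd \<pi> z v $ 4 = 0"
   using nd[OF \<pi>_O[OF zQ]] linear_scale[OF dd_lin[OF smooth_b4 \<pi>_O[OF zQ]]] by simp
  hence w0: "dd \<pi> z v = 0" using w by simp
  \<comment> \<open>Differentiating \<open>retrace\<close> shows that a vector killed by the
    derivative of \<open>\<pi>\<close> is a multiple of \<open>char_field\<close>, along which
    \<open>q\<close> changes.\<close>
  define p where "p = (z $ 1, \<pi> z)"
  have p: "p \<in> Dom" using \<pi>B(4)[OF z B2(2)[OF z]] by (simp add: p_def)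
  have "((\<lambda>z. (z $ 1, \<pi> z)) has_derivative (\<lambda>v. (v $ 1, dd \<pi> z v))) (at z)"
   by (intro has_derivative_Pair bounded_linear.has_derivative[OF bounded_linear_vec_nth has_derivative_ident] smooth_on_has_derivative[OF \<pi>_smooth zQ])
  from has_derivative_compose[OF this, of \<Phi>] smooth_on_has_derivative[OF \<Phi>_smooth p]
  have "((\<lambda>z. \<Phi> (z $ 1, \<pi> z)) has_derivative (\<lambda>v. dd \<Phi> p (v $ 1, dd \<pi> z v))) (at z)" by (simp add: p_def)
  hence "((\<lambda>z. z) has_derivative (\<lambda>v. dd \<Phi> p (v $ 1, dd \<pi> z v))) (at z)"
   by (rule has_derivative_transform_within_open[OF _ open_slab z]) (rule retrace[symmetric])
  hence "v = dd \<Phi> p (v $ 1, dd \<pi> z v)" using fun_cong[OF has_derivative_unique[OF has_derivative_ident[of "at z"]], of _ v] by auto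
  hence ve: "v = v $ 1 *R char_field b z" using \<Phi>_time[OF p, of "v $ 1"] w0 retrace[OF z, symmetric] by (simp add: p_def)
  have "dd q z (v $ 1 *R char_field b z) = 0" using q0 ve by simp
  hence "v $ 1 = 0"
   using B2(1)[OF z] linear_scale[OF dd_lin[OF q_smooth], of z] by (simp add: Q2_def)
  thus "v = 0" using ve by simp
 qed
 have BQ2: "?B \<subseteq> Q2" using B2(1) by auto
 have dif: "diffeo_onto_image ?B \<Psi>"
  by (rule diffeoI[OF open_slab smooth_on_subset[OF \<Psi>_smooth BQ2] inj ker])
 \<comment> \<open>Along \<open>e4\<close> the quotient of the differentials of \<open>q\<close> and
   \<open>X\<close> is dq/dx on a solution, which is the right-hand side of the equation.\<close>
 define F where "F y = dd q (inv_into ?B \<Psi> y) e4 / dd X (inv_into ?B \<Psi> y) e4" for y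
 note i = diffeo_inverse[OF dif]
 have "smooth_on ?B (\<lambda>z. dd q z e4 / dd X z e4)"
  by (intro smooth_on_divide open_slab smooth_on_frechet smooth_on_subset[OF q_smooth] smooth_on_subset[OF XYP_smooth(1)])
   (use BQ2 Q2Q in \<open>auto simp: Q1_def\<close>)
 hence "smooth_on (\<Psi> ` ?B) F" unfolding F_def[abs_def]
  by (intro smooth_on_compose[OF diffeoD(2)[OF dif] open_slab _ diffeoD(5)[OF dif]]) (use i(6) in auto)
 hence ode: "third_order_ode (\<Psi> ` ?B) F" using diffeoD(2)[OF dif] by (simp add: third_order_ode_def)
 have "dd \<Psi> z (null_dir b z) \<in> contact_plane (\<Psi> z) \<and> (\<exists>m. m \<noteq> 0 \<and> dd \<Psi> z e4 = m *R total_field F (\<Psi> z))" if z: "z \<in> ?B" for z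
 proof -
  note z2 = B2(1)[OF z] and zQ = B2(4)[OF z]
  have X4: "dd X z e4 \<noteq> 0" using z2 Q2Q by (auto simp: Q1_def)
  have lin: "linear (dd X z)" "linear (dd P z)"
   using dd_lin[OF XYP_smooth(1) zQ] dd_lin[OF XYP_smooth(2) zQ] .
  have nd: "null_dir b z = char_field b z + null_coeff b z *R e4" by (simp add: char_field_def)
  have Y4: "dd Y z e4 = P z * dd X z e4" "dd Y z (null_dir b z) = P z * dd X z (null_dir b z)"
   by (simp_all add: contact_form_kernel[OF zQ] null_form_inner)
  have P4: "dd P z e4 = q z * dd X z e4" using X4 by (simp add: q_def)
  have e: "dd X z (null_dir b z) = null_coeff b z * dd X z e4" "dd P z (null_dir b z) = null_coeff b z * dd P z e4"
   unfolding nd by (simp_all add: linear_add[OF lin(1)] linear_scale[OF lin(1)] linear_add[OF lin(2)] linear_scale[OF lin(2)] XYP_invariant[OF zQ])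
  have "dd \<Psi> z (null_dir b z) \<in> contact_plane (\<Psi> z)"
   by (simp add: contact_plane_def theta_app dd_\<Psi>[OF z2] Y4 e P4)
  moreover have "dd \<Psi> z e4 = dd X z e4 *R total_field F (\<Psi> z)"
   using X4 by (simp add: vec_eq_iff forall_4 dd_\<Psi>[OF z2] Y4 P4 F_def i(2)[OF z])
  ultimately show ?thesis using X4 by blast
 qed
 thus ?thesis using r(1) dif ode B2(4) Q_sub by (intro exI[of _ r]) auto
qed

end

lemma null_chart:
 assumes S: "open S" and b: "smooth_on S b" and s12: "s1 \<le> s2" and seg: "\<And>s. s1 \<le> s ==> s \<le> s2 ==> s *R e4 \<in> S"
  and nd: "\<And>z. z \<in> S ==> dd (\<lambda>y. dd b y e4) z e4 \<noteq> 0"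
 obtains r \<Psi> F where "r > 0" "slab s1 s2 r \<subseteq> S" "diffeo_onto_image (slab s1 s2 r) \<Psi>" "third_order_ode (\<Psi> ` slab s1 s2 r) F"
  "\<And>z. z \<in> slab s1 s2 r ==> dd \<Psi> z (null_dir b z) \<in> contact_plane (\<Psi> z)"
  "\<And>z. z \<in> slab s1 s2 r ==> \<exists>m. m \<noteq> 0 \<and> dd \<Psi> z e4 = m *R total_field F (\<Psi> z)"
proof -
 interpret null_field S b by unfold_locales (use S b nd in auto)
 let ?K = "(\<lambda>s. s *R e4) ` {s1..s2}"
 obtain T U \<phi> where f: "T > 0" "open U" "?K \<subseteq> U" "U \<subseteq> S" "smooth_on ({-T<..<T} \<times> U) (\<lambda>p. \<phi> (fst p) (snd p))"
  "\<And>x. x \<in> U ==> \<phi> 0 x = x"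
  "\<And>t x. t \<in> {-T<..<T} ==> x \<in> U ==> \<phi> t x \<in> S"
  "\<And>t x. t \<in> {-T<..<T} ==> x \<in> U ==> ((\<lambda>s. \<phi> s x) has_vector_derivative char_field b (\<phi> t x)) (at t)"
  "\<And>s t x. t \<in> {-T<..<T} ==> s \<in> {-T<..<T} ==> s + t \<in> {-T<..<T} ==> x \<in> U ==> \<phi> t x \<in> U
   ==> \<phi> s (\<phi> t x) = \<phi> (s + t) x"
  by (rule local_flow[OF S smooth_char_field segment_axis[OF s12]]) (use seg in auto)
 interpret null_flow S b T U \<phi>
  by unfold_locales (use f S smooth_char_field in auto)
 have "\<And>s. s1 \<le> s ==> s \<le> s2 ==> s *R e4 \<in> U" using f(3) by auto
 from chart_theorem[OF s12 this] that show thesis by blast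
qed

section \<open>Tensors with a prescribed field of null directions\<close>

lemma dd_vanish:
 assumes "open S" "z \<in> S" "\<And>y. y \<in> S ==> f y = 0"
 shows "dd f z v = 0"
 using frechet_cong[OF assms(1,2), of f "\<lambda>_. 0"] assms(3) by simp

lemma dd_tensor_e4:
 assumes "open S" "smooth_on S T" "smooth_on S a" "smooth_on S c" "z \<in> S"
 shows "dd (\<lambda>z. tensor_app (T z) (a z) (c z)) z e4 = tensor_app (\<L> E4 T z) (a z) (c z)
  + tensor_app (T z) (dd a z e4) (c z) + tensor_app (T z) (a z) (dd c z e4)"
 using dd_tensor_app[OF assms(2-4)[THEN smooth_onD, OF assms(5)], of e4]
  lie_app[OF smooth_onD[OF assms(2,5)] differentiable_const, of e4 "a z" "c z"]
 by (simp add: tensor_app_linear)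

text \<open>Serves every step of the recursion in \<open>relations\<close>. Derivatives of the
  tensors turn into Lie derivatives because \<open>e4\<close> is constant.\<close>

lemma vanish_pair:
 assumes S: "open S" and T: "smooth_on S T" "smooth_on S a" "smooth_on S c" and T': "smooth_on S T'" "smooth_on S a'" "smooth_on S c'"
  and 0: "\<And>y. y \<in> S ==> tensor_app (T y) (a y) (c y) + k * tensor_app (T' y) (a' y) (c' y) = 0" and z: "z \<in> S"
 shows "tensor_app (\<L> E4 T z) (a z) (c z)
  + tensor_app (T z) (dd a z e4) (c z) + tensor_app (T z) (a z) (dd c z e4)
  + k * (tensor_app (\<L> E4 T' z) (a' z) (c' z)
  + tensor_app (T' z) (dd a' z e4) (c' z) + tensor_app (T' z) (a' z) (dd c' z e4)) = 0"
proof -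
 have d: "(\<lambda>y. tensor_app (T y) (a y) (c y)) differentiable (at z)" "(\<lambda>y. tensor_app (T' y) (a' y) (c' y)) differentiable (at z)"
  using smooth_onD[OF smooth_on_tensor_app[OF S T] z] smooth_onD[OF smooth_on_tensor_app[OF S T'] z] .
 have "dd (\<lambda>y. tensor_app (T y) (a y) (c y) + k * tensor_app (T' y) (a' y) (c' y)) z e4 = 0"
  by (rule dd_vanish[OF S z]) (rule 0)
 moreover have "dd (\<lambda>y. tensor_app (T y) (a y) (c y) + k * tensor_app (T' y) (a' y) (c' y)) z e4
  = dd (\<lambda>y. tensor_app (T y) (a y) (c y)) z e4 + k * dd (\<lambda>y. tensor_app (T' y) (a' y) (c' y)) z e4"
  using frechet_eqI[OF has_derivative_add[OF d(1)[unfolded frechet_derivative_works] has_derivative_mult_right[OF d(2)[unfolded frechet_derivative_works]]], of k]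
  by simp
 ultimately show ?thesis by (simp add: dd_tensor_e4[OF S T z] dd_tensor_e4[OF S T' z])
qed

context null_field
begin

lemma dd_null_dir:
 assumes "z \<in> S"
 shows "dd (null_dir b) z e4 = null_dir' b z" "dd (null_dir' b) z e4 = dd (\<lambda>y. dd b y e4) z e4 *R axis 2 1"
proof -
 have c: "dd (null_dir b) z e4 $ i = dd (\<lambda>z. null_dir b z $ i) z e4" "dd (null_dir' b) z e4 $ i = dd (\<lambda>z. null_dir' b z $ i) z e4" for i
  using smooth_null_dir[THEN smooth_onD, OF assms] by (simp_all add: dd_vec_nth)
 show "dd (null_dir b) z e4 = null_dir' b z" "dd (null_dir' b) z e4 = dd (\<lambda>y. dd b y e4) z e4 *R axis 2 1"
  by (simp_all add: vec_eq_iff forall_4 c dd_coord axis_def[of "2 :: 4"])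
qed

end

locale null_tensor = null_field +
 fixes T :: "point \<Rightarrow> tensor"
 assumes T: "smooth_on S T" "symmetric_on S T" "annihilates S E4 T"
  and null: "\<And>z. z \<in> S ==> flag_null T E4 z (null_dir b z)"
begin

definition "L k = (\<L> E4 ^^ k) T"

abbreviation "b44 z \<equiv> dd (\<lambda>y. dd b y e4) z e4"
abbreviation "b5 z \<equiv> dd b44 z e4"
abbreviation "b6 z \<equiv> dd b5 z e4"

lemma L_smooth: "smooth_on S (L k)"
 unfolding L_def by (rule smooth_on_lie_iter[OF S smooth_on_const T(1)])

lemma L_Suc: "\<L> E4 (L k) = L (Suc k)" by (simp add: L_def)

lemma L_sym: "z \<in> S ==> tensor_app (L k z) v w = tensor_app (L k z) w v"
 using symmetric_lie_iter[OF S smooth_on_const T(1,2), of k e4] by (simp add: symmetric_on_def L_def)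

lemma smooth_b44: "smooth_on S b44" "smooth_on S b5" "smooth_on S b6"
 by (intro smooth_on_frechet smooth_b4)+

lemma e2_field:
 assumes "smooth_on S f" "z \<in> S"
 shows "smooth_on S (\<lambda>z. f z *R axis 2 1 :: point)" "dd (\<lambda>z. f z *R axis 2 1 :: point) z e4 = dd f z e4 *R axis 2 1"
 subgoal by (rule smooth_on_scaleR[OF S assms(1) smooth_on_const])
 subgoal by (rule fun_cong[OF frechet_eqI[OF has_derivative_scaleR_left[OF smooth_on_has_derivative[OF assms]]]])
 done

text \<open>Write e, e' for \<open>null_dir\<close>, \<open>null_dir'\<close> and a for the second
  coordinate vector; e'' is a multiple of a. Each differentiation of (L_k T)(e, e) = 0 along
  \<open>e4\<close> gives up the highest \<open>k\<close> and produces one new relation, from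
  \<open>k < 5\<close> down to the single one for \<open>k = 0\<close>.\<close>

lemma relations:
 assumes z: "z \<in> S"
 shows "tensor_app (T z) (null_dir b z) (null_dir b z) = 0"
  "tensor_app (T z) (null_dir b z) (null_dir' b z) = 0"
  "tensor_app (T z) (null_dir' b z) (null_dir' b z) = - b44 z * tensor_app (T z) (null_dir b z) (axis 2 1)"
  "3 * b44 z * tensor_app (T z) (null_dir' b z) (axis 2 1) = - b5 z * tensor_app (T z) (null_dir b z) (axis 2 1)"
  "3 * (b44 z)\<^sup>2 * tensor_app (T z) (axis 2 1) (axis 2 1)
   = - b6 z * tensor_app (T z) (null_dir b z) (axis 2 1) - 4 * b5 z * tensor_app (T z) (null_dir' b z) (axis 2 1)"
proof -
 let ?e = "null_dir b" and ?f = "null_dir' b"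
 let ?a = "\<lambda>_. axis 2 1 :: point"
 let ?g = "\<lambda>z. b44 z *R axis 2 1 :: point" and ?h = "\<lambda>z. b5 z *R axis 2 1 :: point"
 note sm = smooth_null_dir L_smooth
 have sg: "smooth_on S ?g" "smooth_on S ?h" by (rule smooth_on_scaleR[OF S smooth_b44(1) smooth_on_const], rule smooth_on_scaleR[OF S smooth_b44(2) smooth_on_const])
 note D = dd_null_dir e2_field(2)[OF smooth_b44(1)] e2_field(2)[OF smooth_b44(2)]
 have 0: "tensor_app (L k y) (?e y) (?e y) = 0" if "k < 5" "y \<in> S" for k y
  using null[OF that(2)] that(1) by (simp add: flag_null_iff L_def)
 have 1: "tensor_app (L k y) (?e y) (?f y) = 0" if k: "k < 4" and y: "y \<in> S" for k y
 proof -
  have "tensor_app (L k y) (?e y) (?e y) + 0 * tensor_app (L k y) (?e y) (?e y) = 0" if "y \<in> S" for y using 0 that k by simp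
  from vanish_pair[OF S sm(3,1,1) sm(3,1,1) this y] show ?thesis
   using 0[of "Suc k" y] L_sym[OF y, of k "?f y" "?e y"] k y by (simp add: D(1-4)[OF y] L_Suc)
 qed
 have 2: "tensor_app (L k y) (?f y) (?f y) + 1 * tensor_app (L k y) (?e y) (?g y) = 0" if k: "k < 3" and y: "y \<in> S" for k y
 proof -
  have "tensor_app (L k y) (?e y) (?f y) + 0 * tensor_app (L k y) (?e y) (?e y) = 0" if "y \<in> S" for y using 1 that k by simp
  from vanish_pair[OF S sm(3,1,2) sm(3,1,1) this y] show ?thesis
   using 1[of "Suc k" y] k y by (simp add: D(1,2)[OF y] L_Suc)
 qed
 \<comment> \<open>The numbers 1, 3 and below 1, 4, 3 are the halved Leibniz coefficients of the
   third and fourth derivative of the symmetric expression T(e, e).\<close>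
 have 3: "tensor_app (L k y) (?e y) (?h y) + 3 * tensor_app (L k y) (?f y) (?g y) = 0" if k: "k < 2" and y: "y \<in> S" for k y
  using vanish_pair[OF S sm(3,2,2) sm(3,1) sg(1) 2[of k] y] 2[of "Suc k" y] k y L_sym[OF y, of k "?g y" "?f y"]
  by (simp add: D(1-3)[OF y] L_Suc)
 have 4: "tensor_app (L 0 z) (?e z) (b6 z *R axis 2 1) + 4 * tensor_app (L 0 z) (?f z) (?h z) + 3 * tensor_app (L 0 z) (?g z) (?g z) = 0"
  using vanish_pair[OF S sm(3,1) sg(2) sm(3,2) sg(1) 3[of 0] z] 3[of 1 z] z
  by (simp add: D(1-4)[OF z] L_Suc)
 have L0: "L 0 = T" by (simp add: L_def)
 show "tensor_app (T z) (?e z) (?e z) = 0" "tensor_app (T z) (?e z) (?f z) = 0" using 0[of 0 z] 1[of 0 z] z by (simp_all add: L0)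
 show "tensor_app (T z) (?f z) (?f z) = - b44 z * tensor_app (T z) (?e z) (axis 2 1)"
  using 2[of 0 z] z by (simp add: L0 tensor_app_linear)
 show "3 * b44 z * tensor_app (T z) (?f z) (axis 2 1) = - b5 z * tensor_app (T z) (?e z) (axis 2 1)"
  using 3[of 0 z] z by (simp add: L0 tensor_app_linear)
 show "3 * (b44 z)\<^sup>2 * tensor_app (T z) (axis 2 1) (axis 2 1)
   = - b6 z * tensor_app (T z) (?e z) (axis 2 1) - 4 * b5 z * tensor_app (T z) (?f z) (axis 2 1)"
  using 4 by (simp add: L0 tensor_app_linear power2_eq_square)
qed

text \<open>In the frame e, e', a, \<open>e4\<close> every component of \<open>T\<close> is T(e, a)
  times a factor that depends on \<open>b\<close> only. This is the one-dimensionality that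
  identifies two conformal metrics.\<close>

lemma tensor_formula:
 assumes z: "z \<in> S"
 shows "tensor_app (T z) v w = tensor_app (T z) (null_dir b z) (axis 2 1) * (let
   q = (\<lambda>v. v $ 3 - v $ 1 * z $ 4); r = (\<lambda>v. v $ 2 - v $ 1 * b z - q v * dd b z e4)
  in v $ 1 * r w + r v * w $ 1 - q v * q w * b44 z - (q v * r w + r v * q w) * (b5 z / (3 * b44 z))
    - r v * r w * ((b6 z - 4 * b5 z * (b5 z / (3 * b44 z))) / (3 * (b44 z)\<^sup>2)))"
proof -
 let ?e = "null_dir b z" and ?f = "null_dir' b z" and ?a = "axis 2 1 :: point"
 define c where "c = b44 z"
 define d where "d = b5 z"
 define k where "k = b6 z"
 have c0: "c \<noteq> 0" using nd[OF z] by (simp add: c_def)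
 define s where "s = tensor_app (T z) ?e ?a"
 define x1 where "x1 = tensor_app (T z) ?f ?a"
 define x2 where "x2 = tensor_app (T z) ?a ?a"
 note R = relations[OF z, folded c_def d_def k_def x1_def x2_def s_def]
 define h where "h = d / (3 * c)"
 have x1: "x1 = - h * s" using R(4) c0 by (simp add: field_simps h_def)
 define m where "m = (k - 4 * d * h) / (3 * c\<^sup>2)"
 have x2: "x2 = - s * m" unfolding m_def using R(5) c0 unfolding x1 by (simp add: field_simps)
 have sym: "tensor_app (T z) v w = tensor_app (T z) w v" for v w
  using T(2) z by (auto simp: symmetric_on_def)
 have ann: "tensor_app (T z) e4 w = 0" "tensor_app (T z) w e4 = 0" for w
  using T(3) z by (auto simp: annihilates_def)
 define q where "q v = v $ 3 - v $ 1 * z $ 4" for v :: point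
 define r where "r v = v $ 2 - v $ 1 * b z - q v * dd b z e4" for v :: point
 have ex: "v = v $ 1 *R ?e + q v *R ?f + r v *R ?a + v $ 4 *R e4" for v
  by (simp add: vec_eq_iff forall_4 q_def r_def axis_def[of "2 :: 4"])
 have "tensor_app (T z) v w = s * (v $ 1 * r w + r v * w $ 1 - q v * q w * c - (q v * r w + r v * q w) * h
    - r v * r w * m)" for v w
 proof -
  have "tensor_app (T z) v w = tensor_app (T z) (v $ 1 *R ?e + q v *R ?f + r v *R ?a + v $ 4 *R e4) (w $ 1 *R ?e + q w *R ?f + r w *R ?a + w $ 4 *R e4)"
   using ex[of v] ex[of w] by simp
  also have "\<dots> = (v $ 1 * r w + r v * w $ 1) * s - q v * q w * c * s + (q v * r w + r v * q w) * x1 + r v * r w * x2"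
   unfolding tensor_app_linear ann R(1-3) sym[of ?a ?e] sym[of ?a ?f] sym[of ?f ?e] x1_def[symmetric] x2_def[symmetric] s_def[symmetric]
   by (simp add: algebra_simps)
  finally show ?thesis unfolding x1 x2 by (simp add: algebra_simps)
 qed
 from this[unfolded q_def r_def m_def h_def c_def d_def k_def s_def] show ?thesis unfolding Let_def .
qed

end

lemma null_tensors_proportional:
 assumes "null_tensor S b T" "null_tensor S b H" "z \<in> S"
 shows "tensor_app (T z) (null_dir b z) (axis 2 1) *R H z = tensor_app (H z) (null_dir b z) (axis 2 1) *R T z"
proof (rule tensor_eqI)
 fix v w
 note f = null_tensor.tensor_formula[OF assms(1,3), of v w] null_tensor.tensor_formula[OF assms(2,3), of v w]
 show "tensor_app (tensor_app (T z) (null_dir b z) (axis 2 1) *R H z) v w = tensor_app (tensor_app (H z) (null_dir b z) (axis 2 1) *R T z) v w"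
  unfolding tensor_app_linear f(1) f(2) by (simp only: mult.assoc mult.left_commute)
qed

text \<open>The chart takes \<open>null_dir\<close> into the contact planes, and these consist of
  null vectors for the flag of any equation. So the pullback of the metric of the equation is a
  \<open>null_tensor\<close> for the same \<open>b\<close>, and
  \<open>null_tensors_proportional\<close> applies.\<close>

lemma null_tensor_isometry:
 assumes T: "null_tensor S b T" and T0: "\<And>z. z \<in> S ==> T z \<noteq> 0"
  and s12: "s1 \<le> s2" and seg: "\<And>s. s1 \<le> s ==> s \<le> s2 ==> s *R e4 \<in> S"
 obtains r \<Psi> F where "r > 0" "slab s1 s2 r \<subseteq> S" "ode_isometry T (slab s1 s2 r) \<Psi> (\<Psi> ` slab s1 s2 r) F"
  "\<And>z. z \<in> slab s1 s2 r ==> dd \<Psi> z (null_dir b z) \<in> contact_plane (\<Psi> z)"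
  "\<And>z. z \<in> slab s1 s2 r ==> \<exists>m. m \<noteq> 0 \<and> dd \<Psi> z e4 = m *R total_field F (\<Psi> z)"
proof -
 interpret T: null_tensor S b T by fact
 obtain r \<Psi> F where r: "r > 0" "slab s1 s2 r \<subseteq> S" and dif: "diffeo_onto_image (slab s1 s2 r) \<Psi>"
  and ode: "third_order_ode (\<Psi> ` slab s1 s2 r) F"
  and con: "\<And>z. z \<in> slab s1 s2 r ==> dd \<Psi> z (null_dir b z) \<in> contact_plane (\<Psi> z)"
  and tot: "\<And>z. z \<in> slab s1 s2 r ==> \<exists>m. m \<noteq> 0 \<and> dd \<Psi> z e4 = m *R total_field F (\<Psi> z)"
  by (rule null_chart[OF T.S T.b s12 seg T.nd]) blast+
 let ?B = "slab s1 s2 r"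
 define h where "h = pullback \<Psi> (ode_metric F)"
 note Ps = diffeoD(4)[OF dif] note oB = diffeoD(1)[OF dif]
 have app: "tensor_app (h z) v w = tensor_app (ode_metric F (\<Psi> z)) (dd \<Psi> z v) (dd \<Psi> z w)" if "z \<in> ?B" for z v w
  unfolding h_def by (rule pullback_app[OF smooth_onD[OF Ps that]])
 have e41: "dd \<Psi> z e4 $ 1 \<noteq> 0 \<and> dd \<Psi> z e4 = dd \<Psi> z e4 $ 1 *R total_field F (\<Psi> z)" if "z \<in> ?B" for z
  using tot[OF that] by (auto simp: total_field_nth)
 have s1: "smooth_on ?B (\<lambda>z. dd \<Psi> z e4 $ 1)" by (intro smooth_on_nth smooth_on_frechet Ps oB)
 have hs: "smooth_on ?B h" unfolding h_def
  by (rule smooth_on_pullback[OF oB diffeoD(2)[OF dif] _ Ps smooth_ode_metric[OF ode]]) simp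
 have hn: "annihilates ?B E4 h" unfolding annihilates_def
 proof (intro ballI allI)
  fix z w assume z: "z \<in> ?B"
  obtain m where m: "dd \<Psi> z e4 = m *R total_field F (\<Psi> z)" using tot[OF z] by blast
  show "tensor_app (h z) e4 w = 0 \<and> tensor_app (h z) w e4 = 0"
   using ode_annihilates[of "\<Psi> ` ?B" F] z by (simp add: app[OF z] m tensor_app_linear annihilates_def)
 qed
 have fl: "flag h E4 z k = pull_tensor (jacobian \<Psi> (at z)) ` flag (ode_metric F) (total_field F) (\<Psi> z) k" if z: "z \<in> ?B" for z k
  by (rule flag_transport[OF oB diffeoD(2)[OF dif] order_refl Ps smooth_ode_metric[OF ode] smooth_total_field[OF ode] hs smooth_on_const s1 smooth_on_const[of _ 1] _ _ _ _ hn z])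
   (use e41 in \<open>auto simp: h_def\<close>)
 interpret H: null_tensor ?B b h
 proof unfold_locales
  show "open ?B" by (rule oB)
  show "smooth_on ?B b" by (rule smooth_on_subset[OF T.b r(2)])
  show "smooth_on ?B h" "annihilates ?B E4 h" by (fact hs hn)+
  show "symmetric_on ?B h" using ode_symmetric[of "\<Psi> ` ?B" F] by (auto simp: symmetric_on_def app)
  fix z assume z: "z \<in> ?B"
  thus "dd (\<lambda>y. dd b y e4) z e4 \<noteq> 0" using T.nd r(2) by auto
  obtain a c where ac: "dd \<Psi> z (null_dir b z) = a *R total_field F (\<Psi> z) + c *R axis 4 1"
   using iffD1[OF contact_plane_iff[where F = F] con[OF z]] by blast
  have "flag_null (ode_metric F) (total_field F) (\<Psi> z) (dd \<Psi> z (null_dir b z))"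
  proof -
   have pz: "\<Psi> z \<in> \<Psi> ` ?B" using z by simp
   have a: "annihilates (\<Psi> ` ?B) (total_field F) ((\<L> (total_field F) ^^ k) (ode_metric F))" for k
    by (rule annihilates_lie_iter[OF ode_open[OF ode] smooth_total_field[OF ode] smooth_ode_metric[OF ode] ode_annihilates])
   have "tensor_app ((\<L> (total_field F) ^^ k) (ode_metric F) (\<Psi> z)) (total_field F (\<Psi> z)) w = 0"
    "tensor_app ((\<L> (total_field F) ^^ k) (ode_metric F) (\<Psi> z)) w (total_field F (\<Psi> z)) = 0" for k w
    using bspec[OF a[of k, unfolded annihilates_def] pz] by blast+
   thus ?thesis using ode_flag_null[OF ode pz]
    unfolding flag_null_iff ac tensor_app_linear by simp
  qed
  thus "flag_null h E4 z (null_dir b z)"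
   using flag_transport_consequences(2)[OF dif z, of h "\<lambda>_. e4" "ode_metric F" "total_field F"] fl[OF z] by blast
 qed
 interpret TB: null_tensor ?B b T
 proof unfold_locales
  show "smooth_on ?B T" by (rule smooth_on_subset[OF T.T(1) r(2)])
  show "symmetric_on ?B T" "annihilates ?B E4 T" using T.T(2,3) r(2) by (auto simp: symmetric_on_def annihilates_def)
  show "flag_null T E4 z (null_dir b z)" if "z \<in> ?B" for z using T.null that r(2) by auto
 qed
 define \<sigma> where "\<sigma> H z = tensor_app (H z) (null_dir b z) (axis 2 1)" for H :: "point \<Rightarrow> tensor" and z
 have proportional: "\<sigma> T z *R h z = \<sigma> h z *R T z" if "z \<in> ?B" for z
  unfolding \<sigma>_def by (rule null_tensors_proportional[OF TB.null_tensor_axioms H.null_tensor_axioms that])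
 \<comment> \<open>By \<open>tensor_formula\<close> this single component controls the whole
   tensor.\<close>
 have nz: "\<sigma> G z \<noteq> 0" if G: "null_tensor ?B b G" and z: "z \<in> ?B" and G0: "G z \<noteq> 0" for G z
 proof
  assume "\<sigma> G z = 0"
  hence "tensor_app (G z) v w = tensor_app 0 v w" for v w
   unfolding null_tensor.tensor_formula[OF G z, of v w] by (simp add: \<sigma>_def tensor_app_linear)
  thus False using G0 tensor_eqI by blast
 qed
 have h0: "h z \<noteq> 0" if z: "z \<in> ?B" for z
 proof
  assume 0: "h z = 0"
  obtain v where v: "dd \<Psi> z v = e4" using diffeo_surj[OF dif z] by blast
  have "tensor_app (ode_metric F (\<Psi> z)) e4 w = 0" for w
  proof -
   obtain u where "dd \<Psi> z u = w" using diffeo_surj[OF dif z] by blast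
   thus ?thesis using app[OF z, of v u] v 0 by (simp add: tensor_app_linear)
  qed
  hence "e4 \<in> span {total_field F (\<Psi> z)}" using ode_kernel by blast
  then obtain c where c: "e4 = c *R total_field F (\<Psi> z)" by (auto simp: span_singleton)
  have "c = 0" using arg_cong[OF c, of "\<lambda>v. v $ 1"] by (simp add: total_field_nth)
  thus False using arg_cong[OF c, of "\<lambda>v. v $ 4"] by simp
 qed
 have s: "smooth_on ?B (\<sigma> G)" if "null_tensor ?B b G" for G
 proof -
  interpret G: null_tensor ?B b G by fact
  show ?thesis unfolding \<sigma>_def by (intro smooth_on_tensor_app oB G.T(1) H.smooth_null_dir(1) smooth_on_const)
 qed
 have T0': "T z \<noteq> 0" if "z \<in> ?B" for z using T0 r(2) that by auto
 have "ode_isometry T ?B \<Psi> (\<Psi> ` ?B) F"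
  unfolding ode_isometry_def
 proof (intro conjI exI[of _ "\<lambda>z. \<sigma> h z / \<sigma> T z"] ballI)
  show "smooth_on ?B (\<lambda>z. \<sigma> h z / \<sigma> T z)"
   by (intro smooth_on_divide oB s TB.null_tensor_axioms H.null_tensor_axioms nz T0')
  fix z assume z: "z \<in> ?B"
  have n: "\<sigma> h z \<noteq> 0" "\<sigma> T z \<noteq> 0" using nz[OF H.null_tensor_axioms z h0[OF z]] nz[OF TB.null_tensor_axioms z T0'[OF z]] .
  thus "\<sigma> h z / \<sigma> T z \<noteq> 0" by simp
  have "h z = inverse (\<sigma> T z) *R (\<sigma> T z *R h z)" using n by simp
  also have "\<dots> = (\<sigma> h z / \<sigma> T z) *R T z" unfolding proportional[OF z] by (simp add: divide_inverse mult.commute)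
  finally show "pullback \<Psi> (ode_metric F) z = (\<sigma> h z / \<sigma> T z) *R T z" by (simp add: h_def)
 qed (use ode dif in auto)
 thus thesis using that r con tot by blast
qed

section \<open>Metrics with nonzero \<open>\<Gamma>\<close>\<close>

context unit_flow
begin

text \<open>Keeps the foot point given by \<open>\<pi>\<close> and uses time as a coordinate, so
  that \<open>Z\<close> becomes a coordinate field.\<close>

definition "straight z = \<pi> z + z $ k *R axis k 1"

lemma smooth_straight: "smooth_on Q straight"
 unfolding straight_def[abs_def] by (intro smooth_on_add smooth_on_scaleR smooth_on_const smooth_on_coord \<pi>_smooth Q_open)

lemma dd_straight: "z \<in> Q ==> dd straight z v = dd \<pi> z v + v $ k *R axis k 1"
proof -
 assume z: "z \<in> Q"
 have "((\<lambda>z. \<pi> z + z $ k *R (axis k 1 :: point)) has_derivative (\<lambda>v. dd \<pi> z v + v $ k *R axis k 1)) (at z)"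
  by (intro has_derivative_add smooth_on_has_derivative[OF \<pi>_smooth z] has_derivative_scaleR_left
   bounded_linear.has_derivative[OF bounded_linear_vec_nth has_derivative_ident])
 thus ?thesis unfolding straight_def[abs_def] by (simp add: frechet_eqI)
qed

lemma dd_straight_field: "z \<in> Q ==> dd straight z (Z z) = axis k 1"
 using \<phi>S[of 0 z] T \<phi>0[of z] by (simp add: dd_straight \<pi>_invariant Z(2) Q_def)

text \<open>The identity derivative at the origin lets the chart respect a frame chosen beforehand
  at one point.\<close>

lemma straight_origin:
 assumes "0 \<in> U0" "Z 0 = axis k 1"
 shows "0 \<in> Q" "straight 0 = 0" "dd straight 0 v = v"
proof -
 show Q: "0 \<in> Q" using assms(1) T by (simp add: Q_def)
 have p0: "\<pi> 0 = 0" using \<phi>0[OF assms(1)] by (simp add: \<pi>_def \<Phi>_def)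
 show "straight 0 = 0" by (simp add: straight_def p0)
 have D0: "(0, 0) \<in> Dom" using assms(1) T by (simp add: Dom_def)
 have "((\<lambda>z :: point. (0 :: real, z)) has_derivative (\<lambda>v. (0, v))) (at 0)" by (auto intro!: derivative_eq_intros)
 from has_derivative_compose[OF this smooth_on_has_derivative[OF \<Phi>_smooth D0]]
 have "((\<lambda>z. \<Phi> (0, z)) has_derivative (\<lambda>v. dd \<Phi> (0, 0) (0, v))) (at 0)" .
 hence "((\<lambda>z. z) has_derivative (\<lambda>v. dd \<Phi> (0, 0) (0, v))) (at 0)"
  by (rule has_derivative_transform_within_open[OF _ U0(1) assms(1)]) (simp add: \<Phi>_def \<phi>0)
 from fun_cong[OF has_derivative_unique[OF has_derivative_ident this], of v] have "dd \<Phi> (0, 0) (0, v) = v" by simp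
 thus "dd straight 0 v = v" by (simp add: dd_straight[OF Q] dd_\<pi>[OF Q] p0 assms(2))
qed

end

text \<open>Apart from its last column the frame \<open>A\<close> at \<open>x\<close> is free; for
  metrics with proportional Lie derivative it carries the normal form of the metric at
  \<open>x\<close> into the chart.\<close>

lemma straighten:
 assumes N: "open N" "smooth_on N V" "x \<in> N" and A: "det A \<noteq> 0" "A *v e4 = V x"
 obtains U \<xi> f where "open U" "x \<in> U" "U \<subseteq> N" "diffeo_onto_image U \<xi>" "\<xi> x = 0" "\<And>v. dd \<xi> x (A *v v) = v"
  "smooth_on U f" "\<And>z. z \<in> U ==> f z \<noteq> 0" "\<And>z. z \<in> U ==> dd \<xi> z (V z) = f z *R e4"
proof -
 define \<iota> where "\<iota> z = x + A *v z" for z :: point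
 define \<tau> where "\<tau> y = solve A (y - x)" for y :: point
 have sA: "solve A (A *v v) = v" "A *v solve A v = v" for v using solve_iff[OF A(1), of _ v] solve_iff[OF A(1), of v "A *v v"] by auto
 have lin: "linear (solve A)" by (rule solve_linear[OF A(1)])
 have it: "\<iota> (\<tau> y) = y" "\<tau> (\<iota> z) = z" for y z by (simp_all add: \<iota>_def \<tau>_def sA)
 have bA: "bounded_linear (solve A)" "bounded_linear ((*v) A)" using lin matrix_vector_mul_linear linear_conv_bounded_linear by blast+
 have d\<iota>: "(\<iota> has_derivative (\<lambda>v. A *v v)) (at z)" for z
  unfolding \<iota>_def[abs_def] using has_derivative_add[OF has_derivative_const bounded_linear.has_derivative[OF bA(2) has_derivative_ident]] by simp
 have d\<tau>: "(\<tau> has_derivative solve A) (at y)" for y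
  unfolding \<tau>_def[abs_def] using bounded_linear.has_derivative[OF bA(1) has_derivative_diff[OF has_derivative_ident has_derivative_const]] by simp
 have s\<iota>: "smooth_on UNIV \<iota>" unfolding \<iota>_def[abs_def]
  by (rule smooth_on_add[OF open_UNIV smooth_on_const smooth_on_linear[OF bA(2) open_UNIV smooth_on_id]])
 have s\<tau>: "smooth_on UNIV \<tau>" unfolding \<tau>_def[abs_def]
  by (rule smooth_on_compose[OF open_UNIV open_UNIV _ smooth_on_diff[OF open_UNIV smooth_on_id smooth_on_const] smooth_on_linear[OF bA(1) open_UNIV smooth_on_id]]) simp
 define N' where "N' = \<iota> -` N"
 have N': "open N'" unfolding N'_def by (rule open_vimage[OF N(1)]) (use smooth_on_continuous[OF s\<iota>] in auto)
 define W where "W z = solve A (V (\<iota> z))" for z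
 have sW: "smooth_on N' W" unfolding W_def[abs_def]
  by (rule smooth_on_compose[OF N' open_UNIV _ smooth_on_compose[OF N' N(1) _ smooth_on_subset[OF s\<iota>] N(2)] smooth_on_linear[OF bA(1) open_UNIV smooth_on_id]])
   (auto simp: N'_def)
 have W0: "W 0 = e4" "0 \<in> N'" using sA(1)[of e4] N(3) by (simp_all add: W_def \<iota>_def A(2) N'_def)
 define S where "S = {z \<in> N'. W z $ 4 \<noteq> 0}"
 have S: "open S" unfolding S_def by (intro open_nonzero N' smooth_on_continuous[OF smooth_on_nth] sW)
 have SN: "S \<subseteq> N'" and S0: "0 \<in> S" using W0 by (auto simp: S_def)
 \<comment> \<open>Dividing by the fourth component makes that coordinate the time of the flow; the
   divisor survives as the factor \<open>f\<close>.\<close>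
 define Z where "Z z = inverse (W z $ 4) *R W z" for z
 have sZ: "smooth_on S Z" unfolding Z_def[abs_def]
  by (intro smooth_on_scaleR smooth_on_inverse smooth_on_nth S smooth_on_subset[OF sW SN]) (auto simp: S_def)
 have Z4: "Z z $ 4 = 1" if "z \<in> S" for z using that by (simp add: Z_def S_def)
 have Z0: "Z 0 = e4" by (simp add: Z_def W0)
 obtain T U \<phi> where f: "T > 0" "open U" "{0} \<subseteq> U" "U \<subseteq> S" "smooth_on ({-T<..<T} \<times> U) (\<lambda>p. \<phi> (fst p) (snd p))"
  "\<And>x. x \<in> U ==> \<phi> 0 x = x"
  "\<And>t x. t \<in> {-T<..<T} ==> x \<in> U ==> \<phi> t x \<in> S"
  "\<And>t x. t \<in> {-T<..<T} ==> x \<in> U ==> ((\<lambda>s. \<phi> s x) has_vector_derivative Z (\<phi> t x)) (at t)"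
  "\<And>s t x. t \<in> {-T<..<T} ==> s \<in> {-T<..<T} ==> s + t \<in> {-T<..<T} ==> x \<in> U ==> \<phi> t x \<in> U
   ==> \<phi> s (\<phi> t x) = \<phi> (s + t) x"
  by (rule local_flow[OF S sZ, of "{0}"]) (use S0 in auto)
 interpret F: unit_flow S Z 4 T U \<phi>
  by unfold_locales (use f S sZ Z4 in auto)
 have U0: "0 \<in> U" using f(3) by simp
 note o = F.straight_origin[OF U0 Z0]
 obtain B where B: "open B" "0 \<in> B" "B \<subseteq> F.Q" "diffeo_onto_image B F.straight"
  using local_diffeo[OF F.Q_open F.smooth_straight o(1)] o(3) by auto
 have BS: "B \<subseteq> S" using B(3) f(4) by (auto simp: F.Q_def)
 define U1 where "U1 = \<tau> -` B"
 define \<xi> where "\<xi> y = F.straight (\<tau> y)" for y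
 have U1: "open U1" unfolding U1_def by (rule open_vimage[OF B(1)]) (use smooth_on_continuous[OF s\<tau>] in auto)
 have x1: "\<tau> x = 0" using it(2)[of 0] by (simp add: \<iota>_def)
 have dif\<tau>: "diffeo_onto_image U1 \<tau>"
 proof (rule diffeoI[OF U1 smooth_on_subset[OF s\<tau>]])
  show "inj_on \<tau> U1" by (rule inj_on_inverseI[of _ \<iota>]) (rule it)
  fix y v assume "dd \<tau> y v = 0"
  hence "solve A v = 0" unfolding frechet_eqI[OF d\<tau>] .
  thus "v = 0" using sA(2)[of v] by simp
 qed simp
 have dchi: "dd \<xi> y v = dd F.straight (\<tau> y) (solve A v)" if "y \<in> U1" for y v
 proof -
  have "dd \<xi> y v = dd F.straight (\<tau> y) (dd \<tau> y v)" unfolding \<xi>_def[abs_def]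
   by (rule dd_compose[OF smooth_onD[OF s\<tau>] smooth_onD[OF F.smooth_straight]]) (use that B(3) in \<open>auto simp: U1_def\<close>)
  thus ?thesis unfolding frechet_eqI[OF d\<tau>] .
 qed
 show thesis
 proof (rule that[of U1 \<xi> "\<lambda>y. W (\<tau> y) $ 4"])
  show "open U1" by (rule U1)
  show xU: "x \<in> U1" using B(2) by (simp add: U1_def x1)
  show UN: "U1 \<subseteq> N"
  proof
   fix y assume "y \<in> U1"
   hence "\<tau> y \<in> N'" using BS SN by (auto simp: U1_def)
   thus "y \<in> N" by (simp add: N'_def it)
  qed
  show "diffeo_onto_image U1 \<xi>" unfolding \<xi>_def[abs_def]
   by (rule diffeo_compose[OF dif\<tau> B(4)]) (auto simp: U1_def)
  show "\<xi> x = 0" by (simp add: \<xi>_def x1 o)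
  show "dd \<xi> x (A *v v) = v" for v by (simp add: dchi[OF xU] x1 sA o)
  show "smooth_on U1 (\<lambda>y. W (\<tau> y) $ 4)"
   by (intro smooth_on_nth U1 smooth_on_compose[OF U1 N' _ smooth_on_subset[OF s\<tau>] sW])
    (use BS SN in \<open>auto simp: U1_def\<close>)
  fix y assume y: "y \<in> U1"
  hence yS: "\<tau> y \<in> S" "\<tau> y \<in> F.Q" using BS B(3) by (auto simp: U1_def)
  thus n: "W (\<tau> y) $ 4 \<noteq> 0" by (simp add: S_def)
  have "solve A (V y) = W (\<tau> y) $ 4 *R Z (\<tau> y)" using n by (simp add: W_def it Z_def)
  thus "dd \<xi> y (V y) = W (\<tau> y) $ 4 *R e4"
   by (simp add: dchi[OF y] linear_scale[OF dd_lin[OF F.smooth_straight yS(2)]] F.dd_straight_field[OF yS(2)])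
 qed
qed

lemma lorentzian_transport:
 assumes N: "degenerate_lorentzian N g V" and U: "U \<subseteq> N" and \<xi>: "diffeo_onto_image U \<xi>"
  and f': "smooth_on U f" "\<forall>z\<in>U. f z \<noteq> 0 \<and> dd \<xi> z (V z) = f z *R e4"
 defines "T \<equiv> pullback (inv_into U \<xi>) g"
 shows "\<forall>z\<in>U. \<forall>v w. tensor_app (T (\<xi> z)) (dd \<xi> z v) (dd \<xi> z w) = tensor_app (g z) v w"
  and "degenerate_lorentzian (\<xi> ` U) T E4"
  and "\<And>z k. z \<in> U ==> flag g V z k = pull_tensor (jacobian \<xi> (at z)) ` flag T E4 (\<xi> z) k"
proof -
 have f: "smooth_on U f" "\<And>z. z \<in> U ==> f z \<noteq> 0" "\<And>z. z \<in> U ==> dd \<xi> z (V z) = f z *R e4" using f' by auto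
 note d = diffeoD[OF \<xi>] note i = diffeo_inverse[OF \<xi>] note L = degenerate_lorentzianD[OF N]
 have gU: "smooth_on U g" "smooth_on U V" using L(1,2) smooth_on_subset U by blast+
 have app: "tensor_app (T (\<xi> z)) (dd \<xi> z v) (dd \<xi> z w) = tensor_app (g z) v w" if z: "z \<in> U" for z v w
 proof -
  have z': "\<xi> z \<in> \<xi> ` U" using z by simp
  show ?thesis unfolding T_def pullback_app[OF smooth_onD[OF d(5) z']] by (simp add: i(2)[OF z] i(4)[OF z])
 qed
 thus "\<forall>z\<in>U. \<forall>v w. tensor_app (T (\<xi> z)) (dd \<xi> z v) (dd \<xi> z w) = tensor_app (g z) v w" by blast
 have sT: "smooth_on (\<xi> ` U) T" unfolding T_def
  by (rule smooth_on_pullback[OF d(2) d(1) _ d(5) gU(1)]) (simp add: i(7))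
 have lin: "linear (dd \<xi> z)" if "z \<in> U" for z by (rule dd_lin[OF d(4) that])
 have eV: "e4 = dd \<xi> z (inverse (f z) *R V z)" if "z \<in> U" for z
  using f(2,3)[OF that] by (simp add: linear_scale[OF lin[OF that]])
 have "transpose (T y) = T y \<and> e4 \<noteq> 0 \<and> {v. T y *v v = 0} = span {e4} \<and>
    (\<exists>\<epsilon>\<in>{1, -1}. \<exists>a b c.
      tensor_app (T y) a a = \<epsilon> \<and> tensor_app (T y) b b = -\<epsilon> \<and> tensor_app (T y) c c = -\<epsilon> \<and>
      tensor_app (T y) a b = 0 \<and> tensor_app (T y) a c = 0 \<and> tensor_app (T y) b c = 0)" if y: "y \<in> \<xi> ` U" for y
 proof -
  obtain z where z: "z \<in> U" "y = \<xi> z" using y by blast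
  have zN: "z \<in> N" using z U by auto
  have sym: "tensor_app (T y) v w = tensor_app (T y) w v" for v w
  proof -
   obtain v' w' where "dd \<xi> z v' = v" "dd \<xi> z w' = w" using diffeo_surj[OF \<xi> z(1)] by metis
   thus ?thesis using L(4) zN app[OF z(1), of v' w'] app[OF z(1), of w' v'] unfolding z(2) symmetric_on_def by metis
  qed
  have "transpose (T y) = T y" by (simp add: vec_eq_iff transpose_def sym[unfolded tensor_app_axis] tensor_app_axis[symmetric] sym[of "axis _ 1" "axis _ 1"]) 
  moreover have "{v. T y *v v = 0} = span {e4}"
  proof (intro set_eqI iffI)
   fix v assume "v \<in> {v. T y *v v = 0}"
   hence "tensor_app (T y) w v = 0" for w by (simp add: tensor_app_def)
   moreover obtain v' where v': "dd \<xi> z v' = v" using diffeo_surj[OF \<xi> z(1)] by metis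
   ultimately have "\<forall>w. tensor_app (g z) v' w = 0" using app[OF z(1), of v'] sym z(2) by metis
   then obtain c where "v' = c *R V z" using L(6)[OF zN] by (auto simp: span_singleton)
   thus "v \<in> span {e4}" using v' f(3)[OF z(1)] by (auto simp: linear_scale[OF lin[OF z(1)]] span_singleton)
  next
   fix v assume "v \<in> span {e4}"
   then obtain c where c: "v = c *R e4" by (auto simp: span_singleton)
   have "tensor_app (T y) w v = 0" for w
   proof -
    obtain w' where w': "dd \<xi> z w' = w" using diffeo_surj[OF \<xi> z(1)] by metis
    have "tensor_app (T y) w e4 = tensor_app (g z) w' (inverse (f z) *R V z)"
     unfolding eV[OF z(1)] z(2) w'[symmetric] by (rule app[OF z(1)])
    thus ?thesis using L(3) zN by (simp add: c tensor_app_linear annihilates_def)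
   qed
   hence "w \<bullet> (T y *v v) = 0" for w by (simp add: tensor_app_def)
   thus "v \<in> {v. T y *v v = 0}" using inner_eq_zero_iff by blast
  qed
  moreover have "\<exists>\<epsilon>\<in>{1, -1}. \<exists>a b c.
      tensor_app (T y) a a = \<epsilon> \<and> tensor_app (T y) b b = -\<epsilon> \<and> tensor_app (T y) c c = -\<epsilon> \<and>
      tensor_app (T y) a b = 0 \<and> tensor_app (T y) a c = 0 \<and> tensor_app (T y) b c = 0"
  proof -
   obtain \<epsilon> a b c where e: "\<epsilon> \<in> {1, -1 :: real}" "tensor_app (g z) a a = \<epsilon> \<and> tensor_app (g z) b b = -\<epsilon> \<and> tensor_app (g z) c c = -\<epsilon> \<and>
      tensor_app (g z) a b = 0 \<and> tensor_app (g z) a c = 0 \<and> tensor_app (g z) b c = 0"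
    using N zN unfolding degenerate_lorentzian_def by blast
   show ?thesis
    by (rule bexI[OF _ e(1)], rule exI[of _ "dd \<xi> z a"], rule exI[of _ "dd \<xi> z b"], rule exI[of _ "dd \<xi> z c"])
     (use e(2) in \<open>simp add: z(2) app[OF z(1)]\<close>)
  qed
  moreover have "e4 \<noteq> 0" using arg_cong[of e4 0 "\<lambda>v. v $ 4"] by auto
  ultimately show ?thesis by blast
 qed
 thus L': "degenerate_lorentzian (\<xi> ` U) T E4"
  using sT smooth_on_const unfolding degenerate_lorentzian_def by blast
 have ann: "annihilates U V g" using L(3) U by (auto simp: annihilates_def)
 have pb: "pullback \<xi> T z = 1 *R g z" if z: "z \<in> U" for z
  by (rule tensor_eqI) (simp add: pullback_app[OF smooth_onD[OF d(4) z]] app[OF z])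
 show "flag g V z k = pull_tensor (jacobian \<xi> (at z)) ` flag T E4 (\<xi> z) k" if z: "z \<in> U" for z k
  by (rule flag_transport[OF d(1,2) order_refl d(4) sT smooth_on_const gU f(1) smooth_on_const[of _ 1] f(2) _ pb f(3) ann z]) simp_all
qed

lemma isometry_compose:
 assumes \<xi>: "diffeo_onto_image U \<xi>" and T: "\<forall>z\<in>U. \<forall>v w. tensor_app (T (\<xi> z)) (dd \<xi> z v) (dd \<xi> z w) = tensor_app (g z) v w"
  and iso: "ode_isometry T W \<Psi> D F" and U1: "open U1" "U1 \<subseteq> U" "\<xi> ` U1 \<subseteq> W"
 shows "ode_isometry g U1 (\<lambda>z. \<Psi> (\<xi> z)) D F"
proof -
 obtain \<rho> where ode: "third_order_ode D F" and P: "diffeo_onto_image W \<Psi>" "\<Psi> ` W \<subseteq> D" and r: "smooth_on W \<rho>"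
  "\<And>y. y \<in> W ==> \<rho> y \<noteq> 0 \<and> pullback \<Psi> (ode_metric F) y = \<rho> y *R T y"
  using iso unfolding ode_isometry_def by blast
 have c1: "diffeo_onto_image U1 \<xi>" by (rule diffeo_subset[OF \<xi> U1(1,2)])
 note d = diffeoD[OF c1] note dP = diffeoD[OF P(1)]
 have dif: "diffeo_onto_image U1 (\<lambda>z. \<Psi> (\<xi> z))" by (rule diffeo_compose[OF c1 P(1) U1(3)])
 show ?thesis unfolding ode_isometry_def
 proof (intro conjI exI[of _ "\<lambda>z. \<rho> (\<xi> z)"] ballI ode dif)
  show "(\<lambda>z. \<Psi> (\<xi> z)) ` U1 \<subseteq> D" using U1(3) P(2) by auto
  show "smooth_on U1 (\<lambda>z. \<rho> (\<xi> z))" by (rule smooth_on_compose[OF d(1) dP(1) U1(3) d(4) r(1)])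
  fix z assume z: "z \<in> U1"
  have W: "\<xi> z \<in> W" "z \<in> U" using U1 z by auto
  show "\<rho> (\<xi> z) \<noteq> 0" using r(2)[OF W(1)] by blast
  show "pullback (\<lambda>z. \<Psi> (\<xi> z)) (ode_metric F) z = \<rho> (\<xi> z) *R g z"
  proof (rule tensor_eqI)
   fix v w
   have dc: "dd (\<lambda>z. \<Psi> (\<xi> z)) z v = dd \<Psi> (\<xi> z) (dd \<xi> z v)" for v
    by (rule dd_compose[OF smooth_onD[OF d(4) z] smooth_onD[OF dP(4) W(1)]])
   have "tensor_app (pullback (\<lambda>z. \<Psi> (\<xi> z)) (ode_metric F) z) v w
    = tensor_app (pullback \<Psi> (ode_metric F) (\<xi> z)) (dd \<xi> z v) (dd \<xi> z w)"
    unfolding pullback_app[OF smooth_onD[OF diffeoD(4)[OF dif] z]] pullback_app[OF smooth_onD[OF dP(4) W(1)]] dc ..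
   also have "\<dots> = tensor_app (\<rho> (\<xi> z) *R g z) v w"
    using r(2)[OF W(1)] using bspec[OF T W(2)] by (simp add: tensor_app_linear)
   finally show "tensor_app (pullback (\<lambda>z. \<Psi> (\<xi> z)) (ode_metric F) z) v w = tensor_app (\<rho> (\<xi> z) *R g z) v w" .
  qed
 qed
qed

lemma isometry_rescale:
 assumes iso: "ode_isometry h W \<Psi> D F" and r: "smooth_on W r" "\<And>z. z \<in> W ==> r z \<noteq> 0" "\<And>z. z \<in> W ==> h z = r z *R g z"
 shows "ode_isometry g W \<Psi> D F"
proof -
 obtain \<rho> where o: "third_order_ode D F" "diffeo_onto_image W \<Psi>" "\<Psi> ` W \<subseteq> D" and s: "smooth_on W \<rho>"
  "\<And>y. y \<in> W ==> \<rho> y \<noteq> 0 \<and> pullback \<Psi> (ode_metric F) y = \<rho> y *R h y"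
  using iso unfolding ode_isometry_def by blast
 have "smooth_on W (\<lambda>z. \<rho> z * r z)" by (intro smooth_on_mult diffeoD(1)[OF o(2)] s r)
 moreover have "\<rho> z * r z \<noteq> 0 \<and> pullback \<Psi> (ode_metric F) z = (\<rho> z * r z) *R g z" if "z \<in> W" for z
  using s(2)[OF that] r(2,3)[OF that] by simp
 ultimately show ?thesis unfolding ode_isometry_def using o by blast
qed

section \<open>Linear algebra of a degenerate Lorentzian form\<close>

lemma columns_app: "transpose (vector [n1, n2, n3, n4] :: real ^ 4 ^ 4) *v v = v $ 1 *R n1 + v $ 2 *R n2 + v $ 3 *R n3 + v $ 4 *R n4"
 unfolding vec_eq_iff by (intro allI) (simp add: matrix_vector_mult_def transpose_def sum_4)

lemma columns_det:
 assumes "\<And>v :: point. v $ 1 *R n1 + v $ 2 *R n2 + v $ 3 *R n3 + v $ 4 *R n4 = 0 ==> v = 0"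
 shows "det (transpose (vector [n1, n2, n3, n4] :: real ^ 4 ^ 4)) \<noteq> 0"
proof -
 let ?A = "transpose (vector [n1, n2, n3, n4] :: real ^ 4 ^ 4)"
 have "\<forall>v. ?A *v v = 0 \<longrightarrow> v = 0" using assms unfolding columns_app by blast
 hence "\<exists>B. B ** ?A = mat 1" by (simp add: matrix_left_invertible_ker)
 thus ?thesis unfolding invertible_left_inverse[symmetric] invertible_det_nz .
qed

lemma lorentz_coords:
 assumes N: "degenerate_lorentzian N g V" and x: "x \<in> N"
 obtains \<epsilon> A where "\<epsilon> = 1 \<or> \<epsilon> = -1" "det A \<noteq> 0" "A *v e4 = V x"
  "\<And>p q. tensor_app (g x) (A *v p) (A *v q) = \<epsilon> * (p $ 1 * q $ 1 - p $ 2 * q $ 2 - p $ 3 * q $ 3)"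
  "\<And>p. p $ 1 = 0 ==> p $ 2 = 0 ==> p $ 3 = 0 ==> A *v p \<in> span {V x}"
proof -
 obtain \<epsilon> a b c where e: "\<epsilon> \<in> {1, -1 :: real}" "tensor_app (g x) a a = \<epsilon> \<and> tensor_app (g x) b b = -\<epsilon> \<and> tensor_app (g x) c c = -\<epsilon> \<and>
  tensor_app (g x) a b = 0 \<and> tensor_app (g x) a c = 0 \<and> tensor_app (g x) b c = 0"
  using N x unfolding degenerate_lorentzian_def by blast
 note L = degenerate_lorentzianD[OF N]
 have an: "tensor_app (g x) (V x) w = 0" "tensor_app (g x) w (V x) = 0" for w using L(3) x by (auto simp: annihilates_def)
 have s: "tensor_app (g x) v w = tensor_app (g x) w v" for v w using bspec[OF L(4)[unfolded symmetric_on_def] x] by blast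
 have r: "tensor_app (g x) a a = \<epsilon>" "tensor_app (g x) b b = -\<epsilon>" "tensor_app (g x) c c = -\<epsilon>"
  "tensor_app (g x) a b = 0" "tensor_app (g x) a c = 0" "tensor_app (g x) b c = 0"
  "tensor_app (g x) b a = 0" "tensor_app (g x) c a = 0" "tensor_app (g x) c b = 0"
  using e(2) s[of b a] s[of c a] s[of c b] by simp_all
 define A where "A = (transpose (vector [a, b, c, V x]) :: real ^ 4 ^ 4)"
 have Ap: "A *v p = p $ 1 *R a + p $ 2 *R b + p $ 3 *R c + p $ 4 *R V x" for p
  unfolding A_def by (rule columns_app)
 have f: "tensor_app (g x) (A *v p) (A *v q) = \<epsilon> * (p $ 1 * q $ 1 - p $ 2 * q $ 2 - p $ 3 * q $ 3)" for p q
  unfolding Ap tensor_app_linear an r by (simp add: algebra_simps)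
 have "det A \<noteq> 0" unfolding A_def
 proof (rule columns_det, fold Ap)
  fix v :: point
  assume 0: "A *v v = 0"
  have "\<epsilon> * (v $ 1 * q $ 1 - v $ 2 * q $ 2 - v $ 3 * q $ 3) = 0" for q :: point
   unfolding f[symmetric] 0 by (simp add: tensor_app_linear)
  from this[of "axis 1 1"] this[of "axis 2 1"] this[of "axis 3 1"] e(1)
  have z: "v $ 1 = 0" "v $ 2 = 0" "v $ 3 = 0" by (auto simp: axis_def)
  hence "v $ 4 = 0" using 0 L(5)[OF x] by (simp add: Ap)
  thus "v = 0" using z by (simp add: vec_eq_iff forall_4)
 qed
 moreover have "A *v p \<in> span {V x}" if "p $ 1 = 0" "p $ 2 = 0" "p $ 3 = 0" for p
  unfolding Ap that by (simp add: span_base span_mul)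
 ultimately show thesis using that[OF _ _ _ f] e(1) by (simp add: Ap)
qed

text \<open>A Lorentzian form in three dimensions has no totally null plane. In coordinates,
  Lagrange's identity makes the spatial parts of the two vectors parallel, and the same determinant
  then bounds the remaining minors.\<close>

lemma lorentz_null_pair:
 assumes N: "degenerate_lorentzian N g V" and x: "x \<in> N"
  and uw: "tensor_app (g x) u u = 0" "tensor_app (g x) u w = 0" "tensor_app (g x) w w = 0"
 shows "\<exists>c d. (c \<noteq> 0 \<or> d \<noteq> 0) \<and> c *R u + d *R w \<in> span {V x}"
proof -
 obtain \<epsilon> A where e: "\<epsilon> = 1 \<or> \<epsilon> = -1" "det A \<noteq> 0" "A *v e4 = V x"
  and f: "\<And>p q. tensor_app (g x) (A *v p) (A *v q) = \<epsilon> * (p $ 1 * q $ 1 - p $ 2 * q $ 2 - p $ 3 * q $ 3)"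
  and sp: "\<And>p. p $ 1 = 0 ==> p $ 2 = 0 ==> p $ 3 = 0 ==> A *v p \<in> span {V x}"
  by (rule lorentz_coords[OF N x]) blast
 obtain p q where p: "A *v p = u" and q: "A *v q = w" using solve_iff[OF e(2)] by blast
 have n: "\<epsilon> \<noteq> 0" using e(1) by auto
 have 1: "(p $ 1)\<^sup>2 = (p $ 2)\<^sup>2 + (p $ 3)\<^sup>2" "p $ 1 * q $ 1 = p $ 2 * q $ 2 + p $ 3 * q $ 3" "(q $ 1)\<^sup>2 = (q $ 2)\<^sup>2 + (q $ 3)\<^sup>2"
  using n uw[folded p q, unfolded f mult_eq_0_iff] unfolding power2_eq_square by argo+
 have 2: "(p $ 2 * q $ 3 - p $ 3 * q $ 2)\<^sup>2 = ((p $ 2)\<^sup>2 + (p $ 3)\<^sup>2) * ((q $ 2)\<^sup>2 + (q $ 3)\<^sup>2) - (p $ 2 * q $ 2 + p $ 3 * q $ 3)\<^sup>2"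
  by (simp add: power2_eq_square algebra_simps)
 have "(p $ 2 * q $ 3 - p $ 3 * q $ 2)\<^sup>2 = 0" unfolding 2 1[symmetric] by (simp add: power2_eq_square algebra_simps)
 hence m: "p $ 2 * q $ 3 = p $ 3 * q $ 2" by simp
 show ?thesis
 proof (cases "p $ 1 = 0 \<and> q $ 1 = 0")
  case True
  hence "p $ 2 = 0" "p $ 3 = 0" using 1(1) by (simp_all add: sum_power2_eq_zero_iff)
  hence "u \<in> span {V x}" using sp[of p] p True by simp
  hence "1 *R u + 0 *R w \<in> span {V x}" by simp
  thus ?thesis using one_neq_zero by blast
 next
  case False
  have "(q $ 1 * p $ 2 - p $ 1 * q $ 2)\<^sup>2 = (q $ 1)\<^sup>2 * (p $ 2)\<^sup>2 - 2 * (p $ 1 * q $ 1) * (p $ 2 * q $ 2) + (p $ 1)\<^sup>2 * (q $ 2)\<^sup>2"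
   by (simp add: power2_eq_square algebra_simps)
  also have "\<dots> = (p $ 2 * q $ 3 - p $ 3 * q $ 2)\<^sup>2" unfolding 1 by (simp add: power2_eq_square algebra_simps)
  finally have r2: "q $ 1 * p $ 2 - p $ 1 * q $ 2 = 0" by (simp add: m)
  have "(q $ 1 * p $ 3 - p $ 1 * q $ 3)\<^sup>2 = (q $ 1)\<^sup>2 * (p $ 3)\<^sup>2 - 2 * (p $ 1 * q $ 1) * (p $ 3 * q $ 3) + (p $ 1)\<^sup>2 * (q $ 3)\<^sup>2"
   by (simp add: power2_eq_square algebra_simps)
  also have "\<dots> = (p $ 2 * q $ 3 - p $ 3 * q $ 2)\<^sup>2" unfolding 1 by (simp add: power2_eq_square algebra_simps)
  finally have r3: "q $ 1 * p $ 3 - p $ 1 * q $ 3 = 0" by (simp add: m)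
  have "q $ 1 *R u + (- (p $ 1)) *R w = A *v (q $ 1 *R p - p $ 1 *R q)"
   by (simp add: p[symmetric] q[symmetric] matrix_vector_mult_diff_distrib matrix_vector_mult_scaleR)
  also have "\<dots> \<in> span {V x}" by (rule sp) (use r2 r3 in simp_all)
  finally have "q $ 1 *R u + (- (p $ 1)) *R w \<in> span {V x}" .
  moreover have "q $ 1 \<noteq> 0 \<or> - (p $ 1) \<noteq> 0" using False by auto
  ultimately show ?thesis by blast
 qed
qed

text \<open>\<open>Gamma_osc\<close> is the pairing of \<open>Gamma\<close> with the fifth
  derivative, and rank one lets the square of the column \<open>i\<close> stand for G_ii times
  \<open>Gamma\<close>. So \<open>Gamma_osc\<close> becomes the value of that derivative on a null
  vector.\<close>

lemma Gamma_osc_column: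
 assumes N: "open N" "smooth_on N V" "smooth_on N g" "annihilates N V g" "symmetric_on N g" and x: "x \<in> N"
  and adj: "adjugate (Gamma g V E x) = 0"
 defines "e \<equiv> \<lambda>i. \<Sum>j\<in>UNIV. Gamma g V E x $ j $ i *R E x $ j"
 shows "Gamma_osc g V E x * Gamma g V E x $ i $ i = tensor_app ((\<L> V ^^ 5) g x) (e i) (e i)"
  and "Gamma g V E x \<noteq> 0 ==> \<exists>i. Gamma g V E x $ i $ i \<noteq> 0"
proof -
 let ?G = "Gamma g V E x"
 have mi: "?G $ i $ k * ?G $ j $ l = ?G $ i $ l * ?G $ j $ k" for i j k l using adj[unfolded minors_adjugate] by blast
 have sG: "?G $ i $ j = ?G $ j $ i" for i j unfolding Gamma_def using wedge5_symm by (auto simp: symm_def)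
 have m2: "?G $ j $ k * ?G $ i $ i = ?G $ j $ i * ?G $ k $ i" for j k
  unfolding mi[of j k i i] sG[of i k] ..
 have tl: "tensor_app S (e i) w = (\<Sum>j\<in>UNIV. ?G $ j $ i * tensor_app S (E x $ j) w)"
  and tr: "tensor_app S w (e i) = (\<Sum>j\<in>UNIV. ?G $ j $ i * tensor_app S w (E x $ j))" for S w
  unfolding e_def tensor_app_sum_left tensor_app_sum_right by (simp_all add: tensor_app_linear)
 have "symmetric_on N ((\<L> V ^^ 5) g)" by (rule symmetric_lie_iter[OF N(1,2,3,5)])
 hence sy: "symm (lie_jet g V E x 5)" using x by (simp add: symm_def lie_jet_def frame_matrix_def symmetric_on_def)
 have "Gamma_osc g V E x = tr_pair ?G (lie_jet g V E x 5)"
  unfolding Gamma_osc_def Gamma_def by (rule wedge6_tr_pair[OF sy])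
 hence "Gamma_osc g V E x * ?G $ i $ i = (\<Sum>j\<in>UNIV. \<Sum>k\<in>UNIV. ?G $ j $ k * ?G $ i $ i * lie_jet g V E x 5 $ j $ k)"
  by (simp add: tr_pair_def sum_distrib_left sum_distrib_right mult_ac)
 also have "\<dots> = (\<Sum>j\<in>UNIV. \<Sum>k\<in>UNIV. ?G $ j $ i * ?G $ k $ i * lie_jet g V E x 5 $ j $ k)"
  by (simp only: m2)
 also have "\<dots> = tensor_app ((\<L> V ^^ 5) g x) (e i) (e i)"
  by (subst tl, unfold tr sum_distrib_left) (simp add: lie_jet_def frame_matrix_def mult.assoc)
 finally show "Gamma_osc g V E x * ?G $ i $ i = tensor_app ((\<L> V ^^ 5) g x) (e i) (e i)" .
 show "\<exists>i. ?G $ i $ i \<noteq> 0" if "?G \<noteq> 0"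
 proof (rule ccontr)
  assume "\<not> ?thesis"
  hence "?G $ i $ j * ?G $ i $ j = 0" for i j using mi[of i j j i] sG[of i j] by auto
  thus False using that by (simp add: vec_eq_iff)
 qed
qed

section \<open>Coordinates adapted to the null directions given by \<open>Gamma\<close>\<close>

lemma smooth_wedge6:
 assumes N: "open N" and "\<And>i j. smooth_on N (\<lambda>z. A z $ i $ j)" "\<And>i j. smooth_on N (\<lambda>z. B z $ i $ j)"
  "\<And>i j. smooth_on N (\<lambda>z. C z $ i $ j)" "\<And>i j. smooth_on N (\<lambda>z. D z $ i $ j)"
  "\<And>i j. smooth_on N (\<lambda>z. E z $ i $ j)" "\<And>i j. smooth_on N (\<lambda>z. F z $ i $ j)"
 shows "smooth_on N (\<lambda>z. wedge6 (A z) (B z) (C z) (D z) (E z) (F z))"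
proof -
 have s: "smooth_on N (\<lambda>z. sym_coords (M z) $ i)" if "\<And>i j. smooth_on N (\<lambda>z. M z $ i $ j)" for M i
  using exhaust_6[of i] by (elim disjE) (simp_all add: sym_coords_def that)
 show ?thesis unfolding wedge6_def
 proof (rule smooth_on_det[OF N])
  fix i j :: 6
  show "smooth_on N (\<lambda>z. (vector [sym_coords (A z), sym_coords (B z), sym_coords (C z), sym_coords (D z), sym_coords (E z), sym_coords (F z)] :: real ^ 6 ^ 6) $ i $ j)"
   using exhaust_6[of i] by (elim disjE) (simp_all add: s assms)
 qed
qed

text \<open>A smooth representative of the line is a column of \<open>Gamma\<close> divided by its
  diagonal entry, which is nonzero near the point. One component is then constantly 1 and the fourth
  constantly 0, so both drop out of all derivatives along \<open>e4\<close>.\<close>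

lemma null_line_field:
 assumes N: "open N" "degenerate_lorentzian N T E4" "x \<in> N"
  and fl: "\<And>z. z \<in> N ==> flag_indep T E4 z 6" "\<And>z. z \<in> N ==> \<exists>w. w \<notin> span {e4} \<and> flag_null T E4 z w"
 obtains U e i where "open U" "x \<in> U" "U \<subseteq> N" "smooth_on U e" "\<And>z. z \<in> U ==> e z $ 4 = 0" "i \<noteq> 4" "\<And>z. z \<in> U ==> e z $ i = 1"
  "\<And>z. z \<in> U ==> flag_null T E4 z (e z)"
  "\<And>z. z \<in> U ==> tensor_app ((\<L> E4 ^^ 5) T z) (e z) (e z) \<noteq> 0"
proof -
 note L = degenerate_lorentzianD[OF N(2)]
 define E :: "point \<Rightarrow> point ^ 3" where "E = (\<lambda>_. vector [axis 1 1, axis 2 1, axis 3 1])"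
 have E: "E z $ 1 = axis 1 1" "E z $ 2 = axis 2 1" "E z $ 3 = axis 3 1" for z by (simp_all add: E_def)
 have dE: "det (vector [e4, E z $ 1, E z $ 2, E z $ 3] :: real ^ 4 ^ 4) \<noteq> 0" for z
 proof -
  have "det (transpose (vector [e4, axis 1 1, axis 2 1, axis 3 1] :: real ^ 4 ^ 4)) \<noteq> 0"
   by (rule columns_det) (simp add: vec_eq_iff forall_4 axis_def)
  thus ?thesis by (simp add: E)
 qed
 define G where "G = Gamma T E4 E"
 note GF = Gamma_flag[where E = E, OF N(1) L(2,1,3,4) _ dE, folded G_def]
 have i56: "flag_indep T E4 z 5" if "z \<in> N" for z
  using fl(1)[OF that] unfolding flag_indep_def by (auto intro: inj_on_subset independent_mono)
 have G0: "G z \<noteq> 0" and adj: "adjugate (G z) = 0" and osc: "Gamma_osc T E4 E z \<noteq> 0" if "z \<in> N" for z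
  using GF(1-3)[OF that] i56[OF that] fl[OF that] by auto
 have sG: "smooth_on N (\<lambda>z. G z $ j $ k)" for j k
 proof -
  have J: "smooth_on N (\<lambda>z. lie_jet T E4 E z n $ p $ q)" for n p q
   unfolding lie_jet_def frame_matrix_def E_def
   by (simp, intro smooth_on_tensor_app N(1) smooth_on_lie_iter smooth_on_const L(1))
  show ?thesis unfolding G_def Gamma_def wedge5_def
   by (simp, intro smooth_wedge6 N(1) J smooth_on_const)
 qed
 obtain i0 where i0: "G x $ i0 $ i0 \<noteq> 0"
  using Gamma_osc_column(2)[OF N(1) L(2,1,3,4) N(3), of E] adj[OF N(3)] G0[OF N(3)] unfolding G_def by blast
 define U where "U = {z \<in> N. G z $ i0 $ i0 \<noteq> 0}"
 have U: "open U" unfolding U_def by (intro open_nonzero N(1) smooth_on_continuous sG)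
 have UN: "U \<subseteq> N" by (auto simp: U_def)
 define c where "c z = (\<Sum>j\<in>UNIV. G z $ j $ i0 *R E z $ j)" for z
 define e where "e z = inverse (G z $ i0 $ i0) *R c z" for z
 define i :: 4 where "i = (if i0 = 1 then 1 else if i0 = 2 then 2 else 3)"
 have sGU: "smooth_on U (\<lambda>z. G z $ j $ k)" for j k by (rule smooth_on_subset[OF sG UN])
 have sc: "smooth_on U c" unfolding c_def[abs_def] E_def
  by (intro smooth_on_sum smooth_on_scaleR U sGU smooth_on_const)
 show thesis
 proof (rule that[of U e i])
  show "open U" "x \<in> U" "U \<subseteq> N" by (fact U, use N(3) i0 in \<open>simp add: U_def\<close>, fact UN)
  show "smooth_on U e" unfolding e_def[abs_def]
   by (intro smooth_on_scaleR smooth_on_inverse U sGU sc) (simp add: U_def)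
  show "i \<noteq> 4" by (simp add: i_def)
  fix z assume z: "z \<in> U"
  hence zN: "z \<in> N" and nz: "G z $ i0 $ i0 \<noteq> 0" by (auto simp: U_def)
  show "e z $ 4 = 0" by (simp add: e_def c_def E sum_3 axis_def)
  have "c z $ i = G z $ i0 $ i0"
   using exhaust_3[of i0] by (elim disjE) (simp_all add: c_def E sum_3 axis_def i_def)
  thus "e z $ i = 1" using nz by (simp add: e_def)
  show "flag_null T E4 z (e z)"
   using GF(4)[OF zN adj[OF zN], of i0] unfolding e_def c_def flag_null_iff tensor_app_linear by simp
  have oc: "Gamma_osc T E4 E z * G z $ i0 $ i0 = tensor_app ((\<L> E4 ^^ 5) T z) (c z) (c z)"
   unfolding c_def G_def by (rule Gamma_osc_column(1)[OF N(1) L(2,1,3,4) zN adj[OF zN, unfolded G_def]])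
  have "tensor_app ((\<L> E4 ^^ 5) T z) (c z) (c z) \<noteq> 0"
   unfolding oc[symmetric] using osc[OF zN] nz by (intro no_zero_divisors)
  thus "tensor_app ((\<L> E4 ^^ 5) T z) (e z) (e z) \<noteq> 0"
   using nz unfolding e_def tensor_app_linear by (intro no_zero_divisors) simp_all
 qed
qed

lemma open_preimage: "open B ==> smooth_on B k ==> open S ==> open (B \<inter> k -` S)"
 by (rule continuous_open_preimage[OF smooth_on_continuous])

lemma flag_null_shift:
 assumes "open N" "smooth_on N V" "smooth_on N h" "annihilates N V h" "z \<in> N"
 shows "flag_null h V z (v + c *R V z) \<longleftrightarrow> flag_null h V z v"
proof -
 have "tensor_app ((\<L> V ^^ k) h z) (V z) w = 0" "tensor_app ((\<L> V ^^ k) h z) w (V z) = 0" for k w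
  using bspec[OF annihilates_lie_iter[OF assms(1-4), of k, unfolded annihilates_def] assms(5)] by blast+
 thus ?thesis by (simp add: flag_null_iff tensor_app_linear)
qed

lemma lorentzian_nonzero:
 assumes N: "degenerate_lorentzian N g V" and x: "x \<in> N"
 shows "g x \<noteq> 0"
proof
 assume 0: "g x = 0"
 obtain \<epsilon> A where e: "\<epsilon> = 1 \<or> \<epsilon> = -1" and
  f: "\<And>p q :: point. tensor_app (g x) (A *v p) (A *v q) = \<epsilon> * (p $ 1 * q $ 1 - p $ 2 * q $ 2 - p $ 3 * q $ 3)"
  by (rule lorentz_coords[OF N x]) blast
 have "\<epsilon> = tensor_app (g x) (A *v axis 1 1) (A *v axis 1 1)" unfolding f by (simp add: axis_def)
 also have "\<dots> = 0" unfolding 0 by (simp only: tensor_app_linear)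
 finally show False using e by auto
qed

lemma null_derivatives:
 assumes U: "open U" "smooth_on U T" "symmetric_on U T" and e: "smooth_on U e"
  and null: "\<And>z. z \<in> U ==> flag_null T E4 z (e z)" and z: "z \<in> U"
 defines "L k \<equiv> (\<L> E4 ^^ k) T" and "e' \<equiv> \<lambda>y. dd e y e4"
 shows "tensor_app (L 5 z) (e z) (e z) + 2 * tensor_app (L 4 z) (e z) (e' z) = 0"
  and "tensor_app (T z) (e z) (e z) = 0" and "tensor_app (T z) (e z) (e' z) = 0"
  and "tensor_app (T z) (e' z) (e' z) + tensor_app (T z) (e z) (dd e' z e4) = 0"
proof -
 have Ls: "smooth_on U (L k)" for k unfolding L_def by (rule smooth_on_lie_iter[OF U(1) smooth_on_const U(2)])
 have LS: "\<L> E4 (L k) = L (Suc k)" for k by (simp add: L_def)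
 have sym: "tensor_app (L k z) v w = tensor_app (L k z) w v" if "z \<in> U" for k z v w
  using bspec[OF symmetric_lie_iter[OF U(1) smooth_on_const U(2,3), of k e4, unfolded symmetric_on_def] that] unfolding L_def by blast
 have e's: "smooth_on U e'" unfolding e'_def by (rule smooth_on_frechet[OF e])
 have 0: "tensor_app (L k z) (e z) (e z) = 0" if "k < 5" "z \<in> U" for k z
  using null[OF that(2)] that(1) by (simp add: flag_null_iff L_def)
 have 1: "tensor_app (L (Suc k) z) (e z) (e z) + 2 * tensor_app (L k z) (e z) (e' z) = 0" if k: "k < 5" and z: "z \<in> U" for k z
 proof -
  have "dd (\<lambda>z. tensor_app (L k z) (e z) (e z)) z e4 = 0" by (rule dd_vanish[OF U(1) z 0[OF k]])
  thus ?thesis unfolding dd_tensor_e4[OF U(1) Ls e e z] LS sym[OF z, of k "dd e z e4" "e z"] e'_def by simp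
 qed
 have 2: "tensor_app (L k z) (e z) (e' z) = 0" if k: "k < 4" and z: "z \<in> U" for k z
  using 1[of k z] 0[of "Suc k" z] k z by simp
 show "tensor_app (L 5 z) (e z) (e z) + 2 * tensor_app (L 4 z) (e z) (e' z) = 0" using 1[of 4 z] z by simp
 have L0: "L 0 = T" by (simp add: L_def)
 show "tensor_app (T z) (e z) (e z) = 0" "tensor_app (T z) (e z) (e' z) = 0"
  using 0[of 0 z] 2[of 0 z] z by (simp_all add: L0)
 have "dd (\<lambda>z. tensor_app (L 0 z) (e z) (e' z)) z e4 = 0" by (rule dd_vanish[OF U(1) z 2]) simp_all
 thus "tensor_app (T z) (e' z) (e' z) + tensor_app (T z) (e z) (dd e' z e4) = 0"
  unfolding dd_tensor_e4[OF U(1) Ls e e's z] LS using 2[of 1 z] z by (simp add: L0 e'_def)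
qed

lemma null_line_chart:
 assumes N: "open N" "degenerate_lorentzian N T E4" "0 \<in> N"
  and fl: "\<And>z. z \<in> N ==> flag_indep T E4 z 6" "\<And>z. z \<in> N ==> \<exists>w. w \<notin> span {e4} \<and> flag_null T E4 z w"
 obtains B \<kappa> s b where "open B" "0 \<in> B" "B \<subseteq> N" "diffeo_onto_image B \<kappa>" "\<kappa> 0 = 0" "smooth_on B s" "\<And>z. z \<in> B ==> s z \<noteq> 0"
  "\<And>z. z \<in> B ==> dd \<kappa> z e4 = s z *R e4" "smooth_on (\<kappa> ` B) b" "dd (\<lambda>y. dd b y e4) 0 e4 \<noteq> 0"
  "\<And>z. z \<in> B ==> \<exists>e c. flag_null T E4 z e \<and> dd \<kappa> z e = null_dir b (\<kappa> z) + c *R e4"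
proof -
 note L = degenerate_lorentzianD[OF N(2)]
 obtain U e i where U: "open U" "0 \<in> U" "U \<subseteq> N" and e: "smooth_on U e" and e4: "\<And>z. z \<in> U ==> e z $ 4 = 0"
  and i: "i \<noteq> 4" and ei: "\<And>z. z \<in> U ==> e z $ i = 1" and null: "\<And>z. z \<in> U ==> flag_null T E4 z (e z)"
  and L5: "\<And>z. z \<in> U ==> tensor_app ((\<L> E4 ^^ 5) T z) (e z) (e z) \<noteq> 0"
  by (rule null_line_field[OF N fl]) blast+
 define e' where "e' = (\<lambda>z. dd e z e4)"
 define e'' where "e'' z = dd e' z e4" for z
 have e's: "smooth_on U e'" unfolding e'_def by (rule smooth_on_frechet[OF e])
 have comp: "dd f z e4 $ j = 0" if f: "smooth_on U f" and c: "\<And>z. z \<in> U ==> f z $ j = c" and z: "z \<in> U" for f :: "point \<Rightarrow> point" and c j z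
 proof -
  have "dd f z e4 $ j = dd (\<lambda>z. f z $ j) z e4" by (rule dd_vec_nth[OF smooth_onD[OF f z], symmetric])
  also have "\<dots> = 0" using frechet_cong[OF U(1) z, of "\<lambda>z. f z $ j" "\<lambda>_. c"] c by simp
  finally show ?thesis .
 qed
 have c': "e' z $ 4 = 0" "e' z $ i = 0" if "z \<in> U" for z
  unfolding e'_def by (rule comp[OF e e4 that], assumption, rule comp[OF e ei that])
 have c'': "e'' z $ 4 = 0" "e'' z $ i = 0" if "z \<in> U" for z
  unfolding e''_def by (rule comp[OF e's c'(1) that], assumption, rule comp[OF e's c'(2) that])
 have TU: "smooth_on U T" "symmetric_on U T" using smooth_on_subset[OF L(1) U(3)] L(4) U(3) by (auto simp: symmetric_on_def)
 have nd: "tensor_app ((\<L> E4 ^^ 5) T 0) (e 0) (e 0) + 2 * tensor_app ((\<L> E4 ^^ 4) T 0) (e 0) (e' 0) = 0"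
  "tensor_app (T 0) (e 0) (e 0) = 0" "tensor_app (T 0) (e 0) (e' 0) = 0"
  "tensor_app (T 0) (e' 0) (e' 0) + tensor_app (T 0) (e 0) (e'' 0) = 0"
  using null_derivatives[OF U(1) TU e null U(2)] by (simp_all add: e'_def e''_def)
 \<comment> \<open>This is the use of the fifth Lie derivative: were the derivative of
   \<open>e\<close> zero at the origin, its value on \<open>e\<close> would vanish.\<close>
 have e'0: "e' 0 \<noteq> 0"
 proof
  assume "e' 0 = 0"
  thus False using nd(1) L5[OF U(2)] by (simp add: tensor_app_linear)
 qed
 \<comment> \<open>Otherwise \<open>e\<close> and \<open>e'\<close> would be dependent modulo
   \<open>e4\<close>; the normalized components \<open>i\<close> and \<open>4\<close> exclude
   that.\<close>
 have Te: "tensor_app (T 0) (e' 0) (e' 0) \<noteq> 0"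
 proof
  assume 0: "tensor_app (T 0) (e' 0) (e' 0) = 0"
  obtain c d where cd: "c \<noteq> 0 \<or> d \<noteq> 0" "c *R e 0 + d *R e' 0 \<in> span {e4}"
   using lorentz_null_pair[OF N(2,3) nd(2,3) 0] by blast
  obtain k where k: "c *R e 0 + d *R e' 0 = k *R e4" using cd(2) by (auto simp: span_singleton)
  have "c = 0" using arg_cong[OF k, of "\<lambda>v. v $ i"] ei[OF U(2)] c'[OF U(2)] i by (simp add: axis_def)
  moreover have "k = 0" using arg_cong[OF k, of "\<lambda>v. v $ 4"] e4[OF U(2)] c'[OF U(2)] by simp
  ultimately show False using k cd(1) e'0 by simp
 qed
 \<comment> \<open>Axes along e, e'', e' and \<open>e4\<close>. At the origin the components of
   \<open>e\<close> then agree to second order along the fibre with the model (1, t^2 / 2, t,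
   0).\<close>
 define A where "A = transpose (vector [e 0, e'' 0, e' 0, e4] :: real ^ 4 ^ 4)"
 have Av: "A *v v = v $ 1 *R e 0 + v $ 2 *R e'' 0 + v $ 3 *R e' 0 + v $ 4 *R e4" for v
  unfolding A_def by (rule columns_app)
 have Ai: "(A *v v) $ i = v $ 1" "(A *v v) $ 4 = v $ 4" for v
  unfolding Av using ei[OF U(2)] e4[OF U(2)] c'[OF U(2)] c''[OF U(2)] i by (simp_all add: axis_def)
 have dA: "det A \<noteq> 0" unfolding A_def
 proof (rule columns_det)
  fix v :: point
  assume 0: "v $ 1 *R e 0 + v $ 2 *R e'' 0 + v $ 3 *R e' 0 + v $ 4 *R e4 = 0"
  have 14: "v $ 1 = 0" "v $ 4 = 0" using Ai[of v] unfolding Av 0 by simp_all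
  have "tensor_app (T 0) (e 0) (v $ 2 *R e'' 0 + v $ 3 *R e' 0) = 0" using 0 unfolding 14 by (simp add: tensor_app_linear)
  hence "v $ 2 * tensor_app (T 0) (e 0) (e'' 0) = 0" using nd(3) by (simp add: tensor_app_linear)
  moreover have "tensor_app (T 0) (e 0) (e'' 0) \<noteq> 0" using nd(4) Te by auto
  ultimately have 2: "v $ 2 = 0" by simp
  hence "v $ 3 = 0" using 0 14 e'0 by simp
  thus "v = 0" using 14 2 by (simp add: vec_eq_iff forall_4)
 qed
 have sA: "solve A (A *v v) = v" "A *v solve A v = v" for v using solve_iff[OF dA, of _ v] solve_iff[OF dA, of v "A *v v"] by auto
 have bA: "bounded_linear (solve A)" using solve_linear[OF dA] linear_conv_bounded_linear by blast
 have b3: "bounded_linear (\<lambda>v. solve A v $ j)" for j by (rule bounded_linear_compose[OF bounded_linear_vec_nth bA])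
 have ax: "A *v axis 1 1 = e 0" "A *v axis 2 1 = e'' 0" "A *v axis 3 1 = e' 0" "A *v e4 = e4"
  unfolding Av by (simp_all add: axis_def)
 have sax: "solve A (e 0) = axis 1 1" "solve A (e'' 0) = axis 2 1" "solve A (e' 0) = axis 3 1" "solve A e4 = e4"
  using sA(1)[of "axis 1 1"] sA(1)[of "axis 2 1"] sA(1)[of "axis 3 1"] sA(1)[of e4] unfolding ax .
 define f where "f j z = solve A (e z) $ j" for j z
 have fs: "smooth_on U (f j)" for j unfolding f_def[abs_def] by (rule smooth_on_linear[OF b3 U(1) e])
 have df: "dd (f j) z e4 = solve A (e' z) $ j" if "z \<in> U" for j z
  unfolding f_def[abs_def] e'_def by (rule frechet_linear[OF b3 smooth_onD[OF e that]])
 have ddf: "dd (\<lambda>z. dd (f j) z e4) z e4 = solve A (e'' z) $ j" if z: "z \<in> U" for j z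
 proof -
  have "dd (\<lambda>z. dd (f j) z e4) z = dd (\<lambda>z. solve A (e' z) $ j) z" by (rule frechet_cong[OF U(1) z df])
  thus ?thesis unfolding e''_def using frechet_linear[OF b3 smooth_onD[OF e's z]] by simp
 qed
 have f1: "f 1 z = 1" "f 4 z = 0" if "z \<in> U" for z
  using Ai[of "solve A (e z)"] ei[OF that] e4[OF that] unfolding sA(2) f_def by simp_all
 define s where "s z = dd (f 3) z e4" for z
 have ss: "smooth_on U s" unfolding s_def[abs_def] by (rule smooth_on_frechet[OF fs])
 \<comment> \<open>The fourth coordinate is replaced by the third component of \<open>e\<close>, as
   the shape of \<open>null_dir\<close> demands; it is a coordinate along the fibre where
   \<open>s\<close> is nonzero.\<close>
 define \<kappa> where "\<kappa> z = solve A z + (f 3 z - solve A z $ 4) *R e4" for z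
 have \<kappa>s: "smooth_on U \<kappa>" unfolding \<kappa>_def[abs_def]
  by (intro smooth_on_add smooth_on_scaleR smooth_on_diff smooth_on_const fs U(1) smooth_on_linear[OF bA] smooth_on_linear[OF b3] smooth_on_id)
 have d\<kappa>: "dd \<kappa> z v = solve A v + (dd (f 3) z v - solve A v $ 4) *R e4" if z: "z \<in> U" for z v
 proof -
  have "(\<kappa> has_derivative (\<lambda>v. solve A v + (dd (f 3) z v - solve A v $ 4) *R e4)) (at z)"
   unfolding \<kappa>_def[abs_def]
   by (intro has_derivative_add has_derivative_scaleR_left has_derivative_diff smooth_on_has_derivative[OF fs z]
    bounded_linear_imp_has_derivative bA b3)
  thus ?thesis by (simp add: frechet_eqI)
 qed
 have \<kappa>4: "dd \<kappa> z e4 = s z *R e4" if "z \<in> U" for z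
  unfolding d\<kappa>[OF that] sax s_def by (simp add: algebra_simps)
 have s0: "s 0 = 1" unfolding s_def df[OF U(2)] sax by (simp add: axis_def)
 define U2 where "U2 = {z \<in> U. s z \<noteq> 0}"
 have U2: "open U2" "0 \<in> U2" "U2 \<subseteq> U"
  unfolding U2_def by (intro open_nonzero U(1) smooth_on_continuous[OF ss]) (use U(2) s0 in auto)
 obtain B where B: "open B" "0 \<in> B" "B \<subseteq> U2" "diffeo_onto_image B \<kappa>"
 proof -
  have "v = 0" if v: "dd \<kappa> 0 v = 0" for v
  proof -
   define c where "c = solve A v $ 4 - dd (f 3) 0 v"
   have c: "solve A v = c *R e4" using v unfolding d\<kappa>[OF U(2)] c_def by (simp add: algebra_simps add_eq_0_iff)
   have v': "v = c *R e4" using sA(2)[of v] unfolding c by (simp add: matrix_vector_mult_scaleR ax)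
   have "c *R dd \<kappa> 0 e4 = 0" using v linear_scale[OF dd_lin[OF \<kappa>s U(2)], of c e4] by (simp add: v')
   hence "c = 0" unfolding \<kappa>4[OF U(2)] s0 using arg_cong[of "c *R 1 *R e4" 0 "\<lambda>v. v $ 4"] by simp
   thus "v = 0" by (simp add: v')
  qed
  thus thesis using local_diffeo[OF U2(1) smooth_on_subset[OF \<kappa>s U2(3)] U2(2)] that by blast
 qed
 have BU: "B \<subseteq> U" using B(3) U2(3) by auto
 note inv = diffeo_inverse[OF B(4)]
 define b where "b w = f 2 (inv_into B \<kappa> w)" for w
 have bs: "smooth_on (\<kappa> ` B) b" unfolding b_def[abs_def]
  by (rule smooth_on_compose[OF diffeoD(2)[OF B(4)] B(1) _ diffeoD(5)[OF B(4)] smooth_on_subset[OF fs BU]]) (simp add: inv(7))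
 have b\<kappa>: "b (\<kappa> z) = f 2 z" if "z \<in> B" for z using inv(2)[OF that] by (simp add: b_def)
 have chain: "dd (\<lambda>z. h (\<kappa> z)) z e4 = s z * dd h (\<kappa> z) e4" if h: "smooth_on (\<kappa> ` B) h" and z: "z \<in> B" for h :: "point \<Rightarrow> real" and z
 proof -
  have dh: "h differentiable (at (\<kappa> z))" by (rule smooth_onD[OF h]) (use z in simp)
  have zU: "z \<in> U" using z BU by auto
  have "dd (\<lambda>z. h (\<kappa> z)) z e4 = dd h (\<kappa> z) (dd \<kappa> z e4)" by (rule dd_compose[OF smooth_onD[OF \<kappa>s zU] dh])
  thus ?thesis unfolding \<kappa>4[OF zU] linear_scale[OF dd_linear[OF dh]] by simp
 qed
 have b4: "dd (f 2) z e4 = s z * dd b (\<kappa> z) e4" if z: "z \<in> B" for z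
  using chain[OF bs z] frechet_cong[OF B(1) z, of "\<lambda>z. b (\<kappa> z)" "f 2"] b\<kappa> by simp
 have b4s: "smooth_on (\<kappa> ` B) (\<lambda>y. dd b y e4)" by (rule smooth_on_frechet[OF bs])
 have \<kappa>0: "\<kappa> 0 = 0" using linear_0[OF solve_linear[OF dA]] by (simp add: \<kappa>_def f_def sax axis_def)
 have "dd s 0 e4 = solve A (e'' 0) $ 3" unfolding s_def[abs_def] by (rule ddf[OF U(2)])
 hence ds0: "dd s 0 e4 = 0" unfolding sax by (simp add: axis_def[of "2 :: 4"])
 \<comment> \<open>At the origin \<open>s = 1\<close> with derivative 0 along \<open>e4\<close>, so
   the second derivative of \<open>b\<close> in the new fibre coordinate equals that of
   \<open>f 2\<close> in the old one, which is 1.\<close>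
 have "dd (\<lambda>z. dd (f 2) z e4) 0 e4 = dd (\<lambda>z. s z * dd b (\<kappa> z) e4) 0 e4"
  using frechet_cong[OF B(1,2), of "\<lambda>z. dd (f 2) z e4" "\<lambda>z. s z * dd b (\<kappa> z) e4"] b4 by simp
 also have "\<dots> = dd s 0 e4 * dd b (\<kappa> 0) e4 + s 0 * dd (\<lambda>z. dd b (\<kappa> z) e4) 0 e4"
  by (rule dd_mult[OF smooth_onD[OF ss U(2)] smooth_onD[OF smooth_on_compose[OF B(1) diffeoD(2)[OF B(4)] order_refl diffeoD(4)[OF B(4)] b4s] B(2)]])
 also have "\<dots> = dd (\<lambda>y. dd b y e4) 0 e4"
  using ds0 chain[OF b4s B(2)] by (simp add: s0 \<kappa>0)
 finally have "dd (\<lambda>y. dd b y e4) 0 e4 = 1" unfolding ddf[OF U(2)] sax by (simp add: axis_def[of "2 :: 4"])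
 hence b44: "dd (\<lambda>y. dd b y e4) 0 e4 \<noteq> 0" by simp
 have nl: "flag_null T E4 z (e z) \<and> dd \<kappa> z (e z) = null_dir b (\<kappa> z) + (dd \<kappa> z (e z) $ 4) *R e4" if z: "z \<in> B" for z
 proof -
  have zU: "z \<in> U" using z BU by auto
  have "dd \<kappa> z (e z) $ 1 = 1" "dd \<kappa> z (e z) $ 2 = b (\<kappa> z)" "dd \<kappa> z (e z) $ 3 = f 3 z"
   using f1[OF zU] b\<kappa>[OF z] by (simp_all add: d\<kappa>[OF zU] f_def)
  moreover have "\<kappa> z $ 4 = f 3 z" by (simp add: \<kappa>_def)
  ultimately show ?thesis using null[OF zU] by (simp add: vec_eq_iff forall_4)
 qed
 have ex: "\<exists>e c. flag_null T E4 z e \<and> dd \<kappa> z e = null_dir b (\<kappa> z) + c *R e4" if "z \<in> B" for z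
  using nl[OF that] by blast
 have BN: "B \<subseteq> N" "\<And>z. z \<in> B ==> s z \<noteq> 0" "\<And>z. z \<in> B ==> dd \<kappa> z e4 = s z *R e4"
  using BU U(3) B(3) \<kappa>4 by (auto simp: U2_def)
 show thesis
  by (rule that[OF B(1,2) BN(1) B(4) \<kappa>0 smooth_on_subset[OF ss BU] BN(2,3) bs b44 ex])
qed

lemma isometry_preimage:
 assumes \<xi>: "diffeo_onto_image U \<xi>" and T: "\<forall>z\<in>U. \<forall>v w. tensor_app (T (\<xi> z)) (dd \<xi> z v) (dd \<xi> z w) = tensor_app (g z) v w"
  and iso: "ode_isometry T W \<Psi> (\<Psi> ` W) F" and W: "W \<subseteq> \<xi> ` U"
 defines "U1 \<equiv> U \<inter> \<xi> -` W"
 shows "open U1" "U1 \<subseteq> U" "\<xi> ` U1 = W" "ode_isometry g U1 (\<lambda>z. \<Psi> (\<xi> z)) ((\<lambda>z. \<Psi> (\<xi> z)) ` U1) F"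
proof -
 have oW: "open W" using iso unfolding ode_isometry_def by (auto dest: diffeoD)
 show o: "open U1" unfolding U1_def by (rule open_preimage[OF diffeoD(1)[OF \<xi>] diffeoD(4)[OF \<xi>] oW])
 show s: "U1 \<subseteq> U" by (simp add: U1_def)
 show im: "\<xi> ` U1 = W" using W by (auto simp: U1_def)
 have "(\<lambda>z. \<Psi> (\<xi> z)) ` U1 = \<Psi> ` W" using im by (metis image_image)
 thus "ode_isometry g U1 (\<lambda>z. \<Psi> (\<xi> z)) ((\<lambda>z. \<Psi> (\<xi> z)) ` U1) F"
  using isometry_compose[OF \<xi> T iso o s] im by simp
qed

lemma null_line_isometry:
 assumes N: "open N" "degenerate_lorentzian N T E4" "0 \<in> N"
  and fl: "\<And>z. z \<in> N ==> flag_indep T E4 z 6" "\<And>z. z \<in> N ==> \<exists>w. w \<notin> span {e4} \<and> flag_null T E4 z w"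
 shows "\<exists>U \<psi> F. open U \<and> 0 \<in> U \<and> U \<subseteq> N \<and> ode_isometry T U \<psi> (\<psi> ` U) F"
proof -
 obtain B \<kappa> s b where B: "open B" "0 \<in> B" "B \<subseteq> N" and \<kappa>: "diffeo_onto_image B \<kappa>" "\<kappa> 0 = 0"
  and s: "smooth_on B s" "\<forall>z\<in>B. s z \<noteq> 0 \<and> dd \<kappa> z e4 = s z *R e4"
  and b: "smooth_on (\<kappa> ` B) b" "dd (\<lambda>y. dd b y e4) 0 e4 \<noteq> 0"
  and nl: "\<And>z. z \<in> B ==> \<exists>e c. flag_null T E4 z e \<and> dd \<kappa> z e = null_dir b (\<kappa> z) + c *R e4"
  by (rule null_line_chart[OF N fl]) blast+
 define H where "H = pullback (inv_into B \<kappa>) T"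
 note tr = lorentzian_transport[OF N(2) B(3) \<kappa>(1) s, folded H_def]
 note LH = degenerate_lorentzianD[OF tr(2)]
 note d = diffeoD[OF \<kappa>(1)]
 define S where "S = {w \<in> \<kappa> ` B. dd (\<lambda>y. dd b y e4) w e4 \<noteq> 0}"
 have S: "open S" "S \<subseteq> \<kappa> ` B" unfolding S_def by (intro open_nonzero d(2) smooth_on_continuous smooth_on_frechet b(1)) auto
 have S0: "0 \<in> S" using b(2) B(2) \<kappa>(2) by (force simp: S_def)
 have nt: "null_tensor S b H"
 proof unfold_locales
  show "open S" "smooth_on S b" "smooth_on S H" by (fact S(1), rule smooth_on_subset[OF b(1) S(2)], rule smooth_on_subset[OF LH(1) S(2)])
  show "dd (\<lambda>y. dd b y e4) z e4 \<noteq> 0" if "z \<in> S" for z using that by (simp add: S_def)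
  show "symmetric_on S H" "annihilates S E4 H" using LH(3,4) S(2) by (auto simp: symmetric_on_def annihilates_def)
  show "flag_null H E4 w (null_dir b w)" if "w \<in> S" for w
  proof -
   obtain z where z: "z \<in> B" "w = \<kappa> z" using S(2) \<open>w \<in> S\<close> by blast
   obtain e c where e: "flag_null T E4 z e" "dd \<kappa> z e = null_dir b (\<kappa> z) + c *R e4" using nl[OF z(1)] by blast
   have "flag_null H E4 (\<kappa> z) (dd \<kappa> z e)"
    using flag_transport_consequences(2)[OF \<kappa>(1) z(1) tr(3)[OF z(1)]] e(1) by blast
   moreover have "\<kappa> z \<in> \<kappa> ` B" using z(1) by simp
   ultimately show ?thesis unfolding e(2) z(2) using flag_null_shift[OF d(2) LH(2,1,3)] by blast
  qed
 qed
 have H0: "H z \<noteq> 0" if "z \<in> S" for z by (rule lorentzian_nonzero[OF tr(2)]) (use that S(2) in blast)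
 obtain r \<Psi> F where r: "r > 0" "slab 0 0 r \<subseteq> S" "ode_isometry H (slab 0 0 r) \<Psi> (\<Psi> ` slab 0 0 r) F"
  by (rule null_tensor_isometry[OF nt H0 order_refl[of 0]]) (use S0 in auto)
 have W: "slab 0 0 r \<subseteq> \<kappa> ` B" using r(2) S(2) by blast
 note p = isometry_preimage[OF \<kappa>(1) tr(1) r(3) W]
 have "0 \<in> B \<inter> \<kappa> -` slab 0 0 r" using B(2) \<kappa>(2) slab_axis[OF r(1), of 0 0 0] by simp
 thus ?thesis using p(1,2,4) B(3) by blast
qed

lemma Gamma_isometry:
 assumes N: "open N" "degenerate_lorentzian N g V" "x \<in> N"
  and fl: "\<And>z. z \<in> N ==> flag_indep g V z 6" "\<And>z. z \<in> N ==> \<exists>w. w \<notin> span {V z} \<and> flag_null g V z w"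
 shows "\<exists>U \<phi> F. open U \<and> x \<in> U \<and> U \<subseteq> N \<and> ode_isometry g U \<phi> (\<phi> ` U) F"
proof -
 note L = degenerate_lorentzianD[OF N(2)]
 obtain A where A: "det A \<noteq> 0" "A *v e4 = V x" by (rule lorentz_coords[OF N(2,3)]) blast
 obtain U \<xi> f where U: "open U" "x \<in> U" "U \<subseteq> N" and \<xi>: "diffeo_onto_image U \<xi>" "\<xi> x = 0"
  and f: "smooth_on U f" "\<forall>z\<in>U. f z \<noteq> 0 \<and> dd \<xi> z (V z) = f z *R e4"
  by (rule straighten[OF N(1) L(2) N(3) A]) blast+
 define T where "T = pullback (inv_into U \<xi>) g"
 note tr = lorentzian_transport[OF N(2) U(3) \<xi>(1) f, folded T_def]
 have 0: "0 \<in> \<xi> ` U" using U(2) \<xi>(2) by force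
 have fT: "flag_indep T E4 w 6" "\<exists>v. v \<notin> span {e4} \<and> flag_null T E4 w v" if "w \<in> \<xi> ` U" for w
 proof -
  obtain z where z: "z \<in> U" "w = \<xi> z" using \<open>w \<in> \<xi> ` U\<close> by blast
  have zN: "z \<in> N" using z U(3) by blast
  show "flag_indep T E4 w 6" using flag_transport_consequences(1)[OF \<xi>(1) z(1) tr(3)[OF z(1)], of 6] fl(1)[OF zN] z(2) by simp
  obtain v where v: "v \<notin> span {V z}" "flag_null g V z v" using fl(2)[OF zN] by blast
  have "flag_null T E4 w (dd \<xi> z v)" using flag_transport_consequences(2)[OF \<xi>(1) z(1) tr(3)[OF z(1)], of v] v(2) z(2) by simp
  moreover have "dd \<xi> z v \<notin> span {e4}"
  proof
   assume "dd \<xi> z v \<in> span {e4}"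
   then obtain k where k: "dd \<xi> z v = k *R e4" by (auto simp: span_singleton)
   have lin: "linear (dd \<xi> z)" by (rule dd_lin[OF diffeoD(4)[OF \<xi>(1)] z(1)])
   have "dd \<xi> z (v - (k / f z) *R V z) = 0"
    using bspec[OF f(2) z(1)] by (simp add: linear_diff[OF lin] linear_scale[OF lin] k)
   hence "v - (k / f z) *R V z = 0" by (rule diffeo_ker[OF \<xi>(1) z(1)])
   hence "v = (k / f z) *R V z" by simp
   thus False using v(1) by (auto simp: span_singleton)
  qed
  ultimately show "\<exists>v. v \<notin> span {e4} \<and> flag_null T E4 w v" by blast
 qed
 obtain W \<psi> F where W: "open W" "0 \<in> W" "W \<subseteq> \<xi> ` U" "ode_isometry T W \<psi> (\<psi> ` W) F"
  using null_line_isometry[OF diffeoD(2)[OF \<xi>(1)] tr(2) 0 fT] by blast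
 note p = isometry_preimage[OF \<xi>(1) tr(1) W(4,3)]
 have "x \<in> U \<inter> \<xi> -` W" using U(2) \<xi>(2) W(2) by simp
 thus ?thesis using p(1,2,4) U(3) by blast
qed

section \<open>Metrics with proportional Lie derivative\<close>

definition drop4 :: "point \<Rightarrow> point" where "drop4 z = z - z $ 4 *R e4"

lemma drop4_simps [simp]: "drop4 (s *R e4) = 0" "drop4 e4 = 0" "drop4 0 = 0" "drop4 z $ 1 = z $ 1" "drop4 z $ 2 = z $ 2" "drop4 z $ 3 = z $ 3" "drop4 z $ 4 = 0"
 by (simp_all add: drop4_def)

lemma bounded_linear_drop4: "bounded_linear drop4"
 unfolding drop4_def[abs_def]
 by (intro bounded_linear_sub bounded_linear_ident bounded_linear_compose[OF bounded_linear_scaleR_left bounded_linear_vec_nth])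

lemma smooth_on_drop4: "open U ==> smooth_on U drop4"
 by (rule smooth_on_linear[OF bounded_linear_drop4 _ smooth_on_id])

definition lorentzian_at :: "tensor \<Rightarrow> point \<Rightarrow> bool" where
 "lorentzian_at T v \<longleftrightarrow> transpose T = T \<and> v \<noteq> 0 \<and> {w. T *v w = 0} = span {v} \<and>
   (\<exists>\<epsilon>\<in>{1, -1}. \<exists>a b c. tensor_app T a a = \<epsilon> \<and> tensor_app T b b = -\<epsilon> \<and> tensor_app T c c = -\<epsilon> \<and>
    tensor_app T a b = 0 \<and> tensor_app T a c = 0 \<and> tensor_app T b c = 0)"

lemma degenerate_lorentzian_iff:
 "degenerate_lorentzian N g V \<longleftrightarrow> smooth_on N g \<and> smooth_on N V \<and> (\<forall>x\<in>N. lorentzian_at (g x) (V x))"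
 unfolding degenerate_lorentzian_def lorentzian_at_def ..

lemma lorentzian_subset:
 assumes "degenerate_lorentzian N g V" "M \<subseteq> N"
 shows "degenerate_lorentzian M g V"
 using assms smooth_on_subset[of N g M] smooth_on_subset[of N V M] unfolding degenerate_lorentzian_iff by blast

lemma lorentzian_rescale:
 assumes N: "open N" "degenerate_lorentzian N g V" and r: "smooth_on N r" "\<And>x. x \<in> N ==> r x \<noteq> 0"
 shows "degenerate_lorentzian N (\<lambda>x. r x *R g x) V"
 unfolding degenerate_lorentzian_def
proof (intro conjI ballI)
 note D = degenerate_lorentzianD[OF N(2)]
 show "smooth_on N (\<lambda>x. r x *R g x)" by (rule smooth_on_scaleR[OF N(1) r(1) D(1)])
 show "smooth_on N V" by (rule D(2))
 fix x assume x: "x \<in> N"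
 have p: "transpose (g x) = g x" "{v. g x *v v = 0} = span {V x}"
  using N(2) x unfolding degenerate_lorentzian_def by blast+
 show "transpose (r x *R g x) = r x *R g x" using p(1) by (simp add: vec_eq_iff transpose_def)
 show "V x \<noteq> 0" by (rule D(5)[OF x])
 have "(r x *R g x) *v v = r x *R (g x *v v)" for v
  by (simp add: vec_eq_iff matrix_vector_mult_def sum_distrib_left mult.assoc)
 thus "{v. (r x *R g x) *v v = 0} = span {V x}" using p(2) r(2)[OF x] by simp
 obtain \<epsilon> a b c where e: "\<epsilon> \<in> {1, -1 :: real}" "tensor_app (g x) a a = \<epsilon> \<and> tensor_app (g x) b b = -\<epsilon> \<and> tensor_app (g x) c c = -\<epsilon> \<and>
  tensor_app (g x) a b = 0 \<and> tensor_app (g x) a c = 0 \<and> tensor_app (g x) b c = 0"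
  using N(2) x unfolding degenerate_lorentzian_def by blast
 \<comment> \<open>Rescaling the basis by this factor leaves only the sign of \<open>r x\<close>,
   which moves into \<open>\<epsilon>\<close>.\<close>
 define k where "k = 1 / sqrt \<bar>r x\<bar>"
 have k: "r x * (k * k) = sgn (r x)" using r(2)[OF x] by (simp add: k_def sgn_if)
 have "tensor_app (r x *R g x) (k *R u) (k *R v) = sgn (r x) * tensor_app (g x) u v" for u v
  unfolding k[symmetric] by (simp add: tensor_app_linear)
 note sc = this
 have eps: "sgn (r x) * \<epsilon> \<in> {1, -1}" using e(1) r(2)[OF x] by (auto simp: sgn_if)
 show "\<exists>\<epsilon>\<in>{1, - 1}. \<exists>a b c. tensor_app (r x *R g x) a a = \<epsilon> \<and> tensor_app (r x *R g x) b b = - \<epsilon> \<and> tensor_app (r x *R g x) c c = - \<epsilon> \<and>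
   tensor_app (r x *R g x) a b = 0 \<and> tensor_app (r x *R g x) a c = 0 \<and> tensor_app (r x *R g x) b c = 0"
  by (rule bexI[OF _ eps], rule exI[of _ "k *R a"], rule exI[of _ "k *R b"], rule exI[of _ "k *R c"])
   (use e(2) in \<open>simp add: sc\<close>)
qed

text \<open>A metric that does not change along \<open>V\<close>, in coordinates that straighten \<open>V\<close> and after rescaling,
 extended to a cylinder.\<close>

locale flat_metric =
 fixes B :: "point set" and h :: "point \<Rightarrow> tensor"
 assumes B: "open B" "0 \<in> B" and h: "degenerate_lorentzian B h E4"
  and h12: "\<And>z. z \<in> B ==> h z $ 1 $ 2 = 1"
  and h0: "h 0 $ 1 $ 1 = 0" "h 0 $ 2 $ 2 = 0" "h 0 $ 1 $ 3 = 0" "h 0 $ 2 $ 3 = 0" "h 0 $ 3 $ 3 = -1"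
begin

definition "H z = h (drop4 z)"
definition "S0 = drop4 -` B"

lemma S0: "open S0" "s *R e4 \<in> S0"
 unfolding S0_def using B smooth_on_continuous[OF smooth_on_drop4[OF open_UNIV]] by (auto intro: open_vimage)

lemma H_smooth: "smooth_on S0 H"
 unfolding H_def[abs_def]
 by (rule smooth_on_compose[OF S0(1) B(1) _ smooth_on_drop4[OF S0(1)] degenerate_lorentzianD(1)[OF h]]) (auto simp: S0_def)

lemma H_lorentzian: "degenerate_lorentzian S0 H E4"
proof -
 have "drop4 z \<in> B" if "z \<in> S0" for z using that by (simp add: S0_def)
 thus ?thesis using h H_smooth smooth_on_const unfolding degenerate_lorentzian_iff H_def by blast
qed

lemma dd_H: "z \<in> S0 ==> dd H z e4 = 0"
proof -
 assume "z \<in> S0"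
 hence z: "drop4 z \<in> B" by (simp add: S0_def)
 note d = smooth_onD[OF degenerate_lorentzianD(1)[OF h] z]
 have "dd H z e4 = dd h (drop4 z) (dd drop4 z e4)" unfolding H_def[abs_def]
  by (rule dd_compose[of drop4 z h e4, OF _ d]) (rule bounded_linear_imp_differentiable[OF bounded_linear_drop4])
 also have "dd drop4 z e4 = 0" using frechet_eqI[OF bounded_linear_imp_has_derivative[OF bounded_linear_drop4]] by simp
 finally show ?thesis using linear_0[OF dd_linear[OF d]] by simp
qed

lemma lie_H: "z \<in> S0 ==> (\<L> E4 ^^ Suc k) H z = 0"
proof (induction k arbitrary: z)
 case 0
 show ?case by (rule tensor_eqI)
  (use lie_app[OF smooth_onD[OF H_smooth 0] differentiable_const] dd_H[OF 0] in \<open>simp add: tensor_app_linear\<close>)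
next
 case (Suc k)
 let ?G = "(\<L> E4 ^^ Suc k) H"
 have G: "smooth_on S0 ?G" by (rule smooth_on_lie_iter[OF S0(1) smooth_on_const H_smooth])
 have "dd ?G z e4 = 0" by (rule dd_vanish[OF S0(1) Suc.prems Suc.IH])
 hence "\<L> E4 ?G z = 0"
  using lie_app[OF smooth_onD[OF G Suc.prems] differentiable_const, of e4] Suc.IH[OF Suc.prems]
  by (intro tensor_eqI) (simp only: tensor_app_linear dd_const add_0_right)
 thus ?case by simp
qed

text \<open>A null vector with first component 1 and third component \<open>z $ 4\<close> has as
  second component a root of the quadratic with coefficients H_22, 2 \<open>qB\<close>,
  \<open>qC\<close>, where H_12 = 1. The root \<open>b\<close> is written with the square root in
  the denominator, which stays valid when H_22 vanishes.\<close>

definition "qB z = 1 + H z $ 2 $ 3 * z $ 4"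
definition "qC z = H z $ 1 $ 1 + 2 * H z $ 1 $ 3 * z $ 4 + H z $ 3 $ 3 * (z $ 4)\<^sup>2"
definition "disc z = (qB z)\<^sup>2 - H z $ 2 $ 2 * qC z"
definition "b z = - qC z / (qB z + sqrt (disc z))"
definition "S1 = {z \<in> S0. disc z > 0 \<and> qB z > 0}"

lemma q_smooth: "smooth_on S0 qB" "smooth_on S0 qC" "smooth_on S0 disc"
proof -
 show B: "smooth_on S0 qB" and C: "smooth_on S0 qC" unfolding qB_def[abs_def] qC_def[abs_def]
  by (intro smooth_on_add smooth_on_mult smooth_on_power smooth_on_const smooth_on_coord smooth_on_nth S0(1) H_smooth)+
 show "smooth_on S0 disc" unfolding disc_def[abs_def]
  by (intro smooth_on_diff smooth_on_mult smooth_on_power smooth_on_nth S0(1) H_smooth B C)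
qed

lemma S1: "open S1" "S1 \<subseteq> S0"
proof -
 have "open {z \<in> S0. f z > 0}" if "smooth_on S0 f" for f :: "point \<Rightarrow> real"
 proof -
  have "open (S0 \<inter> f -` {0<..})" by (rule open_preimage[OF S0(1) that]) simp
  thus ?thesis by (simp add: vimage_def Int_def)
 qed
 from this[OF q_smooth(3)] this[OF q_smooth(1)] have "open ({z \<in> S0. disc z > 0} \<inter> {z \<in> S0. qB z > 0})" by (rule open_Int)
 moreover have "S1 = {z \<in> S0. disc z > 0} \<inter> {z \<in> S0. qB z > 0}" by (auto simp: S1_def)
 ultimately show "open S1" by simp
 show "S1 \<subseteq> S0" by (auto simp: S1_def)
qed

text \<open>On the axis the metric has its normal form and \<open>b\<close> is the parabola of the
  flat null cone. In particular the whole axis lies in the domain of \<open>b\<close>, so segments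
  of any length are available.\<close>

lemma axis_values: "qB (s *R e4) = 1" "qC (s *R e4) = - s\<^sup>2" "disc (s *R e4) = 1" "b (s *R e4) = s\<^sup>2 / 2" "s *R e4 \<in> S1"
proof -
 show 1: "qB (s *R e4) = 1" "qC (s *R e4) = - s\<^sup>2" by (simp_all add: qB_def qC_def H_def h0)
 show 2: "disc (s *R e4) = 1" by (simp add: disc_def 1 H_def h0)
 show "b (s *R e4) = s\<^sup>2 / 2" by (simp add: b_def 1 2)
 show "s *R e4 \<in> S1" using S0(2) by (simp add: S1_def 1 2)
qed

lemma b_smooth: "smooth_on S1 b"
proof -
 have d: "disc z > 0" if "z \<in> S1" for z using that by (simp add: S1_def)
 have ne: "qB z + sqrt (disc z) \<noteq> 0" if "z \<in> S1" for z
  using add_pos_pos[of "qB z" "sqrt (disc z)"] that by (simp add: S1_def)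
 show ?thesis unfolding b_def[abs_def]
  by (intro smooth_on_divide smooth_on_minus smooth_on_add smooth_on_sqrt S1(1) q_smooth[THEN smooth_on_subset, OF S1(2)] d ne)
qed

lemma b_axis: "dd b (s *R e4) e4 = s" "dd (\<lambda>y. dd b y e4) (s *R e4) e4 = 1"
proof -
 have c: "((\<lambda>s. s *R e4) has_vector_derivative e4) (at s)" for s :: real by (auto intro!: derivative_eq_intros)
 have 1: "dd b (s *R e4) e4 = s" for s
 proof -
  have "((\<lambda>s. b (s *R e4)) has_vector_derivative dd b (s *R e4) e4) (at s)"
   by (rule dd_curve[OF smooth_onD[OF b_smooth axis_values(5)] c])
  moreover have "((\<lambda>s. b (s *R e4)) has_vector_derivative s) (at s)"
   unfolding axis_values(4) has_real_derivative_iff_has_vector_derivative[symmetric] by (auto intro!: derivative_eq_intros)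
  ultimately show ?thesis by (rule vector_derivative_unique_at)
 qed
 thus "dd b (s *R e4) e4 = s" .
 have "((\<lambda>s. dd b (s *R e4) e4) has_vector_derivative dd (\<lambda>y. dd b y e4) (s *R e4) e4) (at s)"
  by (rule dd_curve[OF smooth_onD[OF smooth_on_frechet[OF b_smooth] axis_values(5)] c])
 hence "((\<lambda>s. s) has_vector_derivative dd (\<lambda>y. dd b y e4) (s *R e4) e4) (at s)" unfolding 1 .
 thus "dd (\<lambda>y. dd b y e4) (s *R e4) e4 = 1" by (rule vector_derivative_unique_at[OF _ has_vector_derivative_id])
qed

lemma quadratic:
 assumes z: "z \<in> S0" and v: "v $ 1 = 1" "v $ 3 = z $ 4"
 shows "tensor_app (H z) v v = H z $ 2 $ 2 * (v $ 2)\<^sup>2 + 2 * qB z * v $ 2 + qC z"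
proof -
 note D = degenerate_lorentzianD[OF H_lorentzian]
 have an: "tensor_app (H z) e4 w = 0" "tensor_app (H z) w e4 = 0" for w using D(3) z by (auto simp: annihilates_def)
 have sym: "H z $ i $ j = H z $ j $ i" for i j
  using D(4) z unfolding symmetric_on_def tensor_app_axis[symmetric] by blast
 have "drop4 z \<in> B" using z by (simp add: S0_def)
 hence 12: "H z $ 1 $ 2 = 1" "H z $ 2 $ 1 = 1" using h12 sym[of 2 1] by (simp_all add: H_def)
 have "v = axis 1 1 + v $ 2 *R axis 2 1 + z $ 4 *R axis 3 1 + v $ 4 *R e4"
  using v by (simp add: vec_eq_iff forall_4 axis_def[of "1 :: 4"] axis_def[of "2 :: 4"] axis_def[of "3 :: 4"])
 then obtain c where c: "v = axis 1 1 + v $ 2 *R axis 2 1 + z $ 4 *R axis 3 1 + c *R e4" by blast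
 have "tensor_app (H z) v v = tensor_app (H z) (axis 1 1 + v $ 2 *R axis 2 1 + z $ 4 *R axis 3 1 + c *R e4) (axis 1 1 + v $ 2 *R axis 2 1 + z $ 4 *R axis 3 1 + c *R e4)"
  using c by simp
 also have "\<dots> = H z $ 2 $ 2 * (v $ 2)\<^sup>2 + 2 * qB z * v $ 2 + qC z"
  unfolding tensor_app_linear an unfolding tensor_app_axis 12 sym[of 3 1] sym[of 3 2] by (simp add: qB_def qC_def power2_eq_square algebra_simps)
 finally show ?thesis .
qed

text \<open>At a root \<beta> the quantity H_22 \<beta> + \<open>qB\<close> is plus or minus the
  square root of \<open>disc\<close>. The sign plus selects \<open>b\<close>, the branch that passes
  through the model on the axis.\<close>

lemma root:
 assumes z: "z \<in> S1"
 shows "H z $ 2 $ 2 * (b z)\<^sup>2 + 2 * qB z * b z + qC z = 0"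
  and "H z $ 2 $ 2 * \<beta>\<^sup>2 + 2 * qB z * \<beta> + qC z = 0 ==> H z $ 2 $ 2 * \<beta> + qB z > 0 ==> \<beta> = b z"
proof -
 define A where "A = H z $ 2 $ 2"
 define D where "D = sqrt (disc z)"
 have D: "D > 0" "D\<^sup>2 = (qB z)\<^sup>2 - A * qC z" and Bp: "qB z > 0" using z by (simp_all add: S1_def D_def A_def disc_def)
 have b: "b z * (qB z + D) = - qC z" using D(1) Bp by (simp add: b_def D_def[symmetric])
 have "(A * (b z)\<^sup>2 + 2 * qB z * b z + qC z) * (qB z + D)\<^sup>2 = A * (b z * (qB z + D))\<^sup>2 + 2 * qB z * (b z * (qB z + D)) * (qB z + D) + qC z * (qB z + D)\<^sup>2"
  by (simp add: power2_eq_square algebra_simps)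
 also have "\<dots> = qC z * (A * qC z - (qB z)\<^sup>2 + D\<^sup>2)" unfolding b by (simp add: power2_eq_square algebra_simps)
 also have "\<dots> = 0" unfolding D(2) by simp
 finally show "H z $ 2 $ 2 * (b z)\<^sup>2 + 2 * qB z * b z + qC z = 0" using D(1) Bp by (simp add: A_def)
 assume r: "H z $ 2 $ 2 * \<beta>\<^sup>2 + 2 * qB z * \<beta> + qC z = 0" "H z $ 2 $ 2 * \<beta> + qB z > 0"
 have "(A * \<beta> + qB z)\<^sup>2 = A * (A * \<beta>\<^sup>2 + 2 * qB z * \<beta> + qC z) + D\<^sup>2" unfolding D(2) by (simp add: power2_eq_square algebra_simps)
 hence "(A * \<beta> + qB z)\<^sup>2 = D\<^sup>2" using r(1) by (simp add: A_def)
 hence d: "A * \<beta> + qB z = D" using r(2) D(1) by (simp add: A_def power2_eq_iff_nonneg)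
 have "\<beta> * (qB z + D) = (A * \<beta>\<^sup>2 + 2 * qB z * \<beta> + qC z) - qC z" unfolding d[symmetric] by (simp add: power2_eq_square algebra_simps)
 hence "\<beta> * (qB z + D) = b z * (qB z + D)" using r(1) b by (simp add: A_def)
 thus "\<beta> = b z" using D(1) Bp by simp
qed

text \<open>The higher Lie derivatives of \<open>H\<close> vanish, so of the five conditions on null
  directions only the quadratic equation for \<open>b\<close> remains.\<close>

lemma flat_chart:
 assumes "s1 \<le> s2"
 obtains r \<Psi> F where "r > 0" "slab s1 s2 r \<subseteq> S1" "ode_isometry H (slab s1 s2 r) \<Psi> (\<Psi> ` slab s1 s2 r) F"
  "\<And>z. z \<in> slab s1 s2 r ==> dd \<Psi> z (null_dir b z) \<in> contact_plane (\<Psi> z)"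
  "\<And>z. z \<in> slab s1 s2 r ==> \<exists>m. m \<noteq> 0 \<and> dd \<Psi> z e4 = m *R total_field F (\<Psi> z)"
  "\<And>y. y \<in> \<Psi> ` slab s1 s2 r ==> wuenschmann F y = 0"
proof -
 define S where "S = {z \<in> S1. dd (\<lambda>y. dd b y e4) z e4 \<noteq> 0}"
 have S: "open S" "S \<subseteq> S1" unfolding S_def by (intro open_nonzero S1(1) smooth_on_continuous smooth_on_frechet b_smooth) auto
 have SS0: "S \<subseteq> S0" using S(2) S1(2) by auto
 have ax: "s *R e4 \<in> S" for s by (simp add: S_def axis_values(5) b_axis(2))
 have nt: "null_tensor S b H"
 proof unfold_locales
  show "open S" "smooth_on S b" "smooth_on S H"
   by (fact S(1), rule smooth_on_subset[OF b_smooth S(2)], rule smooth_on_subset[OF H_smooth SS0])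
  show "dd (\<lambda>y. dd b y e4) z e4 \<noteq> 0" if "z \<in> S" for z using that by (simp add: S_def)
  show "symmetric_on S H" "annihilates S E4 H"
   using degenerate_lorentzianD(3,4)[OF H_lorentzian] SS0 by (auto simp: symmetric_on_def annihilates_def)
  fix z assume z: "z \<in> S"
  hence z0: "z \<in> S0" "z \<in> S1" using SS0 S(2) by auto
  show "flag_null H E4 z (null_dir b z)" unfolding flag_null_iff
  proof (intro allI impI)
   fix k :: nat
   show "tensor_app ((\<L> E4 ^^ k) H z) (null_dir b z) (null_dir b z) = 0"
   proof (cases k)
    case 0
    thus ?thesis using quadratic[OF z0(1), of "null_dir b z"] root(1)[OF z0(2)] by simp
   next
    case (Suc n)
    thus ?thesis using lie_H[OF z0(1), of n] by (simp only: tensor_app_linear)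
   qed
  qed
 qed
 have H0: "H z \<noteq> 0" if "z \<in> S" for z by (rule lorentzian_nonzero[OF H_lorentzian]) (use that SS0 in blast)
 obtain r \<Psi> F where r: "r > 0" "slab s1 s2 r \<subseteq> S" "ode_isometry H (slab s1 s2 r) \<Psi> (\<Psi> ` slab s1 s2 r) F"
  "\<And>z. z \<in> slab s1 s2 r ==> dd \<Psi> z (null_dir b z) \<in> contact_plane (\<Psi> z)"
  "\<And>z. z \<in> slab s1 s2 r ==> \<exists>m. m \<noteq> 0 \<and> dd \<Psi> z e4 = m *R total_field F (\<Psi> z)"
  by (rule null_tensor_isometry[OF nt H0 assms ax]) blast+
 have sub: "slab s1 s2 r \<subseteq> S0" using r(2) SS0 by auto
 have "wuenschmann F (\<Psi> z) = 0" if z: "z \<in> slab s1 s2 r" for z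
 proof -
  have "\<L> E4 H z = 0 *R H z" using lie_H[of z 0] z sub by auto
  hence "lie_proportional {z} H E4" unfolding lie_proportional_def by blast
  thus ?thesis
   using isometry_consequences(1)[OF open_slab lorentzian_subset[OF H_lorentzian sub] order_refl r(3) z] by blast
 qed
 hence W: "wuenschmann F y = 0" if "y \<in> \<Psi> ` slab s1 s2 r" for y using that by blast
 show thesis by (rule that[OF r(1) order_trans[OF r(2) S(2)] r(3) r(4) r(5) W])
qed

end

text \<open>The null vectors among \<open>w1\<close>, \<open>w2\<close> must not be orthogonal to
  \<open>n2\<close>, since their first components later serve as divisors. Orthogonal null vectors
  are proportional modulo \<open>V\<close>, so each of the two excludes at most one of the three
  null directions tried, and one remains.\<close>

lemma null_basis:
 assumes N: "degenerate_lorentzian N g V" and x: "x \<in> N"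
 obtains \<epsilon> n1 n2 n3 where "\<epsilon> = 1 \<or> \<epsilon> = -1" "tensor_app (g x) n1 n2 = \<epsilon>" "tensor_app (g x) n3 n3 = - \<epsilon>"
  "tensor_app (g x) n1 n1 = 0" "tensor_app (g x) n2 n2 = 0" "tensor_app (g x) n1 n3 = 0" "tensor_app (g x) n2 n3 = 0"
  "det (transpose (vector [n1, n2, n3, V x] :: real ^ 4 ^ 4)) \<noteq> 0"
  "\<forall>w\<in>{w1, w2}. tensor_app (g x) w w = 0 \<and> w \<notin> span {V x} \<longrightarrow> tensor_app (g x) w n2 \<noteq> 0"
proof -
 obtain \<epsilon> A where e: "\<epsilon> = 1 \<or> \<epsilon> = -1" "det A \<noteq> 0" "A *v e4 = V x"
  and f: "\<And>p q. tensor_app (g x) (A *v p) (A *v q) = \<epsilon> * (p $ 1 * q $ 1 - p $ 2 * q $ 2 - p $ 3 * q $ 3)"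
  and sp: "\<And>p. p $ 1 = 0 ==> p $ 2 = 0 ==> p $ 3 = 0 ==> A *v p \<in> span {V x}"
  by (rule lorentz_coords[OF N x]) blast
 have n: "\<epsilon> \<noteq> 0" using e(1) by auto
 note L = degenerate_lorentzianD[OF N]
 have an: "tensor_app (g x) (V x) w = 0" "tensor_app (g x) w (V x) = 0" for w using L(3) x by (auto simp: annihilates_def)
 have s: "tensor_app (g x) v w = tensor_app (g x) w v" for v w using bspec[OF L(4)[unfolded symmetric_on_def] x] by blast
 have ex: "\<exists>p. A *v p = w" for w using solve_iff[OF e(2)] by blast
 define d :: "real \<Rightarrow> real \<Rightarrow> point" where "d u v = vector [1, u, v, 0]" for u v
 define K where "K w u v \<longleftrightarrow> tensor_app (g x) w (A *v d u v) = 0" for w u v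
 define bad where "bad w \<longleftrightarrow> tensor_app (g x) w w = 0 \<and> w \<notin> span {V x}" for w
 have k: "\<not> (K w 1 0 \<and> K w (-1) 0)" "\<not> (K w 1 0 \<and> K w 0 1)" "\<not> (K w (-1) 0 \<and> K w 0 1)" if w: "bad w" for w
 proof -
  obtain p where p: "A *v p = w" using ex by blast
  have nz: "(p $ 1)\<^sup>2 = (p $ 2)\<^sup>2 + (p $ 3)\<^sup>2" using w n unfolding bad_def p[symmetric] f by (simp add: power2_eq_square)
  have p1: "p $ 1 \<noteq> 0"
  proof
   assume 1: "p $ 1 = 0"
   hence "p $ 2 = 0" "p $ 3 = 0" using nz by (simp_all add: sum_power2_eq_zero_iff)
   thus False using sp[OF 1] w p by (simp add: bad_def)
  qed
  have K: "K w u v \<longleftrightarrow> p $ 1 - p $ 2 * u - p $ 3 * v = 0" for u v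
   unfolding K_def p[symmetric] f d_def using n by simp
  show "\<not> (K w 1 0 \<and> K w (-1) 0)" using p1 unfolding K by auto
  show "\<not> (K w 1 0 \<and> K w 0 1)" "\<not> (K w (-1) 0 \<and> K w 0 1)" using p1 nz unfolding K by (auto simp: power2_eq_square)
 qed
 have "(\<forall>w\<in>{w1, w2}. bad w \<longrightarrow> \<not> K w 1 0) \<or> (\<forall>w\<in>{w1, w2}. bad w \<longrightarrow> \<not> K w (-1) 0) \<or> (\<forall>w\<in>{w1, w2}. bad w \<longrightarrow> \<not> K w 0 1)"
  using k[of w1] k[of w2] by auto
 then obtain u v where uv: "u\<^sup>2 + v\<^sup>2 = 1" "\<forall>w\<in>{w1, w2}. bad w \<longrightarrow> \<not> K w u v"
 proof (elim disjE)
 qed (auto intro: that[of 1 0] that[of "-1" 0] that[of 0 1])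
 define n1 where "n1 = A *v d (-u) (-v)"
 \<comment> \<open>The factor one half compensates for \<open>1 + u\<^sup>2 + v\<^sup>2 = 2\<close>,
   so that \<open>n1\<close> and \<open>n2\<close> pair to \<open>\<epsilon>\<close>.\<close>
 define n2 where "n2 = (1 / 2) *R (A *v d u v)"
 define n3 where "n3 = A *v vector [0, -v, u, 0]"
 have uv': "u * u + v * v = 1" using uv(1) by (simp add: power2_eq_square)
 have v: "tensor_app (g x) n1 n2 = \<epsilon>" "tensor_app (g x) n3 n3 = - \<epsilon>"
  "tensor_app (g x) n1 n1 = 0" "tensor_app (g x) n2 n2 = 0" "tensor_app (g x) n1 n3 = 0" "tensor_app (g x) n2 n3 = 0"
 proof -
  have "1 - u * u - v * v = 0" "u * u + v * v = 1" "v * v + u * u = 1" "1 + u * u + v * v = 2" using uv' by simp_all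
  note uvs = this
  have t: "\<epsilon> * (1 + u * u + v * v) = 2 * \<epsilon>" "\<epsilon> * (- (v * v) - u * u) = - \<epsilon>" using uv' by (simp_all add: algebra_simps flip: distrib_left)
  show "tensor_app (g x) n1 n2 = \<epsilon>" using t(1) unfolding n1_def n2_def tensor_app_linear f d_def by simp
  show "tensor_app (g x) n3 n3 = - \<epsilon>" using t(2) unfolding n3_def f by simp
  show "tensor_app (g x) n1 n1 = 0" "tensor_app (g x) n2 n2 = 0" using uvs(1) unfolding n1_def n2_def tensor_app_linear f d_def by simp_all
  show "tensor_app (g x) n1 n3 = 0" "tensor_app (g x) n2 n3 = 0" unfolding n1_def n2_def n3_def tensor_app_linear f d_def by simp_all
 qed
 have vs: "tensor_app (g x) n2 n1 = \<epsilon>" "tensor_app (g x) n3 n1 = 0" "tensor_app (g x) n3 n2 = 0"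
  using v(1,5,6) s[of n2 n1] s[of n3 n1] s[of n3 n2] by simp_all
 have dt: "det (transpose (vector [n1, n2, n3, V x] :: real ^ 4 ^ 4)) \<noteq> 0"
 proof (rule columns_det)
  fix q :: point
  assume 0: "q $ 1 *R n1 + q $ 2 *R n2 + q $ 3 *R n3 + q $ 4 *R V x = 0"
  have p: "tensor_app (g x) (q $ 1 *R n1 + q $ 2 *R n2 + q $ 3 *R n3 + q $ 4 *R V x) w = 0" for w
   unfolding 0 by (simp add: tensor_app_linear)
  have z: "q $ 1 = 0" "q $ 2 = 0" "q $ 3 = 0"
   using p[of n2] p[of n1] p[of n3] n by (simp_all add: tensor_app_linear v an vs)
  hence "q $ 4 = 0" using 0 L(5)[OF x] by simp
  thus "q = 0" using z by (simp add: vec_eq_iff forall_4)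
 qed
 have av: "\<forall>w\<in>{w1, w2}. tensor_app (g x) w w = 0 \<and> w \<notin> span {V x} \<longrightarrow> tensor_app (g x) w n2 \<noteq> 0"
  using uv(2) unfolding bad_def K_def n2_def tensor_app_linear by simp
 show thesis by (rule that[OF e(1) v dt av])
qed

text \<open>Proportionality means that along \<open>e4\<close> all components of the transported
  metric satisfy the same linear equation. Dividing by the entry 12, which is nonzero near the
  origin, makes them constant along \<open>e4\<close>.\<close>

lemma flat_straight:
 assumes N: "open N" "degenerate_lorentzian N g V" "x \<in> N" and pr: "lie_proportional N g V"
  and n: "\<epsilon> = 1 \<or> \<epsilon> = -1" "tensor_app (g x) n1 n2 = \<epsilon>" "tensor_app (g x) n3 n3 = - \<epsilon>"
  "tensor_app (g x) n1 n1 = 0" "tensor_app (g x) n2 n2 = 0" "tensor_app (g x) n1 n3 = 0" "tensor_app (g x) n2 n3 = 0"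
  and A: "det (transpose (vector [n1, n2, n3, V x] :: real ^ 4 ^ 4)) \<noteq> 0"
 obtains U \<xi> f \<rho> h r where "open U" "x \<in> U" "U \<subseteq> N" "diffeo_onto_image U \<xi>" "\<xi> x = 0"
  "\<And>v. dd \<xi> x (v $ 1 *R n1 + v $ 2 *R n2 + v $ 3 *R n3 + v $ 4 *R V x) = v"
  "smooth_on U f" "\<forall>z\<in>U. f z \<noteq> 0 \<and> dd \<xi> z (V z) = f z *R e4"
  "flat_metric (slab 0 0 \<rho>) h" "\<xi> ` U \<subseteq> slab 0 0 \<rho>" "smooth_on U r" "\<forall>z\<in>U. r z \<noteq> 0"
  "\<forall>z\<in>U. \<forall>v w. tensor_app (flat_metric.H h (\<xi> z)) (dd \<xi> z v) (dd \<xi> z w) = tensor_app (r z *R g z) v w"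
proof -
 note L = degenerate_lorentzianD[OF N(2)]
 define A where "A = (transpose (vector [n1, n2, n3, V x]) :: real ^ 4 ^ 4)"
 have Av: "A *v v = v $ 1 *R n1 + v $ 2 *R n2 + v $ 3 *R n3 + v $ 4 *R V x" for v
  unfolding A_def by (rule columns_app)
 have A4: "A *v e4 = V x" unfolding Av by simp
 have ax: "A *v axis 1 1 = n1" "A *v axis 2 1 = n2" "A *v axis 3 1 = n3" unfolding Av by (simp_all add: axis_def)
 obtain U \<xi> f where U: "open U" "x \<in> U" "U \<subseteq> N" and \<xi>: "diffeo_onto_image U \<xi>" "\<xi> x = 0" "\<And>v. dd \<xi> x (A *v v) = v"
  and f: "smooth_on U f" "\<forall>z\<in>U. f z \<noteq> 0 \<and> dd \<xi> z (V z) = f z *R e4"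
  by (rule straighten[OF N(1) L(2) N(3) A[folded A_def] A4]) blast+
 define T where "T = pullback (inv_into U \<xi>) g"
 note tr = lorentzian_transport[OF N(2) U(3) \<xi>(1) f, folded T_def]
 note LT = degenerate_lorentzianD[OF tr(2)]
 have oT: "open (\<xi> ` U)" by (rule diffeoD(2)[OF \<xi>(1)])
 have 0: "0 \<in> \<xi> ` U" using U(2) \<xi>(2) by force
 have T0: "tensor_app (T 0) v w = tensor_app (g x) (A *v v) (A *v w)" for v w
  using bspec[OF tr(1) U(2)] \<xi>(2,3) by metis
 have T0c: "T 0 $ 1 $ 2 = \<epsilon>" "T 0 $ 3 $ 3 = - \<epsilon>" "T 0 $ 1 $ 1 = 0" "T 0 $ 2 $ 2 = 0" "T 0 $ 1 $ 3 = 0" "T 0 $ 2 $ 3 = 0"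
  unfolding tensor_app_axis[symmetric] T0 ax by (simp_all add: n)
 have sTc: "smooth_on (\<xi> ` U) (\<lambda>w. T w $ i $ j)" for i j by (intro smooth_on_nth oT LT(1))
 define P where "P = {w \<in> \<xi> ` U. T w $ 1 $ 2 \<noteq> 0}"
 have P: "open P" "0 \<in> P" "P \<subseteq> \<xi> ` U" unfolding P_def
  using open_nonzero[OF oT smooth_on_continuous[OF sTc]] 0 T0c(1) n(1) by auto
 obtain \<rho> where \<rho>: "\<rho> > 0" "slab 0 0 \<rho> \<subseteq> P" using thicken[of P 0 0] P(1,2) by auto
 let ?B = "slab 0 0 \<rho>"
 have B\<xi>: "?B \<subseteq> \<xi> ` U" using \<rho>(2) P(3) by auto
 define h where "h w = inverse (T w $ 1 $ 2) *R T w" for w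
 have T12: "T w $ 1 $ 2 \<noteq> 0" if "w \<in> ?B" for w using that \<rho>(2) by (auto simp: P_def)
 have si: "smooth_on ?B (\<lambda>w. inverse (T w $ 1 $ 2))"
  by (rule smooth_on_inverse[OF open_slab smooth_on_subset[OF sTc B\<xi>] T12])
 have lh: "degenerate_lorentzian ?B h E4" unfolding h_def
  by (rule lorentzian_rescale[OF open_slab lorentzian_subset[OF tr(2) B\<xi>] si]) (simp add: T12)
 have fm: "flat_metric ?B h"
 proof unfold_locales
  show "open ?B" "0 \<in> ?B" using open_slab slab_axis[OF \<rho>(1), of 0 0 0] by simp_all
  show "degenerate_lorentzian ?B h E4" by (rule lh)
  show "h w $ 1 $ 2 = 1" if "w \<in> ?B" for w using T12[OF that] by (simp add: h_def)
  show "h 0 $ 1 $ 1 = 0" "h 0 $ 2 $ 2 = 0" "h 0 $ 1 $ 3 = 0" "h 0 $ 2 $ 3 = 0" "h 0 $ 3 $ 3 = -1"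
   using n(1) by (auto simp: h_def T0c)
 qed
 have dT: "\<exists>c. dd T w e4 = c *R T w" if w: "w \<in> ?B" for w
 proof -
  obtain z where z: "z \<in> U" "w = \<xi> z" using w B\<xi> by blast
  have wU: "w \<in> \<xi> ` U" using z by simp
  have "lie_proportional {z} g V" using pr z(1) U(3) by (auto simp: lie_proportional_def)
  hence "flag T E4 w 1 = flag T E4 w 2"
   using flag_transport_consequences(3)[OF \<xi>(1) z(1) tr(3)[OF z(1)]] z(2) by (simp only: lie_proportional_flag)
  hence "lie_proportional {w} T E4" by (simp only: lie_proportional_flag)
  then obtain c where c: "\<L> E4 T w = c *R T w" by (auto simp: lie_proportional_def)
  have "dd T w e4 = \<L> E4 T w"
   using lie_app[OF smooth_onD[OF LT(1) wU] differentiable_const, of e4]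
   by (intro tensor_eqI) (simp add: tensor_app_linear)
  thus ?thesis using c by auto
 qed
 have dh: "dd (\<lambda>w. h w $ i $ j) w e4 = 0" if w: "w \<in> ?B" for w i j
 proof -
  obtain c where c: "dd T w e4 = c *R T w" using dT[OF w] by blast
  have wU: "w \<in> \<xi> ` U" using w B\<xi> by auto
  have dc: "dd (\<lambda>w. T w $ i $ j) w e4 = c * T w $ i $ j" for i j
   using dd_vec_nth[OF differentiable_vec_nth[OF smooth_onD[OF LT(1) wU]], of i j e4]
    dd_vec_nth[OF smooth_onD[OF LT(1) wU], of i e4] c by simp
  have "(\<lambda>w. h w $ i $ j) = (\<lambda>w. T w $ i $ j / T w $ 1 $ 2)" by (simp add: h_def divide_inverse mult.commute)
  thus ?thesis
   using dd_divide[OF smooth_onD[OF sTc wU, of i j] smooth_onD[OF sTc wU, of 1 2] T12[OF w], of e4]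
   by (simp add: dc)
 qed
 have ind: "h (drop4 w) = h w" if w: "w \<in> ?B" for w
 proof -
  have "h (drop4 w) $ i $ j = h w $ i $ j" for i j
  proof -
   define q where "q t = drop4 w + t *R e4" for t
   have qB: "q t \<in> ?B" if "t \<in> {-\<rho><..<\<rho>}" for t using w that by (simp add: slab_def q_def)
   have "((\<lambda>t. h (q t) $ i $ j) has_vector_derivative 0) (at t within {-\<rho><..<\<rho>})" if t: "t \<in> {-\<rho><..<\<rho>}" for t
   proof -
    have "(q has_vector_derivative e4) (at t)" unfolding q_def[abs_def] by (auto intro!: derivative_eq_intros)
    moreover have "(\<lambda>w. h w $ i $ j) differentiable (at (q t))"
     by (rule smooth_onD[OF smooth_on_nth[OF open_slab smooth_on_nth[OF open_slab degenerate_lorentzianD(1)[OF lh]]] qB[OF t]])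
    ultimately have "((\<lambda>t. h (q t) $ i $ j) has_vector_derivative 0) (at t)"
     using dd_curve[of "\<lambda>w. h w $ i $ j" q t e4] dh[OF qB[OF t]] by simp
    thus ?thesis by (rule has_vector_derivative_at_within)
   qed
   then obtain c where c: "\<And>t. t \<in> {-\<rho><..<\<rho>} ==> h (q t) $ i $ j = c"
    using has_vector_derivative_zero_constant[of "{-\<rho><..<\<rho>}" "\<lambda>t. h (q t) $ i $ j"] by auto
   have "q 0 = drop4 w" "q (w $ 4) = w" by (simp_all add: q_def drop4_def)
   moreover have "0 \<in> {-\<rho><..<\<rho>}" "w $ 4 \<in> {-\<rho><..<\<rho>}" using w \<rho>(1) by (auto simp: slab_def)
   ultimately show ?thesis using c by metis
  qed
  thus ?thesis by (simp add: vec_eq_iff)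
 qed
 define U1 where "U1 = U \<inter> \<xi> -` ?B"
 have U1: "open U1" "U1 \<subseteq> U" "x \<in> U1" "\<xi> ` U1 \<subseteq> ?B"
  using open_preimage[OF U(1) diffeoD(4)[OF \<xi>(1)] open_slab] U(2) \<xi>(2) slab_axis[OF \<rho>(1), of 0 0 0] by (auto simp: U1_def)
 define r where "r z = inverse (T (\<xi> z) $ 1 $ 2)" for z
 have sr: "smooth_on U1 r" unfolding r_def[abs_def]
  by (rule smooth_on_compose[OF U1(1) open_slab U1(4) smooth_on_subset[OF diffeoD(4)[OF \<xi>(1)] U1(2)] si])
 have rn: "r z \<noteq> 0" if "z \<in> U1" for z using T12[of "\<xi> z"] U1(4) that by (auto simp: r_def)
 have rel: "tensor_app (flat_metric.H h (\<xi> z)) (dd \<xi> z v) (dd \<xi> z w) = tensor_app (r z *R g z) v w" if z: "z \<in> U1" for z v w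
 proof -
  have zB: "\<xi> z \<in> ?B" using U1(4) z by auto
  have "z \<in> U" using z U1(2) by auto
  from bspec[OF tr(1) this] have "tensor_app (T (\<xi> z)) (dd \<xi> z v) (dd \<xi> z w) = tensor_app (g z) v w" by blast
  thus ?thesis unfolding flat_metric.H_def[OF fm] ind[OF zB] by (simp add: h_def r_def tensor_app_linear)
 qed
 have f1: "smooth_on U1 f" "\<forall>z\<in>U1. f z \<noteq> 0 \<and> dd \<xi> z (V z) = f z *R e4" using smooth_on_subset[OF f(1) U1(2)] f(2) U1(2) by auto
 show thesis
  by (rule that[OF U1(1) U1(3) order_trans[OF U1(2) U(3)] diffeo_subset[OF \<xi>(1) U1(1,2)] \<xi>(2) \<xi>(3)[unfolded Av] f1 fm U1(4) sr])
   (use rn rel in blast)+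
qed

lemma isometry_restrict:
 assumes "ode_isometry T W \<Psi> D F" "open W'" "W' \<subseteq> W" "\<Psi> ` W' \<subseteq> D'" "open D'" "D' \<subseteq> D"
 shows "ode_isometry T W' \<Psi> D' F"
proof -
 obtain \<rho> where o: "third_order_ode D F" "diffeo_onto_image W \<Psi>" and s: "smooth_on W \<rho>"
  "\<And>y. y \<in> W ==> \<rho> y \<noteq> 0 \<and> pullback \<Psi> (ode_metric F) y = \<rho> y *R T y"
  using assms(1) unfolding ode_isometry_def by blast
 have "third_order_ode D' F" using o(1) assms(5,6) smooth_on_subset unfolding third_order_ode_def by blast
 thus ?thesis unfolding ode_isometry_def
  using diffeo_subset[OF o(2) assms(2,3)] smooth_on_subset[OF s(1) assms(3)] s(2) assms(3,4) by blast
qed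

lemma flat_isometry:
 assumes N: "open N" "degenerate_lorentzian N g V" "x \<in> N" and pr: "lie_proportional N g V"
 shows "\<exists>U \<phi> F. open U \<and> x \<in> U \<and> U \<subseteq> N \<and> ode_isometry g U \<phi> (\<phi> ` U) F"
proof -
 obtain \<epsilon> n1 n2 n3 where n: "\<epsilon> = 1 \<or> \<epsilon> = (-1 :: real)" "tensor_app (g x) n1 n2 = \<epsilon>" "tensor_app (g x) n3 n3 = - \<epsilon>"
  "tensor_app (g x) n1 n1 = 0" "tensor_app (g x) n2 n2 = 0" "tensor_app (g x) n1 n3 = 0" "tensor_app (g x) n2 n3 = 0"
  "det (transpose (vector [n1, n2, n3, V x] :: real ^ 4 ^ 4)) \<noteq> 0" by (rule null_basis[OF N(2,3), of 0 0]) blast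
 obtain U \<xi> f \<rho> h r where U: "open U" "x \<in> U" "U \<subseteq> N" and \<xi>: "diffeo_onto_image U \<xi>" "\<xi> x = 0"
  and fm: "flat_metric (slab 0 0 \<rho>) h" and r: "smooth_on U r" "\<forall>z\<in>U. r z \<noteq> 0"
  and rel: "\<forall>z\<in>U. \<forall>v w. tensor_app (flat_metric.H h (\<xi> z)) (dd \<xi> z v) (dd \<xi> z w) = tensor_app (r z *R g z) v w"
  by (rule flat_straight[OF N pr n]) blast
 interpret flat_metric "slab 0 0 \<rho>" h by (rule fm)
 obtain t \<Psi> F where t: "t > 0" and iso: "ode_isometry H (slab 0 0 t) \<Psi> (\<Psi> ` slab 0 0 t) F" by (rule flat_chart[of 0 0]) auto
 define W where "W = slab 0 0 t \<inter> \<xi> ` U"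
 have W: "open W" "W \<subseteq> slab 0 0 t" "W \<subseteq> \<xi> ` U" using open_slab diffeoD(2)[OF \<xi>(1)] by (auto simp: W_def)
 have dW: "diffeo_onto_image W \<Psi>" using iso diffeo_subset[OF _ W(1,2)] unfolding ode_isometry_def by blast
 have iW: "ode_isometry H W \<Psi> (\<Psi> ` W) F"
  by (rule isometry_restrict[OF iso W(1,2) order_refl diffeoD(2)[OF dW]]) (use W(2) in blast)
 note p = isometry_preimage[OF \<xi>(1) rel iW W(3)]
 define U1 where "U1 = U \<inter> \<xi> -` W"
 have "ode_isometry g U1 (\<lambda>z. \<Psi> (\<xi> z)) ((\<lambda>z. \<Psi> (\<xi> z)) ` U1) F" unfolding U1_def
  by (rule isometry_rescale[OF p(4) smooth_on_subset[OF r(1) p(2)]]) (use r(2) in auto)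
 moreover have "x \<in> U1" using U(2) \<xi>(2) slab_axis[OF t, of 0 0 0] by (force simp: U1_def W_def)
 moreover have "open U1" "U1 \<subseteq> N" using p(1,2) U(3) unfolding U1_def by auto
 ultimately show ?thesis by blast
qed

section \<open>Contact and gauge equivalence\<close>

text \<open>The contact plane is two-dimensional and contains the independent images of
  \<open>e\<close> and \<open>V\<close>, so its preimage is their span.\<close>

lemma contact_preimage:
 assumes L: "linear L" "\<And>v. L v = 0 ==> v = 0" and V: "L V = \<mu> *R total_field F z" "\<mu> \<noteq> 0"
  and e: "L e \<in> contact_plane z" "e \<notin> span {V}"
 shows "L w \<in> contact_plane z \<longleftrightarrow> (\<exists>a b. w = a *R e + b *R V)"
proof
 obtain \<alpha> \<beta> where ab: "L e = \<alpha> *R total_field F z + \<beta> *R axis 4 1"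
  using iffD1[OF contact_plane_iff[where F = F] e(1)] by blast
 have \<beta>: "\<beta> \<noteq> 0"
 proof
  assume "\<beta> = 0"
  hence "L (e - (\<alpha> / \<mu>) *R V) = 0" using V ab by (simp add: linear_diff[OF L(1)] linear_scale[OF L(1)])
  from L(2)[OF this] have "e = (\<alpha> / \<mu>) *R V" by simp
  thus False using e(2) by (auto simp: span_singleton)
 qed
 assume "L w \<in> contact_plane z"
 then obtain a b where w: "L w = a *R total_field F z + b *R axis 4 1" using contact_plane_iff[where F = F] by blast
 define p where "p = b / \<beta>"
 define q where "q = (a - p * \<alpha>) / \<mu>"
 have pq: "b - p * \<beta> = 0" "a - p * \<alpha> - q * \<mu> = 0" using \<beta> V(2) by (simp_all add: p_def q_def)
 have "L (w - (p *R e + q *R V)) = (a - p * \<alpha> - q * \<mu>) *R total_field F z + (b - p * \<beta>) *R axis 4 1"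
  by (simp add: linear_diff[OF L(1)] linear_add[OF L(1)] linear_scale[OF L(1)] w ab V(1) algebra_simps)
 hence "L (w - (p *R e + q *R V)) = 0" unfolding pq by simp
 from L(2)[OF this] have "w = p *R e + q *R V" by simp
 thus "\<exists>a b. w = a *R e + b *R V" by blast
next
 assume "\<exists>a b. w = a *R e + b *R V"
 then obtain a b where w: "w = a *R e + b *R V" by blast
 obtain \<alpha> \<beta> where ab: "L e = \<alpha> *R total_field F z + \<beta> *R axis 4 1"
  using iffD1[OF contact_plane_iff[where F = F] e(1)] by blast
 have "L w = (a * \<alpha> + b * \<mu>) *R total_field F z + (a * \<beta>) *R axis 4 1"
  unfolding w by (simp add: linear_add[OF L(1)] linear_scale[OF L(1)] ab V(1) algebra_simps)
 thus "L w \<in> contact_plane z" using contact_plane_iff[where F = F] by blast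
qed

lemma contact_plane_axis: "axis 4 1 \<in> contact_plane z"
 by (simp add: contact_plane_def theta_app axis_def)

text \<open>A line in the direction \<open>e4\<close> is mapped to a solution curve up to
  parametrization. The first jet coordinate has nonzero derivative along it, and as parameter it
  gives speed exactly \<open>total_field\<close>, whose first component is 1.\<close>

lemma same_leaf_slab:
 assumes \<Psi>: "diffeo_onto_image (slab s1 s2 r) \<Psi>"
  and tot: "\<And>z. z \<in> slab s1 s2 r ==> \<exists>m. m \<noteq> 0 \<and> dd \<Psi> z e4 = m *R total_field F (\<Psi> z)"
  and z: "z \<in> slab s1 s2 r" "z' \<in> slab s1 s2 r" "drop4 z = drop4 z'"
 shows "same_leaf (\<Psi> ` slab s1 s2 r) F (\<Psi> z) (\<Psi> z')"
proof -
 define q where "q s = drop4 z + s *R e4" for s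
 define J where "J = {s1 - r<..<s2 + r}"
 define X where "X s = \<Psi> (q s) $ 1" for s
 have qB: "q s \<in> slab s1 s2 r" if "s \<in> J" for s using that z(1) by (simp add: slab_def q_def J_def)
 define m where "m s = dd \<Psi> (q s) e4 $ 1" for s
 have m: "m s \<noteq> 0" "dd \<Psi> (q s) e4 = m s *R total_field F (\<Psi> (q s))" if "s \<in> J" for s
  using tot[OF qB[OF that]] by (auto simp: m_def total_field_nth)
 have dq: "((\<lambda>s. \<Psi> (q s)) has_vector_derivative m s *R total_field F (\<Psi> (q s))) (at s)" if s: "s \<in> J" for s
 proof -
  have "(q has_vector_derivative e4) (at s)" unfolding q_def[abs_def] by (auto intro!: derivative_eq_intros)
  from dd_curve[OF smooth_onD[OF diffeoD(4)[OF \<Psi>] qB[OF s]] this] show ?thesis unfolding m(2)[OF s] .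
 qed
 have dX: "(X has_real_derivative m s) (at s)" if s: "s \<in> J" for s
 proof -
  have "((\<lambda>s. \<Psi> (q s) $ 1) has_vector_derivative (m s *R total_field F (\<Psi> (q s))) $ 1) (at s)"
   by (rule bounded_linear.has_vector_derivative[OF bounded_linear_vec_nth dq[OF s]])
  thus ?thesis unfolding X_def[abs_def] by (simp add: has_real_derivative_iff_has_vector_derivative total_field_nth)
 qed
 have inj: "inj_on X J"
 proof (rule inj_onI)
  fix a b assume ab: "a \<in> J" "b \<in> J" "X a = X b"
  have sub: "closed_segment a b \<subseteq> J" using ab by (auto simp: J_def closed_segment_eq_real_ivl split: if_splits)
  show "a = b" by (rule inj_on_derivative_nonzero[OF dX m(1) ab(3)]) (use sub in auto)
 qed
 define G where "G = inv_into J X"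
 have GX: "G (X s) = s" if "s \<in> J" for s unfolding G_def by (rule inv_into_f_f[OF inj that])
 have dG: "(G has_vector_derivative inverse (m s)) (at (X s))" if s: "s \<in> J" for s
 proof -
  have "(G has_derivative (\<lambda>s h. h * inverse (m s)) s) (at (X s))"
  proof (rule has_derivative_inverse_on[where S = J and f = X and g = G and x = s and f' = "\<lambda>s h. m s * h" and g' = "\<lambda>s h. h * inverse (m s)"])
   show "(X has_derivative (*) (m s)) (at s)" if "s \<in> J" for s using dX[OF that] by (simp add: has_field_derivative_def)
   show "(*) (m s) \<circ> (\<lambda>h. h * inverse (m s)) = id" using m(1)[OF s] by (simp add: fun_eq_iff)
  qed (use s GX in \<open>simp_all add: J_def\<close>)
  thus ?thesis by (simp add: has_vector_derivative_def)
 qed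
 define \<sigma> where "\<sigma> t = \<Psi> (q (G t))" for t
 have \<sigma>: "\<sigma> t \<in> \<Psi> ` slab s1 s2 r \<and> (\<sigma> has_vector_derivative total_field F (\<sigma> t)) (at t within X ` J)" if t: "t \<in> X ` J" for t
 proof -
  obtain s where s: "s \<in> J" "t = X s" using t by blast
  have "(((\<lambda>s. \<Psi> (q s)) \<circ> G) has_vector_derivative inverse (m s) *R (m s *R total_field F (\<Psi> (q s)))) (at t)"
   unfolding s(2) by (rule vector_diff_chain_at[OF dG[OF s(1)]]) (use dq[OF s(1)] GX[OF s(1)] in simp)
  hence "(\<sigma> has_vector_derivative total_field F (\<sigma> t)) (at t)"
   using m(1)[OF s(1)] GX[OF s(1)] by (simp add: \<sigma>_def[abs_def] o_def s(2))
  thus ?thesis using qB[OF s(1)] GX[OF s(1)] s(2) by (auto simp: \<sigma>_def intro: has_vector_derivative_at_within)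
 qed
 have "continuous_on J X" by (rule continuous_at_imp_continuous_on) (use dX in \<open>auto intro: DERIV_isCont\<close>)
 hence I: "is_interval (X ` J)"
  unfolding is_interval_connected_1 by (rule connected_continuous_image) (simp add: J_def)
 have zJ: "z $ 4 \<in> J" "z' $ 4 \<in> J" using z by (auto simp: slab_def J_def)
 have qz: "q (z $ 4) = z" unfolding q_def by (simp add: drop4_def)
 have qz': "q (z' $ 4) = z'" unfolding q_def z(3) by (simp add: drop4_def)
 have "\<sigma> (X (z $ 4)) = \<Psi> z" "\<sigma> (X (z' $ 4)) = \<Psi> z'" by (simp_all add: \<sigma>_def GX[OF zJ(1)] GX[OF zJ(2)] qz qz')
 thus ?thesis unfolding same_leaf_def using I \<sigma> zJ by blast
qed

text \<open>The second derivatives of \<open>f\<close> cancel by symmetry: naturality of the Lie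
  bracket of \<open>V\<close> and \<open>e\<close>.\<close>

lemma bracket_push:
 fixes f :: "point \<Rightarrow> point"
 assumes "open U" "x \<in> U" "smooth_on U f" "smooth_on U e" "smooth_on U V"
 shows "dd (\<lambda>z. dd f z (e z)) x (V x) - dd (\<lambda>z. dd f z (V z)) x (e x) = dd f x (dd e x (V x) - dd V x (e x))"
 unfolding dd_field[OF assms(1-3) smooth_onD[OF assms(4,2)]] dd_field[OF assms(1-3) smooth_onD[OF assms(5,2)]]
  frechet_symmetric[OF assms(1-3), of "e x" "V x"]
 by (simp add: linear_diff[OF dd_lin[OF assms(3,2)]])

text \<open>What a contact comparison needs to know of an isometry: two maps adapted to the same
  \<open>V\<close> and \<open>e\<close> differ by a contact transformation.\<close>

definition adapted :: "point set \<Rightarrow> (point \<Rightarrow> point) \<Rightarrow> (point \<Rightarrow> point) \<Rightarrow> (point \<Rightarrow> real) \<Rightarrow> (point \<Rightarrow> point) \<Rightarrow> bool" where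
 "adapted U V \<phi> F e \<longleftrightarrow> diffeo_onto_image U \<phi> \<and> (\<forall>y\<in>U. e y \<notin> span {V y} \<and>
   (\<exists>m. m \<noteq> 0 \<and> dd \<phi> y (V y) = m *R total_field F (\<phi> y)) \<and> dd \<phi> y (e y) \<in> contact_plane (\<phi> y))"

lemma adapted_subset: "adapted U V \<phi> F e ==> open M ==> M \<subseteq> U ==> adapted M V \<phi> F e"
 unfolding adapted_def using diffeo_subset by blast

lemma adapted_plane:
 assumes a: "adapted U V \<phi> F e" and y: "y \<in> U"
 shows "dd \<phi> y w \<in> contact_plane (\<phi> y) \<longleftrightarrow> (\<exists>a b. w = a *R e y + b *R V y)"
proof -
 obtain m where m: "m \<noteq> 0" "dd \<phi> y (V y) = m *R total_field F (\<phi> y)" and d: "diffeo_onto_image U \<phi>"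
  and e: "dd \<phi> y (e y) \<in> contact_plane (\<phi> y)" "e y \<notin> span {V y}"
  using a y unfolding adapted_def by blast
 show ?thesis
  by (rule contact_preimage[OF dd_lin[OF diffeoD(4)[OF d] y] diffeo_ker[OF d y] m(2,1) e])
qed

lemma adapted_contact_related:
 assumes "adapted U V \<phi>1 F1 e" "adapted U V \<phi>2 F2 e"
 shows "contact_related U \<phi>1 F1 \<phi>2 F2"
 by (rule contact_relatedI[where V = V]) (use assms adapted_plane[OF assms(1)] adapted_plane[OF assms(2)] in \<open>auto simp: adapted_def\<close>)

text \<open>The field is d/dq pulled back. Its bracket with the total derivative contains d/dp and
  so leaves the contact plane; the last claim records this rotation along the fibre.\<close>

lemma isometry_null_field:
 assumes N: "open N" "degenerate_lorentzian N g V" and U: "U \<subseteq> N" and iso: "ode_isometry g U \<phi> D F"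
 obtains e where "smooth_on U e" "adapted U V \<phi> F e" "\<forall>y\<in>U. flag_null g V y (e y)"
  "\<forall>y\<in>U. \<not> (\<exists>a b. dd e y (V y) - dd V y (e y) = a *R e y + b *R V y)"
proof -
 have dif: "diffeo_onto_image U \<phi>" and ode: "third_order_ode D F" and im: "\<phi> ` U \<subseteq> D" using iso by (auto simp: ode_isometry_def)
 note d = diffeoD[OF dif] note i = diffeo_inverse[OF dif]
 have VU: "smooth_on U V" by (rule smooth_on_subset[OF degenerate_lorentzianD(2)[OF N(2)] U])
 obtain f where f: "smooth_on U f" "\<And>x. x \<in> U ==> f x \<noteq> 0" "\<And>x. x \<in> U ==> dd \<phi> x (V x) = f x *R total_field F (\<phi> x)"
  by (rule isometry_flags[OF N(2) U iso]) blast
 define e where "e y = dd (inv_into U \<phi>) (\<phi> y) (axis 4 1 :: point)" for y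
 have e: "smooth_on U e" unfolding e_def[abs_def]
  by (rule smooth_on_compose[OF d(1,2) order_refl d(4) smooth_on_frechet[OF d(5)]])
 have de: "dd \<phi> y (e y) = axis 4 1" if y: "y \<in> U" for y
  using i(5)[of "\<phi> y" "axis 4 1"] i(2)[OF y] y by (simp add: e_def)
 have null: "flag_null g V y (e y)" if y: "y \<in> U" for y
  unfolding isometry_consequences(4)[OF N U iso y] de[OF y] by (rule ode_flag_null[OF ode]) (use im y in auto)
 have es: "e y \<notin> span {V y}" if y: "y \<in> U" for y
 proof
  assume "e y \<in> span {V y}"
  then obtain k where k: "e y = k *R V y" by (auto simp: span_singleton)
  have "e4 = (k * f y) *R total_field F (\<phi> y)"
   using de[OF y] f(3)[OF y] unfolding k by (simp add: linear_scale[OF dd_lin[OF d(4) y]])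
  from arg_cong[OF this, of "\<lambda>v. v $ 1"] arg_cong[OF this, of "\<lambda>v. v $ 4"] show False by (auto simp: total_field_nth)
 qed
 have ad: "adapted U V \<phi> F e"
  unfolding adapted_def using dif es f(2,3) de contact_plane_axis by (metis (no_types, lifting))
 have "dd \<phi> y (dd e y (V y) - dd V y (e y)) \<notin> contact_plane (\<phi> y)" if y: "y \<in> U" for y
 proof -
  have py: "\<phi> y \<in> D" using im y by auto
  note sT = smooth_total_field[OF ode]
  have oD: "open D" by (rule ode_open[OF ode])
  define X where "X = total_field F (\<phi> y)"
  define Y where "Y = dd (total_field F) (\<phi> y) e4"
  have Y: "Y $ i = dd (\<lambda>z. total_field F z $ i) (\<phi> y) e4" for i
   unfolding Y_def by (rule dd_vec_nth[OF smooth_onD[OF sT py], symmetric])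
  have Y13: "Y $ 1 = 0" "Y $ 3 = 1" by (simp_all add: Y total_field_nth dd_coord)
  have 1: "dd (\<lambda>z. dd \<phi> z (e z)) y (V y) = 0"
   using frechet_cong[OF d(1) y, of "\<lambda>z. dd \<phi> z (e z)" "\<lambda>_. axis 4 1"] de by simp
  have sf: "(\<lambda>z. total_field F (\<phi> z)) differentiable (at y)"
   by (rule smooth_onD[OF smooth_on_compose[OF d(1) oD im d(4) sT] y])
  have "dd (\<lambda>z. dd \<phi> z (V z)) y = dd (\<lambda>z. f z *R total_field F (\<phi> z)) y"
   by (rule frechet_cong[OF d(1) y f(3)])
  hence "dd (\<lambda>z. dd \<phi> z (V z)) y (e y) = dd f y (e y) *R X + f y *R dd (\<lambda>z. total_field F (\<phi> z)) y (e y)"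
   by (simp add: dd_scaleR[OF smooth_onD[OF f(1) y] sf] X_def)
  also have "dd (\<lambda>z. total_field F (\<phi> z)) y (e y) = Y"
   using dd_compose[OF smooth_onD[OF d(4) y] smooth_onD[OF sT py], of "e y"] by (simp add: de[OF y] Y_def)
  finally have 2: "dd \<phi> y (dd e y (V y) - dd V y (e y)) = - (dd f y (e y) *R X + f y *R Y)"
   using bracket_push[OF d(1) y d(4) e VU] 1 by simp
  have X: "X $ 1 = 1" "X $ 3 = \<phi> y $ 4" by (simp_all add: X_def total_field_nth)
  have "theta2 (\<phi> y) \<bullet> dd \<phi> y (dd e y (V y) - dd V y (e y)) = - f y"
   unfolding 2 theta_app by (simp add: X Y13)
  thus ?thesis using f(2)[OF y] by (simp add: contact_plane_def)
 qed
 thus thesis using that[of e] e ad null adapted_plane[OF ad] by blast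
qed

context flat_metric
begin

text \<open>A rotating field of null directions occurs in the fixed chart \<open>\<Psi>\<close>
  after sliding each point along its fibre: \<open>m\<close> moves it to where the fourth coordinate
  equals the slope of \<open>e\<close>, so that \<open>e\<close> becomes a multiple of
  \<open>null_dir b\<close> modulo \<open>e4\<close>. The slab from \<open>s1\<close> to
  \<open>s2\<close> must contain the slope at \<open>x\<close>.\<close>

lemma flat_branch:
 assumes W: "x \<in> W" and \<xi>: "diffeo_onto_image W \<xi>" "\<xi> x = 0" and V: "smooth_on W V" and e: "smooth_on W e"
  and f: "smooth_on W f" "\<forall>z\<in>W. f z \<noteq> 0 \<and> dd \<xi> z (V z) = f z *R e4"
  and null: "\<forall>y\<in>W. tensor_app (H (\<xi> y)) (dd \<xi> y (e y)) (dd \<xi> y (e y)) = 0"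
  and e1: "dd \<xi> x (e x) $ 1 \<noteq> 0" and eV: "\<forall>y\<in>W. e y \<notin> span {V y}"
  and br: "\<forall>y\<in>W. \<not> (\<exists>a b. dd e y (V y) - dd V y (e y) = a *R e y + b *R V y)"
  and s: "s1 \<le> dd \<xi> x (e x) $ 3 / dd \<xi> x (e x) $ 1" "dd \<xi> x (e x) $ 3 / dd \<xi> x (e x) $ 1 \<le> s2"
  and r: "r > 0" "slab s1 s2 r \<subseteq> S1" and \<Psi>: "diffeo_onto_image (slab s1 s2 r) \<Psi>"
  and con: "\<And>z. z \<in> slab s1 s2 r ==> dd \<Psi> z (null_dir b z) \<in> contact_plane (\<Psi> z)"
  and tot: "\<And>z. z \<in> slab s1 s2 r ==> \<exists>m. m \<noteq> 0 \<and> dd \<Psi> z e4 = m *R total_field F (\<Psi> z)"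
 obtains U m where "open U" "x \<in> U" "U \<subseteq> W" "adapted U V (\<lambda>y. \<Psi> (m y)) F e" "m ` U \<subseteq> slab s1 s2 r"
  "\<forall>y\<in>U. drop4 (m y) = drop4 (\<xi> y)"
proof -
 note d = diffeoD[OF \<xi>(1)]
 define u where "u y = dd \<xi> y (e y)" for y
 have us: "smooth_on W u" unfolding u_def[abs_def] by (rule smooth_on_frechet_field[OF d(1,4) e])
 have uc: "smooth_on W (\<lambda>y. u y $ i)" for i by (rule smooth_on_nth[OF d(1) us])
 define Wa where "Wa = {y \<in> W. u y $ 1 \<noteq> 0}"
 have Wa: "open Wa" "Wa \<subseteq> W" "x \<in> Wa" unfolding Wa_def
  by (intro open_nonzero d(1) smooth_on_continuous uc) (use W e1 in \<open>auto simp: u_def\<close>)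
 have u1: "u y $ 1 \<noteq> 0" if "y \<in> Wa" for y using that by (simp add: Wa_def)
 define \<kappa> where "\<kappa> y = u y $ 3 / u y $ 1" for y
 define \<beta> where "\<beta> y = u y $ 2 / u y $ 1" for y
 have \<kappa>s: "smooth_on Wa \<kappa>" and \<beta>s: "smooth_on Wa \<beta>" unfolding \<kappa>_def[abs_def] \<beta>_def[abs_def]
  by (intro smooth_on_divide Wa(1) smooth_on_subset[OF uc Wa(2)] u1; assumption)+
 define m where "m y = drop4 (\<xi> y) + \<kappa> y *R e4" for y
 have \<xi>a: "smooth_on Wa \<xi>" by (rule smooth_on_subset[OF d(4) Wa(2)])
 have ms: "smooth_on Wa m" unfolding m_def[abs_def]
  by (intro smooth_on_add smooth_on_scaleR smooth_on_const \<kappa>s Wa(1) smooth_on_linear[OF bounded_linear_drop4] \<xi>a)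
 have dm: "dd m y v = drop4 (dd \<xi> y v) + dd \<kappa> y v *R e4" if y: "y \<in> Wa" for y v
 proof -
  have "(m has_derivative (\<lambda>v. drop4 (dd \<xi> y v) + dd \<kappa> y v *R e4)) (at y)" unfolding m_def[abs_def]
   by (rule has_derivative_add[OF bounded_linear.has_derivative[OF bounded_linear_drop4 smooth_on_has_derivative[OF \<xi>a y]]
    has_derivative_scaleR_left[OF smooth_on_has_derivative[OF \<kappa>s y]]])
  thus ?thesis by (simp add: frechet_eqI)
 qed
 have m4: "m y $ 1 = \<xi> y $ 1" "m y $ 2 = \<xi> y $ 2" "m y $ 3 = \<xi> y $ 3" "m y $ 4 = \<kappa> y" for y by (simp_all add: m_def)
 have dr: "drop4 (m y) = drop4 (\<xi> y)" for y by (simp add: vec_eq_iff forall_4 m4)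
 have mx: "m x = \<kappa> x *R e4" by (simp add: m_def \<xi>(2))
 define U1 where "U1 = Wa \<inter> m -` slab s1 s2 r"
 have U1: "open U1" "U1 \<subseteq> Wa" "m ` U1 \<subseteq> slab s1 s2 r" using open_preimage[OF Wa(1) ms open_slab] by (auto simp: U1_def)
 have xU1: "x \<in> U1" using slab_axis[OF r(1), of s1 "\<kappa> x" s2] s Wa(3) by (simp add: U1_def mx \<kappa>_def u_def)
 have mS: "m y \<in> S1" "m y \<in> S0" if "y \<in> U1" for y using U1(3) r(2) S1(2) that by auto
 \<comment> \<open>Positivity selects the branch of the quadratic equation on which \<open>b\<close>
   is the root; at \<open>x\<close> the value is 1.\<close>
 define t where "t y = H (m y) $ 2 $ 2 * \<beta> y + qB (m y)" for y
 have m1: "smooth_on U1 m" by (rule smooth_on_subset[OF ms U1(2)])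
 have mS0: "m ` U1 \<subseteq> S0" using mS(2) by auto
 have ts: "smooth_on U1 t" unfolding t_def[abs_def]
  by (intro smooth_on_add smooth_on_mult smooth_on_nth U1(1) smooth_on_subset[OF \<beta>s U1(2)]
   smooth_on_compose[OF U1(1) S0(1) mS0 m1 H_smooth] smooth_on_compose[OF U1(1) S0(1) mS0 m1 q_smooth(1)])
 define U2 where "U2 = U1 \<inter> t -` {0<..}"
 have U2: "open U2" "U2 \<subseteq> U1" using open_preimage[OF U1(1) ts, of "{0<..}"] by (auto simp: U2_def)
 have "t x = 1" unfolding t_def mx axis_values by (simp add: H_def h0)
 hence xU2: "x \<in> U2" using xU1 by (simp add: U2_def)
 have \<beta>b: "\<beta> y = b (m y)" if y: "y \<in> U2" for y
 proof (rule root(2))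
  have yU: "y \<in> U1" "y \<in> Wa" "y \<in> W" using y U2(2) U1(2) Wa(2) by auto
  show "m y \<in> S1" by (rule mS(1)[OF yU(1)])
  show "H (m y) $ 2 $ 2 * \<beta> y + qB (m y) > 0" using y by (simp add: U2_def t_def)
  define v where "v = inverse (u y $ 1) *R u y"
  have "v $ 1 = 1" "v $ 3 = m y $ 4" "v $ 2 = \<beta> y" using u1[OF yU(2)] by (simp_all add: v_def m4 \<kappa>_def \<beta>_def divide_inverse mult.commute)
  moreover have "tensor_app (H (m y)) v v = 0"
   using bspec[OF null yU(3)] by (simp add: H_def dr v_def u_def tensor_app_linear)
  ultimately show "H (m y) $ 2 $ 2 * (\<beta> y)\<^sup>2 + 2 * qB (m y) * \<beta> y + qC (m y) = 0"
   using quadratic[OF mS(2)[OF yU(1)], of v] by simp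
 qed
 have dmV: "dd m y (V y) = dd \<kappa> y (V y) *R e4" if y: "y \<in> Wa" for y
 proof -
  have "dd \<xi> y (V y) = f y *R e4" using f(2) y Wa(2) by auto
  thus ?thesis by (simp add: dm[OF y])
 qed
 \<comment> \<open>Were the slope stationary along \<open>V\<close>, then \<open>m\<close> and with
   it \<beta> = b(m y) would be so too, and the bracket of \<open>V\<close> and \<open>e\<close>
   would be a combination of both, against \<open>br\<close>.\<close>
 have \<kappa>V: "dd \<kappa> y (V y) \<noteq> 0" if y: "y \<in> U2" for y
 proof
  assume 0: "dd \<kappa> y (V y) = 0"
  have yU: "y \<in> U1" "y \<in> Wa" "y \<in> W" using y U2(2) U1(2) Wa(2) by auto
  note u0 = u1[OF yU(2)]
  define u' where "u' = dd u y (V y)"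
  have u'c: "dd (\<lambda>y. u y $ i) y (V y) = u' $ i" for i unfolding u'_def by (rule dd_vec_nth[OF smooth_onD[OF us yU(3)]])
  have duc: "(\<lambda>y. u y $ i) differentiable (at y)" for i by (rule smooth_onD[OF uc yU(3)])
  have "dd \<kappa> y (V y) = (u' $ 3 * u y $ 1 - u y $ 3 * u' $ 1) / (u y $ 1)\<^sup>2"
   unfolding \<kappa>_def[abs_def] dd_divide[OF duc duc u0] u'c ..
  hence 3: "u' $ 3 * u y $ 1 = u y $ 3 * u' $ 1" using 0 u0 by simp
  have "dd \<beta> y (V y) = dd (\<lambda>y. b (m y)) y (V y)" using frechet_cong[OF U2(1) y \<beta>b] by simp
  also have "\<dots> = dd b (m y) (dd m y (V y))"
   by (rule dd_compose[OF smooth_onD[OF ms yU(2)] smooth_onD[OF b_smooth mS(1)[OF yU(1)]]])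
  also have "\<dots> = 0" unfolding dmV[OF yU(2)] 0
   using linear_0[OF dd_lin[OF b_smooth mS(1)[OF yU(1)]]] by simp
  also have "dd \<beta> y (V y) = (u' $ 2 * u y $ 1 - u y $ 2 * u' $ 1) / (u y $ 1)\<^sup>2"
   unfolding \<beta>_def[abs_def] dd_divide[OF duc duc u0] u'c ..
  finally have 2: "u' $ 2 * u y $ 1 = u y $ 2 * u' $ 1" using u0 by simp
  define w where "w = dd e y (V y) - dd V y (e y)"
  have dfe: "dd (\<lambda>z. dd \<xi> z (V z)) y (e y) = dd f y (e y) *R e4"
  proof -
   have "dd (\<lambda>z. dd \<xi> z (V z)) y = dd (\<lambda>z. f z *R e4) y" by (rule frechet_cong[OF d(1) yU(3)]) (use f(2) in blast)
   thus ?thesis using frechet_eqI[OF has_derivative_scaleR_left[OF smooth_on_has_derivative[OF f(1) yU(3)]], of e4] by simp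
  qed
  have "u' - dd f y (e y) *R e4 = dd \<xi> y w"
   using bracket_push[OF d(1) yU(3) d(4) e V] dfe unfolding w_def u'_def u_def[abs_def] by simp
  hence dw: "dd \<xi> y w = u' - dd f y (e y) *R e4" by simp
  define k where "k = u' $ 1 / u y $ 1"
  define l where "l = (u' $ 4 - dd f y (e y) - k * u y $ 4) / f y"
  have fy: "f y \<noteq> 0" "dd \<xi> y (V y) = f y *R e4" using f(2) yU(3) by auto
  have k: "u' $ 1 = k * u y $ 1" "u' $ 2 = k * u y $ 2" "u' $ 3 = k * u y $ 3" "u' $ 4 - dd f y (e y) = k * u y $ 4 + l * f y"
   using 2 3 u0 fy(1) by (simp_all add: k_def l_def field_simps)
  have lin: "linear (dd \<xi> y)" by (rule dd_lin[OF d(4) yU(3)])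
  have "dd \<xi> y (w - (k *R e y + l *R V y)) = 0"
   using k by (simp add: linear_diff[OF lin] linear_add[OF lin] linear_scale[OF lin] dw fy(2) u_def[symmetric] vec_eq_iff forall_4)
  hence "w - (k *R e y + l *R V y) = 0" by (rule diffeo_ker[OF \<xi>(1) yU(3)])
  hence "w = k *R e y + l *R V y" by simp
  thus False using bspec[OF br yU(3)] unfolding w_def by blast
 qed
 define \<psi> where "\<psi> y = \<Psi> (m y)" for y
 have m2: "smooth_on U2 m" "m ` U2 \<subseteq> slab s1 s2 r" using smooth_on_subset[OF m1 U2(2)] U1(3) U2(2) by auto
 have \<psi>s: "smooth_on U2 \<psi>" unfolding \<psi>_def[abs_def]
  by (rule smooth_on_compose[OF U2(1) open_slab m2(2) m2(1) diffeoD(4)[OF \<Psi>]])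
 have d\<psi>: "dd \<psi> y v = dd \<Psi> (m y) (dd m y v)" if y: "y \<in> U2" for y v
  unfolding \<psi>_def[abs_def]
  by (rule dd_compose[OF smooth_onD[OF m2(1) y] smooth_onD[OF diffeoD(4)[OF \<Psi>]]]) (use m2(2) y in auto)
 have ker: "v = 0" if y: "y \<in> U2" and v: "dd \<psi> y v = 0" for y v
 proof -
  have yU: "y \<in> U1" "y \<in> Wa" "y \<in> W" using y U2(2) U1(2) Wa(2) by auto
  have my: "m y \<in> slab s1 s2 r" using m2(2) y by auto
  have "dd m y v = 0" using diffeo_ker[OF \<Psi> my] v unfolding d\<psi>[OF y] by blast
  hence dv: "drop4 (dd \<xi> y v) + dd \<kappa> y v *R e4 = 0" unfolding dm[OF yU(2)] .
  have "dd \<xi> y v $ 1 = 0" "dd \<xi> y v $ 2 = 0" "dd \<xi> y v $ 3 = 0"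
   using arg_cong[OF dv, of "\<lambda>v. v $ 1"] arg_cong[OF dv, of "\<lambda>v. v $ 2"] arg_cong[OF dv, of "\<lambda>v. v $ 3"] by simp_all
  hence x4: "dd \<xi> y v = dd \<xi> y v $ 4 *R e4" by (simp add: vec_eq_iff forall_4)
  have fy: "f y \<noteq> 0" "dd \<xi> y (V y) = f y *R e4" using f(2) yU(3) by auto
  define k where "k = dd \<xi> y v $ 4 / f y"
  have lin: "linear (dd \<xi> y)" by (rule dd_lin[OF d(4) yU(3)])
  have "dd \<xi> y (v - k *R V y) = 0" using fy x4 by (simp add: linear_diff[OF lin] linear_scale[OF lin] k_def)
  hence "v - k *R V y = 0" by (rule diffeo_ker[OF \<xi>(1) yU(3)])
  hence vk: "v = k *R V y" by simp
  have "dd \<kappa> y v = 0" using arg_cong[OF dv, of "\<lambda>v. v $ 4"] by simp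
  hence "k * dd \<kappa> y (V y) = 0"
   unfolding vk using linear_scale[OF dd_lin[OF \<kappa>s yU(2)]] by simp
  thus "v = 0" using \<kappa>V[OF y] vk by simp
 qed
 obtain U where U: "open U" "x \<in> U" "U \<subseteq> U2" "diffeo_onto_image U \<psi>"
  using local_diffeo[OF U2(1) \<psi>s xU2 ker[OF xU2]] by blast
 have tV: "\<exists>\<mu>. \<mu> \<noteq> 0 \<and> dd \<psi> y (V y) = \<mu> *R total_field F (\<Psi> (m y))" if y: "y \<in> U2" for y
 proof -
  have my: "m y \<in> slab s1 s2 r" using m2(2) y by auto
  have yWa: "y \<in> Wa" using y U2(2) U1(2) by auto
  obtain \<mu> where \<mu>: "\<mu> \<noteq> 0" "dd \<Psi> (m y) e4 = \<mu> *R total_field F (\<Psi> (m y))" using tot[OF my] by blast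
  have "dd \<psi> y (V y) = (dd \<kappa> y (V y) * \<mu>) *R total_field F (\<Psi> (m y))"
   unfolding d\<psi>[OF y] dmV[OF yWa] linear_scale[OF dd_lin[OF diffeoD(4)[OF \<Psi>] my]] \<mu>(2) by simp
  thus ?thesis using \<kappa>V[OF y] \<mu>(1) by (intro exI[of _ "dd \<kappa> y (V y) * \<mu>"]) simp
 qed
 have te: "dd \<psi> y (e y) \<in> contact_plane (\<Psi> (m y))" if y: "y \<in> U2" for y
 proof -
  have my: "m y \<in> slab s1 s2 r" using m2(2) y by auto
  have yWa: "y \<in> Wa" using y U2(2) U1(2) by auto
  define c where "c = dd m y (e y) $ 4"
  have "dd m y (e y) $ 1 = u y $ 1" "dd m y (e y) $ 2 = u y $ 1 * b (m y)" "dd m y (e y) $ 3 = u y $ 1 * m y $ 4"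
   using u1[OF yWa] by (simp_all add: dm[OF yWa] u_def[symmetric] \<beta>b[OF y, symmetric] \<beta>_def m4 \<kappa>_def)
  hence dme: "dd m y (e y) = u y $ 1 *R null_dir b (m y) + c *R e4" by (simp add: vec_eq_iff forall_4 c_def)
  have lin: "linear (dd \<Psi> (m y))" by (rule dd_lin[OF diffeoD(4)[OF \<Psi>] my])
  obtain \<mu> where \<mu>: "dd \<Psi> (m y) e4 = \<mu> *R total_field F (\<Psi> (m y))" using tot[OF my] by blast
  obtain p q where pq: "dd \<Psi> (m y) (null_dir b (m y)) = p *R total_field F (\<Psi> (m y)) + q *R axis 4 1"
   using iffD1[OF contact_plane_iff[where F = F] con[OF my]] by blast
  have "dd \<psi> y (e y) = (u y $ 1 * p + c * \<mu>) *R total_field F (\<Psi> (m y)) + (u y $ 1 * q) *R axis 4 1"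
   unfolding d\<psi>[OF y] dme linear_add[OF lin] linear_scale[OF lin] \<mu> pq by (simp add: algebra_simps)
  thus ?thesis using contact_plane_iff[where F = F] by blast
 qed
 have UW: "U \<subseteq> W" "m ` U \<subseteq> slab s1 s2 r" using U(3) U2(2) U1(2) Wa(2) m2(2) by blast+
 have "adapted U V \<psi> F e" using U(3,4) UW(1) tV te eV unfolding adapted_def by (auto simp: \<psi>_def subset_iff)
 hence ad: "adapted U V (\<lambda>y. \<Psi> (m y)) F e" by (simp add: \<psi>_def[abs_def])
 show thesis by (rule that[OF U(1,2) UW(1) ad UW(2)]) (simp add: dr)
qed

end

text \<open>Where the Wuenschmann invariant does not vanish, null vectors of the flag lie in the
  contact plane, so the null field of the first isometry is adapted to the second as well.\<close>

lemma isometries_contact_related: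
 assumes N: "open N" "degenerate_lorentzian N g V"
  and U: "U1 \<subseteq> N" "U2 \<subseteq> N" and i1: "ode_isometry g U1 \<phi>1 D1 F1" and i2: "ode_isometry g U2 \<phi>2 D2 F2"
  and W: "\<And>x. x \<in> U1 \<inter> U2 ==> \<not> lie_proportional {x} g V"
 shows "contact_related (U1 \<inter> U2) \<phi>1 F1 \<phi>2 F2"
proof -
 have d: "diffeo_onto_image U1 \<phi>1" "diffeo_onto_image U2 \<phi>2" and ode: "third_order_ode D2 F2"
  and im: "\<phi>2 ` U2 \<subseteq> D2" using i1 i2 by (auto simp: ode_isometry_def)
 have op: "open (U1 \<inter> U2)" using diffeoD(1)[OF d(1)] diffeoD(1)[OF d(2)] by blast
 obtain e where e: "adapted U1 V \<phi>1 F1 e" "\<forall>y\<in>U1. flag_null g V y (e y)" by (rule isometry_null_field[OF N U(1) i1]) blast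
 obtain f where f: "\<And>x. x \<in> U2 ==> f x \<noteq> 0" "\<And>x. x \<in> U2 ==> dd \<phi>2 x (V x) = f x *R total_field F2 (\<phi>2 x)"
  by (rule isometry_flags[OF N(2) U(2) i2]) blast
 have "dd \<phi>2 y (e y) \<in> contact_plane (\<phi>2 y)" if y: "y \<in> U1" "y \<in> U2" for y
 proof (rule ode_null_contact[OF ode])
  note c = isometry_consequences[OF N U(2) i2 y(2)]
  show "\<phi>2 y \<in> D2" using im y by auto
  show "wuenschmann F2 (\<phi>2 y) \<noteq> 0" using c(1) W y by simp
  show "flag_null (ode_metric F2) (total_field F2) (\<phi>2 y) (dd \<phi>2 y (e y))" by (rule iffD1[OF c(4)]) (use e(2) y(1) in blast)
 qed
 hence "adapted (U1 \<inter> U2) V \<phi>2 F2 e"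
  using diffeo_subset[OF d(2) op] f e(1) unfolding adapted_def by blast
 thus ?thesis by (rule adapted_contact_related[OF adapted_subset[OF e(1) op Int_lower1]])
qed

text \<open>With no distinguished null direction the two isometries come with different fields
  \<open>e1\<close>, \<open>e2\<close>. \<open>flat_branch\<close> fits both into one chart of one
  equation over the same leaves; passing from \<open>m1\<close> to \<open>m2\<close> along the
  leaves is the gauge transformation.\<close>

lemma isometries_gauge_related:
 assumes N: "open N" "degenerate_lorentzian N g V" and pr: "lie_proportional N g V"
  and U: "U1 \<subseteq> N" "U2 \<subseteq> N" and x: "x \<in> U1" "x \<in> U2"
  and iso: "ode_isometry g U1 \<phi>1 D1 F1" "ode_isometry g U2 \<phi>2 D2 F2"
 shows "\<exists>U. open U \<and> x \<in> U \<and> U \<subseteq> U1 \<inter> U2 \<and> gauge_related U \<phi>1 F1 \<phi>2 F2"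
proof -
 note L = degenerate_lorentzianD[OF N(2)]
 have xN: "x \<in> N" using x U by auto
 obtain e1 where e1: "smooth_on U1 e1" "adapted U1 V \<phi>1 F1 e1" "\<forall>y\<in>U1. flag_null g V y (e1 y)"
  "\<forall>y\<in>U1. \<not> (\<exists>a b. dd e1 y (V y) - dd V y (e1 y) = a *R e1 y + b *R V y)"
  by (rule isometry_null_field[OF N U(1) iso(1)])
 obtain e2 where e2: "smooth_on U2 e2" "adapted U2 V \<phi>2 F2 e2" "\<forall>y\<in>U2. flag_null g V y (e2 y)"
  "\<forall>y\<in>U2. \<not> (\<exists>a b. dd e2 y (V y) - dd V y (e2 y) = a *R e2 y + b *R V y)"
  by (rule isometry_null_field[OF N U(2) iso(2)])
 obtain \<epsilon> n1 n2 n3 where n: "\<epsilon> = 1 \<or> \<epsilon> = (-1 :: real)" "tensor_app (g x) n1 n2 = \<epsilon>" "tensor_app (g x) n3 n3 = - \<epsilon>"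
  "tensor_app (g x) n1 n1 = 0" "tensor_app (g x) n2 n2 = 0" "tensor_app (g x) n1 n3 = 0" "tensor_app (g x) n2 n3 = 0"
  "det (transpose (vector [n1, n2, n3, V x] :: real ^ 4 ^ 4)) \<noteq> 0"
  and av: "\<forall>w\<in>{e1 x, e2 x}. tensor_app (g x) w w = 0 \<and> w \<notin> span {V x} \<longrightarrow> tensor_app (g x) w n2 \<noteq> 0"
  by (rule null_basis[OF N(2) xN, of "e1 x" "e2 x"]) blast
 obtain U \<xi> f \<rho> h r where U0: "open U" "x \<in> U" "U \<subseteq> N" and \<xi>: "diffeo_onto_image U \<xi>" "\<xi> x = 0"
  "\<And>v. dd \<xi> x (v $ 1 *R n1 + v $ 2 *R n2 + v $ 3 *R n3 + v $ 4 *R V x) = v"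
  and f: "smooth_on U f" "\<forall>z\<in>U. f z \<noteq> 0 \<and> dd \<xi> z (V z) = f z *R e4"
  and fm: "flat_metric (slab 0 0 \<rho>) h"
  and rel: "\<forall>z\<in>U. \<forall>v w. tensor_app (flat_metric.H h (\<xi> z)) (dd \<xi> z v) (dd \<xi> z w) = tensor_app (r z *R g z) v w"
  by (rule flat_straight[OF N(1,2) xN pr n]) blast
 interpret flat_metric "slab 0 0 \<rho>" h by (rule fm)
 \<comment> \<open>By the choice of \<open>n2\<close>, neither null vector has vanishing first
   component in the chart, so both slopes are defined.\<close>
 have first: "dd \<xi> x w $ 1 \<noteq> 0" if w: "w \<in> {e1 x, e2 x}" "tensor_app (g x) w w = 0" "w \<notin> span {V x}" for w
 proof
  assume 0: "dd \<xi> x w $ 1 = 0"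
  define v where "v = dd \<xi> x w"
  define w' where "w' = v $ 1 *R n1 + v $ 2 *R n2 + v $ 3 *R n3 + v $ 4 *R V x"
  have lin: "linear (dd \<xi> x)" by (rule dd_lin[OF diffeoD(4)[OF \<xi>(1)] U0(2)])
  have "dd \<xi> x (w - w') = 0" unfolding linear_diff[OF lin] using \<xi>(3)[of v] by (simp add: v_def w'_def)
  hence "w - w' = 0" by (rule diffeo_ker[OF \<xi>(1) U0(2)])
  hence ww: "w = w'" by simp
  have "tensor_app (g x) (V x) n2 = 0" using L(3) xN by (auto simp: annihilates_def)
  moreover have "tensor_app (g x) n3 n2 = 0" using n(7) L(4) xN by (auto simp: symmetric_on_def)
  ultimately have "tensor_app (g x) w n2 = 0" unfolding ww w'_def using 0 by (simp add: tensor_app_linear n v_def)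
  thus False using av w by blast
 qed
 define W where "W = U \<inter> U1 \<inter> U2"
 have d12: "diffeo_onto_image U1 \<phi>1" "diffeo_onto_image U2 \<phi>2" using iso by (auto simp: ode_isometry_def)
 have W: "open W" "x \<in> W" "W \<subseteq> U" "W \<subseteq> U1" "W \<subseteq> U2"
  using U0 x diffeoD(1)[OF d12(1)] diffeoD(1)[OF d12(2)] by (auto simp: W_def)
 have VW: "smooth_on W V" by (rule smooth_on_subset[OF L(2)]) (use W(3) U0(3) in auto)
 have fW: "smooth_on W f" "\<forall>z\<in>W. f z \<noteq> 0 \<and> dd \<xi> z (V z) = f z *R e4" using smooth_on_subset[OF f(1) W(3)] f(2) W(3) by auto
 have \<xi>W: "diffeo_onto_image W \<xi>" by (rule diffeo_subset[OF \<xi>(1) W(1,3)])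
 have fn0: "tensor_app (g y) v v = 0" if "flag_null g V y v" for y v using that unfolding flag_null_iff by (auto dest: spec[of _ 0])
 have nullW: "tensor_app (H (\<xi> y)) (dd \<xi> y v) (dd \<xi> y v) = 0" if "y \<in> W" "flag_null g V y v" for y v
  using bspec[OF rel, of y] W(3) that fn0[OF that(2)] by (auto simp: tensor_app_linear)
 define k1 where "k1 = dd \<xi> x (e1 x) $ 3 / dd \<xi> x (e1 x) $ 1"
 define k2 where "k2 = dd \<xi> x (e2 x) $ 3 / dd \<xi> x (e2 x) $ 1"
 \<comment> \<open>One slab has to contain the axis points at both slopes.\<close>
 define s1 where "s1 = min k1 k2"
 define s2 where "s2 = max k1 k2"
 have s: "s1 \<le> s2" "s1 \<le> k1" "k1 \<le> s2" "s1 \<le> k2" "k2 \<le> s2" by (auto simp: s1_def s2_def)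
 obtain t \<Psi> F where t: "t > 0" "slab s1 s2 t \<subseteq> S1" and ip: "ode_isometry H (slab s1 s2 t) \<Psi> (\<Psi> ` slab s1 s2 t) F"
  and con: "\<And>z. z \<in> slab s1 s2 t ==> dd \<Psi> z (null_dir b z) \<in> contact_plane (\<Psi> z)"
  and tot: "\<And>z. z \<in> slab s1 s2 t ==> \<exists>m. m \<noteq> 0 \<and> dd \<Psi> z e4 = m *R total_field F (\<Psi> z)"
  and W0: "\<And>y. y \<in> \<Psi> ` slab s1 s2 t ==> wuenschmann F y = 0"
  by (rule flat_chart[OF s(1)]) blast
 have \<Psi>: "diffeo_onto_image (slab s1 s2 t) \<Psi>" and ode: "third_order_ode (\<Psi> ` slab s1 s2 t) F" using ip by (auto simp: ode_isometry_def)
 have q1: "dd \<xi> x (e1 x) $ 1 \<noteq> 0" by (rule first) (use e1(2,3) x(1) fn0 in \<open>auto simp: adapted_def\<close>)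
 have q2: "dd \<xi> x (e2 x) $ 1 \<noteq> 0" by (rule first) (use e2(2,3) x(2) fn0 in \<open>auto simp: adapted_def\<close>)
 have p1: "\<forall>y\<in>W. e1 y \<notin> span {V y}" "\<forall>y\<in>W. tensor_app (H (\<xi> y)) (dd \<xi> y (e1 y)) (dd \<xi> y (e1 y)) = 0"
  "\<forall>y\<in>W. \<not> (\<exists>a b. dd e1 y (V y) - dd V y (e1 y) = a *R e1 y + b *R V y)"
  using e1(2-4) W(4) nullW unfolding adapted_def by blast+
 have p2: "\<forall>y\<in>W. e2 y \<notin> span {V y}" "\<forall>y\<in>W. tensor_app (H (\<xi> y)) (dd \<xi> y (e2 y)) (dd \<xi> y (e2 y)) = 0"
  "\<forall>y\<in>W. \<not> (\<exists>a b. dd e2 y (V y) - dd V y (e2 y) = a *R e2 y + b *R V y)"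
  using e2(2-4) W(5) nullW unfolding adapted_def by blast+
 obtain A m1 where A: "open A" "x \<in> A" "A \<subseteq> W" "adapted A V (\<lambda>y. \<Psi> (m1 y)) F e1" "m1 ` A \<subseteq> slab s1 s2 t"
  "\<forall>y\<in>A. drop4 (m1 y) = drop4 (\<xi> y)"
  by (rule flat_branch[OF W(2) \<xi>W \<xi>(2) VW smooth_on_subset[OF e1(1) W(4)] fW p1(2) q1 p1(1,3) s(2,3)[unfolded k1_def] t \<Psi> con tot])
 obtain B m2 where B: "open B" "x \<in> B" "B \<subseteq> W" "adapted B V (\<lambda>y. \<Psi> (m2 y)) F e2" "m2 ` B \<subseteq> slab s1 s2 t"
  "\<forall>y\<in>B. drop4 (m2 y) = drop4 (\<xi> y)"
  by (rule flat_branch[OF W(2) \<xi>W \<xi>(2) VW smooth_on_subset[OF e2(1) W(5)] fW p2(2) q2 p2(1,3) s(4,5)[unfolded k2_def] t \<Psi> con tot])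
 define M where "M = A \<inter> B"
 have M: "open M" "x \<in> M" "M \<subseteq> A" "M \<subseteq> B" "M \<subseteq> U1" "M \<subseteq> U2" using A(1-3) B(1-3) W(4,5) by (auto simp: M_def)
 let ?p = "\<lambda>y. \<Psi> (m1 y)" and ?q = "\<lambda>y. \<Psi> (m2 y)"
 note ap = adapted_subset[OF A(4) M(1,3)] and aq = adapted_subset[OF B(4) M(1,4)]
 have dp: "diffeo_onto_image M ?p" and dq: "diffeo_onto_image M ?q" using ap aq by (auto simp: adapted_def)
 have cp: "contact_related M \<phi>1 F1 ?p F" by (rule adapted_contact_related[OF adapted_subset[OF e1(2) M(1,5)] ap])
 have cq: "contact_related M \<phi>2 F2 ?q F" by (rule adapted_contact_related[OF adapted_subset[OF e2(2) M(1,6)] aq])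
 define \<gamma> where "\<gamma> z = ?q (inv_into M ?p z)" for z
 note ip' = diffeo_inverse[OF dp]
 have \<gamma>p: "\<gamma> (?p y) = ?q y" if "y \<in> M" for y using ip'(2)[OF that] by (simp add: \<gamma>_def)
 have im: "?p ` M \<subseteq> \<Psi> ` slab s1 s2 t" "?q ` M \<subseteq> \<Psi> ` slab s1 s2 t" using A(5) B(5) M(3,4) by blast+
 have "gauge_transformation (\<Psi> ` slab s1 s2 t) F (?p ` M) \<gamma>"
  unfolding gauge_transformation_def
 proof (intro conjI ballI)
  show "diffeo_onto_image (?p ` M) \<gamma>" unfolding \<gamma>_def[abs_def]
   by (rule diffeo_compose[OF ip'(1) dq]) (simp add: ip'(7))
  show "?p ` M \<subseteq> \<Psi> ` slab s1 s2 t" by (rule im(1))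
  show "\<gamma> ` ?p ` M \<subseteq> \<Psi> ` slab s1 s2 t" using im(2) \<gamma>p by force
  fix z assume "z \<in> ?p ` M"
  then obtain y where y: "y \<in> M" "z = ?p y" by blast
  have yAB: "y \<in> A" "y \<in> B" using y(1) M(3,4) by auto
  have ms: "m1 y \<in> slab s1 s2 t" "m2 y \<in> slab s1 s2 t" "drop4 (m1 y) = drop4 (m2 y)"
   using A(5) B(5) yAB bspec[OF A(6) yAB(1)] bspec[OF B(6) yAB(2)] by auto
  have "same_leaf (\<Psi> ` slab s1 s2 t) F (\<Psi> (m1 y)) (\<Psi> (m2 y))"
   by (rule same_leaf_slab[OF \<Psi> tot ms])
  thus "same_leaf (\<Psi> ` slab s1 s2 t) F z (\<gamma> z)" using \<gamma>p[OF y(1)] y(2) by simp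
 qed
 hence "gauge_related M \<phi>1 F1 \<phi>2 F2"
  unfolding gauge_related_def using ode W0 cp cq \<gamma>p
  by (intro exI[of _ "\<Psi> ` slab s1 s2 t"] exI[of _ F] exI[of _ ?p] exI[of _ ?q] exI[of _ \<gamma>]) auto
 thus ?thesis using M by blast
qed

text \<open>An equation whose Wuenschmann invariant vanishes only at some points gives a metric of
  neither type on all of \<open>N\<close>; so the equivalence is stated when \<open>Gamma\<close>
  vanishes nowhere or identically, next to a pointwise dichotomy in general.
  \<open>Gamma_osc\<close> belongs to the criterion because rank one alone does not make the null
  direction rotate.\<close>

theorem theorem2:
  fixes N :: "point set" and g :: "point \<Rightarrow> tensor"
    and V :: "point \<Rightarrow> point" and E :: "point \<Rightarrow> point ^ 3"
  assumes "open N" and "degenerate_lorentzian N g V" and "transverse_frame N V E"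
  shows
    "((\<forall>x\<in>N. Gamma g V E x \<noteq> 0) \<or> (\<forall>x\<in>N. Gamma g V E x = 0) \<longrightarrow>
        (arises_from_ode N g \<longleftrightarrow>
           (Gamma_nonzero_adj_zero N g V E \<and> (\<forall>x\<in>N. Gamma_osc g V E x \<noteq> 0)) \<or> lie_proportional N g V))
     \<and> (arises_from_ode N g \<longrightarrow>
        (\<forall>x\<in>N. (Gamma_nonzero_adj_zero {x} g V E \<and> Gamma_osc g V E x \<noteq> 0) \<or> lie_proportional {x} g V))
     \<and> (Gamma_nonzero_adj_zero N g V E \<longleftrightarrow> (\<forall>x\<in>N. rank (Gamma g V E x) = 1))
     \<and> (Gamma_nonzero_adj_zero N g V E \<longrightarrow>
        ((\<forall>x\<in>N. Gamma_osc g V E x \<noteq> 0) \<longrightarrow>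
           (\<forall>x\<in>N. \<exists>U \<phi> D F. x \<in> U \<and> U \<subseteq> N \<and> ode_isometry g U \<phi> D F \<and>
              (\<forall>z\<in>D. wuenschmann F z \<noteq> 0)))
        \<and> (\<forall>U \<phi> D F. U \<subseteq> N \<and> ode_isometry g U \<phi> D F \<longrightarrow> (\<forall>z\<in>\<phi> ` U. wuenschmann F z \<noteq> 0))
        \<and> (\<forall>U\<^sub>1 \<phi>\<^sub>1 D\<^sub>1 F\<^sub>1 U\<^sub>2 \<phi>\<^sub>2 D\<^sub>2 F\<^sub>2.
             U\<^sub>1 \<subseteq> N \<and> U\<^sub>2 \<subseteq> N \<and> ode_isometry g U\<^sub>1 \<phi>\<^sub>1 D\<^sub>1 F\<^sub>1 \<and> ode_isometry g U\<^sub>2 \<phi>\<^sub>2 D\<^sub>2 F\<^sub>2 \<longrightarrow>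
             contact_related (U\<^sub>1 \<inter> U\<^sub>2) \<phi>\<^sub>1 F\<^sub>1 \<phi>\<^sub>2 F\<^sub>2))
     \<and> (lie_proportional N g V \<longrightarrow>
        (\<forall>x\<in>N. \<exists>U \<phi> D F. x \<in> U \<and> U \<subseteq> N \<and> ode_isometry g U \<phi> D F \<and>
           (\<forall>z\<in>D. wuenschmann F z = 0))
        \<and> (\<forall>U \<phi> D F. U \<subseteq> N \<and> ode_isometry g U \<phi> D F \<longrightarrow> (\<forall>z\<in>\<phi> ` U. wuenschmann F z = 0))
        \<and> (\<forall>U\<^sub>1 \<phi>\<^sub>1 D\<^sub>1 F\<^sub>1 U\<^sub>2 \<phi>\<^sub>2 D\<^sub>2 F\<^sub>2 x.
             U\<^sub>1 \<subseteq> N \<and> U\<^sub>2 \<subseteq> N \<and> x \<in> U\<^sub>1 \<inter> U\<^sub>2 \<and>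
             ode_isometry g U\<^sub>1 \<phi>\<^sub>1 D\<^sub>1 F\<^sub>1 \<and> ode_isometry g U\<^sub>2 \<phi>\<^sub>2 D\<^sub>2 F\<^sub>2 \<longrightarrow>
             (\<exists>U. open U \<and> x \<in> U \<and> U \<subseteq> U\<^sub>1 \<inter> U\<^sub>2 \<and> gauge_related U \<phi>\<^sub>1 F\<^sub>1 \<phi>\<^sub>2 F\<^sub>2)))"
proof -
 note N = assms(1,2) and L = degenerate_lorentzianD[OF assms(2)]
 have dE: "det (vector [V x, E x $ 1, E x $ 2, E x $ 3] :: real ^ 4 ^ 4) \<noteq> 0" if "x \<in> N" for x
  using assms(3) that by (simp add: transverse_frame_def)
 note GF = Gamma_flag[where E = E, OF N(1) L(2,1,3,4) _ dE]
 define good where "good x \<longleftrightarrow> Gamma_nonzero_adj_zero {x} g V E \<and> Gamma_osc g V E x \<noteq> 0" for x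
 have good: "good x \<longleftrightarrow> flag_indep g V x 6 \<and> (\<exists>w. w \<notin> span {V x} \<and> flag_null g V x w)" if x: "x \<in> N" for x
 proof -
  have "flag_indep g V x 6 ==> flag_indep g V x 5" by (simp add: flag_indep_def)
  thus ?thesis unfolding good_def Gamma_nonzero_adj_zero_def using GF(1-3)[OF x x] by auto
 qed
 \<comment> \<open>Proportionality stops the flag at its first step, so the two types exclude each
   other at every point.\<close>
 have prop0: "Gamma g V E x = 0" if x: "x \<in> N" "lie_proportional {x} g V" for x
 proof -
  have "\<not> flag_indep g V x 5" using x(2) unfolding lie_proportional_flag flag_indep_def by (auto simp: numeral_2_eq_2 intro!: exI[of _ 1])
  thus ?thesis using GF(1)[OF x(1) x(1)] by blast
 qed
 have propN: "lie_proportional N g V \<longleftrightarrow> (\<forall>x\<in>N. lie_proportional {x} g V)" by (simp add: lie_proportional_def)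
 have GN: "Gamma_nonzero_adj_zero N g V E \<longleftrightarrow> (\<forall>x\<in>N. Gamma_nonzero_adj_zero {x} g V E)" by (simp add: Gamma_nonzero_adj_zero_def)
 have W: "wuenschmann F (\<phi> x) = 0 \<longleftrightarrow> lie_proportional {x} g V"
  if "U \<subseteq> N" "ode_isometry g U \<phi> D F" "x \<in> U" for U \<phi> D F x
  using isometry_consequences(1)[OF N that] by simp
 have alt: "good x \<or> lie_proportional {x} g V" if ar: "arises_from_ode N g" and x: "x \<in> N" for x
 proof -
  obtain U \<phi> D F where U: "x \<in> U" "U \<subseteq> N" "ode_isometry g U \<phi> D F"
   using bspec[OF ar[unfolded arises_from_ode_def] x] by (elim exE conjE)
  note c = isometry_consequences(1-3)[OF N U(2,3,1)]
  show ?thesis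
  proof (cases "wuenschmann F (\<phi> x) = 0")
   case True
   thus ?thesis using c(1) by simp
  next
   case False
   thus ?thesis unfolding good[OF x] using c(2) c(3) by simp
  qed
 qed
 \<comment> \<open>Taking \<open>D\<close> to be the image reduces statements about the invariant on
   all of \<open>D\<close> to points of \<open>U\<close>.\<close>
 have ex: "\<exists>U \<phi> D F. x \<in> U \<and> U \<subseteq> N \<and> ode_isometry g U \<phi> D F \<and> D = \<phi> ` U"
  if x: "x \<in> N" and h: "(\<forall>z\<in>N. good z) \<or> lie_proportional N g V" for x
 proof -
  have "\<exists>U \<phi> F. open U \<and> x \<in> U \<and> U \<subseteq> N \<and> ode_isometry g U \<phi> (\<phi> ` U) F"
   using h
  proof
   assume g: "\<forall>z\<in>N. good z"
   have fl: "flag_indep g V z 6" "\<exists>w. w \<notin> span {V z} \<and> flag_null g V z w" if "z \<in> N" for z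
    using bspec[OF g that] unfolding good[OF that] by simp_all
   show ?thesis by (rule Gamma_isometry[OF N x fl])
  qed (rule flat_isometry[OF N x])
  thus ?thesis by blast
 qed
 have gN: "Gamma_nonzero_adj_zero N g V E \<and> (\<forall>x\<in>N. Gamma_osc g V E x \<noteq> 0) \<longleftrightarrow> (\<forall>x\<in>N. good x)"
  unfolding good_def GN by blast
 have 1: "arises_from_ode N g \<longleftrightarrow> (\<forall>x\<in>N. good x) \<or> lie_proportional N g V"
  if h: "(\<forall>x\<in>N. Gamma g V E x \<noteq> 0) \<or> (\<forall>x\<in>N. Gamma g V E x = 0)"
 proof
  assume ar: "arises_from_ode N g"
  from h show "(\<forall>x\<in>N. good x) \<or> lie_proportional N g V"
  proof
   assume G: "\<forall>x\<in>N. Gamma g V E x \<noteq> 0"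
   have "good x" if "x \<in> N" for x using alt[OF ar that] prop0[OF that] bspec[OF G that] by argo
   thus ?thesis by simp
  next
   assume G: "\<forall>x\<in>N. Gamma g V E x = 0"
   have "lie_proportional {x} g V" if "x \<in> N" for x
    using alt[OF ar that] bspec[OF G that] by (simp add: good_def Gamma_nonzero_adj_zero_def)
   thus ?thesis unfolding propN by simp
  qed
 next
  assume h: "(\<forall>x\<in>N. good x) \<or> lie_proportional N g V"
  show "arises_from_ode N g" unfolding arises_from_ode_def
  proof
   fix x assume x: "x \<in> N"
   obtain U \<phi> D F where U: "x \<in> U" "U \<subseteq> N" "ode_isometry g U \<phi> D F" using ex[OF x h] by (elim exE conjE)
   show "\<exists>U \<phi> D F. x \<in> U \<and> U \<subseteq> N \<and> ode_isometry g U \<phi> D F" by (intro exI conjI) (rule U)+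
  qed
 qed
 have np: "\<not> lie_proportional {x} g V" if "Gamma_nonzero_adj_zero N g V E" "x \<in> N" for x
  using prop0[OF that(2)] that by (auto simp: Gamma_nonzero_adj_zero_def)
 have Wn: "wuenschmann F z \<noteq> 0"
  if "Gamma_nonzero_adj_zero N g V E" "U \<subseteq> N" "ode_isometry g U \<phi> D F" "z \<in> \<phi> ` U" for U \<phi> D F z
  using W[OF that(2,3)] np[OF that(1)] that(2,4) by blast
 have W0: "wuenschmann F z = 0"
  if "lie_proportional N g V" "U \<subseteq> N" "ode_isometry g U \<phi> D F" "z \<in> \<phi> ` U" for U \<phi> D F z
  using W[OF that(2,3)] that(1)[unfolded propN] that(2,4) by blast
 have exW: "\<exists>U \<phi> D F. x \<in> U \<and> U \<subseteq> N \<and> ode_isometry g U \<phi> D F \<and> (\<forall>z\<in>D. P (wuenschmann F z))"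
  if h: "(\<forall>z\<in>N. good z) \<or> lie_proportional N g V" and x: "x \<in> N"
   and P: "\<And>U \<phi> D F z. U \<subseteq> N ==> ode_isometry g U \<phi> D F ==> z \<in> \<phi> ` U ==> P (wuenschmann F z)" for x P
 proof -
  obtain U \<phi> D F where U: "x \<in> U" "U \<subseteq> N" "ode_isometry g U \<phi> D F" "D = \<phi> ` U"
   using ex[OF x h] by (elim exE conjE)
  show ?thesis by (intro exI conjI) (rule U, rule U, rule U, use P[OF U(2,3)] U(4) in blast)
 qed
 have 4: "\<exists>U \<phi> D F. x \<in> U \<and> U \<subseteq> N \<and> ode_isometry g U \<phi> D F \<and> (\<forall>z\<in>D. wuenschmann F z \<noteq> 0)"
  if "Gamma_nonzero_adj_zero N g V E" "\<forall>x\<in>N. Gamma_osc g V E x \<noteq> 0" "x \<in> N" for x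
  by (rule exW[where P = "\<lambda>w. w \<noteq> 0", OF disjI1[OF iffD1[OF gN conjI[OF that(1,2)]]] that(3) Wn[OF that(1)]])
 note 5 = exW[OF disjI2, where P = "\<lambda>w. w = 0"]
 show ?thesis
  apply (intro conjI impI)
  subgoal unfolding gN by (rule 1)
  subgoal using alt unfolding good_def by simp
  subgoal unfolding Gamma_nonzero_adj_zero_def rank_one_iff ..
  subgoal by (rule ballI, rule 4)
  subgoal by (intro allI impI ballI, elim conjE, rule Wn)
  subgoal by (intro allI impI, elim conjE, rule isometries_contact_related[OF N]) (assumption+, rule np, auto)
  subgoal by (rule ballI, rule 5, assumption+, rule W0)
  subgoal by (intro allI impI ballI, elim conjE, rule W0)
  subgoal by (intro allI impI, elim conjE IntE, rule isometries_gauge_related[OF N])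
  done
qed

end
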